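(* Let $I=(f_1,\dots,f_m)\subset S_x$ be a graded ideal generated in degree $d\in\mathbb N$ (each $f_j$ homogeneous of degree $d$). Then: (i) For $j\ge\max\{\mathrm{reg}_y^S(R(I))+m,\ w(R(I))+m\}$ we have $\mathrm{reg}^{S_x}(I^{j+1})=d+\mathrm{reg}^{S_x}(I^j)$. (ii) For $j\ge\max\{\mathrm{reg}_y^S(S(I))+m,\ w(S(I))+m\}$ we have $\mathrm{reg}^{S_x}(S^{j+1}(I))=d+\mathrm{reg}^{S_x}(S^j(I))$.
   Context: $K$ is an infinite field, $\mathbb N=\{0,1,2,\dots\}$, $S=K[x_1,\dots,x_n,y_1,\dots,y_m]$ is the standard bigraded polynomial ring with $\deg x_i=(1,0)$, $\deg y_j=(0,1)$, $S_x=K[x_1,\dots,x_n]$ with its standard grading, and $\mathfrak m_x=(x_1,\dots,x_n)$. For a bigraded module $M$, $M_{(\ast,b)}=\bigoplus_{a\in\mathbb Z}M_{(a,b)}$. The Rees algebra is $R(I)=S/J$ with $J$ the kernel of $S\to S_x[t]$, $x_i\mapsto x_i$, $y_j\mapsto f_jt$; then $I^j\cong R(I)_{(\ast,j)}(-jd)$. The symmetric algebra is $S(I)=S/J'$ with $J'$ the kernel of the surjective $S_x$-algebra map $S\to S(I)$ sending $y_j$ to the element $f_j$ of the degree-one part $I$; $S^j(I)=S(I)_{(\ast,j)}(-jd)$ is the $j$-th symmetric power. Both are bigraded algebras via these presentations. $\mathrm{reg}^{S_x}(M)=\sup\{r\in\mathbb Z:\mathrm{Tor}_i^{S_x}(M,K)_{i+r}\ne0\text{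 for some }i\}$ for finitely generated graded $S_x$-modules $M$; $\mathrm{reg}_y^S(M)=\sup\{b\in\mathbb Z:\mathrm{Tor}^S_i(M,K)_{(a,b+i)}\ne0\text{ for some }i,a\in\mathbb Z\}$ for finitely generated bigraded $S$-modules $M$. For a bigraded algebra $R$ (a quotient of $S$ by a bigraded ideal), fix a form $y$ of bidegree $(0,1)$ that is almost regular with respect to the $y$-degree for all modules $\mathrm{Tor}_i^S(S/\mathfrak m_x,R)$, i.e. $(0:_{\mathrm{Tor}_i^S(S/\mathfrak m_x,R)}y)_{(\ast,b)}=0$ for $b\gg0$. Then $w(R)=\max\{b:(0:_{\mathrm{Tor}_i^S(S/\mathfrak m_x,R)}y)_{(\ast,b)}\ne0\text{ for some }i\in\{1,\dots,n\}\}$, with $w(R)=-\infty$ if this set is empty. *)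

theory Defs
  imports
    "HOL-Algebra.Ideal_Product"
    "HOL-Algebra.Algebraic_Closure_Type"
    "HOL-Library.Poly_Mapping"
    "HOL-Library.Extended_Real"
    "HOL-Library.Product_Plus"
    "HOL-Library.Cardinality"
begin

section \<open>Polynomials with a grading\<close>

text \<open>
  Polynomials over \<open>'k\<close> in the variables \<open>'v\<close> are the finitely supported functions from exponent
  vectors to \<open>'k\<close>, with the convolution product of \<^theory>\<open>HOL-Library.Poly_Mapping\<close>.  The ring
  \<open>S_x\<close> has the variable type \<open>'n\<close> and \<open>S\<close> has the variable type \<open>'n + 'm\<close>, where \<open>Inl i\<close> is
  the index of \<open>x_i\<close> and \<open>Inr j\<close> the index of \<open>y_j\<close>.  As objects of HOL-Algebra these rings are
  the records \<^const>\<open>ring_of_type_algebra\<close>.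
\<close>

type_synonym ('v, 'k) mpoly = "('v \<Rightarrow>\<^sub>0 nat) \<Rightarrow>\<^sub>0 'k"

definition Var :: "'v \<Rightarrow> ('v, 'k::zero_neq_one) mpoly"
  where "Var v = Poly_Mapping.single (Poly_Mapping.single v 1) 1"

definition Const :: "'k \<Rightarrow> ('v, 'k::zero) mpoly"
  where "Const c = Poly_Mapping.single 0 c"

text \<open>\<open>substitute c s\<close> is the ring homomorphism that is \<open>c\<close> on coefficients and sends the variable
  \<open>v\<close> to \<open>s v\<close>.\<close>

definition substitute ::
    "('k::zero \<Rightarrow> 'b::comm_semiring_1) \<Rightarrow> ('v \<Rightarrow> 'b) \<Rightarrow> ('v, 'k) mpoly \<Rightarrow> 'b"
  where "substitute c s h =
    (\<Sum>m\<in>Poly_Mapping.keys h. c (Poly_Mapping.lookup h m) *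
       (\<Prod>v\<in>Poly_Mapping.keys m. s v ^ Poly_Mapping.lookup m v))"

text \<open>The standard grading of \<open>S_x\<close> and the bigrading of \<open>S\<close>, as degrees of exponent vectors.\<close>

definition tdeg :: "('n::finite \<Rightarrow>\<^sub>0 nat) \<Rightarrow> int"
  where "tdeg m = int (\<Sum>i\<in>UNIV. Poly_Mapping.lookup m i)"

definition bideg :: "('n::finite + 'm::finite \<Rightarrow>\<^sub>0 nat) \<Rightarrow> int \<times> int"
  where "bideg m = (int (\<Sum>i\<in>UNIV. Poly_Mapping.lookup m (Inl i)),
                    int (\<Sum>j\<in>UNIV. Poly_Mapping.lookup m (Inr j)))"

definition homog :: "(('v \<Rightarrow>\<^sub>0 nat) \<Rightarrow> 'g) \<Rightarrow> 'g \<Rightarrow> ('v, 'k::zero) mpoly set"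
  where "homog dg g = {h. \<forall>m\<in>Poly_Mapping.keys h. dg m = g}"


section \<open>Graded modules\<close>

text \<open>
  A graded module is a HOL-Algebra module together with its homogeneous components.  As always for
  the record type \<open>module\<close>, the inherited ring fields \<open>mult\<close> and \<open>one\<close> carry no meaning.
\<close>

record ('r, 'a, 'g) graded_module = "('r, 'a) module" +
  gpart :: "'g \<Rightarrow> 'a set"

definition poly_module ::
    "(('v \<Rightarrow>\<^sub>0 nat) \<Rightarrow> 'g) \<Rightarrow> (('v, 'k::comm_ring_1) mpoly, ('v, 'k) mpoly, 'g) graded_module"
  where "poly_module dg =
    \<lparr> carrier = UNIV, monoid.mult = undefined, one = undefined, ring.zero = 0, add = (+),
      module.smult = (*),
      gpart = homog dg \<rparr>"

text \<open>The residue field \<open>K\<close>, concentrated in degree 0; all variables act as zero.\<close>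

definition residue_module :: "(('v, 'k::comm_ring_1) mpoly, 'k, 'g::zero) graded_module"
  where "residue_module =
    \<lparr> carrier = UNIV, monoid.mult = undefined, one = undefined, ring.zero = 0, add = (+),
      module.smult = (\<lambda>h c. Poly_Mapping.lookup h 0 * c),
      gpart = (\<lambda>g. if g = 0 then UNIV else {0}) \<rparr>"

definition submod :: "('r, 'a, 'g) graded_module \<Rightarrow> 'a set \<Rightarrow> ('r, 'a, 'g) graded_module"
  where "submod M Z = M \<lparr> carrier := Z, gpart := (\<lambda>g. gpart M g \<inter> Z) \<rparr>"

definition quot :: "('r, 'a, 'g) graded_module \<Rightarrow> 'a set \<Rightarrow> ('r, 'a set, 'g) graded_module"
  where "quot M B =
    \<lparr> carrier = a_rcosets\<^bsub>M\<^esub> B, monoid.mult = undefined, one = undefined, ring.zero = B,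
      add = (<+>\<^bsub>M\<^esub>), module.smult = (\<lambda>r C. \<Union>x\<in>C. B +>\<^bsub>M\<^esub> (r \<odot>\<^bsub>M\<^esub> x)),
      gpart = (\<lambda>g. (\<lambda>x. B +>\<^bsub>M\<^esub> x) ` gpart M g) \<rparr>"

text \<open>The shifted module \<open>M(s)\<close>, whose component of degree \<open>g\<close> is that of \<open>M\<close> in degree \<open>s + g\<close>.\<close>

definition shift :: "'g::ab_group_add \<Rightarrow> ('r, 'a, 'g) graded_module \<Rightarrow> ('r, 'a, 'g) graded_module"
  where "shift s M = M \<lparr> gpart := (\<lambda>g. gpart M (s + g)) \<rparr>"

definition annihilated :: "('r, 'a, 'g) graded_module \<Rightarrow> 'r \<Rightarrow> ('r, 'a, 'g) graded_module"
  where "annihilated M y = submod M {t \<in> carrier M. y \<odot>\<^bsub>M\<^esub> t = \<zero>\<^bsub>M\<^esub>}"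

definition embed_x :: "('n, 'k::comm_ring_1) mpoly \<Rightarrow> ('n + 'm, 'k) mpoly"
  where "embed_x = substitute Const (\<lambda>i. Var (Inl i))"

text \<open>The graded \<open>S_x\<close>-module \<open>M\<^sub>(\<^sub>*\<^sub>,\<^sub>b\<^sub>)\<close>, the (internal) direct sum of the \<open>M\<^sub>(\<^sub>a\<^sub>,\<^sub>b\<^sub>)\<close>.\<close>

definition strand ::
    "(('n + 'm, 'k::comm_ring_1) mpoly, 'a, int \<times> int) graded_module \<Rightarrow> int
      \<Rightarrow> (('n, 'k) mpoly, 'a, int) graded_module"
  where "strand M b =
    \<lparr> carrier = {finsum M t A | t A. finite A \<and> (\<forall>a\<in>A. t a \<in> gpart M (a, b))},
      monoid.mult = undefined, one = undefined, ring.zero = \<zero>\<^bsub>M\<^esub>, add = (\<oplus>\<^bsub>M\<^esub>),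
      module.smult = (\<lambda>h x. embed_x h \<odot>\<^bsub>M\<^esub> x),
      gpart = (\<lambda>a. gpart M (a, b)) \<rparr>"


section \<open>Graded free resolutions and Tor\<close>

text \<open>
  For \<open>ds = [d\<^sub>0, \<dots>, d\<^sub>r\<^sub>-\<^sub>1]\<close> this is \<open>M(-d\<^sub>0) \<oplus> \<dots> \<oplus> M(-d\<^sub>r\<^sub>-\<^sub>1)\<close>, that is, \<open>F \<otimes> M\<close> for the graded free
  module \<open>F\<close> with basis elements of degrees \<open>d\<^sub>0, \<dots>, d\<^sub>r\<^sub>-\<^sub>1\<close>.  For \<open>M = poly_module dg\<close> it is \<open>F\<close> itself.
\<close>

definition free_tensor ::
    "'g::ab_group_add list \<Rightarrow> ('r, 'a, 'g) graded_module \<Rightarrow> ('r, nat \<Rightarrow> 'a, 'g) graded_module"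
  where "free_tensor ds M =
    \<lparr> carrier = {..<length ds} \<rightarrow>\<^sub>E carrier M, monoid.mult = undefined, one = undefined,
      ring.zero = (\<lambda>p\<in>{..<length ds}. \<zero>\<^bsub>M\<^esub>),
      add = (\<lambda>u v. \<lambda>p\<in>{..<length ds}. u p \<oplus>\<^bsub>M\<^esub> v p),
      module.smult = (\<lambda>r v. \<lambda>p\<in>{..<length ds}. r \<odot>\<^bsub>M\<^esub> v p),
      gpart = (\<lambda>g. \<Pi>\<^sub>E p\<in>{..<length ds}. gpart M (g - ds ! p)) \<rparr>"

text \<open>
  A resolution \<open>\<dots> \<rightarrow> F\<^sub>1 \<rightarrow> F\<^sub>0 \<rightarrow> N \<rightarrow> 0\<close> by finitely generated graded free modules: the degrees of
  the basis of \<open>F\<^sub>i\<close>, the matrix of \<open>F\<^sub>i\<^sub>+\<^sub>1 \<rightarrow> F\<^sub>i\<close> (row index first), and the images in \<open>N\<close> of the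
  basis elements of \<open>F\<^sub>0\<close>.
\<close>

record ('r, 'a, 'g) free_complex =
  res_degs :: "nat \<Rightarrow> 'g list"
  res_mat :: "nat \<Rightarrow> nat \<Rightarrow> nat \<Rightarrow> 'r"
  res_aug :: "nat \<Rightarrow> 'a"

definition res_map ::
    "('r, 'a, 'g) free_complex \<Rightarrow> ('r, 'b, 'g) graded_module \<Rightarrow> nat \<Rightarrow> (nat \<Rightarrow> 'b) \<Rightarrow> nat \<Rightarrow> 'b"
  \<comment> \<open>the map \<open>F\<^sub>i\<^sub>+\<^sub>1 \<otimes> M \<rightarrow> F\<^sub>i \<otimes> M\<close>\<close>
  where "res_map F M i v =
    (\<lambda>p\<in>{..<length (res_degs F i)}.
       \<Oplus>\<^bsub>M\<^esub>q\<in>{..<length (res_degs F (Suc i))}. res_mat F i p q \<odot>\<^bsub>M\<^esub> v q)"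

definition aug_map ::
    "('r, 'a, 'g) free_complex \<Rightarrow> ('r, 'a, 'g) graded_module \<Rightarrow> (nat \<Rightarrow> 'r) \<Rightarrow> 'a"
  where "aug_map F N v = (\<Oplus>\<^bsub>N\<^esub>q\<in>{..<length (res_degs F 0)}. v q \<odot>\<^bsub>N\<^esub> res_aug F q)"

definition cycles ::
    "('r, 'a, 'g::ab_group_add) free_complex \<Rightarrow> ('r, 'b, 'g) graded_module \<Rightarrow> nat \<Rightarrow> (nat \<Rightarrow> 'b) set"
  where "cycles F M i =
    {z \<in> carrier (free_tensor (res_degs F i) M).
       \<forall>k. i = Suc k \<longrightarrow> res_map F M k z = \<zero>\<^bsub>free_tensor (res_degs F k) M\<^esub>}"

definition boundaries ::
    "('r, 'a, 'g::ab_group_add) free_complex \<Rightarrow> ('r, 'b, 'g) graded_module \<Rightarrow> nat \<Rightarrow> (nat \<Rightarrow> 'b) set"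
  where "boundaries F M i = res_map F M i ` carrier (free_tensor (res_degs F (Suc i)) M)"

definition free_resolution ::
    "(('v \<Rightarrow>\<^sub>0 nat) \<Rightarrow> 'g::ab_group_add) \<Rightarrow> (('v, 'k::comm_ring_1) mpoly, 'a, 'g) graded_module
      \<Rightarrow> (('v, 'k) mpoly, 'a, 'g) free_complex \<Rightarrow> bool"
  where "free_resolution dg N F \<longleftrightarrow>
    (\<forall>i. \<forall>p<length (res_degs F i). \<forall>q<length (res_degs F (Suc i)).
       res_mat F i p q \<in> homog dg (res_degs F (Suc i) ! q - res_degs F i ! p)) \<and>
    (\<forall>q<length (res_degs F 0). res_aug F q \<in> gpart N (res_degs F 0 ! q)) \<and>
    aug_map F N ` carrier (free_tensor (res_degs F 0) (poly_module dg)) = carrier N \<and>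
    {z \<in> carrier (free_tensor (res_degs F 0) (poly_module dg)). aug_map F N z = \<zero>\<^bsub>N\<^esub>} =
      boundaries F (poly_module dg) 0 \<and>
    (\<forall>i. cycles F (poly_module dg) (Suc i) = boundaries F (poly_module dg) (Suc i))"

text \<open>
  The graded module \<open>Tor\<^sub>i(N, M)\<close> is the homology of \<open>F \<otimes> M\<close> for a graded free resolution \<open>F\<close> of
  \<open>N\<close>.  Up to isomorphism of graded modules the choice of \<open>F\<close> is irrelevant; for a finitely
  generated graded \<open>N\<close> over a polynomial ring over a field in finitely many variables an \<open>F\<close> of
  finite ranks exists by Hilbert's basis theorem.
\<close>

definition Tor ::
    "(('v \<Rightarrow>\<^sub>0 nat) \<Rightarrow> 'g::ab_group_add) \<Rightarrow> (('v, 'k::comm_ring_1) mpoly, 'a, 'g) graded_module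
      \<Rightarrow> (('v, 'k) mpoly, 'b, 'g) graded_module \<Rightarrow> nat
      \<Rightarrow> (('v, 'k) mpoly, (nat \<Rightarrow> 'b) set, 'g) graded_module"
  where "Tor dg N M i =
    (let F = (SOME F. free_resolution dg N F)
     in quot (submod (free_tensor (res_degs F i) M) (cycles F M i)) (boundaries F M i))"


section \<open>Regularity\<close>

text \<open>Regularities are extended reals; the supremum of the empty set is \<open>-\<infinity>\<close>.\<close>

definition reg_x :: "(('n::finite, 'k::field) mpoly, 'a, int) graded_module \<Rightarrow> ereal"
  where "reg_x M =
    (SUP r \<in> {r::int. \<exists>i. gpart (Tor tdeg M residue_module i) (int i + r)
                          \<noteq> {\<zero>\<^bsub>Tor tdeg M residue_module i\<^esub>}}. ereal (real_of_int r))"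

definition reg_y ::
    "(('n::finite + 'm::finite, 'k::field) mpoly, 'a, int \<times> int) graded_module \<Rightarrow> ereal"
  where "reg_y M =
    (SUP b \<in> {b::int. \<exists>i a. gpart (Tor bideg M residue_module i) (a, b + int i)
                            \<noteq> {\<zero>\<^bsub>Tor bideg M residue_module i\<^esub>}}. ereal (real_of_int b))"

definition bigraded_algebra ::
    "('n::finite + 'm::finite, 'k::field) mpoly set
      \<Rightarrow> (('n + 'm, 'k) mpoly, ('n + 'm, 'k) mpoly set, int \<times> int) graded_module"
  where "bigraded_algebra J = quot (poly_module bideg) J"

definition Tor_x ::
    "(('n::finite + 'm::finite, 'k::field) mpoly, 'a, int \<times> int) graded_module \<Rightarrow> nat
      \<Rightarrow> (('n + 'm, 'k) mpoly, (nat \<Rightarrow> 'a) set, int \<times> int) graded_module"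
  \<comment> \<open>the modules \<open>Tor\<^sub>i\<^sup>S(S/\<mm>\<^sub>x, R)\<close>\<close>
  where "Tor_x R i =
    Tor bideg (bigraded_algebra (Idl\<^bsub>ring_of_type_algebra\<^esub> (range (\<lambda>i. Var (Inl i))))) R i"

definition almost_regular ::
    "('n::finite + 'm::finite, 'k::field) mpoly
      \<Rightarrow> (('n + 'm, 'k) mpoly, 'a, int \<times> int) graded_module \<Rightarrow> bool"
  where "almost_regular y R \<longleftrightarrow>
    y \<in> homog bideg (0, 1) \<and>
    (\<forall>i. \<forall>\<^sub>F b in at_top. carrier (strand (annihilated (Tor_x R i) y) b) = {\<zero>\<^bsub>Tor_x R i\<^esub>})"

text \<open>For almost regular \<open>y\<close> the set is bounded above, so the supremum is a maximum unless the set
  is empty.\<close>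

definition w_inv ::
    "('n::finite + 'm::finite, 'k::field) mpoly
      \<Rightarrow> (('n + 'm, 'k) mpoly, 'a, int \<times> int) graded_module \<Rightarrow> ereal"
  where "w_inv y R =
    (SUP b \<in> {b::int. \<exists>i\<in>{1..CARD('n)}.
                carrier (strand (annihilated (Tor_x R i) y) b) \<noteq> {\<zero>\<^bsub>Tor_x R i\<^esub>}}.
       ereal (real_of_int b))"


section \<open>Powers, Rees algebra and symmetric algebra of an ideal\<close>

definition gen_ideal :: "('m \<Rightarrow> ('n, 'k::field) mpoly) \<Rightarrow> ('n, 'k) mpoly set"
  where "gen_ideal f = Idl\<^bsub>ring_of_type_algebra\<^esub> (range f)"

definition ideal_power :: "('n::finite, 'k::field) mpoly set \<Rightarrow> nat
      \<Rightarrow> (('n, 'k) mpoly, ('n, 'k) mpoly, int) graded_module"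
  where "ideal_power I j =
    submod (poly_module tdeg) (I [^]\<^bsub>ideals_set ring_of_type_algebra\<^esub> j)"

definition rees_map ::
    "('m \<Rightarrow> ('n, 'k::field) mpoly) \<Rightarrow> ('n + 'm, 'k) mpoly \<Rightarrow> ('n, 'k) mpoly poly"
  where "rees_map f =
    substitute (\<lambda>c. [:Const c:])
      (case_sum (\<lambda>i. [:Var i:]) (\<lambda>j. Polynomial.monom (f j) 1))"

definition rees_algebra ::
    "('m::finite \<Rightarrow> ('n::finite, 'k::field) mpoly)
      \<Rightarrow> (('n + 'm, 'k) mpoly, ('n + 'm, 'k) mpoly set, int \<times> int) graded_module"
  where "rees_algebra f =
    bigraded_algebra (a_kernel ring_of_type_algebra ring_of_type_algebra (rees_map f))"

text \<open>
  The symmetric algebra of the \<open>S_x\<close>-module \<open>I\<close> is constructed as the free commutative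
  \<open>S_x\<close>-algebra \<open>S_x[T_g : g \<in> I]\<close> modulo the relations \<open>T_(g+h) = T_g + T_h\<close> and
  \<open>T_(a g) = a T_g\<close>.  Its degree-one part is \<open>I\<close>, with \<open>g\<close> embedded as the class of \<open>T_g\<close>.
\<close>

definition free_algebra :: "('n, 'k::field) mpoly set \<Rightarrow> (('n, 'k) mpoly, ('n, 'k) mpoly) mpoly ring"
  where "free_algebra I = ring_of_type_algebra
    \<lparr> carrier := {p. \<forall>m\<in>Poly_Mapping.keys p. Poly_Mapping.keys m \<subseteq> I} \<rparr>"

definition sym_relations ::
    "('n, 'k::field) mpoly set \<Rightarrow> (('n, 'k) mpoly, ('n, 'k) mpoly) mpoly set"
  where "sym_relations I =
    {Var (g + h) - (Var g + Var h) | g h. g \<in> I \<and> h \<in> I} \<union>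
    {Var (a * g) - Const a * Var g | a g. g \<in> I}"

definition sym_ideal :: "('n, 'k::field) mpoly set \<Rightarrow> (('n, 'k) mpoly, ('n, 'k) mpoly) mpoly set"
  where "sym_ideal I = Idl\<^bsub>free_algebra I\<^esub> (sym_relations I)"

definition sym_map ::
    "('m \<Rightarrow> ('n, 'k::field) mpoly) \<Rightarrow> ('n + 'm, 'k) mpoly
      \<Rightarrow> (('n, 'k) mpoly, ('n, 'k) mpoly) mpoly set"
  where "sym_map f h =
    sym_ideal (gen_ideal f) +>\<^bsub>free_algebra (gen_ideal f)\<^esub>
      substitute (\<lambda>c. Const (Const c)) (case_sum (\<lambda>i. Const (Var i)) (\<lambda>j. Var (f j))) h"

definition sym_algebra ::
    "('m::finite \<Rightarrow> ('n::finite, 'k::field) mpoly)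
      \<Rightarrow> (('n + 'm, 'k) mpoly, ('n + 'm, 'k) mpoly set, int \<times> int) graded_module"
  where "sym_algebra f =
    bigraded_algebra
      (a_kernel ring_of_type_algebra (free_algebra (gen_ideal f) Quot sym_ideal (gen_ideal f))
        (sym_map f))"

definition sym_power ::
    "('m::finite \<Rightarrow> ('n::finite, 'k::field) mpoly) \<Rightarrow> nat \<Rightarrow> nat
      \<Rightarrow> (('n, 'k) mpoly, ('n + 'm, 'k) mpoly set, int) graded_module"
  where "sym_power f d j = shift (- int (j * d)) (strand (sym_algebra f) (int j))"

end

theory Submission
  imports Defs "HOL-Library.Function_Algebras" "HOL-Library.List_Lenlexorder"
begin

text \<open>
  Let \<open>R = S/J\<close> be the Rees algebra or the symmetric algebra of \<open>I\<close>, and let \<open>R\<^sub>b\<close> denote the strand of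
  \<open>R\<close> in y-degree \<open>b\<close>.  Up to a twist by \<open>b d\<close> these strands are the powers, respectively the symmetric
  powers, of \<open>I\<close>, so the claim is that \<open>R\<^sub>j\<close> and \<open>R\<^sub>j\<^sub>+\<^sub>1\<close> have the same regularity.  All the modules Tor
  that occur are Koszul homology of \<open>R\<close>: the Koszul complex of the x-variables computes both
  \<open>Tor\<^sub>i(R\<^sub>b, K)\<close> over \<open>S_x\<close> and, in y-degree \<open>b\<close>, \<open>Tor\<^sub>i(S/\<mm>\<^sub>x, R)\<close> over \<open>S\<close>; that of all variables computes
  \<open>Tor\<^sub>i(R, K)\<close> over \<open>S\<close>.  Write \<open>H\<^sub>i(x)\<close>, \<open>H\<^sub>i(y)\<close>, \<open>H\<^sub>i(x, y)\<close> for these homologies.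

  The bound on \<open>reg_y\<close> gives \<open>H\<^sub>i(x, y) = 0\<close> in y-degree \<open>j + 1\<close> for all \<open>i \<le> m\<close>.  The x-variables can be
  dropped one at a time by the long exact sequence of a mapping cone and Nakayama's lemma, so
  \<open>H\<^sub>i(y) = 0\<close> in y-degree \<open>j + 1\<close> for all \<open>i\<close>.  Hence the y-Koszul complex in that degree is an exact
  sequence that builds \<open>R\<^sub>j\<^sub>+\<^sub>1\<close> from copies of the \<open>m\<close> preceding strands, and a nonzero class in
  \<open>H\<^sub>i(x)\<close> of bidegree \<open>(a, j + 1)\<close> forces one in \<open>H\<^sub>i\<^sub>-\<^sub>k(x)\<close> of bidegree \<open>(a, j - k)\<close> for some \<open>k < m\<close>
  (\<open>koszul_spectral\<close>).

  Conversely, nonvanishing of \<open>H\<^sub>i(x)\<close> in a bidegree \<open>(a, c)\<close> with \<open>c > j - m\<close> propagates to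
  \<open>(a, c + 1)\<close>.  For \<open>i \<ge> 1\<close> this is because \<open>c\<close> exceeds \<open>w(R)\<close>, so that \<open>y\<close> acts injectively.  For \<open>i = 0\<close>
  the homology lives in x-degree 0, where it is spanned by the forms in the y-variables modulo \<open>J\<close>,
  and once it is nonzero in a positive y-degree, some \<open>f\<^sub>k\<close> is nonzero and its powers keep it nonzero.  Moving the class from
  y-degree \<open>j - k\<close> to \<open>j\<close> and from \<open>j\<close> to \<open>j + 1\<close> yields the two inequalities between the regularities
  (\<open>strand_regularity_stable\<close>).

  Two bodies of theory support this.  The first is that Tor, which is defined by an arbitrarily chosen
  resolution of one argument, may be computed by a Koszul resolution of the other one
  (\<open>homology_zero_balanced\<close>); the chosen resolution exists by Dickson's lemma (\<open>free_resolution_exists\<close>).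
  The second is the passage between modules given as records and explicit spaces of polynomials:
  each module of interest is the image of the polynomials supported on some set of monomials
  (locale \<open>presented\<close>), and the vanishing of a component of Tor becomes a statement about chains of
  polynomials (\<open>tor_vanishes_iff\<close>).
\<close>

section \<open>Double complexes\<close>

text \<open>A first-quadrant double complex with exact rows and columns in positive degrees, with the homology
  at the two axes left free.  Its entries are sets rather than types, since the homogeneous parts of a
  module are sets in one ambient group.\<close>

locale double_complex =
  fixes Y :: "nat \<Rightarrow> nat \<Rightarrow> 'a::ab_group_add set"
    and dh dv :: "nat \<Rightarrow> nat \<Rightarrow> 'a \<Rightarrow> 'a"
  assumes dh_diff: "dh p q (x - y) = dh p q x - dh p q y"
    and dv_diff: "dv p q (x - y) = dv p q x - dv p q y"
    and Y_diff: "x \<in> Y p q \<Longrightarrow> y \<in> Y p q \<Longrightarrow> x - y \<in> Y p q"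
    and dh_in: "x \<in> Y (Suc p) q \<Longrightarrow> dh p q x \<in> Y p q"
    and dv_in: "x \<in> Y p (Suc q) \<Longrightarrow> dv p q x \<in> Y p q"
    and dh_dh: "x \<in> Y (Suc (Suc p)) q \<Longrightarrow> dh p q (dh (Suc p) q x) = 0"
    and dv_dv: "x \<in> Y p (Suc (Suc q)) \<Longrightarrow> dv p q (dv p (Suc q) x) = 0"
    and dh_dv: "x \<in> Y (Suc p) (Suc q) \<Longrightarrow> dh p q (dv (Suc p) q x) = dv p q (dh p (Suc q) x)"
    and rows_exact: "x \<in> Y (Suc p) q \<Longrightarrow> dh p q x = 0 \<Longrightarrow> \<exists>w\<in>Y (Suc (Suc p)) q. x = dh (Suc p) q w"
    and columns_exact: "x \<in> Y p (Suc q) \<Longrightarrow> dv p q x = 0 \<Longrightarrow> \<exists>w\<in>Y p (Suc (Suc q)). x = dv p (Suc q) w"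
begin

text \<open>
  For \<open>q = 0\<close> this is exactness at \<open>p\<close> of the complex of cokernels of the first vertical maps, and for
  \<open>p = 0\<close> exactness at \<open>q\<close> of the complex of cokernels of the first horizontal maps.  The general case
  interpolates between the two along an antidiagonal.\<close>

definition corner_exact :: "nat \<Rightarrow> nat \<Rightarrow> bool"
  where "corner_exact p q \<longleftrightarrow> (\<forall>z\<in>Y p q.
    (\<forall>k. p = Suc k \<longrightarrow> (\<exists>u\<in>Y k (Suc q). dh k q z = dv k q u)) \<longrightarrow>
    (\<forall>l. q = Suc l \<longrightarrow> (\<exists>u\<in>Y (Suc p) l. dv p l z = dh p l u)) \<longrightarrow>
    (\<exists>w\<in>Y (Suc p) q. \<exists>v\<in>Y p (Suc q). z = dh p q w + dv p q v))"

text \<open>One step of the staircase: the image of \<open>z\<close> under the horizontal map lifts vertically, the lift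
  satisfies the condition at the next position, and the solution there is pushed back along the exact
  rows.\<close>

lemma corner_exact_step:
  assumes "corner_exact p (Suc q)"
  shows "corner_exact (Suc p) q"
  unfolding corner_exact_def
proof (intro ballI impI)
  fix z
  assume z: "z \<in> Y (Suc p) q"
    and 1: "\<forall>k. Suc p = Suc k \<longrightarrow> (\<exists>u\<in>Y k (Suc q). dh k q z = dv k q u)"
  obtain u where u: "u \<in> Y p (Suc q)" "dh p q z = dv p q u"
    using 1 by blast
  have "\<exists>s\<in>Y k (Suc (Suc q)). dh k (Suc q) u = dv k (Suc q) s" if k: "p = Suc k" for k
  proof (rule columns_exact)
    show "dh k (Suc q) u \<in> Y k (Suc q)"
      using u(1) k by (auto intro: dh_in)
    have "dv k q (dh k (Suc q) u) = dh k q (dh (Suc k) q z)"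
      using dh_dv u k by metis
    then show "dv k q (dh k (Suc q) u) = 0"
      using dh_dh z k by metis
  qed
  moreover have "\<exists>t\<in>Y (Suc p) l. dv p l u = dh p l t" if "Suc q = Suc l" for l
    using that u z by (intro bexI[of _ z]) auto
  ultimately obtain w v where wv: "w \<in> Y (Suc p) (Suc q)" "v \<in> Y p (Suc (Suc q))"
    "u = dh p (Suc q) w + dv p (Suc q) v"
    using assms u(1) unfolding corner_exact_def by blast
  have "dh p q (z - dv (Suc p) q w) = dv p q (u - dh p (Suc q) w)"
    using wv(1) by (simp add: dh_diff dv_diff u(2) dh_dv)
  also have "\<dots> = dv p q (dv p (Suc q) v)"
    using wv(3) by simp
  also have "\<dots> = 0"
    by (rule dv_dv) (rule wv)
  finally obtain w' where "w' \<in> Y (Suc (Suc p)) q" "z - dv (Suc p) q w = dh (Suc p) q w'"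
    using rows_exact[of "z - dv (Suc p) q w" p q] Y_diff dv_in wv(1) z by metis
  then show "\<exists>w\<in>Y (Suc (Suc p)) q. \<exists>v\<in>Y (Suc p) (Suc q). z = dh (Suc p) q w + dv (Suc p) q v"
    using wv(1) by (metis diff_add_cancel)
qed

lemma corner_exact_along: "corner_exact p (q + k) \<Longrightarrow> corner_exact (p + k) q"
proof (induction k arbitrary: p)
  case (Suc k)
  then have "corner_exact (Suc p) (q + k)"
    by (auto intro: corner_exact_step)
  then show ?case
    using Suc.IH[of "Suc p"] by simp
qed simp

end

lemma (in double_complex) double_complex_swap:
  "double_complex (\<lambda>p q. Y q p) (\<lambda>p q. dv q p) (\<lambda>p q. dh q p)"
  by unfold_locales
    (simp_all add: dh_diff dv_diff Y_diff dh_in dv_in dh_dh dv_dv dh_dv rows_exact columns_exact)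

text \<open>The staircase from one axis to the other gives one implication, and the same argument for the
  transposed double complex gives the other.\<close>

lemma (in double_complex) corner_exact_iff: "corner_exact n 0 \<longleftrightarrow> corner_exact 0 n"
proof
  assume "corner_exact 0 n"
  then show "corner_exact n 0"
    using corner_exact_along[of 0 0 n] by simp
next
  interpret swap: double_complex "\<lambda>p q. Y q p" "\<lambda>p q. dv q p" "\<lambda>p q. dh q p"
    by (rule double_complex_swap)
  have *: "swap.corner_exact p q \<longleftrightarrow> corner_exact q p" for p q
    unfolding swap.corner_exact_def corner_exact_def by (subst add.commute) blast
  assume "corner_exact n 0"
  then show "corner_exact 0 n"
    using swap.corner_exact_along[of 0 0 n] * by simp
qed


section \<open>Complexes of graded free modules\<close>

text \<open>A complex of graded free modules of finite rank: index sets of bases, their degrees, and the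
  matrices of the differentials.  The index type is arbitrary, so that lists of truth values can
  index the basis of an exterior power.\<close>

record ('r, 'i, 'g) matrix_complex =
  basis :: "nat \<Rightarrow> 'i set"
  bdeg :: "nat \<Rightarrow> 'i \<Rightarrow> 'g"
  bmat :: "nat \<Rightarrow> 'i \<Rightarrow> 'i \<Rightarrow> 'r"

text \<open>The component of degree \<open>g\<close> of \<open>P\<^sub>i \<otimes> C\<close> for a family \<open>C\<close> of homogeneous components.\<close>

definition gchains ::
    "('g \<Rightarrow> 'c::zero set) \<Rightarrow> ('r, 'i, 'g::ab_group_add) matrix_complex \<Rightarrow> nat \<Rightarrow> 'g \<Rightarrow> ('i \<Rightarrow> 'c) set"
  where "gchains C P i g =
    {v. (\<forall>p\<in>basis P i. v p \<in> C (g - bdeg P i p)) \<and> (\<forall>p. p \<notin> basis P i \<longrightarrow> v p = 0)}"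

definition bd ::
    "('r \<Rightarrow> 'c \<Rightarrow> 'c::comm_monoid_add) \<Rightarrow> ('r, 'i, 'g) matrix_complex \<Rightarrow> nat \<Rightarrow> ('i \<Rightarrow> 'c) \<Rightarrow> 'i \<Rightarrow> 'c"
  where "bd act P i v =
    (\<lambda>p. if p \<in> basis P i then \<Sum>q\<in>basis P (Suc i). act (bmat P i p q) (v q) else 0)"

text \<open>The homology of \<open>P \<otimes> M\<close> at position \<open>i\<close> is zero in degree \<open>g\<close>, where \<open>M = C/Z\<close>.  Working with
  representatives in \<open>C\<close> modulo \<open>Z\<close> avoids the formation of quotients altogether.\<close>

definition homology_zero ::
    "('r \<Rightarrow> 'c \<Rightarrow> 'c::ab_group_add) \<Rightarrow> ('g \<Rightarrow> 'c set) \<Rightarrow> ('g \<Rightarrow> 'c set)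
      \<Rightarrow> ('r, 'i, 'g::ab_group_add) matrix_complex \<Rightarrow> nat \<Rightarrow> 'g \<Rightarrow> bool"
  where "homology_zero act C Z P i g \<longleftrightarrow> (\<forall>z\<in>gchains C P i g.
    (\<forall>k. i = Suc k \<longrightarrow> bd act P k z \<in> gchains Z P k g) \<longrightarrow>
    (\<exists>w\<in>gchains C P (Suc i) g. z - bd act P i w \<in> gchains Z P i g))"

locale graded_ring =
  fixes H :: "'g::ab_group_add \<Rightarrow> 'r::comm_ring_1 set"
  assumes H_zero [simp]: "0 \<in> H g"
    and H_diff: "r \<in> H g \<Longrightarrow> s \<in> H g \<Longrightarrow> r - s \<in> H g"
    and H_mult: "r \<in> H g \<Longrightarrow> s \<in> H h \<Longrightarrow> r * s \<in> H (g + h)"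
    and H_one: "1 \<in> H 0"

text \<open>A graded module with a graded submodule, given by their homogeneous components in one ambient
  group; the module meant is the quotient \<open>C/Z\<close>.\<close>

locale graded_pair = graded_ring H for H :: "'g::ab_group_add \<Rightarrow> 'r::comm_ring_1 set" +
  fixes act :: "'r \<Rightarrow> 'c::ab_group_add \<Rightarrow> 'c" and C Z :: "'g \<Rightarrow> 'c set"
  assumes act_diff: "act r (x - y) = act r x - act r y"
    and diff_act: "act (r - s) x = act r x - act s x"
    and act_act: "act (r * s) x = act r (act s x)"
    and act_one: "act 1 x = x"
    and act_C: "r \<in> H g \<Longrightarrow> x \<in> C h \<Longrightarrow> act r x \<in> C (g + h)"
    and act_Z: "r \<in> H g \<Longrightarrow> x \<in> Z h \<Longrightarrow> act r x \<in> Z (g + h)"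
    and C_zero [simp]: "0 \<in> C g" and C_diff: "x \<in> C g \<Longrightarrow> y \<in> C g \<Longrightarrow> x - y \<in> C g"
    and Z_zero [simp]: "0 \<in> Z g" and Z_diff: "x \<in> Z g \<Longrightarrow> y \<in> Z g \<Longrightarrow> x - y \<in> Z g"
    and Z_C: "x \<in> Z g \<Longrightarrow> x \<in> C g"

lemma sum_apply_fun: "(\<Sum>i\<in>A. f i) x = (\<Sum>i\<in>A. f i x)" for f :: "'i \<Rightarrow> 'b \<Rightarrow> 'c::comm_monoid_add"
  by (induction A rule: infinite_finite_induct) auto

lemma minus_closed: "0 \<in> A \<Longrightarrow> (\<And>x y. x \<in> A \<Longrightarrow> y \<in> A \<Longrightarrow> x - y \<in> A) \<Longrightarrow> x \<in> A \<Longrightarrow> - x \<in> A"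
  for x :: "'a::ab_group_add"
  by (metis diff_0)

lemma add_closed: "0 \<in> A \<Longrightarrow> (\<And>x y. x \<in> A \<Longrightarrow> y \<in> A \<Longrightarrow> x - y \<in> A) \<Longrightarrow> x \<in> A \<Longrightarrow> y \<in> A \<Longrightarrow> x + y \<in> A"
  for x :: "'a::ab_group_add"
  by (metis diff_0 diff_minus_eq_add)

lemma sum_closed: "0 \<in> A \<Longrightarrow> (\<And>x y. x \<in> A \<Longrightarrow> y \<in> A \<Longrightarrow> x - y \<in> A) \<Longrightarrow> (\<And>i. i \<in> I \<Longrightarrow> f i \<in> A) \<Longrightarrow> sum f I \<in> A"
  for f :: "'i \<Rightarrow> 'a::ab_group_add"
  by (induction I rule: infinite_finite_induct) (auto intro: add_closed)

context graded_pair
begin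

lemma C_add: "x \<in> C g \<Longrightarrow> y \<in> C g \<Longrightarrow> x + y \<in> C g"
  by (rule add_closed) (auto intro: C_diff)

lemma Z_add: "x \<in> Z g \<Longrightarrow> y \<in> Z g \<Longrightarrow> x + y \<in> Z g"
  by (rule add_closed) (auto intro: Z_diff)

lemma act_zero: "act r 0 = 0"
  using act_diff[of r 0 0] by simp

lemma zero_act: "act 0 x = 0"
  using diff_act[of 0 0 x] by simp

lemma act_minus: "act r (- x) = - act r x"
  using act_diff[of r 0 x] by (simp add: act_zero)

lemma act_add: "act r (x + y) = act r x + act r y"
  using act_diff[of r x "- y"] by (simp add: act_minus)

lemma minus_act: "act (- r) x = - act r x"
  using diff_act[of 0 r x] by (simp add: zero_act)

lemma add_act: "act (r + s) x = act r x + act s x"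
  using diff_act[of r "- s" x] by (simp add: minus_act)

lemma act_sum: "act r (\<Sum>i\<in>A. f i) = (\<Sum>i\<in>A. act r (f i))"
  by (induction A rule: infinite_finite_induct) (auto simp: act_add act_zero)

lemma sum_act: "act (\<Sum>i\<in>A. f i) x = (\<Sum>i\<in>A. act (f i) x)"
  by (induction A rule: infinite_finite_induct) (auto simp: add_act zero_act)

end

locale graded_complex = graded_ring H for H :: "'g::ab_group_add \<Rightarrow> 'r::comm_ring_1 set" +
  fixes P :: "('r, 'i, 'g) matrix_complex"
  assumes fin [simp]: "finite (basis P i)"
    and mat_homog: "p \<in> basis P i \<Longrightarrow> q \<in> basis P (Suc i) \<Longrightarrow>
      bmat P i p q \<in> H (bdeg P (Suc i) q - bdeg P i p)"

lemma gchains_diff: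
  "(\<And>g x y. x \<in> C g \<Longrightarrow> y \<in> C g \<Longrightarrow> x - y \<in> C g) \<Longrightarrow> u \<in> gchains C P i g \<Longrightarrow> v \<in> gchains C P i g
    \<Longrightarrow> u - v \<in> gchains C P i g"
  for u :: "'i \<Rightarrow> 'c::ab_group_add"
  by (auto simp: gchains_def)

lemma gchains_zero: "(\<And>g. 0 \<in> C g) \<Longrightarrow> 0 \<in> gchains C P i g"
  by (auto simp: gchains_def)

lemma (in graded_pair) bd_diff: "bd act P i (u - v) = bd act P i u - bd act P i v"
  by (auto simp: bd_def fun_eq_iff act_diff sum_subtractf)

lemma (in graded_pair) bd_chains:
  assumes "graded_complex H P"
    and "\<And>g h r x. r \<in> H g \<Longrightarrow> x \<in> D h \<Longrightarrow> act r x \<in> D (g + h)"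
    and "\<And>g. 0 \<in> D g" "\<And>g x y. x \<in> D g \<Longrightarrow> y \<in> D g \<Longrightarrow> x - y \<in> D g"
    and "v \<in> gchains D P (Suc i) g"
  shows "bd act P i v \<in> gchains D P i g"
proof -
  have "(\<Sum>q\<in>basis P (Suc i). act (bmat P i p q) (v q)) \<in> D (g - bdeg P i p)" if "p \<in> basis P i" for p
  proof (rule sum_closed)
    fix q assume q: "q \<in> basis P (Suc i)"
    have "act (bmat P i p q) (v q) \<in> D (bdeg P (Suc i) q - bdeg P i p + (g - bdeg P (Suc i) q))"
      using graded_complex.mat_homog[OF assms(1) that q] assms(5) q
      by (intro assms(2)) (auto simp: gchains_def)
    then show "act (bmat P i p q) (v q) \<in> D (g - bdeg P i p)"
      by simp
  qed (use assms in auto)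
  then show ?thesis
    by (auto simp: gchains_def bd_def)
qed

lemma (in graded_pair) bd_C:
  "graded_complex H P \<Longrightarrow> v \<in> gchains C P (Suc i) g \<Longrightarrow> bd act P i v \<in> gchains C P i g"
  by (rule bd_chains) (auto intro: act_C C_diff)

lemma (in graded_pair) bd_Z:
  "graded_complex H P \<Longrightarrow> v \<in> gchains Z P (Suc i) g \<Longrightarrow> bd act P i v \<in> gchains Z P i g"
  by (rule bd_chains) (auto intro: act_Z Z_diff)

lemma (in graded_ring) ring_pair: "graded_pair H (*) H (\<lambda>_. {0})"
  by unfold_locales (auto simp: algebra_simps intro: H_mult H_diff)

definition aug ::
    "('r \<Rightarrow> 'c \<Rightarrow> 'c::comm_monoid_add) \<Rightarrow> ('i \<Rightarrow> 'c) \<Rightarrow> ('r, 'i, 'g) matrix_complex \<Rightarrow> ('i \<Rightarrow> 'r) \<Rightarrow> 'c"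
  where "aug act c P v = (\<Sum>p\<in>basis P 0. act (v p) (c p))"

text \<open>\<open>P\<close> is a graded free resolution of \<open>C/Z\<close>, the basis elements of \<open>P\<^sub>0\<close> being sent to the classes of
  the \<open>c p\<close>.\<close>

locale resolves = graded_complex H P + graded_pair H act C Z
  for H :: "'g::ab_group_add \<Rightarrow> 'r::comm_ring_1 set" and P :: "('r, 'i, 'g) matrix_complex"
    and act :: "'r \<Rightarrow> 'c::ab_group_add \<Rightarrow> 'c" and C Z +
  fixes c :: "'i \<Rightarrow> 'c"
  assumes bd_bd: "v \<in> gchains H P (Suc (Suc i)) g \<Longrightarrow> bd (*) P i (bd (*) P (Suc i) v) = 0"
    and exact: "v \<in> gchains H P (Suc i) g \<Longrightarrow> bd (*) P i v = 0 \<Longrightarrow>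
      \<exists>w\<in>gchains H P (Suc (Suc i)) g. v = bd (*) P (Suc i) w"
    and gens: "p \<in> basis P 0 \<Longrightarrow> c p \<in> C (bdeg P 0 p)"
    and aug_surj: "x \<in> C g \<Longrightarrow> \<exists>v\<in>gchains H P 0 g. x - aug act c P v \<in> Z g"
    and aug_ker: "v \<in> gchains H P 0 g \<Longrightarrow>
      aug act c P v \<in> Z g \<longleftrightarrow> (\<exists>w\<in>gchains H P 1 g. v = bd (*) P 0 w)"

abbreviation (input) scale :: "'r::times \<Rightarrow> ('i \<Rightarrow> 'r) \<Rightarrow> 'i \<Rightarrow> 'r"
  where "scale r v \<equiv> (\<lambda>p. r * v p)"

text \<open>The cokernel of \<open>P\<^sub>1 \<rightarrow> P\<^sub>0\<close> as a graded pair.\<close>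

lemma (in graded_complex) presentation_pair:
  "graded_pair H scale (gchains H P 0) (\<lambda>g. bd (*) P 0 ` gchains H P 1 g)"
proof -
  interpret R: graded_pair H "(*)" H "\<lambda>_. {0}"
    by (rule ring_pair)
  have gc: "graded_complex H P"
    by unfold_locales
  have sc: "scale r v \<in> gchains H P i (g + h)" if "r \<in> H g" "v \<in> gchains H P i h" for r v g h i
    using that H_mult[of r g _ "h - _"] by (fastforce simp: gchains_def algebra_simps)
  show ?thesis
  proof (unfold_locales, goal_cases)
    case (6 r g x h)
    then obtain w where w: "w \<in> gchains H P 1 h" "x = bd (*) P 0 w"
      by blast
    have "scale r x = bd (*) P 0 (scale r w)"
      by (auto simp: w bd_def fun_eq_iff sum_distrib_left algebra_simps)
    then show ?case
      using sc w 6 by blast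
  next
    case (9 g)
    have "bd (*) P 0 0 = 0"
      by (auto simp: bd_def)
    then show ?case
      using gchains_zero[of H] by (metis H_zero image_eqI)
  next
    case (10 x g y)
    then obtain u v where u: "u \<in> gchains H P 1 g" "x = bd (*) P 0 u"
      and v: "v \<in> gchains H P 1 g" "y = bd (*) P 0 v"
      by blast
    have "x - y = bd (*) P 0 (u - v)"
      by (simp add: u v R.bd_diff)
    then show ?case
      using gchains_diff[of H u P 1 g v] H_diff u v by blast
  next
    case (11 x g)
    then show ?case
      using R.bd_C[OF gc] by auto
  qed (auto simp: fun_eq_iff algebra_simps intro: sc gchains_zero gchains_diff H_diff)
qed

lemma (in resolves) aug_diff: "aug act c P (u - v) = aug act c P u - aug act c P v"
  by (simp add: aug_def diff_act sum_subtractf)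

lemma (in resolves) aug_scale: "aug act c P (scale r v) = act r (aug act c P v)"
  by (simp add: aug_def act_act act_sum)

lemma (in resolves) aug_chains: "v \<in> gchains H P 0 g \<Longrightarrow> aug act c P v \<in> C g"
  unfolding aug_def
proof (rule sum_closed)
  fix p assume v: "v \<in> gchains H P 0 g" and p: "p \<in> basis P 0"
  have "act (v p) (c p) \<in> C (g - bdeg P 0 p + bdeg P 0 p)"
    using v p by (intro act_C gens) (auto simp: gchains_def)
  then show "act (v p) (c p) \<in> C g"
    by simp
qed (auto intro: C_diff)

text \<open>Coefficients in \<open>C/Z\<close> may be replaced by the cokernel of \<open>P\<^sub>1 \<rightarrow> P\<^sub>0\<close>: the augmentation induces an
  isomorphism, and chains are lifted and projected along it componentwise.\<close>

lemma (in resolves) homology_zero_presentation: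
  fixes Q :: "('r, 'j, 'g) matrix_complex"
  assumes "graded_complex H Q"
  shows "homology_zero scale (gchains H P 0) (\<lambda>g. bd (*) P 0 ` gchains H P 1 g) Q i g \<longleftrightarrow> homology_zero act C Z Q i g"
proof -
  define C' where "C' = gchains H P 0"
  define Z' where "Z' = (\<lambda>g. bd (*) P 0 ` gchains H P 1 g)"
  define t where "t = aug act c P"
  interpret P0: graded_pair H scale C' Z'
    unfolding C'_def Z'_def by (rule presentation_pair)
  have t_diff: "t (u - v) = t u - t v" for u v
    by (simp add: t_def aug_diff)
  have t_zero: "t 0 = 0"
    using t_diff[of 0 0] by simp
  have t_add: "t (u + v) = t u + t v" for u v
    using t_diff[of u "- v"] t_diff[of 0 v] t_zero by simp
  have t_sum: "t (sum f A) = (\<Sum>a\<in>A. t (f a))" for f :: "'j \<Rightarrow> _" and A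
    by (induction A rule: infinite_finite_induct) (simp_all only: sum.infinite sum.empty sum.insert t_add t_zero not_False_eq_True)
  have t_C: "t v \<in> C h" if "v \<in> C' h" for v h
    using aug_chains that by (auto simp: t_def C'_def)
  have t_Z: "t v \<in> Z h \<longleftrightarrow> v \<in> Z' h" if "v \<in> C' h" for v h
    using aug_ker that by (auto simp: t_def C'_def Z'_def)
  have t_lift: "\<exists>v\<in>C' h. x - t v \<in> Z h" if "x \<in> C h" for x h
    using aug_surj that by (auto simp: t_def C'_def)
  have t_bd: "(\<lambda>p. t (bd scale Q k v p)) = bd act Q k (\<lambda>p. t (v p))" for v k
    by (auto simp: bd_def fun_eq_iff t_zero t_sum)
       (simp add: t_def aug_scale)
  have ch_C: "(\<lambda>p. t (v p)) \<in> gchains C Q k g" if "v \<in> gchains C' Q k g" for v k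
    using that t_C t_zero by (auto simp: gchains_def)
  have ch_Z: "(\<lambda>p. t (v p)) \<in> gchains Z Q k g \<longleftrightarrow> v \<in> gchains Z' Q k g" if "v \<in> gchains C' Q k g" for v k
    using that t_Z t_zero by (auto simp: gchains_def)
  have ch_lift: "\<exists>v\<in>gchains C' Q k g. u - (\<lambda>p. t (v p)) \<in> gchains Z Q k g" if "u \<in> gchains C Q k g" for u k
  proof -
    have "\<forall>p\<in>basis Q k. \<exists>v\<in>C' (g - bdeg Q k p). u p - t v \<in> Z (g - bdeg Q k p)"
      using that t_lift by (auto simp: gchains_def)
    then obtain v where v: "\<forall>p\<in>basis Q k. v p \<in> C' (g - bdeg Q k p) \<and> u p - t (v p) \<in> Z (g - bdeg Q k p)"
      by metis
    show ?thesis
      by (rule bexI[of _ "\<lambda>p. if p \<in> basis Q k then v p else 0"])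
         (use v that t_zero in \<open>auto simp: gchains_def\<close>)
  qed
  have dC: "u - v \<in> gchains C Q k g" if "u \<in> gchains C Q k g" "v \<in> gchains C Q k g" for u v k
    using that by (rule gchains_diff[rotated]) (rule C_diff)
  have dC': "u - v \<in> gchains C' Q k g" if "u \<in> gchains C' Q k g" "v \<in> gchains C' Q k g" for u v k
    using that by (rule gchains_diff[rotated]) (rule P0.C_diff)
  have dZ: "u - v \<in> gchains Z Q k g" if "u \<in> gchains Z Q k g" "v \<in> gchains Z Q k g" for u v k
    using that by (rule gchains_diff[rotated]) (rule Z_diff)
  have aZ: "u + v \<in> gchains Z Q k g" if "u \<in> gchains Z Q k g" "v \<in> gchains Z Q k g" for u v k
    using that by (auto simp: gchains_def intro: Z_add)
  have tdm: "(\<lambda>p. t ((u - v) p)) = (\<lambda>p. t (u p)) - (\<lambda>p. t (v p))" for u v :: "'j \<Rightarrow> _"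
    by (auto simp: t_diff fun_eq_iff)
  have "homology_zero act C Z Q i g" if h: "homology_zero scale C' Z' Q i g"
    unfolding homology_zero_def
  proof (intro ballI impI)
    fix z assume z: "z \<in> gchains C Q i g"
      and cyc: "\<forall>k. i = Suc k \<longrightarrow> bd act Q k z \<in> gchains Z Q k g"
    obtain z' where z': "z' \<in> gchains C' Q i g" "z - (\<lambda>p. t (z' p)) \<in> gchains Z Q i g"
      using ch_lift z by blast
    have "bd scale Q k z' \<in> gchains Z' Q k g" if k: "i = Suc k" for k
    proof -
      have "bd act Q k z - bd act Q k (z - (\<lambda>p. t (z' p))) \<in> gchains Z Q k g"
        using bd_Z[OF assms] z'(2) k cyc by (intro dZ) auto
      then have "(\<lambda>p. t (bd scale Q k z' p)) \<in> gchains Z Q k g"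
        by (simp add: bd_diff t_bd)
      then show ?thesis
        using ch_Z P0.bd_C[OF assms] z' k by blast
    qed
    then obtain w where w: "w \<in> gchains C' Q (Suc i) g" "z' - bd scale Q i w \<in> gchains Z' Q i g"
      using h z'(1) unfolding homology_zero_def by blast
    have "(\<lambda>p. t ((z' - bd scale Q i w) p)) \<in> gchains Z Q i g"
      using w z'(1) P0.bd_C[OF assms] ch_Z dC' by blast
    then have "(\<lambda>p. t (z' p)) - bd act Q i (\<lambda>p. t (w p)) \<in> gchains Z Q i g"
      unfolding tdm t_bd .
    then have "z - bd act Q i (\<lambda>p. t (w p)) \<in> gchains Z Q i g"
      using aZ[OF z'(2)] by fastforce
    then show "\<exists>w\<in>gchains C Q (Suc i) g. z - bd act Q i w \<in> gchains Z Q i g"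
      using ch_C w(1) by blast
  qed
  moreover have "homology_zero scale C' Z' Q i g" if h: "homology_zero act C Z Q i g"
    unfolding homology_zero_def
  proof (intro ballI impI)
    fix z assume z: "z \<in> gchains C' Q i g"
      and cyc: "\<forall>k. i = Suc k \<longrightarrow> bd scale Q k z \<in> gchains Z' Q k g"
    have "bd act Q k (\<lambda>p. t (z p)) \<in> gchains Z Q k g" if "i = Suc k" for k
      using ch_Z cyc that P0.bd_C[OF assms] z by (simp flip: t_bd)
    then obtain w where w: "w \<in> gchains C Q (Suc i) g" "(\<lambda>p. t (z p)) - bd act Q i w \<in> gchains Z Q i g"
      using h ch_C z unfolding homology_zero_def by blast
    obtain w' where w': "w' \<in> gchains C' Q (Suc i) g" "w - (\<lambda>p. t (w' p)) \<in> gchains Z Q (Suc i) g"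
      using ch_lift w by blast
    have "(\<lambda>p. t (z p)) - bd act Q i w + bd act Q i (w - (\<lambda>p. t (w' p))) \<in> gchains Z Q i g"
      using aZ w(2) bd_Z[OF assms] w'(2) by blast
    then have "(\<lambda>p. t ((z - bd scale Q i w') p)) \<in> gchains Z Q i g"
      unfolding tdm t_bd bd_diff by simp
    then show "\<exists>w\<in>gchains C' Q (Suc i) g. z - bd scale Q i w \<in> gchains Z' Q i g"
      using ch_Z dC' z w'(1) P0.bd_C[OF assms] by blast
  qed
  ultimately show ?thesis
    unfolding C'_def Z'_def by blast
qed

section \<open>Balancing\<close>

text \<open>Tor may be computed by resolving either argument.  With coefficients replaced by presentations
  from the resolutions, both sides are homology of cokernel complexes at the two axes of the double
  complex \<open>P \<otimes> Q\<close>, whose rows and columns are exact because \<open>P\<close> and \<open>Q\<close> consist of free modules.\<close>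

theorem homology_zero_balanced:
  fixes P :: "('r::comm_ring_1, 'i, 'g::ab_group_add) matrix_complex"
    and Q :: "('r, 'j, 'g) matrix_complex"
  assumes "resolves H P act\<^sub>1 C\<^sub>1 Z\<^sub>1 c\<^sub>1" and "resolves H Q act\<^sub>2 C\<^sub>2 Z\<^sub>2 c\<^sub>2"
  shows "homology_zero act\<^sub>2 C\<^sub>2 Z\<^sub>2 P n g \<longleftrightarrow> homology_zero act\<^sub>1 C\<^sub>1 Z\<^sub>1 Q n g"
proof -
  interpret P: resolves H P act\<^sub>1 C\<^sub>1 Z\<^sub>1 c\<^sub>1 by fact
  interpret Q: resolves H Q act\<^sub>2 C\<^sub>2 Z\<^sub>2 c\<^sub>2 by fact
  interpret R: graded_pair H "(*)" H "\<lambda>_. {0}"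
    by (rule P.ring_pair)
  have gP: "graded_complex H P" and gQ: "graded_complex H Q" by unfold_locales
  define Y where "Y = (\<lambda>p q. {f :: 'i \<Rightarrow> 'j \<Rightarrow> 'r.
    (\<forall>a b. (a \<in> basis P p \<and> b \<in> basis Q q \<longrightarrow> f a b \<in> H (g - bdeg P p a - bdeg Q q b)) \<and>
      (a \<notin> basis P p \<or> b \<notin> basis Q q \<longrightarrow> f a b = 0))})"
  define dh where "dh = (\<lambda>p (q::nat) (f :: 'i \<Rightarrow> 'j \<Rightarrow> 'r) a b. bd (*) P p (\<lambda>a. f a b) a)"
  define dv where "dv = (\<lambda>(p::nat) q (f :: 'i \<Rightarrow> 'j \<Rightarrow> 'r) a. bd (*) Q q (f a))"
  have Y_row: "f \<in> Y p q \<longleftrightarrow> (\<forall>b\<in>basis Q q. (\<lambda>a. f a b) \<in> gchains H P p (g - bdeg Q q b)) \<and>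
      (\<forall>b. b \<notin> basis Q q \<longrightarrow> (\<lambda>a. f a b) = 0)" for f p q
    by (auto simp: Y_def gchains_def fun_eq_iff cancel_ab_semigroup_add_class.diff_right_commute[of g])
  have Y_col: "f \<in> Y p q \<longleftrightarrow> (\<forall>a\<in>basis P p. f a \<in> gchains H Q q (g - bdeg P p a)) \<and>
      (\<forall>a. a \<notin> basis P p \<longrightarrow> f a = 0)" for f p q
    by (auto simp: Y_def gchains_def fun_eq_iff)
  have bd0P: "bd (*) P p 0 = 0" for p by (auto simp: bd_def)
  have bd0Q: "bd (*) Q p 0 = 0" for p by (auto simp: bd_def)
  have dh_col: "(\<lambda>a. dh p q f a b) = bd (*) P p (\<lambda>a. f a b)" for p q f b
    by (simp add: dh_def)
  have lift_rows: "\<exists>w\<in>Y p q. \<forall>b. R b (\<lambda>a. w a b)"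
    if "\<forall>b\<in>basis Q q. \<exists>u\<in>gchains H P p (g - bdeg Q q b). R b u" "\<forall>b. b \<notin> basis Q q \<longrightarrow> R b 0"
    for p q R
  proof -
    obtain u where u: "\<forall>b\<in>basis Q q. u b \<in> gchains H P p (g - bdeg Q q b) \<and> R b (u b)"
      using \<open>\<forall>b\<in>basis Q q. \<exists>u\<in>_. _\<close> by metis
    define w where "w = (\<lambda>a b. if b \<in> basis Q q then u b a else 0)"
    have w: "(\<lambda>a. w a b) = (if b \<in> basis Q q then u b else 0)" for b
      by (auto simp: w_def)
    show ?thesis
      by (rule bexI[of _ w]) (use u that(2) in \<open>simp_all add: Y_row w\<close>)
  qed
  have lift_cols: "\<exists>w\<in>Y p q. \<forall>a. R a (w a)"
    if "\<forall>a\<in>basis P p. \<exists>u\<in>gchains H Q q (g - bdeg P p a). R a u" "\<forall>a. a \<notin> basis P p \<longrightarrow> R a 0"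
    for p q R
  proof -
    obtain u where u: "\<forall>a\<in>basis P p. u a \<in> gchains H Q q (g - bdeg P p a) \<and> R a (u a)"
      using \<open>\<forall>a\<in>basis P p. \<exists>u\<in>_. _\<close> by metis
    show ?thesis
      by (rule bexI[of _ "\<lambda>a. if a \<in> basis P p then u a else 0"]) (use u that(2) in \<open>simp_all add: Y_col\<close>)
  qed
  interpret D: double_complex Y dh dv
  proof (unfold_locales, goal_cases)
    case (1 p q x y)
    then show ?case
      by (auto simp: dh_def fun_eq_iff bd_def sum_subtractf algebra_simps)
  next
    case (2 p q x y)
    then show ?case
      by (auto simp: dv_def fun_eq_iff bd_def sum_subtractf algebra_simps)
  next
    case (3 x p q y)
    then show ?case
      by (auto simp: Y_def P.H_diff)
  next
    case (4 x p q)
    then show ?case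
      using R.bd_C[OF gP] by (auto simp: Y_row dh_col bd0P)
  next
    case (5 x p q)
    then show ?case
      using R.bd_C[OF gQ] by (auto simp: Y_col dv_def bd0Q)
  next
    case (6 x p q)
    have "(\<lambda>a. dh p q (dh (Suc p) q x) a b) = 0" for b
      unfolding dh_col using 6 P.bd_bd by (cases "b \<in> basis Q q") (auto simp: Y_row bd0P)
    then show ?case
      by (auto simp: fun_eq_iff)
  next
    case (7 x p q)
    have "dv p q (dv p (Suc q) x) a = 0" for a
      unfolding dv_def using 7 Q.bd_bd by (cases "a \<in> basis P p") (auto simp: Y_col bd0Q)
    then show ?case
      by (auto simp: fun_eq_iff)
  next
    case (8 x p q)
    show ?case
      by (auto simp: dh_def dv_def bd_def fun_eq_iff sum_distrib_left algebra_simps intro: sum.swap)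
  next
    case (9 x p q)
    have "\<exists>w\<in>Y (Suc (Suc p)) q. \<forall>b. (\<lambda>a. x a b) = bd (*) P (Suc p) (\<lambda>a. w a b)"
    proof (rule lift_rows[where R = "\<lambda>b u. (\<lambda>a. x a b) = bd (*) P (Suc p) u"]; intro ballI allI impI)
      fix b assume "b \<in> basis Q q"
      then show "\<exists>u\<in>gchains H P (Suc (Suc p)) (g - bdeg Q q b). (\<lambda>a. x a b) = bd (*) P (Suc p) u"
        using 9 dh_col[of p q x b] by (intro P.exact) (auto simp: Y_row fun_eq_iff)
    qed (use 9 in \<open>auto simp: Y_row bd0P\<close>)
    then show ?case
      by (auto simp: dh_def fun_eq_iff)
  next
    case (10 x p q)
    have "\<exists>w\<in>Y p (Suc (Suc q)). \<forall>a. x a = bd (*) Q (Suc q) (w a)"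
    proof (rule lift_cols[where R = "\<lambda>a u. x a = bd (*) Q (Suc q) u"]; intro ballI allI impI)
      fix a assume "a \<in> basis P p"
      then show "\<exists>u\<in>gchains H Q (Suc (Suc q)) (g - bdeg P p a). x a = bd (*) Q (Suc q) u"
        using 10 by (intro Q.exact) (auto simp: Y_col dv_def fun_eq_iff)
    qed (use 10 in \<open>auto simp: Y_col bd0Q\<close>)
    then show ?case
      by (auto simp: dv_def fun_eq_iff)
  qed
  define CP where "CP = gchains H P 0" define ZP where "ZP = (\<lambda>g. bd (*) P 0 ` gchains H P 1 g)"
  define CQ where "CQ = gchains H Q 0" define ZQ where "ZQ = (\<lambda>g. bd (*) Q 0 ` gchains H Q 1 g)"
  have bdh: "bd scale P p f = dh p 0 f" for p f
    by (auto simp: bd_def dh_def fun_eq_iff sum_apply_fun)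
  have bdv: "bd scale Q p (\<lambda>b a. f a b) = (\<lambda>b a. dv 0 p f a b)" for p f
    by (auto simp: bd_def dv_def fun_eq_iff sum_apply_fun)
  have chQ: "f \<in> gchains D P p g \<longleftrightarrow> (\<forall>a\<in>basis P p. f a \<in> D (g - bdeg P p a)) \<and>
      (\<forall>a. a \<notin> basis P p \<longrightarrow> f a = 0)" for f p and D :: "'g \<Rightarrow> ('j \<Rightarrow> 'r) set"
    by (auto simp: gchains_def)
  have chP: "f \<in> gchains D Q p g \<longleftrightarrow> (\<forall>a\<in>basis Q p. f a \<in> D (g - bdeg Q p a)) \<and>
      (\<forall>a. a \<notin> basis Q p \<longrightarrow> f a = 0)" for f p and D :: "'g \<Rightarrow> ('i \<Rightarrow> 'r) set"
    by (auto simp: gchains_def)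
  have Y0: "Y p 0 = gchains CQ P p g" for p
    by (simp only: set_eq_iff Y_col chQ) (simp add: CQ_def)
  have Y0': "f \<in> Y 0 q \<longleftrightarrow> (\<lambda>b a. f a b) \<in> gchains CP Q q g" for f q
    by (simp only: Y_row chP) (simp add: CP_def)
  have Z0: "f \<in> gchains ZQ P p g \<longleftrightarrow> (\<exists>u\<in>Y p 1. f = dv p 0 u)" for f p
  proof
    assume f: "f \<in> gchains ZQ P p g"
    have "\<exists>w\<in>Y p 1. \<forall>a. f a = bd (*) Q 0 (w a)"
      by (rule lift_cols[where R = "\<lambda>a u. f a = bd (*) Q 0 u"])
         (use f[unfolded chQ] in \<open>auto simp: ZQ_def bd0Q\<close>)
    then show "\<exists>u\<in>Y p 1. f = dv p 0 u"
      by (auto simp: dv_def fun_eq_iff)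
  next
    assume "\<exists>u\<in>Y p 1. f = dv p 0 u"
    then obtain u where u: "u \<in> Y p 1" "f = dv p 0 u" by blast
    show "f \<in> gchains ZQ P p g"
      unfolding chQ using u by (auto simp: ZQ_def Y_col dv_def bd0Q)
  qed
  have Z0': "(\<lambda>b a. f a b) \<in> gchains ZP Q q g \<longleftrightarrow> (\<exists>u\<in>Y 1 q. f = dh 0 q u)" for f q
  proof
    assume f: "(\<lambda>b a. f a b) \<in> gchains ZP Q q g"
    have "\<exists>w\<in>Y 1 q. \<forall>b. (\<lambda>a. f a b) = bd (*) P 0 (\<lambda>a. w a b)"
      by (rule lift_rows[where R = "\<lambda>b u. (\<lambda>a. f a b) = bd (*) P 0 u"])
         (use f[unfolded chP] in \<open>auto simp: ZP_def bd0P\<close>)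
    then show "\<exists>u\<in>Y 1 q. f = dh 0 q u"
      by (auto simp: dh_def fun_eq_iff)
  next
    assume "\<exists>u\<in>Y 1 q. f = dh 0 q u"
    then obtain u where u: "u \<in> Y 1 q" "f = dh 0 q u" by blast
    have "(\<lambda>a. f a b) = bd (*) P 0 (\<lambda>a. u a b)" for b
      by (simp add: u dh_col)
    then show "(\<lambda>b a. f a b) \<in> gchains ZP Q q g"
      unfolding chP using u(1) by (auto simp: ZP_def Y_row bd0P)
  qed
  have "homology_zero scale CQ ZQ P n g \<longleftrightarrow> D.corner_exact n 0"
    unfolding homology_zero_def D.corner_exact_def bdh Z0 Y0[symmetric]
    by (simp add: diff_eq_eq add.commute[of "dv _ _ _"])
  also have "\<dots> \<longleftrightarrow> D.corner_exact 0 n"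
    by (rule D.corner_exact_iff)
  also have "\<dots> \<longleftrightarrow> homology_zero scale CP ZP Q n g"
  proof -
    have flip: "(\<forall>z\<in>gchains CP Q k g. Ph z) \<longleftrightarrow> (\<forall>z\<in>Y 0 k. Ph (\<lambda>b a. z a b))"
      "(\<exists>z\<in>gchains CP Q k g. Ph z) \<longleftrightarrow> (\<exists>z\<in>Y 0 k. Ph (\<lambda>b a. z a b))" for k Ph
    proof -
      have "f \<in> (\<lambda>z b a. z a b) ` Y 0 k" if "f \<in> gchains CP Q k g" for f
        by (rule image_eqI[of _ _ "\<lambda>a b. f b a"]) (use that Y0'[of "\<lambda>a b. f b a" k] in auto)
      then have "gchains CP Q k g = (\<lambda>z b a. z a b) ` Y 0 k"
        using Y0' by blast
      then show "(\<forall>z\<in>gchains CP Q k g. Ph z) \<longleftrightarrow> (\<forall>z\<in>Y 0 k. Ph (\<lambda>b a. z a b))"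
        "(\<exists>z\<in>gchains CP Q k g. Ph z) \<longleftrightarrow> (\<exists>z\<in>Y 0 k. Ph (\<lambda>b a. z a b))"
        by auto
    qed
    have sub: "(\<lambda>b a. z a b) - (\<lambda>b a. y a b) = (\<lambda>b a. (z - y) a b)" for z y :: "'i \<Rightarrow> 'j \<Rightarrow> 'r"
      by (auto simp: fun_eq_iff)
    show ?thesis
      unfolding homology_zero_def D.corner_exact_def flip bdv sub Z0'
      by (simp add: diff_eq_eq) blast
  qed
  finally show ?thesis
    unfolding CQ_def ZQ_def CP_def ZP_def
    using P.homology_zero_presentation[OF gQ] Q.homology_zero_presentation[OF gP] by blast
qed

section \<open>Koszul complexes\<close>

text \<open>Sequences are lists of ring elements paired with their degrees, and the basis of the
  exterior power is indexed by the characteristic vectors of the chosen entries.  Recursion on the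
  list exhibits the Koszul complex as the mapping cone of multiplication by its first entry on the
  Koszul complex of the others; the sign sits on the shifted copy.\<close>

fun koszul_deg :: "('r \<times> 'g::monoid_add) list \<Rightarrow> bool list \<Rightarrow> 'g"
  where "koszul_deg (x # ws) (b # bs) = (if b then snd x else 0) + koszul_deg ws bs"
  | "koszul_deg _ _ = 0"

fun koszul_mat :: "('r::comm_ring_1 \<times> 'g) list \<Rightarrow> bool list \<Rightarrow> bool list \<Rightarrow> 'r"
  where "koszul_mat (x # ws) (a # as) (b # bs) =
    (if a = b then (if a then - koszul_mat ws as bs else koszul_mat ws as bs)
     else if b \<and> as = bs then fst x else 0)"
  | "koszul_mat _ _ _ = 0"

definition koszul_basis :: "nat \<Rightarrow> nat \<Rightarrow> bool list set"
  where "koszul_basis n i = {bs. length bs = n \<and> count_list bs True = i}"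

definition koszul :: "('r::comm_ring_1 \<times> 'g::ab_group_add) list \<Rightarrow> ('r, bool list, 'g) matrix_complex"
  where "koszul ws = \<lparr> basis = koszul_basis (length ws), bdeg = (\<lambda>_. koszul_deg ws),
    bmat = (\<lambda>_. koszul_mat ws) \<rparr>"

lemma koszul_basis_Nil: "koszul_basis 0 i = (if i = 0 then {[]} else {})"
  by (auto simp: koszul_basis_def)

lemma Cons_in_koszul_basis:
  "b # bs \<in> koszul_basis (Suc n) i \<longleftrightarrow>
    (if b then \<exists>k. i = Suc k \<and> bs \<in> koszul_basis n k else bs \<in> koszul_basis n i)"
  by (auto simp: koszul_basis_def)

lemma Nil_notin_koszul_basis [simp]: "[] \<notin> koszul_basis (Suc n) i"
  by (auto simp: koszul_basis_def)

lemma koszul_basis_Suc: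
  "koszul_basis (Suc n) (Suc i) = Cons False ` koszul_basis n (Suc i) \<union> Cons True ` koszul_basis n i"
proof (rule Set.set_eqI)
  fix bs
  show "bs \<in> koszul_basis (Suc n) (Suc i) \<longleftrightarrow>
    bs \<in> Cons False ` koszul_basis n (Suc i) \<union> Cons True ` koszul_basis n i"
  proof (cases bs)
    case (Cons b bs')
    then show ?thesis
      by (cases b) (auto simp: Cons_in_koszul_basis)
  qed auto
qed

lemma finite_koszul_basis [simp]: "finite (koszul_basis n i)"
  by (rule finite_subset[OF _ finite_lists_length_eq[of "UNIV :: bool set" n]])
    (auto simp: koszul_basis_def)

lemma koszul_basis_empty: "n < i \<Longrightarrow> koszul_basis n i = {}"
  using count_le_length[of _ True] by (auto simp: koszul_basis_def simp flip: not_le)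

lemma koszul_basis_0: "koszul_basis n 0 = {replicate n False}"
proof -
  have "bs = replicate (length bs) False" if "count_list bs True = 0" for bs :: "bool list"
    using that by (induction bs) (auto split: if_splits)
  moreover have "count_list (replicate n False) True = 0"
    by (induction n) auto
  ultimately show ?thesis
    by (auto simp: koszul_basis_def)
qed

lemma koszul_deg_replicate: "koszul_deg ws (replicate n False) = 0"
  by (induction ws arbitrary: n) (case_tac n; simp)+

lemma (in graded_ring) koszul_complex:
  assumes "\<And>w d. (w, d) \<in> set ws \<Longrightarrow> w \<in> H d"
  shows "graded_complex H (koszul ws)"
proof
  have neg: "- r \<in> H g" if "r \<in> H g" for r g
    using H_diff[of 0 g r] that by simp
  have "koszul_mat ws as bs \<in> H (koszul_deg ws bs - koszul_deg ws as)"
    if "length as = length ws" "length bs = length ws" for as bs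
    using that assms
  proof (induction ws arbitrary: as bs)
    case (Cons x ws)
    obtain a as' b bs' where ab: "as = a # as'" "bs = b # bs'"
      using Cons.prems by (cases as; cases bs) auto
    have "koszul_mat ws as' bs' \<in> H (koszul_deg ws bs' - koszul_deg ws as')"
      using Cons ab by auto
    moreover have "fst x \<in> H (snd x)"
      using Cons.prems(3)[of "fst x" "snd x"] by simp
    ultimately show ?case
      by (auto simp: ab neg algebra_simps)
  qed auto
  then show "bmat (koszul ws) i p q \<in> H (bdeg (koszul ws) (Suc i) q - bdeg (koszul ws) i p)"
    if "p \<in> basis (koszul ws) i" "q \<in> basis (koszul ws) (Suc i)" for p q i
    using that by (auto simp: koszul_def koszul_basis_def)
qed (simp add: koszul_def)

text \<open>The two summands of a chain of the mapping cone: the coefficients at basis elements that omit the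
  first entry of the sequence, and at those that contain it.\<close>

definition lo :: "(bool list \<Rightarrow> 'c) \<Rightarrow> bool list \<Rightarrow> 'c" where "lo f bs = f (False # bs)"
definition hi :: "(bool list \<Rightarrow> 'c) \<Rightarrow> bool list \<Rightarrow> 'c" where "hi f bs = f (True # bs)"
definition join :: "(bool list \<Rightarrow> 'c::zero) \<Rightarrow> (bool list \<Rightarrow> 'c) \<Rightarrow> bool list \<Rightarrow> 'c"
  where "join u v bs = (case bs of [] \<Rightarrow> 0 | b # bs' \<Rightarrow> if b then v bs' else u bs')"

lemma join_simps [simp]: "lo (join u v) = u" "hi (join u v) = v" "join u v [] = 0"
  by (auto simp: lo_def hi_def join_def)

lemma lo_diff: "lo (f - g) = lo f - lo g" and hi_diff: "hi (f - g) = hi f - hi g"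
  for f g :: "bool list \<Rightarrow> 'c::ab_group_add"
  by (auto simp: lo_def hi_def fun_eq_iff)

lemma eq_by_lo_hi: "f = g \<longleftrightarrow> f [] = g [] \<and> lo f = lo g \<and> hi f = hi g"
  unfolding lo_def hi_def fun_eq_iff by (metis (full_types) neq_Nil_conv)

lemma ball_lists: "(\<forall>bs. Ph bs) \<longleftrightarrow> Ph [] \<and> (\<forall>bs. Ph (False # bs)) \<and> (\<forall>bs. Ph (True # bs))"
  by (metis (full_types) neq_Nil_conv)

lemma gchains_iff:
  "f \<in> gchains C P i g \<longleftrightarrow> (\<forall>p. if p \<in> basis P i then f p \<in> C (g - bdeg P i p) else f p = 0)"
  by (auto simp: gchains_def)

lemma gchains_koszul_Suc:
  "f \<in> gchains C (koszul (x # ws)) (Suc i) g \<longleftrightarrow>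
    f [] = 0 \<and> lo f \<in> gchains C (koszul ws) (Suc i) g \<and> hi f \<in> gchains C (koszul ws) i (g - snd x)"
  unfolding gchains_iff
  by (subst ball_lists) (simp add: koszul_def Cons_in_koszul_basis lo_def hi_def diff_diff_eq)

lemma gchains_koszul_0:
  "f \<in> gchains C (koszul (x # ws)) 0 g \<longleftrightarrow>
    f [] = 0 \<and> lo f \<in> gchains C (koszul ws) 0 g \<and> hi f = 0"
  unfolding gchains_iff
  by (subst ball_lists) (simp add: koszul_def Cons_in_koszul_basis lo_def hi_def fun_eq_iff)

lemma bd_koszul_Nil [simp]: "bd act (koszul (x # ws)) i f [] = 0"
  by (simp add: bd_def koszul_def)

lemma hi_bd_koszul_0 [simp]: "hi (bd act (koszul (x # ws)) 0 f) = 0"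
  by (auto simp: hi_def bd_def koszul_def Cons_in_koszul_basis fun_eq_iff)

context graded_pair
begin

lemma hi_bd_koszul:
  "hi (bd act (koszul (x # ws)) (Suc i) f) = - bd act (koszul ws) i (hi f)"
proof
  fix as
  have "(\<Sum>q\<in>koszul_basis (Suc (length ws)) (Suc (Suc i)). act (koszul_mat (x # ws) (True # as) q) (f q))
    = (\<Sum>q\<in>koszul_basis (length ws) (Suc (Suc i)). act (koszul_mat (x # ws) (True # as) (False # q)) (f (False # q)))
    + (\<Sum>q\<in>koszul_basis (length ws) (Suc i). act (koszul_mat (x # ws) (True # as) (True # q)) (f (True # q)))"
    unfolding koszul_basis_Suc
    by (subst sum.union_disjoint) (auto simp: sum.reindex inj_on_def)
  then show "hi (bd act (koszul (x # ws)) (Suc i) f) as = (- bd act (koszul ws) i (hi f)) as"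
    by (simp add: bd_def koszul_def hi_def Cons_in_koszul_basis minus_act zero_act sum_negf)
qed

lemma lo_bd_koszul:
  assumes "\<And>bs. bs \<notin> koszul_basis (length ws) i \<Longrightarrow> hi f bs = 0"
  shows "lo (bd act (koszul (x # ws)) i f) =
    bd act (koszul ws) i (lo f) + (\<lambda>bs. act (fst x) (hi f bs))"
proof
  fix as
  have "(\<Sum>q\<in>koszul_basis (Suc (length ws)) (Suc i). act (koszul_mat (x # ws) (False # as) q) (f q))
    = (\<Sum>q\<in>koszul_basis (length ws) (Suc i). act (koszul_mat (x # ws) (False # as) (False # q)) (f (False # q)))
    + (\<Sum>q\<in>koszul_basis (length ws) i. act (koszul_mat (x # ws) (False # as) (True # q)) (f (True # q)))"
    unfolding koszul_basis_Suc
    by (subst sum.union_disjoint) (auto simp: sum.reindex inj_on_def)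
  also have "(\<Sum>q\<in>koszul_basis (length ws) i. act (koszul_mat (x # ws) (False # as) (True # q)) (f (True # q)))
    = (\<Sum>q\<in>koszul_basis (length ws) i. if as = q then act (fst x) (hi f q) else 0)"
    by (rule sum.cong) (auto simp: hi_def zero_act)
  finally show "lo (bd act (koszul (x # ws)) i f) as =
    (bd act (koszul ws) i (lo f) + (\<lambda>bs. act (fst x) (hi f bs))) as"
    using assms[of as]
    by (simp add: bd_def koszul_def lo_def Cons_in_koszul_basis act_zero)
qed

lemma lo_bd_gchains:
  assumes "f \<in> gchains D (koszul (x # ws)) (Suc i) g"
  shows "lo (bd act (koszul (x # ws)) i f) =
    bd act (koszul ws) i (lo f) + (\<lambda>bs. act (fst x) (hi f bs))"
  using assms unfolding gchains_koszul_Suc by (intro lo_bd_koszul) (auto simp: gchains_def koszul_def)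

lemma gchains_C_add: "u \<in> gchains C P i g \<Longrightarrow> v \<in> gchains C P i g \<Longrightarrow> u + v \<in> gchains C P i g"
  by (auto simp: gchains_def intro: C_add)

lemma gchains_Z_add: "u \<in> gchains Z P i g \<Longrightarrow> v \<in> gchains Z P i g \<Longrightarrow> u + v \<in> gchains Z P i g"
  by (auto simp: gchains_def intro: Z_add)

lemma bd_act: "bd act P i (\<lambda>bs. act r (v bs)) = (\<lambda>bs. act r (bd act P i v bs))"
  by (auto simp: bd_def fun_eq_iff act_sum act_zero mult.commute simp flip: act_act)

lemma bd_add: "bd act P i (u + v) = bd act P i u + bd act P i v"
  by (auto simp: bd_def fun_eq_iff act_add sum.distrib)

lemma bd_minus: "bd act P i (- u) = - bd act P i u"
  by (auto simp: bd_def fun_eq_iff act_minus sum_negf)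

lemma bd_0 [simp]: "bd act P i 0 = 0"
  by (auto simp: bd_def act_zero)

lemma act_gchains:
  assumes "r \<in> H d" "v \<in> gchains C P i (g - d)"
  shows "(\<lambda>p. act r (v p)) \<in> gchains C P i g"
proof -
  have "act r (v p) \<in> C (g - bdeg P i p)" if "p \<in> basis P i" for p
    using act_C[OF assms(1), of "v p" "g - d - bdeg P i p"] assms(2) that
    by (auto simp: gchains_def algebra_simps)
  then show ?thesis
    using assms(2) by (auto simp: gchains_def act_zero)
qed

lemma act_gchains_Z:
  assumes "r \<in> H d" "v \<in> gchains Z P i (g - d)"
  shows "(\<lambda>p. act r (v p)) \<in> gchains Z P i g"
proof -
  have "act r (v p) \<in> Z (g - bdeg P i p)" if "p \<in> basis P i" for p
    using act_Z[OF assms(1), of "v p" "g - d - bdeg P i p"] assms(2) that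
    by (auto simp: gchains_def algebra_simps)
  then show ?thesis
    using assms(2) by (auto simp: gchains_def act_zero)
qed

lemma koszul_bd_bd:
  "v \<in> gchains C (koszul ws) (Suc (Suc i)) g \<Longrightarrow>
    bd act (koszul ws) i (bd act (koszul ws) (Suc i) v) = 0"
proof (induction ws arbitrary: v i g)
  case Nil
  then show ?case
    by (auto simp: bd_def koszul_def koszul_basis_Nil)
next
  case (Cons x ws)
  let ?K = "koszul ws" and ?L = "koszul (x # ws)"
  from Cons.prems have lv: "lo v \<in> gchains C ?K (Suc (Suc i)) g"
    and hv: "hi v \<in> gchains C ?K (Suc i) (g - snd x)"
    by (auto simp: gchains_koszul_Suc)
  have h: "hi (bd act ?L (Suc i) v) = - bd act ?K i (hi v)"
    by (rule hi_bd_koszul)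
  have "lo (bd act ?L i (bd act ?L (Suc i) v)) = bd act ?K i (lo (bd act ?L (Suc i) v))
      + (\<lambda>bs. act (fst x) (hi (bd act ?L (Suc i) v) bs))"
    by (rule lo_bd_koszul) (unfold h, simp add: bd_def koszul_def)
  also have "\<dots> = 0"
    by (simp add: lo_bd_gchains[OF Cons.prems] h bd_add bd_act Cons.IH[OF lv])
       (auto simp: fun_eq_iff act_minus)
  finally have 1: "lo (bd act ?L i (bd act ?L (Suc i) v)) = 0" .
  have "hi (bd act ?L i (bd act ?L (Suc i) v)) = 0"
  proof (cases i)
    case (Suc k)
    then show ?thesis
      using Cons.IH[of "hi v" k "g - snd x"] hv by (simp add: hi_bd_koszul bd_minus fun_eq_iff)
  qed simp
  with 1 show ?case
    by (subst eq_by_lo_hi) (auto simp: lo_def hi_def fun_eq_iff)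
qed

text \<open>The long exact sequence of the mapping cone: \<open>H\<^sub>i(ws)\<close> modulo the image of multiplication by
  \<open>x\<close> embeds into \<open>H\<^sub>i(x, ws)\<close>, and the image comes from the degree lowered by that of \<open>x\<close>.\<close>

lemma koszul_homology_zero_tail:
  assumes ws: "\<And>w d. (w, d) \<in> set (x # ws) \<Longrightarrow> w \<in> H d"
    and big: "homology_zero act C Z (koszul (x # ws)) i g"
    and prev: "homology_zero act C Z (koszul ws) i (g - snd x)"
  shows "homology_zero act C Z (koszul ws) i g"
  unfolding homology_zero_def
proof (intro ballI impI)
  let ?K = "koszul ws" and ?L = "koszul (x # ws)"
  have K: "graded_complex H ?K"
    using ws by (intro koszul_complex) auto
  have x: "fst x \<in> H (snd x)"
    using ws[of "fst x" "snd x"] by simp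
  fix z assume z: "z \<in> gchains C ?K i g"
    and cyc: "\<forall>k. i = Suc k \<longrightarrow> bd act ?K k z \<in> gchains Z ?K k g"
  have f: "join z 0 \<in> gchains C ?L i g"
    using z by (cases i) (auto simp: gchains_koszul_Suc gchains_koszul_0 gchains_zero)
  have "bd act ?L k (join z 0) \<in> gchains Z ?L k g" if k: "i = Suc k" for k
  proof -
    have "lo (bd act ?L k (join z 0)) \<in> gchains Z ?K k g"
      using cyc k by (subst lo_bd_koszul) (auto simp: act_zero plus_fun_def)
    then show ?thesis
      by (cases k) (auto simp: gchains_koszul_Suc gchains_koszul_0 hi_bd_koszul gchains_zero)
  qed
  then obtain w where w: "w \<in> gchains C ?L (Suc i) g" "join z 0 - bd act ?L i w \<in> gchains Z ?L i g"
    using big f unfolding homology_zero_def by blast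
  define u v where "u = lo w" and "v = hi w"
  have uv: "u \<in> gchains C ?K (Suc i) g" "v \<in> gchains C ?K i (g - snd x)"
    using w(1) by (auto simp: gchains_koszul_Suc u_def v_def)
  have 1: "z - (bd act ?K i u + (\<lambda>bs. act (fst x) (v bs))) \<in> gchains Z ?K i g"
    using w(2) lo_bd_gchains[OF w(1)]
    by (cases i) (auto simp: gchains_koszul_Suc gchains_koszul_0 lo_diff u_def v_def)
  have "bd act ?K k v \<in> gchains Z ?K k (g - snd x)" if "i = Suc k" for k
    using w(2) that by (auto simp: gchains_koszul_Suc hi_diff hi_bd_koszul v_def)
  then obtain t where t: "t \<in> gchains C ?K (Suc i) (g - snd x)"
    "v - bd act ?K i t \<in> gchains Z ?K i (g - snd x)"
    using prev uv(2) unfolding homology_zero_def by blast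
  have "(\<lambda>bs. act (fst x) ((v - bd act ?K i t) bs)) \<in> gchains Z ?K i g"
    by (rule act_gchains_Z[OF x t(2)])
  then have "(\<lambda>bs. act (fst x) (v bs)) - bd act ?K i (\<lambda>bs. act (fst x) (t bs)) \<in> gchains Z ?K i g"
    by (simp add: bd_act act_diff fun_diff_def)
  with 1 have "z - (bd act ?K i u + (\<lambda>bs. act (fst x) (v bs))) +
      ((\<lambda>bs. act (fst x) (v bs)) - bd act ?K i (\<lambda>bs. act (fst x) (t bs))) \<in> gchains Z ?K i g"
    by (rule gchains_Z_add)
  then have "z - bd act ?K i (u + (\<lambda>bs. act (fst x) (t bs))) \<in> gchains Z ?K i g"
    by (simp add: bd_add algebra_simps)
  moreover have "u + (\<lambda>bs. act (fst x) (t bs)) \<in> gchains C ?K (Suc i) g"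
    by (intro gchains_C_add uv(1) act_gchains[OF x t(1)])
  ultimately show "\<exists>w\<in>gchains C ?K (Suc i) g. z - bd act ?K i w \<in> gchains Z ?K i g"
    by blast
qed

end

section \<open>Homology along an exact sequence\<close>

text \<open>A double complex with a sub-double complex \<open>N\<close>.  Exactness refers to the quotient by \<open>N\<close> and is
  asked position by position, since it is available on one antidiagonal only.\<close>

locale double_complex_mod =
  fixes Y N :: "nat \<Rightarrow> nat \<Rightarrow> 'a::ab_group_add set"
    and dh dv :: "nat \<Rightarrow> nat \<Rightarrow> 'a \<Rightarrow> 'a"
  assumes dh_diff: "dh p q (x - y) = dh p q x - dh p q y"
    and dv_diff: "dv p q (x - y) = dv p q x - dv p q y"
    and Y_diff: "x \<in> Y p q \<Longrightarrow> y \<in> Y p q \<Longrightarrow> x - y \<in> Y p q"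
    and Y_zero: "0 \<in> Y p q" and N_zero: "0 \<in> N p q"
    and N_diff: "x \<in> N p q \<Longrightarrow> y \<in> N p q \<Longrightarrow> x - y \<in> N p q"
    and dh_in: "x \<in> Y (Suc p) q \<Longrightarrow> dh p q x \<in> Y p q"
    and dv_in: "x \<in> Y p (Suc q) \<Longrightarrow> dv p q x \<in> Y p q"
    and dh_N: "x \<in> N (Suc p) q \<Longrightarrow> dh p q x \<in> N p q"
    and dv_N: "x \<in> N p (Suc q) \<Longrightarrow> dv p q x \<in> N p q"
    and dh_dh: "x \<in> Y (Suc (Suc p)) q \<Longrightarrow> dh p q (dh (Suc p) q x) = 0"
    and dv_dv: "x \<in> Y p (Suc (Suc q)) \<Longrightarrow> dv p q (dv p (Suc q) x) = 0"
    and dh_dv: "x \<in> Y (Suc p) (Suc q) \<Longrightarrow> dh p q (dv (Suc p) q x) = dv p q (dh p (Suc q) x)"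
begin

definition row_exact :: "nat \<Rightarrow> nat \<Rightarrow> bool"
  where "row_exact p q \<longleftrightarrow> (\<forall>z\<in>Y p q. (\<forall>k. p = Suc k \<longrightarrow> dh k q z \<in> N k q) \<longrightarrow>
    (\<exists>w\<in>Y (Suc p) q. z - dh p q w \<in> N p q))"

definition column_exact :: "nat \<Rightarrow> nat \<Rightarrow> bool"
  where "column_exact p q \<longleftrightarrow> (\<forall>z\<in>Y p q. (\<forall>k. q = Suc k \<longrightarrow> dv p k z \<in> N p k) \<longrightarrow>
    (\<exists>w\<in>Y p (Suc q). z - dv p q w \<in> N p q))"

lemma N_add: "x \<in> N p q \<Longrightarrow> y \<in> N p q \<Longrightarrow> x + y \<in> N p q"
  by (rule add_closed) (auto intro: N_zero N_diff)

lemma split_sum: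
  assumes "\<And>a b. a + b = p + q \<Longrightarrow> row_exact a (Suc b)"
    and "\<And>a b. a + b = p + q \<Longrightarrow> column_exact a b"
    and "z \<in> Y p (Suc q)"
    and "\<And>k. p = Suc k \<Longrightarrow> dv k q (dh k (Suc q) z) \<in> N k q"
  shows "\<exists>w\<in>Y (Suc p) (Suc q). \<exists>v\<in>Y p (Suc (Suc q)). z - dh p (Suc q) w - dv p (Suc q) v \<in> N p (Suc q)"
  using assms
proof (induction p arbitrary: q z)
  case 0
  have "row_exact 0 (Suc q)"
    using 0 by simp
  then obtain w where "w \<in> Y (Suc 0) (Suc q)" "z - dh 0 (Suc q) w \<in> N 0 (Suc q)"
    using 0 unfolding row_exact_def by blast
  moreover have "dv 0 (Suc q) 0 = 0"
    using dv_diff[of 0 "Suc q" 0 0] by simp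
  ultimately show ?case
    using Y_zero by (metis diff_zero)
next
  case (Suc p)
  note z = Suc.prems(3)
  have "dv p k (dh p (Suc q) z) \<in> N p k" if "Suc q = Suc k" for k
    using Suc.prems(4) that by simp
  moreover have "column_exact p (Suc q)"
    using Suc.prems(2) by simp
  ultimately obtain z' where z': "z' \<in> Y p (Suc (Suc q))"
    "dh p (Suc q) z - dv p (Suc q) z' \<in> N p (Suc q)"
    using dh_in[OF z] unfolding column_exact_def by blast
  have "dv k (Suc q) (dh k (Suc (Suc q)) z') \<in> N k (Suc q)" if k: "p = Suc k" for k
  proof -
    have "dh k (Suc q) (dh p (Suc q) z - dv p (Suc q) z') \<in> N k (Suc q)"
      using dh_N z'(2) k by blast
    then have "0 - dv k (Suc q) (dh k (Suc (Suc q)) z') \<in> N k (Suc q)"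
      using dh_dh[of z k "Suc q"] dh_dv[of z' k "Suc q"] z z'(1) k by (simp add: dh_diff)
    then show ?thesis
      using N_diff[OF N_zero] by fastforce
  qed
  moreover have "a + b = p + Suc q \<Longrightarrow> row_exact a (Suc b)"
    "a + b = p + Suc q \<Longrightarrow> column_exact a b" for a b
    using Suc.prems(1,2)[of a b] by auto
  ultimately obtain w' v' where wv: "w' \<in> Y (Suc p) (Suc (Suc q))" "v' \<in> Y p (Suc (Suc (Suc q)))"
    "z' - dh p (Suc (Suc q)) w' - dv p (Suc (Suc q)) v' \<in> N p (Suc (Suc q))"
    using Suc.IH[of "Suc q" z'] z'(1) by blast
  define y where "y = z - dv (Suc p) (Suc q) w'"
  have "dv p (Suc q) (z' - dh p (Suc (Suc q)) w' - dv p (Suc (Suc q)) v') \<in> N p (Suc q)"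
    by (rule dv_N) (rule wv)
  then have "dv p (Suc q) z' - dv p (Suc q) (dh p (Suc (Suc q)) w') \<in> N p (Suc q)"
    using dv_dv wv(2) by (simp add: dv_diff)
  from N_add[OF z'(2) this] have "dh p (Suc q) y \<in> N p (Suc q)"
    using dh_dv[OF wv(1)] by (simp add: y_def dh_diff)
  moreover have "y \<in> Y (Suc p) (Suc q)"
    unfolding y_def by (intro Y_diff z dv_in wv)
  moreover have "row_exact (Suc p) (Suc q)"
    using Suc.prems(1) by simp
  ultimately obtain w where "w \<in> Y (Suc (Suc p)) (Suc q)" "y - dh (Suc p) (Suc q) w \<in> N (Suc p) (Suc q)"
    unfolding row_exact_def by blast
  then show ?case
    using wv(1) unfolding y_def by (metis cancel_ab_semigroup_add_class.diff_right_commute)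
qed

lemma first_row_exact:
  assumes rows: "\<And>a b. a + b = n \<Longrightarrow> row_exact a (Suc b)"
    and columns: "\<And>a b. a + b = n \<Longrightarrow> column_exact a b"
  shows "row_exact n 0"
  unfolding row_exact_def
proof (intro ballI impI)
  fix z assume z: "z \<in> Y n 0" and cyc: "\<forall>k. n = Suc k \<longrightarrow> dh k 0 z \<in> N k 0"
  have "column_exact n 0"
    using columns by simp
  then obtain z' where z': "z' \<in> Y n (Suc 0)" "z - dv n 0 z' \<in> N n 0"
    using z unfolding column_exact_def by blast
  have "dv k 0 (dh k (Suc 0) z') \<in> N k 0" if k: "n = Suc k" for k
  proof -
    have "dh k 0 z - dh k 0 (z - dv n 0 z') \<in> N k 0"
      using dh_N z'(2) k cyc by (intro N_diff) auto
    then show ?thesis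
      using dh_dv[of z' k 0] z'(1) k by (simp add: dh_diff)
  qed
  then obtain w v where wv: "w \<in> Y (Suc n) (Suc 0)" "v \<in> Y n (Suc (Suc 0))"
    "z' - dh n (Suc 0) w - dv n (Suc 0) v \<in> N n (Suc 0)"
    using split_sum[of n 0 z'] rows columns z'(1) by auto
  have "dv n 0 (z' - dh n (Suc 0) w - dv n (Suc 0) v) \<in> N n 0"
    by (rule dv_N) (rule wv)
  then have "dv n 0 z' - dv n 0 (dh n (Suc 0) w) \<in> N n 0"
    using dv_dv wv(2) by (simp add: dv_diff)
  from N_add[OF z'(2) this] have "z - dh n 0 (dv (Suc n) 0 w) \<in> N n 0"
    using dh_dv[OF wv(1)] by simp
  then show "\<exists>w\<in>Y (Suc n) 0. z - dh n 0 w \<in> N n 0"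
    using dv_in wv(1) by blast
qed

end

text \<open>The form in which the spectral sequence of the double complex \<open>P \<otimes> Q \<otimes> M\<close> is used: when \<open>Q \<otimes> M\<close> is
  exact in the degrees concerned, the homology of \<open>P \<otimes> M\<close> is controlled by the terms \<open>P \<otimes> Q\<^sub>j \<otimes> M\<close>
  with \<open>j \<ge> 1\<close>.  The basis element \<open>b\<^sub>0\<close> of \<open>Q\<^sub>0\<close> only serves to single out one copy of
  \<open>P \<otimes> M\<close> in \<open>P \<otimes> Q\<^sub>0 \<otimes> M\<close>.\<close>

lemma (in graded_pair) homology_zero_from_exact_columns:
  fixes P :: "('r, 'i, 'g) matrix_complex" and Q :: "('r, 'j, 'g) matrix_complex"
  assumes P: "graded_complex H P" and Q: "graded_complex H Q"
    and P_bd_bd: "\<And>v i g. v \<in> gchains C P (Suc (Suc i)) g \<Longrightarrow> bd act P i (bd act P (Suc i) v) = 0"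
    and Q_bd_bd: "\<And>v i g. v \<in> gchains C Q (Suc (Suc i)) g \<Longrightarrow> bd act Q i (bd act Q (Suc i) v) = 0"
    and rows: "\<And>i j b. i + j = n \<Longrightarrow> b \<in> basis Q (Suc j) \<Longrightarrow> homology_zero act C Z P i (g - bdeg Q (Suc j) b)"
    and columns: "\<And>i j a. i + j = n \<Longrightarrow> a \<in> basis P i \<Longrightarrow> homology_zero act C Z Q j (g - bdeg P i a)"
    and b0: "b\<^sub>0 \<in> basis Q 0"
  shows "homology_zero act C Z P n (g - bdeg Q 0 b\<^sub>0)"
proof -
  define T where "T = (\<lambda>D p q. {f :: 'i \<Rightarrow> 'j \<Rightarrow> 'c.
    (\<forall>a b. (a \<in> basis P p \<and> b \<in> basis Q q \<longrightarrow> f a b \<in> D (g - bdeg P p a - bdeg Q q b)) \<and>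
      (a \<notin> basis P p \<or> b \<notin> basis Q q \<longrightarrow> f a b = 0))})"
  define dh where "dh = (\<lambda>p (q::nat) (f :: 'i \<Rightarrow> 'j \<Rightarrow> 'c) a b. bd act P p (\<lambda>a. f a b) a)"
  define dv where "dv = (\<lambda>(p::nat) q (f :: 'i \<Rightarrow> 'j \<Rightarrow> 'c) a. bd act Q q (f a))"
  have T_row: "f \<in> T D p q \<longleftrightarrow> (\<forall>b\<in>basis Q q. (\<lambda>a. f a b) \<in> gchains D P p (g - bdeg Q q b)) \<and>
      (\<forall>b. b \<notin> basis Q q \<longrightarrow> (\<lambda>a. f a b) = 0)" for D f p q
    by (auto simp: T_def gchains_def fun_eq_iff cancel_ab_semigroup_add_class.diff_right_commute[of g])
  have T_col: "f \<in> T D p q \<longleftrightarrow> (\<forall>a\<in>basis P p. f a \<in> gchains D Q q (g - bdeg P p a)) \<and>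
      (\<forall>a. a \<notin> basis P p \<longrightarrow> f a = 0)" for D f p q
    by (auto simp: T_def gchains_def fun_eq_iff)
  have dh_col: "(\<lambda>a. dh p q f a b) = bd act P p (\<lambda>a. f a b)" for p q f b
    by (simp add: dh_def)
  interpret D: double_complex_mod "T C" "T Z" dh dv
  proof (unfold_locales, goal_cases)
    case (8 x p q)
    then show ?case
      using bd_C[OF Q] by (auto simp: T_col dv_def)
  next
    case (7 x p q)
    then show ?case
      using bd_C[OF P] by (auto simp: T_row dh_col)
  next
    case (9 x p q)
    then show ?case
      using bd_Z[OF P] by (auto simp: T_row dh_col)
  next
    case (10 x p q)
    then show ?case
      using bd_Z[OF Q] by (auto simp: T_col dv_def)
  next
    case (11 x p q)
    have "(\<lambda>a. dh p q (dh (Suc p) q x) a b) = 0" for b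
      unfolding dh_col using 11 P_bd_bd by (cases "b \<in> basis Q q") (auto simp: T_row)
    then show ?case
      by (auto simp: fun_eq_iff)
  next
    case (12 x p q)
    have "dv p q (dv p (Suc q) x) a = 0" for a
      unfolding dv_def using 12 Q_bd_bd by (cases "a \<in> basis P p") (auto simp: T_col)
    then show ?case
      by (auto simp: fun_eq_iff)
  next
    case (13 x p q)
    show ?case
      by (auto simp: dh_def dv_def bd_def fun_eq_iff act_sum act_zero mult.commute simp flip: act_act intro: sum.swap)
  qed (auto simp: T_def dh_def dv_def fun_eq_iff bd_def act_diff sum_subtractf C_diff Z_diff)
  have "D.row_exact i (Suc j)" if "i + j = n" for i j
    unfolding D.row_exact_def
  proof (intro ballI impI)
    fix z assume z: "z \<in> T C i (Suc j)" and cyc: "\<forall>k. i = Suc k \<longrightarrow> dh k (Suc j) z \<in> T Z k (Suc j)"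
    have "\<forall>b\<in>basis Q (Suc j). \<exists>w\<in>gchains C P (Suc i) (g - bdeg Q (Suc j) b).
        (\<lambda>a. z a b) - bd act P i w \<in> gchains Z P i (g - bdeg Q (Suc j) b)"
      using rows[OF that] z cyc unfolding homology_zero_def T_row dh_col by blast
    then obtain w where w: "\<forall>b\<in>basis Q (Suc j). w b \<in> gchains C P (Suc i) (g - bdeg Q (Suc j) b) \<and>
        (\<lambda>a. z a b) - bd act P i (w b) \<in> gchains Z P i (g - bdeg Q (Suc j) b)"
      by metis
    define w' where "w' = (\<lambda>a b. if b \<in> basis Q (Suc j) then w b a else 0)"
    have w': "(\<lambda>a. w' a b) = (if b \<in> basis Q (Suc j) then w b else 0)" for b
      by (auto simp: w'_def)
    have "(\<lambda>a. (z - dh i (Suc j) w') a b) = (\<lambda>a. z a b) - bd act P i (\<lambda>a. w' a b)" for b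
      by (auto simp: dh_def)
    then have "w' \<in> T C (Suc i) (Suc j)" "z - dh i (Suc j) w' \<in> T Z i (Suc j)"
      using w z by (simp_all add: T_row w')
    then show "\<exists>w\<in>T C (Suc i) (Suc j). z - dh i (Suc j) w \<in> T Z i (Suc j)"
      by blast
  qed
  moreover have "D.column_exact i j" if "i + j = n" for i j
    unfolding D.column_exact_def
  proof (intro ballI impI)
    fix z assume z: "z \<in> T C i j" and cyc: "\<forall>k. j = Suc k \<longrightarrow> dv i k z \<in> T Z i k"
    have "\<forall>a\<in>basis P i. \<exists>w\<in>gchains C Q (Suc j) (g - bdeg P i a).
        z a - bd act Q j w \<in> gchains Z Q j (g - bdeg P i a)"
      using columns[OF that] z cyc unfolding homology_zero_def T_col dv_def by blast
    then obtain w where w: "\<forall>a\<in>basis P i. w a \<in> gchains C Q (Suc j) (g - bdeg P i a) \<and>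
        z a - bd act Q j (w a) \<in> gchains Z Q j (g - bdeg P i a)"
      by metis
    define w' where "w' = (\<lambda>a. if a \<in> basis P i then w a else 0)"
    have "w' \<in> T C i (Suc j)" "z - dv i j w' \<in> T Z i j"
      using w z by (simp_all add: T_col w'_def dv_def)
    then show "\<exists>w\<in>T C i (Suc j). z - dv i j w \<in> T Z i j"
      by blast
  qed
  ultimately have row: "D.row_exact n 0"
    by (rule D.first_row_exact)
  show ?thesis
    unfolding homology_zero_def
  proof (intro ballI impI)
    fix z assume z: "z \<in> gchains C P n (g - bdeg Q 0 b\<^sub>0)"
      and cyc: "\<forall>k. n = Suc k \<longrightarrow> bd act P k z \<in> gchains Z P k (g - bdeg Q 0 b\<^sub>0)"
    define f where "f = (\<lambda>a b. if b = b\<^sub>0 then z a else 0)"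
    have f: "(\<lambda>a. f a b) = (if b = b\<^sub>0 then z else 0)" for b
      by (auto simp: f_def)
    have "f \<in> T C n 0"
      using z b0 by (auto simp: T_row f gchains_zero)
    moreover have "dh k 0 f \<in> T Z k 0" if "n = Suc k" for k
      using cyc that b0 by (auto simp: T_row dh_col f gchains_zero)
    ultimately obtain w where w: "w \<in> T C (Suc n) 0" "f - dh n 0 w \<in> T Z n 0"
      using row unfolding D.row_exact_def by blast
    have "(\<lambda>a. (f - dh n 0 w) a b\<^sub>0) = z - bd act P n (\<lambda>a. w a b\<^sub>0)"
      by (auto simp: dh_def f_def)
    then have "z - bd act P n (\<lambda>a. w a b\<^sub>0) \<in> gchains Z P n (g - bdeg Q 0 b\<^sub>0)"
      "(\<lambda>a. w a b\<^sub>0) \<in> gchains C P (Suc n) (g - bdeg Q 0 b\<^sub>0)"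
      using w b0 by (auto simp: T_row)
    then show "\<exists>w\<in>gchains C P (Suc n) (g - bdeg Q 0 b\<^sub>0). z - bd act P n w \<in> gchains Z P n (g - bdeg Q 0 b\<^sub>0)"
      by blast
  qed
qed

section \<open>Graded polynomial rings\<close>

abbreviation lookup :: "('a \<Rightarrow>\<^sub>0 'b::zero) \<Rightarrow> 'a \<Rightarrow> 'b"
  where "lookup \<equiv> Poly_Mapping.lookup"

abbreviation keys :: "('a \<Rightarrow>\<^sub>0 'b::zero) \<Rightarrow> 'a set"
  where "keys \<equiv> Poly_Mapping.keys"

definition expo :: "'v \<Rightarrow> 'v \<Rightarrow>\<^sub>0 nat"
  where "expo v = Poly_Mapping.single v 1"

lemma lookup_expo: "lookup (expo v) w = (if w = v then 1 else 0)"
  by (auto simp: expo_def lookup_single when_def)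

lemma Var_expo: "Var v = Poly_Mapping.single (expo v) 1"
  by (simp add: Var_def expo_def)

lemma poly_mapping_monomials: "h = (\<Sum>m\<in>keys h. Poly_Mapping.single m (lookup h m))"
proof (rule poly_mapping_eqI)
  fix m
  have "(\<Sum>t\<in>keys h. lookup (Poly_Mapping.single t (lookup h t)) m) =
      (\<Sum>t\<in>keys h. if t = m then lookup h t else 0)"
    by (rule sum.cong) (auto simp: lookup_single when_def)
  also have "\<dots> = lookup h m"
    by (auto simp: in_keys_iff)
  finally show "lookup h m = lookup (\<Sum>m\<in>keys h. Poly_Mapping.single m (lookup h m)) m"
    by (simp add: lookup_sum)
qed

lemma lookup_monomial_mult:
  fixes h :: "('v, 'k::comm_ring_1) mpoly"
  shows "lookup (Poly_Mapping.single m c * h) s =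
    (if \<exists>t. s = m + t then c * lookup h (s - m) else 0)"
proof -
  have "Poly_Mapping.single m c * h = (\<Sum>t\<in>keys h. Poly_Mapping.single (m + t) (c * lookup h t))"
    by (subst (1) poly_mapping_monomials) (simp add: sum_distrib_left mult_single)
  then have "lookup (Poly_Mapping.single m c * h) s =
      (\<Sum>t\<in>keys h. if m + t = s then c * lookup h t else 0)"
    by (simp add: lookup_sum lookup_single when_def)
  also have "\<dots> = (if \<exists>t. s = m + t then c * lookup h (s - m) else 0)"
  proof (cases "\<exists>t. s = m + t")
    case True
    then obtain t where t: "s = m + t" by blast
    have "(\<Sum>u\<in>keys h. if m + u = s then c * lookup h u else 0) =
        (\<Sum>u\<in>keys h. if u = t then c * lookup h u else 0)"
      by (rule sum.cong) (auto simp: t)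
    also have "\<dots> = c * lookup h t"
      by (auto simp: in_keys_iff)
    finally show ?thesis
      using t by auto
  next
    case False
    then show ?thesis
      by (subst sum.neutral) auto
  qed
  finally show ?thesis .
qed

lemma exponent_split: "lookup m v \<noteq> 0 \<Longrightarrow> m = expo v + (m - expo v)"
  by (rule poly_mapping_eqI) (auto simp: lookup_add lookup_minus lookup_expo)

lemma lookup_Var_mult:
  fixes h :: "('v, 'k::comm_ring_1) mpoly"
  shows "lookup (Var v * h) s = (if lookup s v \<noteq> 0 then lookup h (s - expo v) else 0)"
proof -
  have "(\<exists>t. s = expo v + t) \<longleftrightarrow> lookup s v \<noteq> 0"
    using exponent_split[of s v] by (auto simp: lookup_add lookup_expo)
  then show ?thesis
    unfolding Var_expo lookup_monomial_mult by simp
qed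

lemma keys_mult_subset: "m \<in> keys (f * g) \<Longrightarrow> \<exists>a\<in>keys f. \<exists>b\<in>keys g. m = a + b"
  using keys_mult[of f g] by blast

definition restr :: "'m set \<Rightarrow> ('m \<Rightarrow>\<^sub>0 'k::zero) \<Rightarrow> 'm \<Rightarrow>\<^sub>0 'k"
  where "restr E h = Abs_poly_mapping (\<lambda>m. if m \<in> E then lookup h m else 0)"

lemma lookup_restr: "lookup (restr E h) m = (if m \<in> E then lookup h m else 0)"
proof -
  have "finite {m. (if m \<in> E then lookup h m else 0) \<noteq> 0}"
    by (rule finite_subset[OF _ finite_keys[of h]]) (auto simp: in_keys_iff)
  then show ?thesis
    by (simp add: restr_def)
qed

lemma keys_restr: "keys (restr E h) = keys h \<inter> E"
  by (auto simp: in_keys_iff lookup_restr split: if_splits)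

lemma restr_diff: "restr E (f - g) = restr E f - restr E g"
  for f g :: "'m \<Rightarrow>\<^sub>0 'k::ab_group_add"
  by (rule poly_mapping_eqI) (auto simp: lookup_restr lookup_minus)

lemma restr_add: "restr E (f + g) = restr E f + restr E g"
  for f g :: "'m \<Rightarrow>\<^sub>0 'k::ab_group_add"
  by (rule poly_mapping_eqI) (auto simp: lookup_restr lookup_add)

lemma restr_zero [simp]: "restr E 0 = 0"
  by (rule poly_mapping_eqI) (auto simp: lookup_restr)

lemma restr_sum: "restr E (\<Sum>i\<in>A. f i) = (\<Sum>i\<in>A. restr E (f i))"
  for f :: "'i \<Rightarrow> 'm \<Rightarrow>\<^sub>0 'k::ab_group_add"
  by (rule poly_mapping_eqI) (auto simp: lookup_restr lookup_sum)

lemma restr_all: "keys h \<subseteq> E \<Longrightarrow> restr E h = h"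
  by (rule poly_mapping_eqI) (auto simp: lookup_restr in_keys_iff)

lemma restr_none: "keys h \<inter> E = {} \<Longrightarrow> restr E h = 0"
  by (rule poly_mapping_eqI) (auto simp: lookup_restr in_keys_iff)

locale grading =
  fixes dg :: "('v \<Rightarrow>\<^sub>0 nat) \<Rightarrow> 'g::ab_group_add"
  assumes dg_zero: "dg 0 = 0" and dg_add: "dg (m + m') = dg m + dg m'"

lemma homog_zero [simp]: "0 \<in> homog dg g"
  by (simp add: homog_def)

lemma homog_diff: "f \<in> homog dg g \<Longrightarrow> h \<in> homog dg g \<Longrightarrow> f - h \<in> homog dg g"
  for f h :: "('v, 'k::ab_group_add) mpoly"
  using Poly_Mapping.keys_diff[of f h] by (auto simp: homog_def)

lemma homog_add: "f \<in> homog dg g \<Longrightarrow> h \<in> homog dg g \<Longrightarrow> f + h \<in> homog dg g"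
  for f h :: "('v, 'k::ab_group_add) mpoly"
  using Poly_Mapping.keys_add[of f h] by (auto simp: homog_def)

lemma (in grading) homog_mult:
  "f \<in> homog dg g \<Longrightarrow> h \<in> homog dg g' \<Longrightarrow> f * h \<in> homog dg (g + g')"
proof -
  assume f: "f \<in> homog dg g" and h: "h \<in> homog dg g'"
  have "dg m = g + g'" if "m \<in> keys (f * h)" for m
    using keys_mult_subset[OF that] f h by (auto simp: homog_def dg_add)
  then show ?thesis
    by (simp add: homog_def)
qed

lemma (in grading) graded_ring_homog:
  "graded_ring (homog dg :: 'g \<Rightarrow> ('v, 'k::comm_ring_1) mpoly set)"
  by unfold_locales (auto intro: homog_diff homog_mult simp: homog_def[of dg 0] dg_zero)

lemma (in grading) Var_homog: "(Var v :: ('v, 'k::comm_ring_1) mpoly) \<in> homog dg (dg (expo v))"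
  by (auto simp: homog_def Var_expo)

definition hcomp :: "(('v \<Rightarrow>\<^sub>0 nat) \<Rightarrow> 'g) \<Rightarrow> 'g \<Rightarrow> ('v, 'k::zero) mpoly \<Rightarrow> ('v, 'k) mpoly"
  where "hcomp dg g = restr {m. dg m = g}"

lemma hcomp_homog [simp]: "hcomp dg g h \<in> homog dg g"
  by (auto simp: hcomp_def homog_def keys_restr)

lemma hcomp_id: "h \<in> homog dg g \<Longrightarrow> hcomp dg g h = h"
  unfolding hcomp_def by (rule restr_all) (auto simp: homog_def)

lemma sum_hcomp: "h = (\<Sum>g\<in>dg ` keys h. hcomp dg g h)" for h :: "('v, 'k::comm_monoid_add) mpoly"
proof (rule poly_mapping_eqI)
  fix m
  have "(\<Sum>g\<in>dg ` keys h. lookup (hcomp dg g h) m) = (\<Sum>g\<in>dg ` keys h. if g = dg m then lookup h m else 0)"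
    by (rule sum.cong) (auto simp: hcomp_def lookup_restr)
  also have "\<dots> = lookup h m"
    by (auto simp: in_keys_iff)
  finally show "lookup h m = lookup (\<Sum>g\<in>dg ` keys h. hcomp dg g h) m"
    by (simp add: lookup_sum)
qed

section \<open>Koszul complexes on variables\<close>

definition var_seq :: "(('v \<Rightarrow>\<^sub>0 nat) \<Rightarrow> 'g) \<Rightarrow> 'v list \<Rightarrow> (('v, 'k::comm_ring_1) mpoly \<times> 'g) list"
  where "var_seq dg vs = map (\<lambda>v. (Var v, dg (expo v))) vs"

definition var_divisible :: "'v set \<Rightarrow> ('v, 'k::zero) mpoly \<Rightarrow> bool"
  where "var_divisible V h \<longleftrightarrow> (\<forall>m\<in>keys h. \<exists>v\<in>V. lookup m v \<noteq> 0)"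

definition var_ideal :: "(('v \<Rightarrow>\<^sub>0 nat) \<Rightarrow> 'g) \<Rightarrow> 'v set \<Rightarrow> 'g \<Rightarrow> ('v, 'k::zero) mpoly set"
  where "var_ideal dg V g = {h \<in> homog dg g. var_divisible V h}"

lemma var_seq_Cons: "var_seq dg (v # vs) = (Var v, dg (expo v)) # var_seq dg vs"
  by (simp add: var_seq_def)

lemma length_var_seq [simp]: "length (var_seq dg vs) = length vs"
  by (simp add: var_seq_def)

lemma var_divisible_mult: "var_divisible V h \<Longrightarrow> var_divisible V (r * h)"
proof -
  assume h: "var_divisible V h"
  have "\<exists>v\<in>V. lookup m v \<noteq> 0" if "m \<in> keys (r * h)" for m
  proof -
    from that obtain a b where ab: "b \<in> keys h" "m = a + b"
      using keys_mult_subset by blast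
    then obtain v where "v \<in> V" "lookup b v \<noteq> 0"
      using h by (auto simp: var_divisible_def)
    then show ?thesis
      using ab(2) by (auto simp: lookup_add)
  qed
  then show ?thesis
    by (auto simp: var_divisible_def)
qed

lemma var_divisible_Var_mult: "v \<in> V \<Longrightarrow> var_divisible V (Var v * h)"
  for h :: "('v, 'k::comm_ring_1) mpoly"
  by (auto simp: var_divisible_def in_keys_iff lookup_Var_mult split: if_splits)

lemma var_divisible_add: "var_divisible V f \<Longrightarrow> var_divisible V h \<Longrightarrow> var_divisible V (f + h)"
  for f h :: "('v, 'k::ab_group_add) mpoly"
  using Poly_Mapping.keys_add[of f h] by (auto simp: var_divisible_def)

lemma var_divisible_diff: "var_divisible V f \<Longrightarrow> var_divisible V h \<Longrightarrow> var_divisible V (f - h)"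
  for f h :: "('v, 'k::ab_group_add) mpoly"
  using Poly_Mapping.keys_diff[of f h] by (auto simp: var_divisible_def)

lemma (in grading) var_ideal_pair:
  "graded_pair (homog dg) (*) (homog dg) (var_ideal dg V :: 'g \<Rightarrow> ('v, 'k::comm_ring_1) mpoly set)"
proof -
  interpret graded_ring "homog dg :: 'g \<Rightarrow> ('v, 'k::comm_ring_1) mpoly set"
    by (rule graded_ring_homog)
  show ?thesis
    by unfold_locales
      (auto simp: var_ideal_def algebra_simps var_divisible_def[of V 0]
        intro: homog_mult homog_diff var_divisible_mult var_divisible_diff)
qed

lemma Var_mult_exists:
  fixes h :: "('v, 'k::comm_ring_1) mpoly"
  assumes "\<And>m. m \<in> keys h \<Longrightarrow> lookup m v \<noteq> 0"
  obtains q where "h = Var v * q" "\<And>m. m \<in> keys q \<Longrightarrow> expo v + m \<in> keys h"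
proof -
  define q where "q = Abs_poly_mapping (\<lambda>t. lookup h (expo v + t))"
  have "finite ((+) (expo v) ` {t. lookup h (expo v + t) \<noteq> 0})"
    by (rule finite_subset[OF _ finite_keys[of h]]) (auto simp: in_keys_iff)
  then have "finite {t. lookup h (expo v + t) \<noteq> 0}"
    by (rule finite_imageD) (auto simp: inj_on_def)
  then have q: "lookup q t = lookup h (expo v + t)" for t
    by (simp add: q_def)
  have "h = Var v * q"
  proof (rule poly_mapping_eqI)
    fix s
    show "lookup h s = lookup (Var v * q) s"
    proof (cases "lookup s v = 0")
      case True
      then have "s \<notin> keys h"
        using assms by blast
      with True show ?thesis
        by (simp add: lookup_Var_mult in_keys_iff)
    next
      case False
      then show ?thesis
        using exponent_split[of s v] by (simp add: lookup_Var_mult q)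
    qed
  qed
  moreover have "expo v + m \<in> keys h" if "m \<in> keys q" for m
    using that by (simp add: in_keys_iff q)
  ultimately show ?thesis
    by (rule that)
qed

lemma gchains_koszul_level_0:
  "f \<in> gchains D (koszul ws) 0 g \<longleftrightarrow>
    f (replicate (length ws) False) \<in> D g \<and> (\<forall>bs. bs \<noteq> replicate (length ws) False \<longrightarrow> f bs = 0)"
  by (auto simp: gchains_iff koszul_def koszul_basis_0 koszul_deg_replicate)

context grading
begin

text \<open>By induction on the list of variables: the terms divisible by the first variable come from the
  shifted summand of the mapping cone, and the induction hypothesis applies to the remaining ones.\<close>

lemma koszul_image:
  fixes h :: "bool list \<Rightarrow> ('v, 'k::comm_ring_1) mpoly"
  assumes "h \<in> gchains (homog dg) (koszul (var_seq dg vs :: (('v, 'k) mpoly \<times> 'g) list)) 0 g"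
  shows "(\<exists>w\<in>gchains (homog dg) (koszul (var_seq dg vs :: (('v, 'k) mpoly \<times> 'g) list)) (Suc 0) g. h = bd (*) (koszul (var_seq dg vs :: (('v, 'k) mpoly \<times> 'g) list)) 0 w)
    \<longleftrightarrow> var_divisible (set vs) (h (replicate (length vs) False))"
  using assms
proof (induction vs arbitrary: h g)
  case Nil
  let ?K = "koszul (var_seq dg [] :: (('v, 'k) mpoly \<times> 'g) list)"
  have "bd (*) ?K 0 w = 0" for w
    by (auto simp: bd_def koszul_def var_seq_def koszul_basis_Nil)
  moreover have "0 \<in> gchains (homog dg) ?K (Suc 0) g"
    by (auto intro: gchains_zero)
  moreover have "h = 0 \<longleftrightarrow> h [] = 0"
    using Nil by (auto simp: gchains_koszul_level_0 fun_eq_iff) metis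
  moreover have "keys (h []) = {} \<longleftrightarrow> h [] = 0"
    by (metis all_not_in_conv in_keys_iff keys_zero poly_mapping_eqI lookup_zero)
  ultimately show ?case
    by (auto simp: var_divisible_def)
next
  case (Cons v vs)
  let ?K = "koszul (var_seq dg vs :: (('v, 'k) mpoly \<times> 'g) list)" and ?r = "replicate (length vs) False"
  let ?L = "koszul (var_seq dg (v # vs) :: (('v, 'k) mpoly \<times> 'g) list)"
  interpret R: graded_ring "homog dg :: 'g \<Rightarrow> ('v, 'k) mpoly set"
    by (rule graded_ring_homog)
  interpret R: graded_pair "homog dg :: 'g \<Rightarrow> ('v, 'k) mpoly set" "(*)" "homog dg" "\<lambda>_. {0}"
    by (rule R.ring_pair)
  have K: "graded_complex (homog dg) ?K"
    by (rule R.koszul_complex) (auto simp: var_seq_def Var_homog)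
  have h: "h [] = 0" "lo h \<in> gchains (homog dg) ?K 0 g" "hi h = 0"
    using Cons.prems by (auto simp: var_seq_Cons gchains_koszul_0)
  have hr: "h (replicate (length (v # vs)) False) = lo h ?r"
    by (simp add: lo_def)
  show ?case
    unfolding hr
  proof
    assume "\<exists>w\<in>gchains (homog dg) ?L (Suc 0) g. h = bd (*) ?L 0 w"
    then obtain w where w: "w \<in> gchains (homog dg) ?L (Suc 0) g" "h = bd (*) ?L 0 w"
      by blast
    have lw: "lo w \<in> gchains (homog dg) ?K (Suc 0) g"
      using w(1) by (auto simp: var_seq_Cons gchains_koszul_Suc)
    have "lo h = bd (*) ?K 0 (lo w) + (\<lambda>bs. Var v * hi w bs)"
      using R.lo_bd_gchains w unfolding var_seq_Cons by (metis fst_conv)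
    moreover have "var_divisible (set vs) (bd (*) ?K 0 (lo w) ?r)"
      using Cons.IH[of "bd (*) ?K 0 (lo w)"] R.bd_C[OF K lw] lw by blast
    then have "var_divisible (set (v # vs)) (bd (*) ?K 0 (lo w) ?r)"
      by (auto simp: var_divisible_def)
    ultimately show "var_divisible (set (v # vs)) (lo h ?r)"
      by (auto intro!: var_divisible_add var_divisible_Var_mult)
  next
    assume div: "var_divisible (set (v # vs)) (lo h ?r)"
    define p where "p = lo h ?r"
    define E where "E = {m :: 'v \<Rightarrow>\<^sub>0 nat. lookup m v \<noteq> 0}"
    have p: "p \<in> homog dg g"
      using h(2) by (simp add: p_def gchains_koszul_level_0)
    have split: "p = restr (- E) p + restr E p"
      by (rule poly_mapping_eqI) (auto simp: lookup_add lookup_restr)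
    obtain q where q: "restr E p = Var v * q" "\<And>m. m \<in> keys q \<Longrightarrow> expo v + m \<in> keys (restr E p)"
      by (rule Var_mult_exists[of "restr E p" v]) (auto simp: keys_restr E_def)
    have q_homog: "q \<in> homog dg (g - dg (expo v))"
      using q(2) p by (fastforce simp: homog_def keys_restr dg_add eq_diff_eq add.commute)
    define pt :: "('v, 'k) mpoly \<Rightarrow> bool list \<Rightarrow> ('v, 'k) mpoly"
      where "pt = (\<lambda>f bs. if bs = ?r then f else 0)"
    have pt: "pt f \<in> gchains (homog dg) ?K 0 g'" if "f \<in> homog dg g'" for f g'
      using that by (auto simp: gchains_koszul_level_0 pt_def)
    have "restr (- E) p \<in> homog dg g"
      using p by (auto simp: homog_def keys_restr)
    moreover have "var_divisible (set vs) (restr (- E) p)"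
      using div by (auto simp: var_divisible_def keys_restr E_def p_def)
    ultimately obtain u where u: "u \<in> gchains (homog dg) ?K (Suc 0) g" "pt (restr (- E) p) = bd (*) ?K 0 u"
      using Cons.IH[of "pt (restr (- E) p)" g] pt by (auto simp: pt_def)
    have w: "join u (pt q) \<in> gchains (homog dg) ?L (Suc 0) g"
      using u(1) pt[OF q_homog] by (simp add: var_seq_Cons gchains_koszul_Suc)
    have "lo h = pt p"
      using h(2) by (auto simp: gchains_koszul_level_0 pt_def p_def fun_eq_iff)
    also have "\<dots> = pt (restr (- E) p) + (\<lambda>bs. Var v * pt q bs)"
      using split by (auto simp: pt_def fun_eq_iff q(1))
    also have "\<dots> = lo (bd (*) ?L 0 (join u (pt q)))"
      using R.lo_bd_gchains[OF w[unfolded var_seq_Cons]] u(2) by (simp add: var_seq_Cons)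
    finally have "h = bd (*) ?L 0 (join u (pt q))"
      using h by (subst eq_by_lo_hi) (simp add: var_seq_Cons)
    with w show "\<exists>w\<in>gchains (homog dg) ?L (Suc 0) g. h = bd (*) ?L 0 w"
      by blast
  qed
qed

text \<open>Variables form a regular sequence: if \<open>Var x * h\<close> lies in the ideal of the other variables, every
  monomial of \<open>h\<close> is divisible by one of them.  This settles the bottom of the mapping cone, and above
  it the exactness of the smaller complex suffices.\<close>

lemma koszul_exact:
  fixes z :: "bool list \<Rightarrow> ('v, 'k::comm_ring_1) mpoly"
  assumes "distinct vs" "z \<in> gchains (homog dg) (koszul (var_seq dg vs :: (('v, 'k) mpoly \<times> 'g) list)) (Suc i) g"
    and "bd (*) (koszul (var_seq dg vs :: (('v, 'k) mpoly \<times> 'g) list)) i z = 0"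
  shows "\<exists>w\<in>gchains (homog dg) (koszul (var_seq dg vs :: (('v, 'k) mpoly \<times> 'g) list)) (Suc (Suc i)) g.
    z = bd (*) (koszul (var_seq dg vs :: (('v, 'k) mpoly \<times> 'g) list)) (Suc i) w"
  using assms
proof (induction vs arbitrary: z i g)
  case Nil
  then have "z = 0"
    by (auto simp: gchains_def koszul_def var_seq_def koszul_basis_Nil fun_eq_iff)
  moreover have "bd (*) (koszul (var_seq dg [] :: (('v, 'k) mpoly \<times> 'g) list)) (Suc i) 0 = 0"
    by (auto simp: bd_def)
  ultimately show ?case
    using gchains_zero[of "homog dg"] by (metis homog_zero)
next
  case (Cons x vs)
  let ?K = "koszul (var_seq dg vs :: (('v, 'k) mpoly \<times> 'g) list)" and ?r = "replicate (length vs) False"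
  let ?L = "koszul (var_seq dg (x # vs) :: (('v, 'k) mpoly \<times> 'g) list)"
  let ?d = "dg (expo x)"
  interpret R: graded_ring "homog dg :: 'g \<Rightarrow> ('v, 'k) mpoly set"
    by (rule graded_ring_homog)
  interpret R: graded_pair "homog dg :: 'g \<Rightarrow> ('v, 'k) mpoly set" "(*)" "homog dg" "\<lambda>_. {0}"
    by (rule R.ring_pair)
  have K: "graded_complex (homog dg) ?K"
    by (rule R.koszul_complex) (auto simp: var_seq_def Var_homog)
  define u v where "u = lo z" and "v = hi z"
  have uv: "u \<in> gchains (homog dg) ?K (Suc i) g" "v \<in> gchains (homog dg) ?K i (g - ?d)" "z [] = 0"
    using Cons.prems by (auto simp: u_def v_def var_seq_Cons gchains_koszul_Suc)
  have lo0: "bd (*) ?K i u + (\<lambda>bs. Var x * v bs) = 0"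
    using R.lo_bd_gchains[OF Cons.prems(2)[unfolded var_seq_Cons]] Cons.prems(3)
    by (auto simp: u_def v_def var_seq_Cons lo_def fun_eq_iff)
  have "\<exists>t\<in>gchains (homog dg) ?K (Suc i) (g - ?d). v = bd (*) ?K i t"
  proof (cases i)
    case 0
    have "var_divisible (set vs) (bd (*) ?K 0 u ?r)"
      using koszul_image[of "bd (*) ?K 0 u" vs g] R.bd_C[OF K] uv(1) 0 by blast
    moreover have "bd (*) ?K 0 u ?r = - (Var x * v ?r)"
      using fun_cong[OF lo0, of ?r] 0 by (simp add: add_eq_0_iff2)
    ultimately have div: "var_divisible (set vs) (Var x * v ?r)"
      by (simp add: var_divisible_def Poly_Mapping.keys_minus)
    have "var_divisible (set vs) (v ?r)"
      unfolding var_divisible_def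
    proof
      fix m assume "m \<in> keys (v ?r)"
      then have "expo x + m \<in> keys (Var x * v ?r)"
        by (simp add: in_keys_iff lookup_Var_mult lookup_add lookup_expo)
      then obtain y where "y \<in> set vs" "lookup (expo x + m) y \<noteq> 0"
        using div by (auto simp: var_divisible_def)
      moreover from this have "y \<noteq> x"
        using Cons.prems(1) by auto
      ultimately show "\<exists>v\<in>set vs. lookup m v \<noteq> 0"
        by (auto simp: lookup_add lookup_expo split: if_splits)
    qed
    then show ?thesis
      using koszul_image[of v vs "g - ?d"] uv(2) 0 by blast
  next
    case (Suc k)
    have "- bd (*) ?K k v = hi (bd (*) ?L (Suc k) z)"
      by (simp add: var_seq_Cons R.hi_bd_koszul v_def)
    also have "\<dots> = 0"
      using Cons.prems(3) Suc by (auto simp: hi_def fun_eq_iff)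
    finally have "bd (*) ?K k v = 0"
      by (simp add: fun_eq_iff)
    then show ?thesis
      using Cons.IH[of v k "g - ?d"] Cons.prems(1) uv(2) unfolding Suc by auto
  qed
  then obtain t where t: "t \<in> gchains (homog dg) ?K (Suc i) (g - ?d)" "v = bd (*) ?K i t"
    by blast
  have xt: "(\<lambda>bs. Var x * t bs) \<in> gchains (homog dg) ?K (Suc i) g"
    by (rule R.act_gchains[OF Var_homog t(1)])
  have "bd (*) ?K i (u + (\<lambda>bs. Var x * t bs)) = 0"
    using lo0 by (simp add: R.bd_add R.bd_act flip: t(2))
  then obtain s where s: "s \<in> gchains (homog dg) ?K (Suc (Suc i)) g"
    "u + (\<lambda>bs. Var x * t bs) = bd (*) ?K (Suc i) s"
    using Cons.IH[of "u + (\<lambda>bs. Var x * t bs)" i g] R.gchains_C_add[OF uv(1) xt] Cons.prems(1)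
    unfolding distinct.simps by blast
  have "- t \<in> gchains (homog dg) ?K (Suc i) (g - ?d)"
    using t(1) by (auto simp: gchains_def homog_def Poly_Mapping.keys_minus)
  then have w: "join s (- t) \<in> gchains (homog dg) ?L (Suc (Suc i)) g"
    using s(1) by (simp add: var_seq_Cons gchains_koszul_Suc)
  have "lo (bd (*) ?L (Suc i) (join s (- t))) = u"
    using R.lo_bd_gchains[OF w[unfolded var_seq_Cons]] s(2)[symmetric]
    by (simp add: var_seq_Cons fun_eq_iff)
  moreover have "hi (bd (*) ?L (Suc i) (join s (- t))) = v"
    by (simp add: var_seq_Cons R.hi_bd_koszul R.bd_minus t(2))
  ultimately have "z = bd (*) ?L (Suc i) (join s (- t))"
    using uv(3) by (subst eq_by_lo_hi) (simp add: var_seq_Cons u_def v_def)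
  with w show ?case
    by blast
qed

theorem koszul_resolves:
  assumes "distinct vs"
  shows "resolves (homog dg) (koszul (var_seq dg vs)) (*) (homog dg)
    (var_ideal dg (set vs) :: 'g \<Rightarrow> ('v, 'k::comm_ring_1) mpoly set) (\<lambda>_. 1)"
proof -
  let ?K = "koszul (var_seq dg vs :: (('v, 'k) mpoly \<times> 'g) list)" and ?r = "replicate (length vs) False"
  interpret R: graded_pair "homog dg :: 'g \<Rightarrow> ('v, 'k) mpoly set" "(*)" "homog dg" "var_ideal dg (set vs)"
    by (rule var_ideal_pair)
  interpret K: graded_complex "homog dg" ?K
    by (rule R.koszul_complex) (auto simp: var_seq_def Var_homog)
  have aug: "aug (*) (\<lambda>_. 1) ?K v = v ?r" for v
    by (simp add: aug_def koszul_def koszul_basis_0)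
  show ?thesis
  proof (unfold_locales, goal_cases)
    case (1 v i g)
    then show ?case
      by (rule R.koszul_bd_bd)
  next
    case (2 v i g)
    then show ?case
      using koszul_exact assms by blast
  next
    case (3 p)
    then show ?case
      using R.H_one by (simp add: koszul_def koszul_basis_0 koszul_deg_replicate)
  next
    case (4 x g)
    then show ?case
      by (intro bexI[of _ "\<lambda>bs. if bs = ?r then x else 0"])
        (auto simp: aug gchains_koszul_level_0 var_ideal_def var_divisible_def)
  next
    case (5 v g)
    then show ?case
      using koszul_image[of v vs g] by (auto simp: aug var_ideal_def gchains_koszul_level_0)
  qed
qed

end

section \<open>Homogeneous submodules of free modules are finitely generated\<close>

text \<open>Induction on the length of the lists: either the head is at least as large as the heads of
  finitely many chosen lists with minimal tails, or it is one of finitely many smaller values, and for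
  each of these the tails form a set to which the induction hypothesis applies.\<close>

theorem dickson:
  assumes "\<And>a. a \<in> A \<Longrightarrow> length a = n"
  shows "\<exists>M\<subseteq>A. finite M \<and> (\<forall>a\<in>A. \<exists>m\<in>M. list_all2 (\<le>) m (a :: nat list))"
  using assms
proof (induction n arbitrary: A)
  case 0
  then have "A \<subseteq> {[]}"
    by auto
  then have "finite A"
    by (rule finite_subset) simp
  then show ?case
    by (intro exI[of _ A]) (auto intro!: bexI list_all2_refl)
next
  case (Suc n)
  have len: "a \<noteq> []" "length (tl a) = n" if "a \<in> A" for a
    using Suc.prems[OF that] by auto
  have "\<exists>T\<subseteq>tl ` A. finite T \<and> (\<forall>a\<in>tl ` A. \<exists>m\<in>T. list_all2 (\<le>) m a)"
    by (rule Suc.IH) (use len(2) in blast)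
  then obtain T where T: "T \<subseteq> tl ` A" "finite T" "\<And>a. a \<in> A \<Longrightarrow> \<exists>m\<in>T. list_all2 (\<le>) m (tl a)"
    by auto
  obtain f where f: "\<And>t. t \<in> T \<Longrightarrow> f t \<in> A \<and> tl (f t) = t"
    using T(1) by (metis (no_types, opaque_lifting) image_iff subsetD)
  define N where "N = Max (insert 0 ((\<lambda>t. hd (f t)) ` T))"
  have N: "hd (f t) \<le> N" if "t \<in> T" for t
    unfolding N_def using that T(2) by (intro Max_ge) auto
  have "\<exists>M\<subseteq>{a. j # a \<in> A}. finite M \<and> (\<forall>a\<in>{a. j # a \<in> A}. \<exists>m\<in>M. list_all2 (\<le>) m a)" for j
    using len(2)[of "j # _"] by (intro Suc.IH) auto
  then obtain M where M: "\<And>j. M j \<subseteq> {a. j # a \<in> A}" "\<And>j. finite (M j)"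
    "\<And>j a. j # a \<in> A \<Longrightarrow> \<exists>m\<in>M j. list_all2 (\<le>) m a"
    by (metis mem_Collect_eq)
  show ?case
  proof (intro exI conjI ballI)
    show "f ` T \<union> (\<Union>j<N. Cons j ` M j) \<subseteq> A"
      using f M(1) by auto
    show "finite (f ` T \<union> (\<Union>j<N. Cons j ` M j))"
      using T(2) M(2) by auto
    fix a assume a: "a \<in> A"
    obtain j b where jb: "a = j # b"
      using len(1)[OF a] by (cases a) auto
    show "\<exists>m\<in>f ` T \<union> (\<Union>j<N. Cons j ` M j). list_all2 (\<le>) m a"
    proof (cases "j < N")
      case True
      obtain m where "m \<in> M j" "list_all2 (\<le>) m b"
        using M(3) a jb by blast
      then show ?thesis
        using True by (intro bexI[of _ "j # m"]) (auto simp: jb)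
    next
      case False
      obtain t where t: "t \<in> T" "list_all2 (\<le>) t b"
        using T(3)[OF a] jb by auto
      have "f t = hd (f t) # t"
        using f[OF t(1)] len(1) by (metis list.collapse)
      then have "list_all2 (\<le>) (f t) a"
        using N[OF t(1)] False t(2) jb by (metis le_trans linorder_not_less list_all2_Cons)
      then show ?thesis
        using t(1) by blast
    qed
  qed
qed

text \<open>Monomials times basis vectors are compared lexicographically, position first; this order is
  a well-order that is preserved by multiplication with a monomial.\<close>

definition expo_list :: "('v::finite \<Rightarrow>\<^sub>0 nat) \<Rightarrow> nat list"
  where "expo_list m = map (lookup m) (SOME vs. set vs = UNIV)"

definition mono_key :: "nat \<Rightarrow> ('v::finite \<Rightarrow>\<^sub>0 nat) \<Rightarrow> nat list"
  where "mono_key p m = p # expo_list m"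

lemma set_some_vars: "set (SOME vs. set vs = (UNIV :: 'v::finite set)) = UNIV"
  by (rule someI_ex) (simp add: finite_list)

lemma length_expo_list: "length (expo_list (m :: 'v::finite \<Rightarrow>\<^sub>0 nat)) = length (SOME vs. set vs = (UNIV :: 'v set))"
  by (simp add: expo_list_def)

lemma expo_list_le: "list_all2 (\<le>) (expo_list m) (expo_list m') \<Longrightarrow> \<exists>t. m' = m + t"
  for m m' :: "'v::finite \<Rightarrow>\<^sub>0 nat"
proof -
  assume "list_all2 (\<le>) (expo_list m) (expo_list m')"
  then have "\<forall>v\<in>set (SOME vs. set vs = (UNIV :: 'v set)). lookup m v \<le> lookup m' v"
    by (auto simp: expo_list_def list_all2_map1 list_all2_map2 list_all2_same)
  then have "m' = m + (m' - m)"
    by (intro poly_mapping_eqI) (simp add: set_some_vars lookup_add lookup_minus)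
  then show ?thesis
    by blast
qed

lemma mono_key_inject: "mono_key p m = mono_key q m' \<longleftrightarrow> p = q \<and> m = m'"
proof -
  have "m = m'" if "expo_list m = expo_list m'"
    using that set_some_vars by (auto simp: expo_list_def intro!: poly_mapping_eqI)
  then show ?thesis
    by (auto simp: mono_key_def)
qed

lemma map_add_less:
  fixes f g h :: "'v \<Rightarrow> nat"
  shows "map f vs < map g vs \<Longrightarrow> map (\<lambda>v. f v + h v) vs < map (\<lambda>v. g v + h v) vs"
  by (induction vs) (auto simp: Cons_less_Cons)

lemma mono_key_translate:
  "mono_key p m \<le> mono_key q m' \<Longrightarrow> mono_key p (t + m) \<le> mono_key q (t + m')"
proof -
  have "expo_list (t + m) = map (\<lambda>v. lookup m v + lookup t v) (SOME vs. set vs = UNIV)" for m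
    by (simp add: expo_list_def lookup_add add.commute)
  then have "expo_list (t + m) < expo_list (t + m')" if "expo_list m < expo_list m'"
    using map_add_less[OF that[unfolded expo_list_def], of "lookup t"] by (simp only:)
  moreover have "expo_list (t + m) = expo_list (t + m')" if "expo_list m = expo_list m'"
    using that mono_key_inject[of 0 m 0 m'] by (simp add: mono_key_def)
  ultimately have "expo_list (t + m) \<le> expo_list (t + m')" if "expo_list m \<le> expo_list m'"
    using that unfolding list_le_def by blast
  then show "mono_key p m \<le> mono_key q m' \<Longrightarrow> mono_key p (t + m) \<le> mono_key q (t + m')"
    by (auto simp: mono_key_def Cons_le_Cons length_expo_list)
qed

definition supp_keys :: "nat \<Rightarrow> (nat \<Rightarrow> ('v::finite, 'k::zero) mpoly) \<Rightarrow> nat list set"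
  where "supp_keys n u = {mono_key p m | p m. p < n \<and> m \<in> keys (u p)}"

lemma finite_supp_keys [simp]: "finite (supp_keys n u)"
proof -
  have "supp_keys n u = (\<Union>p<n. mono_key p ` keys (u p))"
    by (auto simp: supp_keys_def)
  then show ?thesis
    by simp
qed

lemma supp_keys_empty: "supp_keys n u = {} \<Longrightarrow> p < n \<Longrightarrow> u p = 0"
  by (rule poly_mapping_eqI) (auto simp: supp_keys_def in_keys_iff)

text \<open>\<open>vec dg ds g\<close> is the component of degree \<open>g\<close> of the free module with basis degrees \<open>ds\<close>.\<close>

definition vec :: "(('v \<Rightarrow>\<^sub>0 nat) \<Rightarrow> 'g::ab_group_add) \<Rightarrow> 'g list \<Rightarrow> 'g \<Rightarrow> (nat \<Rightarrow> ('v, 'k::zero) mpoly) set"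
  where "vec dg ds g = {v. (\<forall>p<length ds. v p \<in> homog dg (g - ds ! p)) \<and> (\<forall>p\<ge>length ds. v p = 0)}"

definition combination :: "('g \<times> (nat \<Rightarrow> 'r::comm_ring_1)) list \<Rightarrow> (nat \<Rightarrow> 'r) \<Rightarrow> nat \<Rightarrow> 'r"
  where "combination L r = (\<lambda>p. \<Sum>q<length L. snd (L ! q) p * r q)"

text \<open>Division with respect to a monomial order: Dickson's lemma gives finitely many elements whose
  leading terms divide all leading terms of \<open>U\<close>, and subtracting a suitable multiple of one of them
  lowers the leading term.  Homogeneity is preserved because that multiple has the right degree.\<close>

theorem homogeneous_submodule_finitely_generated:
  fixes dg :: "('v::finite \<Rightarrow>\<^sub>0 nat) \<Rightarrow> 'g::ab_group_add"
    and U :: "'g \<Rightarrow> (nat \<Rightarrow> ('v, 'k::field) mpoly) set"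
  assumes dg: "grading dg"
    and U_vec: "\<And>g. U g \<subseteq> vec dg ds g"
    and U_diff: "\<And>g u v. u \<in> U g \<Longrightarrow> v \<in> U g \<Longrightarrow> u - v \<in> U g"
    and U_scale: "\<And>g h r u. r \<in> homog dg h \<Longrightarrow> u \<in> U g \<Longrightarrow> scale r u \<in> U (h + g)"
  shows "\<exists>L. (\<forall>(g, u)\<in>set L. u \<in> U g) \<and> (\<forall>g. \<forall>u\<in>U g. \<exists>r\<in>vec dg (map fst L) g. u = combination L r)"
proof -
  interpret grading dg by (rule dg)
  define n where "n = length ds"
  define lead where "lead = (\<lambda>u :: nat \<Rightarrow> ('v, 'k) mpoly. Max (supp_keys n u))"
  have lead_in: "lead u \<in> supp_keys n u" if "supp_keys n u \<noteq> {}" for u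
    unfolding lead_def using that by (intro Max_in) auto
  have lead_ge: "k \<le> lead u" if "k \<in> supp_keys n u" for u k
    unfolding lead_def using that by (intro Max_ge) auto
  \<comment> \<open>The leading exponents at each position \<open>p\<close>, to which Dickson's lemma is applied.\<close>
  define A where "A = (\<lambda>p. {expo_list m | m :: 'v \<Rightarrow>\<^sub>0 nat. \<exists>g. \<exists>u\<in>U g. p < n \<and> supp_keys n u \<noteq> {} \<and> lead u = mono_key p m})"
  have "\<exists>M\<subseteq>A p. finite M \<and> (\<forall>a\<in>A p. \<exists>m\<in>M. list_all2 (\<le>) m a)" for p
    by (rule dickson[of "A p" "length (SOME vs. set vs = (UNIV :: 'v set))"])
       (auto simp: A_def length_expo_list)
  then obtain M where M: "\<And>p. M p \<subseteq> A p" "\<And>p. finite (M p)" "\<And>p a. a \<in> A p \<Longrightarrow> \<exists>m\<in>M p. list_all2 (\<le>) m a"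
    by metis
  have "\<forall>p. \<forall>a\<in>M p. \<exists>gu. snd gu \<in> U (fst gu) \<and> p < n \<and> supp_keys n (snd gu) \<noteq> {} \<and>
      (\<exists>m :: 'v \<Rightarrow>\<^sub>0 nat. a = expo_list m \<and> lead (snd gu) = mono_key p m)"
    using M(1) by (fastforce simp: A_def)
  then obtain w where w: "\<And>p a. a \<in> M p \<Longrightarrow> snd (w p a) \<in> U (fst (w p a)) \<and> p < n \<and>
      supp_keys n (snd (w p a)) \<noteq> {} \<and> (\<exists>m :: 'v \<Rightarrow>\<^sub>0 nat. a = expo_list m \<and> lead (snd (w p a)) = mono_key p m)"
    by metis
  obtain L where L: "set L = (\<Union>p<n. w p ` M p)"
    using finite_list[of "\<Union>p<n. w p ` M p"] M(2) by auto
  have gen: "\<exists>r\<in>vec dg (map fst L) g. u = combination L r" if "u \<in> U g" for g u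
    using that
  proof (induction "lead u" arbitrary: u rule: less_induct)
    case (less u)
    show ?case
    proof (cases "supp_keys n u = {}")
      case True
      then have "u p = 0" for p
        using less.prems U_vec[of g] supp_keys_empty[of n u p]
        by (cases "p < n") (auto simp: vec_def n_def)
      then have "u = 0"
        by (simp add: fun_eq_iff)
      then show ?thesis
        by (intro bexI[of _ 0]) (auto simp: combination_def vec_def fun_eq_iff)
    next
      case False
      obtain p and m :: "'v \<Rightarrow>\<^sub>0 nat" where pm: "lead u = mono_key p m" "p < n" "m \<in> keys (u p)"
        using lead_in[OF False] by (auto simp: supp_keys_def)
      then have "expo_list m \<in> A p"
        using less.prems False by (auto simp: A_def)
      then obtain a where a: "a \<in> M p" "list_all2 (\<le>) a (expo_list m)"
        using M(3) by blast
      define h v where "h = fst (w p a)" and "v = snd (w p a)"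
      obtain m' :: "'v \<Rightarrow>\<^sub>0 nat" where m': "a = expo_list m'" "lead v = mono_key p m'" and v: "v \<in> U h" "supp_keys n v \<noteq> {}"
        using w[OF a(1)] by (auto simp: h_def v_def)
      have m'_key: "m' \<in> keys (v p)"
        using lead_in[OF v(2)] m'(2) by (auto simp: supp_keys_def mono_key_inject)
      obtain t where t: "m = t + m'"
        using expo_list_le a(2) m'(1) by (metis add.commute)
      \<comment> \<open>The multiple \<open>x v\<close> cancels the leading term of \<open>u\<close>.\<close>
      define c where "c = lookup (u p) m / lookup (v p) m'"
      define x where "x = (Poly_Mapping.single t c :: ('v, 'k) mpoly)"
      have "dg m = g - ds ! p" "dg m' = h - ds ! p"
        using less.prems U_vec v(1) pm m'_key by (fastforce simp: vec_def homog_def n_def)+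
      then have "dg t = g - h"
        by (simp add: t dg_add algebra_simps)
      then have x: "x \<in> homog dg (g - h)"
        by (auto simp: x_def homog_def)
      have u': "u - scale x v \<in> U g"
        using U_diff[OF less.prems] U_scale[OF x v(1)] by simp
      have less': "lead (u - scale x v) < lead u" if ne: "supp_keys n (u - scale x v) \<noteq> {}"
      proof -
        obtain q s where qs: "lead (u - scale x v) = mono_key q s" "q < n" "s \<in> keys (u q - x * v q)"
          using lead_in[OF ne] by (auto simp: supp_keys_def)
        have "mono_key q s \<le> lead u"
        proof (cases "s \<in> keys (u q)")
          case True
          then show ?thesis
            using qs(2) by (intro lead_ge) (auto simp: supp_keys_def)
        next
          case False
          then have "s \<in> keys (x * v q)"
            using qs(3) Poly_Mapping.keys_diff[of "u q" "x * v q"] by auto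
          then obtain s' where s': "s = t + s'" "s' \<in> keys (v q)"
            unfolding x_def by (auto simp: in_keys_iff lookup_monomial_mult split: if_splits)
          then have "mono_key q s' \<le> mono_key p m'"
            unfolding m'(2)[symmetric] using qs(2) by (intro lead_ge) (auto simp: supp_keys_def)
          then show ?thesis
            using mono_key_translate[of q s' p m' t] by (simp add: s'(1) pm(1) t)
        qed
        moreover have "lookup (u p - x * v p) m = 0"
          using m'_key by (simp add: lookup_minus x_def lookup_monomial_mult t c_def in_keys_iff)
        then have "mono_key q s \<noteq> lead u"
          using qs(3) by (auto simp: pm(1) mono_key_inject in_keys_iff)
        ultimately show ?thesis
          by (simp add: qs(1))
      qed
      have "\<exists>r\<in>vec dg (map fst L) g. u - scale x v = combination L r"
      proof (cases "supp_keys n (u - scale x v) = {}")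
        case True
        then have "(u - scale x v) p = 0" for p
          using u' U_vec[of g] supp_keys_empty[OF True, of p]
          by (cases "p < n") (auto simp: vec_def n_def)
        then have "u - scale x v = 0"
          by (simp add: fun_eq_iff)
        then show ?thesis
          by (intro bexI[of _ 0]) (auto simp: combination_def vec_def fun_eq_iff)
      next
        case False
        then show ?thesis
          using less.hyps less' u' by blast
      qed
      then obtain r where r: "r \<in> vec dg (map fst L) g" "u - scale x v = combination L r"
        by blast
      have "w p a \<in> set L"
        using L a(1) pm(2) by auto
      then obtain j where j: "j < length L" "L ! j = (h, v)"
        by (metis h_def in_set_conv_nth prod.collapse v_def)
      define r' where "r' = (\<lambda>q. r q + (if q = j then x else 0))"
      have "combination L r' = combination L r + scale x v"
        using j by (auto simp: combination_def r'_def fun_eq_iff algebra_simps sum.distrib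
            if_distrib[of "\<lambda>z. z * _"] if_distrib[of "\<lambda>z. _ * z"] cong: if_cong)
      then have "u = combination L r'"
        using r(2) by (metis diff_add_cancel)
      moreover have "r j \<in> homog dg (g - h)"
        using r(1) j by (auto simp: vec_def)
      then have "r' \<in> vec dg (map fst L) g"
        using r(1) x j by (auto simp: vec_def r'_def intro: homog_add)
      ultimately show ?thesis
        by blast
    qed
  qed
  moreover have "u \<in> U g" if "(g, u) \<in> set L" for g u
  proof -
    from that obtain p a where "a \<in> M p" "w p a = (g, u)"
      using L by auto
    then show ?thesis
      using w[of a p] by simp
  qed
  ultimately show ?thesis
    by blast
qed

section \<open>Existence of graded free resolutions\<close>

definition list_complex :: "(nat \<Rightarrow> 'g list) \<Rightarrow> (nat \<Rightarrow> nat \<Rightarrow> nat \<Rightarrow> 'r) \<Rightarrow> ('r, nat, 'g) matrix_complex"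
  where "list_complex D A = \<lparr> basis = (\<lambda>i. {..<length (D i)}), bdeg = (\<lambda>i p. D i ! p), bmat = A \<rparr>"

lemma gchains_list_complex: "gchains (homog dg) (list_complex D A) i g = vec dg (D i) g"
  by (auto simp: gchains_def list_complex_def vec_def not_less)

text \<open>A finite list of homogeneous generators, each with its degree.\<close>

definition relations ::
    "(('v \<Rightarrow>\<^sub>0 nat) \<Rightarrow> 'g::ab_group_add) \<Rightarrow> ('g \<Rightarrow> (nat \<Rightarrow> ('v, 'k::comm_ring_1) mpoly) set)
      \<Rightarrow> ('g \<times> (nat \<Rightarrow> ('v, 'k) mpoly)) list"
  where "relations dg U = (SOME L. (\<forall>(g, u)\<in>set L. u \<in> U g) \<and>
    (\<forall>g. \<forall>u\<in>U g. \<exists>r\<in>vec dg (map fst L) g. u = combination L r))"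

text \<open>The generators of the successive modules of relations, chosen by a recursion that carries the basis
  degrees together with the list of columns of the current matrix.\<close>

theorem free_resolution_exists:
  fixes dg :: "('v::finite \<Rightarrow>\<^sub>0 nat) \<Rightarrow> 'g::ab_group_add"
    and act :: "('v, 'k::field) mpoly \<Rightarrow> 'c::ab_group_add \<Rightarrow> 'c"
  assumes dg: "grading dg" and pair: "graded_pair (homog dg) act C Z"
    and gens: "\<And>p. p < length ds \<Longrightarrow> c p \<in> C (ds ! p)"
    and surj: "\<And>g x. x \<in> C g \<Longrightarrow> \<exists>v\<in>vec dg ds g. x - (\<Sum>p<length ds. act (v p) (c p)) \<in> Z g"
  shows "\<exists>D A. D 0 = ds \<and> resolves (homog dg) (list_complex D A) act C Z c"
proof -
  interpret grading dg by (rule dg)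
  interpret graded_pair "homog dg" act C Z by (rule pair)
  let ?R = "relations dg"
  \<comment> \<open>The first module of relations is taken among the given generators of \<open>C/Z\<close>; later ones are kernels
    of the matrix of the previous step.\<close>
  define U0 where "U0 = (\<lambda>g. {v \<in> vec dg ds g. (\<Sum>p<length ds. act (v p) (c p)) \<in> Z g})"
  define ker :: "'g list \<Rightarrow> ('g \<times> (nat \<Rightarrow> ('v, 'k) mpoly)) list \<Rightarrow> 'g \<Rightarrow> (nat \<Rightarrow> ('v, 'k) mpoly) set"
    where "ker = (\<lambda>ds L g. {v \<in> vec dg (map fst L) g. combination L v = 0})"
  define step where "step = (\<lambda>(ds, L). (map fst L, ?R (ker ds L)))"
  define S where "S = (\<lambda>i. (step ^^ i) (ds, ?R U0))"
  define D where "D = (\<lambda>i. fst (S i))"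
  define A where "A = (\<lambda>i p q. snd (snd (S i) ! q) p)"
  have S_Suc: "S (Suc i) = step (S i)" for i
    by (simp add: S_def)
  have D_Suc: "D (Suc i) = map fst (snd (S i))" for i
    by (simp add: D_def S_Suc step_def split: prod.splits)
  have ker_Suc: "snd (S (Suc i)) = ?R (ker (D i) (snd (S i)))" for i
    by (simp add: S_Suc step_def D_def case_prod_unfold)
  have vec_diff: "u - v \<in> vec dg E g" if "u \<in> vec dg E g" "v \<in> vec dg E g"
    for E g and u v :: "nat \<Rightarrow> ('v, 'k) mpoly"
    using that by (auto simp: vec_def intro: homog_diff)
  have vec_scale: "scale r u \<in> vec dg E (h + g)" if "r \<in> homog dg h" "u \<in> vec dg E g"
    for E g h r and u :: "nat \<Rightarrow> ('v, 'k) mpoly"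
  proof -
    have "r * u p \<in> homog dg (h + g - E ! p)" if "p < length E" for p
      using homog_mult[OF \<open>r \<in> homog dg h\<close>, of "u p" "g - E ! p"] \<open>u \<in> vec dg E g\<close> that
      by (simp add: vec_def add_diff_eq)
    then show ?thesis
      using that by (auto simp: vec_def)
  qed
  have U0: "(\<forall>(g, u)\<in>set (?R U0). u \<in> U0 g) \<and>
      (\<forall>g. \<forall>u\<in>U0 g. \<exists>r\<in>vec dg (map fst (?R U0)) g. u = combination (?R U0) r)"
    unfolding relations_def
  proof (rule someI_ex, rule homogeneous_submodule_finitely_generated[OF dg])
    show "U0 g \<subseteq> vec dg ds g" for g
      by (auto simp: U0_def)
    show "u - v \<in> U0 g" if "u \<in> U0 g" "v \<in> U0 g" for g u v
      using that by (auto simp: U0_def diff_act sum_subtractf intro: vec_diff Z_diff)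
    show "scale r u \<in> U0 (h + g)" if "r \<in> homog dg h" "u \<in> U0 g" for g h r u
      using that act_Z by (auto simp: U0_def act_act simp flip: act_sum intro: vec_scale)
  qed
  have ker: "(\<forall>(g, u)\<in>set (?R (ker E L)). u \<in> ker E L g) \<and>
      (\<forall>g. \<forall>u\<in>ker E L g. \<exists>r\<in>vec dg (map fst (?R (ker E L))) g. u = combination (?R (ker E L)) r)" for E L
    unfolding relations_def
  proof (rule someI_ex, rule homogeneous_submodule_finitely_generated[OF dg])
    show "ker E L g \<subseteq> vec dg (map fst L) g" for g
      by (auto simp: ker_def)
    show "u - v \<in> ker E L g" if "u \<in> ker E L g" "v \<in> ker E L g" for g u v
    proof -
      have "combination L (u - v) = combination L u - combination L v"
        by (auto simp: combination_def fun_eq_iff algebra_simps sum_subtractf)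
      then show ?thesis
        using that by (auto simp: ker_def intro: vec_diff)
    qed
    show "scale r u \<in> ker E L (h + g)" if "r \<in> homog dg h" "u \<in> ker E L g" for g h r u
    proof -
      have "combination L (scale r u) = scale r (combination L u)"
        by (auto simp: combination_def fun_eq_iff sum_distrib_left algebra_simps)
      then show ?thesis
        using that by (auto simp: ker_def fun_eq_iff intro: vec_scale)
    qed
  qed
  have cols: "u \<in> vec dg (D i) g" if "(g, u) \<in> set (snd (S i))" for i g u
  proof (cases i)
    case 0
    then show ?thesis
      using that U0 by (auto simp: S_def D_def U0_def)
  next
    case (Suc k)
    then show ?thesis
      using that ker[of "D k" "snd (S k)"] unfolding Suc D_Suc ker_Suc by (auto simp: ker_def)
  qed
  let ?P = "list_complex D A"
  have bd: "bd (*) ?P i v = combination (snd (S i)) v" for i v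
  proof
    fix p
    have "snd (snd (S i) ! q) p = 0" if "p \<ge> length (D i)" "q < length (snd (S i))" for q
      using cols[of "fst (snd (S i) ! q)" "snd (snd (S i) ! q)" i] that by (auto simp: vec_def)
    then show "bd (*) ?P i v p = combination (snd (S i)) v p"
      by (auto simp: bd_def list_complex_def combination_def A_def D_Suc not_less)
  qed
  interpret P: graded_complex "homog dg" ?P
  proof
    fix p i q assume p: "p \<in> basis ?P i" and q: "q \<in> basis ?P (Suc i)"
    then have "q < length (snd (S i))"
      by (simp add: list_complex_def D_Suc)
    then have "snd (snd (S i) ! q) \<in> vec dg (D i) (D (Suc i) ! q)"
      using cols[of "fst (snd (S i) ! q)" "snd (snd (S i) ! q)" i] by (simp add: D_Suc)
    then show "bmat ?P i p q \<in> homog dg (bdeg ?P (Suc i) q - bdeg ?P i p)"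
      using p by (auto simp: list_complex_def vec_def A_def)
  qed (simp add: list_complex_def)
  have aug: "aug act c ?P v = (\<Sum>p<length ds. act (v p) (c p))" for v
    by (simp add: aug_def list_complex_def D_def S_def)
  have D0: "D 0 = ds"
    by (simp add: D_def S_def)
  have "resolves (homog dg) ?P act C Z c"
  proof (unfold_locales, goal_cases)
    case (1 v i g)
    have in_ker: "u \<in> ker (D i) (snd (S i)) h" if "(h, u) \<in> set (snd (S (Suc i)))" for h u
      using ker[of "D i" "snd (S i)"] that unfolding ker_Suc by blast
    have col: "combination (snd (S i)) (snd (snd (S (Suc i)) ! q)) = 0" if "q < length (snd (S (Suc i)))" for q
      using in_ker[of "fst (snd (S (Suc i)) ! q)" "snd (snd (S (Suc i)) ! q)"] nth_mem[OF that]
      by (simp add: ker_def)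
    have "combination (snd (S i)) (combination (snd (S (Suc i))) v) p =
      (\<Sum>q<length (snd (S (Suc i))). combination (snd (S i)) (snd (snd (S (Suc i)) ! q)) p * v q)" for p
      unfolding combination_def sum_distrib_left sum_distrib_right
      by (subst sum.swap) (simp add: algebra_simps)
    then show ?case
      using col by (simp add: bd fun_eq_iff)
  next
    case (2 v i g)
    then have "v \<in> ker (D i) (snd (S i)) g"
      by (simp add: gchains_list_complex D_Suc ker_def bd)
    then obtain r where "r \<in> vec dg (map fst (snd (S (Suc i)))) g" "v = combination (snd (S (Suc i))) r"
      using ker[of "D i" "snd (S i)"] unfolding ker_Suc by blast
    then show ?case
      by (auto simp: gchains_list_complex D_Suc bd)
  next
    case (3 p)
    then show ?case
      using gens by (simp add: list_complex_def D0)
  next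
    case (4 x g)
    then show ?case
      using surj by (simp add: gchains_list_complex D0 aug)
  next
    case (5 v g)
    have S0: "snd (S 0) = ?R U0"
      by (simp add: S_def)
    show ?case
    proof
      assume "aug act c ?P v \<in> Z g"
      then have "v \<in> U0 g"
        using 5 by (simp add: U0_def aug gchains_list_complex D0)
      then show "\<exists>w\<in>gchains (homog dg) ?P 1 g. v = bd (*) ?P 0 w"
        using U0 by (simp add: gchains_list_complex D_Suc bd S0)
    next
      assume "\<exists>w\<in>gchains (homog dg) ?P 1 g. v = bd (*) ?P 0 w"
      then obtain w where w: "w \<in> vec dg (map fst (?R U0)) g" "v = combination (?R U0) w"
        by (auto simp: gchains_list_complex D_Suc bd S0)
      have "aug act c ?P v = (\<Sum>q<length (?R U0). act (w q) (\<Sum>p<length ds. act (snd (?R U0 ! q) p) (c p)))"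
        unfolding aug w(2) combination_def sum_act act_sum
        by (subst sum.swap) (simp add: mult.commute flip: act_act)
      also have "\<dots> \<in> Z g"
      proof (rule sum_closed)
        fix q assume q: "q \<in> {..<length (?R U0)}"
        have "snd (?R U0 ! q) \<in> U0 (fst (?R U0 ! q))"
          using conjunct1[OF U0] nth_mem[of q "?R U0"] q by (simp add: case_prod_unfold)
        moreover have "w q \<in> homog dg (g - fst (?R U0 ! q))"
          using w(1) q by (auto simp: vec_def)
        ultimately show "act (w q) (\<Sum>p<length ds. act (snd (?R U0 ! q) p) (c p)) \<in> Z g"
          using act_Z[of "w q" "g - fst (?R U0 ! q)" _ "fst (?R U0 ! q)"] by (auto simp: U0_def)
      qed (auto intro: Z_diff)
      finally show "aug act c ?P v \<in> Z g" .
    qed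
  qed
  with D0 show ?thesis
    by blast
qed

section \<open>Modules presented by polynomials\<close>

text \<open>The records in question are images of additive groups of polynomials, which spares a direct
  verification of the group axioms for cosets and extensional functions.\<close>

lemma abelian_group_image:
  fixes \<pi> :: "'c::ab_group_add \<Rightarrow> 'b" and N :: "('b, 'x) ring_scheme"
  assumes T: "0 \<in> T" "\<And>x y. x \<in> T \<Longrightarrow> y \<in> T \<Longrightarrow> x - y \<in> T"
    and N: "carrier N = \<pi> ` T" "\<zero>\<^bsub>N\<^esub> = \<pi> 0"
    and add: "\<And>x y. x \<in> T \<Longrightarrow> y \<in> T \<Longrightarrow> \<pi> x \<oplus>\<^bsub>N\<^esub> \<pi> y = \<pi> (x + y)"
  shows "abelian_group N"
proof (rule abelian_groupI)
  note closed = add_closed[OF T] minus_closed[OF T]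
  show "x \<oplus>\<^bsub>N\<^esub> y \<in> carrier N" if "x \<in> carrier N" "y \<in> carrier N" for x y
    using that closed(1) by (auto simp: N add)
  show "\<zero>\<^bsub>N\<^esub> \<in> carrier N"
    using T(1) by (simp add: N)
  show "x \<oplus>\<^bsub>N\<^esub> y \<oplus>\<^bsub>N\<^esub> z = x \<oplus>\<^bsub>N\<^esub> (y \<oplus>\<^bsub>N\<^esub> z)"
    if "x \<in> carrier N" "y \<in> carrier N" "z \<in> carrier N" for x y z
    using that closed(1) by (auto simp: N add add.assoc)
  show "x \<oplus>\<^bsub>N\<^esub> y = y \<oplus>\<^bsub>N\<^esub> x" if "x \<in> carrier N" "y \<in> carrier N" for x y
    using that by (auto simp: N add add.commute)
  show "\<zero>\<^bsub>N\<^esub> \<oplus>\<^bsub>N\<^esub> x = x" if "x \<in> carrier N" for x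
    using that T(1) by (auto simp: N add)
  show "\<exists>y\<in>carrier N. y \<oplus>\<^bsub>N\<^esub> x = \<zero>\<^bsub>N\<^esub>" if "x \<in> carrier N" for x
  proof -
    from that obtain t where t: "t \<in> T" "x = \<pi> t"
      using N by auto
    then have "\<pi> (- t) \<oplus>\<^bsub>N\<^esub> x = \<zero>\<^bsub>N\<^esub>"
      using closed(2) by (simp add: N add)
    then show ?thesis
      using closed(2) t N by blast
  qed
qed

text \<open>A graded module that is the image, under \<open>\<pi>\<close>, of the polynomials supported on the set \<open>E\<close> of
  monomials; \<open>e\<close> is the degree of a monomial as an element of the module, and the ring acts through
  the homomorphism \<open>\<rho>\<close>.\<close>

locale presented = grading dg
  for dg :: "('v \<Rightarrow>\<^sub>0 nat) \<Rightarrow> 'g::ab_group_add" +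
  fixes N :: "(('v, 'k::comm_ring_1) mpoly, 'b, 'g) graded_module"
    and E :: "('w \<Rightarrow>\<^sub>0 nat) set" and e :: "('w \<Rightarrow>\<^sub>0 nat) \<Rightarrow> 'g"
    and \<rho> :: "('v, 'k) mpoly \<Rightarrow> ('w, 'k) mpoly" and \<pi> :: "('w, 'k) mpoly \<Rightarrow> 'b"
  assumes rho_diff: "\<rho> (r - s) = \<rho> r - \<rho> s" and rho_mult: "\<rho> (r * s) = \<rho> r * \<rho> s" and rho_one: "\<rho> 1 = 1"
    and rho_supp: "keys x \<subseteq> E \<Longrightarrow> keys (\<rho> r * x) \<subseteq> E"
    and rho_deg: "r \<in> homog dg h \<Longrightarrow> keys x \<subseteq> E \<Longrightarrow> x \<in> homog e g \<Longrightarrow> \<rho> r * x \<in> homog e (h + g)"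
    and carrier_N: "carrier N = \<pi> ` {x. keys x \<subseteq> E}"
    and gpart_N: "gpart N g = \<pi> ` {x. keys x \<subseteq> E \<and> x \<in> homog e g}"
    and add_N: "keys x \<subseteq> E \<Longrightarrow> keys y \<subseteq> E \<Longrightarrow> \<pi> x \<oplus>\<^bsub>N\<^esub> \<pi> y = \<pi> (x + y)"
    and zero_N: "\<zero>\<^bsub>N\<^esub> = \<pi> 0"
    and smult_N: "keys x \<subseteq> E \<Longrightarrow> r \<odot>\<^bsub>N\<^esub> \<pi> x = \<pi> (\<rho> r * x)"
    and ker_homog: "keys x \<subseteq> E \<Longrightarrow> \<pi> x = \<pi> 0 \<Longrightarrow> \<pi> (hcomp e g x) = \<pi> 0"
begin

definition "elems = {x :: ('w, 'k) mpoly. keys x \<subseteq> E}"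
definition "comps g = {x \<in> elems. x \<in> homog e g}"
definition "kers g = {x \<in> comps g. \<pi> x = \<pi> 0}"
definition "act r x = \<rho> r * x"

lemma elems_zero [simp]: "0 \<in> elems"
  by (simp add: elems_def)

lemma elems_diff: "x \<in> elems \<Longrightarrow> y \<in> elems \<Longrightarrow> x - y \<in> elems"
  using Poly_Mapping.keys_diff[of x y] by (auto simp: elems_def)

lemma elems_add: "x \<in> elems \<Longrightarrow> y \<in> elems \<Longrightarrow> x + y \<in> elems"
  using Poly_Mapping.keys_add[of x y] by (auto simp: elems_def)

lemma elems_sum: "(\<And>i. i \<in> A \<Longrightarrow> f i \<in> elems) \<Longrightarrow> sum f A \<in> elems"
  by (rule sum_closed) (auto intro: elems_diff)

lemma elems_act: "x \<in> elems \<Longrightarrow> act r x \<in> elems"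
  by (simp add: elems_def act_def rho_supp)

lemma comps_elems: "x \<in> comps g \<Longrightarrow> x \<in> elems"
  by (simp add: comps_def)

lemma hcomp_comps: "x \<in> elems \<Longrightarrow> hcomp e g x \<in> comps g"
  by (auto simp: comps_def elems_def hcomp_def keys_restr homog_def)

lemma pi_add: "x \<in> elems \<Longrightarrow> y \<in> elems \<Longrightarrow> \<pi> x \<oplus>\<^bsub>N\<^esub> \<pi> y = \<pi> (x + y)"
  by (simp add: elems_def add_N)

lemma abelian_group_N: "abelian_group N"
  by (rule abelian_group_image[of elems N \<pi>])
    (auto simp: elems_def[symmetric] zero_N carrier_N pi_add intro: elems_diff)

lemma pi_eq_iff:
  assumes "x \<in> elems" "y \<in> elems"
  shows "\<pi> x = \<pi> y \<longleftrightarrow> \<pi> (x - y) = \<pi> 0"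
proof
  have y: "- y \<in> elems"
    using elems_diff[of 0 y] assms by simp
  assume "\<pi> x = \<pi> y"
  then have "\<pi> x \<oplus>\<^bsub>N\<^esub> \<pi> (- y) = \<pi> y \<oplus>\<^bsub>N\<^esub> \<pi> (- y)"
    by simp
  then show "\<pi> (x - y) = \<pi> 0"
    using assms y by (simp add: pi_add)
next
  assume "\<pi> (x - y) = \<pi> 0"
  then have "\<pi> y \<oplus>\<^bsub>N\<^esub> \<pi> (x - y) = \<pi> y \<oplus>\<^bsub>N\<^esub> \<pi> 0"
    by simp
  then show "\<pi> x = \<pi> y"
    using assms by (simp add: pi_add elems_diff)
qed

lemma pi_act_zero: "x \<in> elems \<Longrightarrow> \<pi> x = \<pi> 0 \<Longrightarrow> \<pi> (act r x) = \<pi> 0"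
proof -
  assume x: "x \<in> elems" "\<pi> x = \<pi> 0"
  have "\<pi> (act r x) = r \<odot>\<^bsub>N\<^esub> \<pi> 0"
    using x smult_N[of x r] by (simp add: elems_def act_def)
  then show ?thesis
    using smult_N[of 0 r] by simp
qed

lemma graded_pair: "graded_pair (homog dg) act comps kers"
proof -
  interpret graded_ring "homog dg :: 'g \<Rightarrow> ('v, 'k) mpoly set"
    by (rule graded_ring_homog)
  have C: "x - y \<in> comps g" if "x \<in> comps g" "y \<in> comps g" for x y g
    using that by (auto simp: comps_def intro: elems_diff homog_diff)
  have A: "act r x \<in> comps (g + h)" if "r \<in> homog dg g" "x \<in> comps h" for r x g h
    using that rho_deg rho_supp by (auto simp: comps_def elems_def act_def)
  show ?thesis
  proof (unfold_locales, goal_cases)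
    case (5 r g x h)
    then show ?case
      by (rule A)
  next
    case (7 g)
    then show ?case
      by (simp add: comps_def)
  next
    case (8 x g y)
    then show ?case
      by (rule C)
  next
    case (9 g)
    then show ?case
      by (simp add: kers_def comps_def)
  next
    case (6 r g x h)
    then show ?case
      using A pi_act_zero by (auto simp: kers_def comps_def)
  next
    case (10 x g y)
    then have "\<pi> x = \<pi> y" "x \<in> elems" "y \<in> elems"
      by (auto simp: kers_def comps_def)
    then have "\<pi> (x - y) = \<pi> 0"
      using pi_eq_iff by blast
    then show ?case
      using 10 C by (auto simp: kers_def)
  qed (auto simp: act_def algebra_simps rho_diff rho_mult rho_one kers_def)
qed

lemma finsum_pi: "finite A \<Longrightarrow> (\<And>q. q \<in> A \<Longrightarrow> f q \<in> elems) \<Longrightarrow> finsum N (\<lambda>q. \<pi> (f q)) A = \<pi> (\<Sum>q\<in>A. f q)"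
proof (induction A rule: finite_induct)
  interpret abelian_group N by (rule abelian_group_N)
  {
    case empty
    show ?case by (simp add: zero_N)
  next
    case (insert q A)
    then show ?case
      by (subst finsum_insert) (auto simp: carrier_N elems_def[symmetric] pi_add elems_sum)
  }
qed

lemma hcomp_sum: "hcomp e g (sum f A) = (\<Sum>a\<in>A. hcomp e g (f a))" for f :: "'z \<Rightarrow> ('w, 'k) mpoly"
  by (simp add: hcomp_def restr_sum)

lemma hcomp_diff: "hcomp e g (x - y) = hcomp e g x - hcomp e g y" for x y :: "('w, 'k) mpoly"
  by (simp add: hcomp_def restr_diff)

lemma hcomp_comps_eq: "x \<in> comps h \<Longrightarrow> hcomp e g x = (if g = h then x else 0)"
  by (auto simp: comps_def hcomp_id) (auto simp: hcomp_def homog_def intro!: restr_none)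

lemma hcomp_act:
  assumes "r \<in> homog dg h" "x \<in> elems"
  shows "hcomp e g (act r x) = act r (hcomp e (g - h) x)"
proof -
  interpret graded_pair "homog dg" act comps kers
    by (rule graded_pair)
  have c: "act r (hcomp e i x) \<in> comps (h + i)" for i
    using act_C assms hcomp_comps by blast
  have "act r x = (\<Sum>i\<in>e ` keys x. act r (hcomp e i x))"
    by (subst (1) sum_hcomp[of x e]) (rule act_sum)
  then have "hcomp e g (act r x) = (\<Sum>i\<in>e ` keys x. if g = h + i then act r (hcomp e i x) else 0)"
    by (simp add: hcomp_sum hcomp_comps_eq[OF c])
  also have "\<dots> = (\<Sum>i\<in>e ` keys x. if i = g - h then act r (hcomp e (g - h) x) else 0)"
    by (rule sum.cong[OF refl]) (auto simp: algebra_simps)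
  also have "\<dots> = act r (hcomp e (g - h) x)"
  proof (cases "g - h \<in> e ` keys x")
    case False
    then have "hcomp e (g - h) x = 0"
      unfolding hcomp_def by (intro restr_none) (auto, metis imageI)
    with False show ?thesis
      by (simp add: act_zero)
  qed simp
  finally show ?thesis .
qed

lemma hcomp_act_coefficient:
  assumes "x \<in> comps h"
  shows "hcomp e g (act r x) = act (hcomp dg (g - h) r) x"
proof -
  interpret graded_pair "homog dg" act comps kers
    by (rule graded_pair)
  have c: "act (hcomp dg i r) x \<in> comps (i + h)" for i
    using act_C assms by simp
  have "act r x = (\<Sum>i\<in>dg ` keys r. act (hcomp dg i r) x)"
    by (subst (1) sum_hcomp[of r dg]) (rule sum_act)
  then have "hcomp e g (act r x) = (\<Sum>i\<in>dg ` keys r. if g = i + h then act (hcomp dg i r) x else 0)"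
    by (simp add: hcomp_sum hcomp_comps_eq[OF c])
  also have "\<dots> = (\<Sum>i\<in>dg ` keys r. if i = g - h then act (hcomp dg (g - h) r) x else 0)"
    by (rule sum.cong[OF refl]) (auto simp: algebra_simps)
  also have "\<dots> = act (hcomp dg (g - h) r) x"
  proof (cases "g - h \<in> dg ` keys r")
    case False
    then have "hcomp dg (g - h) r = 0"
      unfolding hcomp_def by (intro restr_none) (auto, metis imageI)
    with False show ?thesis
      by (simp add: zero_act)
  qed simp
  finally show ?thesis .
qed

end

section \<open>Homology of a complex with coefficients in a presented module\<close>

abbreviation complex_of :: "('r, 'a, 'g) free_complex \<Rightarrow> ('r, nat, 'g) matrix_complex"
  where "complex_of F \<equiv> list_complex (res_degs F) (res_mat F)"

lemma basis_complex_of [simp]: "basis (list_complex D A) i = {..<length (D i)}"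
  and bdeg_complex_of [simp]: "bdeg (list_complex D A) i p = D i ! p"
  and bmat_complex_of [simp]: "bmat (list_complex D A) = A"
  by (simp_all add: list_complex_def)

text \<open>The tensor product of a complex of free modules with a presented module is again an image of tuples
  of polynomials; \<open>tchains\<close> are these tuples without any condition of homogeneity, and \<open>img\<close> is the
  projection.\<close>

locale presented_complex = presented dg N E e \<rho> \<pi>
  for dg :: "('v \<Rightarrow>\<^sub>0 nat) \<Rightarrow> 'g::ab_group_add"
    and N :: "(('v, 'k::comm_ring_1) mpoly, 'b, 'g) graded_module"
    and E :: "('w \<Rightarrow>\<^sub>0 nat) set" and e \<rho> \<pi> +
  fixes F :: "(('v, 'k) mpoly, 'z, 'g) free_complex"
  assumes F: "graded_complex (homog dg) (complex_of F)"
begin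

sublocale pair: graded_pair "homog dg" act comps kers
  by (rule graded_pair)

abbreviation "K \<equiv> complex_of F"

definition "tchains i = {z :: nat \<Rightarrow> ('w, 'k) mpoly. (\<forall>p<length (res_degs F i). z p \<in> elems) \<and>
  (\<forall>p\<ge>length (res_degs F i). z p = 0)}"

definition "img i z = (\<lambda>p\<in>{..<length (res_degs F i)}. \<pi> (z p))"

lemma tchains_zero [simp]: "0 \<in> tchains i"
  by (simp add: tchains_def)

lemma tchains_diff: "u \<in> tchains i \<Longrightarrow> v \<in> tchains i \<Longrightarrow> u - v \<in> tchains i"
  by (auto simp: tchains_def intro: elems_diff)

lemma tchains_add: "u \<in> tchains i \<Longrightarrow> v \<in> tchains i \<Longrightarrow> u + v \<in> tchains i"
  by (auto simp: tchains_def intro: elems_add)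

lemma gchains_tchains: "z \<in> gchains comps K i g \<Longrightarrow> z \<in> tchains i"
  by (auto simp: tchains_def gchains_def comps_def not_less)

lemma bd_tchains: "z \<in> tchains (Suc i) \<Longrightarrow> bd act K i z \<in> tchains i"
  by (auto simp: tchains_def bd_def intro!: elems_sum elems_act)

lemma act_tchains: "z \<in> tchains i \<Longrightarrow> (\<lambda>p. act r (z p)) \<in> tchains i"
  by (auto simp: tchains_def pair.act_zero intro: elems_act)

lemma img_eq_iff: "img i u = img i v \<longleftrightarrow> (\<forall>p<length (res_degs F i). \<pi> (u p) = \<pi> (v p))"
  by (auto simp: img_def fun_eq_iff restrict_def)

lemma img_diff_eq: "u \<in> tchains i \<Longrightarrow> v \<in> tchains i \<Longrightarrow> img i u = img i v \<longleftrightarrow> img i (u - v) = img i 0"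
  unfolding img_eq_iff tchains_def by (simp add: pi_eq_iff)

lemma img_kers: "z \<in> gchains comps K i g \<Longrightarrow> img i z = img i 0 \<longleftrightarrow> z \<in> gchains kers K i g"
  by (auto simp: img_eq_iff gchains_def kers_def)

lemma carrier_tensor: "carrier (free_tensor (res_degs F i) N) = img i ` tchains i"
proof
  show "carrier (free_tensor (res_degs F i) N) \<subseteq> img i ` tchains i"
  proof
    fix v assume v: "v \<in> carrier (free_tensor (res_degs F i) N)"
    then have "\<forall>p<length (res_degs F i). \<exists>x\<in>elems. v p = \<pi> x"
      by (auto simp: free_tensor_def PiE_def Pi_def carrier_N elems_def)
    then obtain z where z: "\<forall>p<length (res_degs F i). z p \<in> elems \<and> v p = \<pi> (z p)"
      by metis
    define z' where "z' = (\<lambda>p. if p < length (res_degs F i) then z p else 0)"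
    have "v = img i z'"
      using v z by (auto simp: img_def z'_def fun_eq_iff free_tensor_def PiE_def extensional_def)
    moreover have "z' \<in> tchains i"
      using z by (auto simp: tchains_def z'_def)
    ultimately show "v \<in> img i ` tchains i"
      by blast
  qed
qed (auto simp: free_tensor_def img_def tchains_def carrier_N elems_def split: if_splits)

lemma gpart_tensor: "gpart (free_tensor (res_degs F i) N) g = img i ` gchains comps K i g"
proof
  show "gpart (free_tensor (res_degs F i) N) g \<subseteq> img i ` gchains comps K i g"
  proof
    fix v assume v: "v \<in> gpart (free_tensor (res_degs F i) N) g"
    then have "\<forall>p<length (res_degs F i). \<exists>x\<in>comps (g - res_degs F i ! p). v p = \<pi> x"
      by (fastforce simp: free_tensor_def PiE_def Pi_def gpart_N elems_def comps_def)
    then obtain z where z: "\<forall>p<length (res_degs F i). z p \<in> comps (g - res_degs F i ! p) \<and> v p = \<pi> (z p)"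
      by metis
    define z' where "z' = (\<lambda>p. if p < length (res_degs F i) then z p else 0)"
    have "v = img i z'"
      using v z by (auto simp: img_def z'_def fun_eq_iff free_tensor_def PiE_def extensional_def)
    moreover have "z' \<in> gchains comps K i g"
      using z by (auto simp: gchains_def z'_def)
    ultimately show "v \<in> img i ` gchains comps K i g"
      by blast
  qed
qed (auto simp: free_tensor_def img_def gchains_def gpart_N elems_def comps_def split: if_splits)

lemma tensor_ops:
  "\<zero>\<^bsub>free_tensor (res_degs F i) N\<^esub> = img i 0"
  "u \<in> tchains i \<Longrightarrow> v \<in> tchains i \<Longrightarrow> img i u \<oplus>\<^bsub>free_tensor (res_degs F i) N\<^esub> img i v = img i (u + v)"
  "u \<in> tchains i \<Longrightarrow> r \<odot>\<^bsub>free_tensor (res_degs F i) N\<^esub> img i u = img i (\<lambda>p. act r (u p))"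
  by (auto simp: free_tensor_def img_def zero_N tchains_def pi_add elems_def act_def smult_N
      fun_eq_iff restrict_def)

lemma res_map_img:
  assumes z: "z \<in> tchains (Suc i)"
  shows "res_map F N i (img (Suc i) z) = img i (bd act K i z)"
proof -
  have "(\<Oplus>\<^bsub>N\<^esub>q\<in>{..<length (res_degs F (Suc i))}. res_mat F i p q \<odot>\<^bsub>N\<^esub> img (Suc i) z q) =
      \<pi> (\<Sum>q<length (res_degs F (Suc i)). act (res_mat F i p q) (z q))" for p
  proof -
    have "res_mat F i p q \<odot>\<^bsub>N\<^esub> img (Suc i) z q = \<pi> (act (res_mat F i p q) (z q))"
      if "q < length (res_degs F (Suc i))" for q
      using that z smult_N by (simp add: img_def tchains_def elems_def act_def)
    moreover have "\<pi> x \<in> carrier N" if "x \<in> elems" for x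
      using that by (auto simp: carrier_N elems_def)
    moreover have "act (res_mat F i p q) (z q) \<in> elems" if "q < length (res_degs F (Suc i))" for q
      using that z by (auto simp: tchains_def intro: elems_act)
    moreover from this have "(\<Oplus>\<^bsub>N\<^esub>q\<in>{..<length (res_degs F (Suc i))}. \<pi> (act (res_mat F i p q) (z q))) =
        \<pi> (\<Sum>q<length (res_degs F (Suc i)). act (res_mat F i p q) (z q))"
      by (intro finsum_pi) auto
    ultimately show ?thesis
      using abelian_monoid.finsum_cong'[OF abelian_group.axioms(1)[OF abelian_group_N], of
          "{..<length (res_degs F (Suc i))}" "{..<length (res_degs F (Suc i))}"
          "\<lambda>q. \<pi> (act (res_mat F i p q) (z q))" "\<lambda>q. res_mat F i p q \<odot>\<^bsub>N\<^esub> img (Suc i) z q"]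
      by (auto simp: Pi_def)
  qed
  then show ?thesis
    by (auto simp: res_map_def img_def bd_def fun_eq_iff restrict_def)
qed

lemma boundaries_img: "boundaries F N i = img i ` bd act K i ` tchains (Suc i)"
  by (auto simp: boundaries_def carrier_tensor res_map_img image_image)

definition "cyc i = {z \<in> tchains i. \<forall>k. i = Suc k \<longrightarrow> img k (bd act K k z) = img k 0}"

lemma cycles_img: "cycles F N i = img i ` cyc i"
  by (auto simp: cycles_def carrier_tensor cyc_def tensor_ops res_map_img)

definition "part i g z = (\<lambda>p. hcomp e (g - res_degs F i ! p) (z p))" for z :: "nat \<Rightarrow> ('w, 'k) mpoly"

lemma part_gchains: "z \<in> tchains i \<Longrightarrow> part i g z \<in> gchains comps K i g"
  using hcomp_comps by (auto simp: part_def gchains_def tchains_def not_less hcomp_def)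

lemma part_id: "z \<in> gchains comps K i g \<Longrightarrow> part i g z = z"
proof
  fix p
  assume z: "z \<in> gchains comps K i g"
  show "part i g z p = z p"
  proof (cases "p < length (res_degs F i)")
    case True
    then show ?thesis
      using z by (auto simp: part_def gchains_def comps_def hcomp_id)
  next
    case False
    then show ?thesis
      using z by (simp add: part_def gchains_def hcomp_def)
  qed
qed

lemma part_zero [simp]: "part i g 0 = 0"
  by (auto simp: part_def hcomp_def)

lemma bd_part:
  assumes z: "z \<in> tchains (Suc i)"
  shows "bd act K i (part (Suc i) g z) = part i g (bd act K i z)"
proof
  fix p
  show "bd act K i (part (Suc i) g z) p = part i g (bd act K i z) p"
  proof (cases "p < length (res_degs F i)")
    case True
    have "act (res_mat F i p q) (part (Suc i) g z q) =
        hcomp e (g - res_degs F i ! p) (act (res_mat F i p q) (z q))"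
      if q: "q < length (res_degs F (Suc i))" for q
    proof -
      have "res_mat F i p q \<in> homog dg (res_degs F (Suc i) ! q - res_degs F i ! p)"
        using graded_complex.mat_homog[OF F, of p i q] True q by simp
      then show ?thesis
        using z q by (subst hcomp_act) (auto simp: part_def tchains_def)
    qed
    then show ?thesis
      using True by (simp add: part_def[of i] bd_def hcomp_sum)
  qed (simp add: part_def[of i] bd_def hcomp_def)
qed

lemma sum_parts:
  assumes z: "z \<in> tchains i"
  obtains G where "finite G" "z = (\<Sum>g\<in>G. part i g z)"
proof
  define n where "n = length (res_degs F i)"
  define G where "G = (\<Union>p<n. (\<lambda>m. e m + res_degs F i ! p) ` keys (z p))"
  show "finite G"
    by (auto simp: G_def)
  show "z = (\<Sum>g\<in>G. part i g z)"
  proof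
    fix p
    show "z p = (\<Sum>g\<in>G. part i g z) p"
    proof (cases "p < n")
      case True
      have "lookup (\<Sum>g\<in>G. part i g z p) m = lookup (z p) m" for m
      proof -
        have "lookup (\<Sum>g\<in>G. part i g z p) m =
            (\<Sum>g\<in>G. if g = e m + res_degs F i ! p then lookup (z p) m else 0)"
          by (auto simp: lookup_sum part_def hcomp_def lookup_restr algebra_simps intro!: sum.cong)
        also have "\<dots> = lookup (z p) m"
        proof (cases "lookup (z p) m = 0")
          case False
          then have "m \<in> keys (z p)"
            by (simp add: in_keys_iff)
          then have "e m + res_degs F i ! p \<in> G"
            using True unfolding G_def by blast
          then show ?thesis
            using \<open>finite G\<close> by simp
        qed (auto intro: sum.neutral)
        finally show ?thesis .
      qed
      then show ?thesis
        by (auto simp: sum_apply_fun intro!: poly_mapping_eqI)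
    next
      case False
      then have "z p = 0"
        using z by (simp add: tchains_def n_def)
      then show ?thesis
        by (simp add: sum_apply_fun part_def hcomp_def)
    qed
  qed
qed

text \<open>A homogeneous boundary is the boundary of a homogeneous chain: the component of the right degree of
  any preimage works, because the kernel of the presentation is homogeneous.\<close>

lemma boundary_homogeneous:
  assumes z: "z \<in> gchains comps K i g"
  shows "img i z \<in> boundaries F N i \<longleftrightarrow>
    (\<exists>w\<in>gchains comps K (Suc i) g. z - bd act K i w \<in> gchains kers K i g)"
proof
  assume "img i z \<in> boundaries F N i"
  then obtain w where w: "w \<in> tchains (Suc i)" "img i z = img i (bd act K i w)"
    by (auto simp: boundaries_img)
  have d: "z - bd act K i w \<in> tchains i"
    by (intro tchains_diff gchains_tchains[OF z] bd_tchains w)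
  have "img i (z - bd act K i w) = img i 0"
    using w z img_diff_eq gchains_tchains bd_tchains by blast
  then have "img i (part i g (z - bd act K i w)) = img i 0"
    using d ker_homog by (auto simp: img_eq_iff part_def tchains_def elems_def)
  then have "part i g (z - bd act K i w) \<in> gchains kers K i g"
    using img_kers part_gchains[OF d] by blast
  moreover have "part i g (z - bd act K i w) = z - bd act K i (part (Suc i) g w)"
    using part_id[OF z] bd_part[OF w(1), of g]
    by (auto simp: part_def[of i] fun_eq_iff hcomp_diff)
  ultimately show "\<exists>w\<in>gchains comps K (Suc i) g. z - bd act K i w \<in> gchains kers K i g"
    using part_gchains[OF w(1)] by (intro bexI[of _ "part (Suc i) g w"]) simp_all
next
  assume "\<exists>w\<in>gchains comps K (Suc i) g. z - bd act K i w \<in> gchains kers K i g"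
  then obtain w where w: "w \<in> gchains comps K (Suc i) g" "z - bd act K i w \<in> gchains kers K i g"
    by blast
  then have "img i (z - bd act K i w) = img i 0"
    by (auto simp: img_eq_iff gchains_def kers_def)
  then have "img i z = img i (bd act K i w)"
    using img_diff_eq gchains_tchains[OF z] bd_tchains gchains_tchains[OF w(1)] by blast
  then show "img i z \<in> boundaries F N i"
    using gchains_tchains[OF w(1)] by (auto simp: boundaries_img)
qed

lemma cyc_diff: "u \<in> cyc i \<Longrightarrow> v \<in> cyc i \<Longrightarrow> u - v \<in> cyc i"
proof -
  assume u: "u \<in> cyc i" and v: "v \<in> cyc i"
  have "img k (bd act K k (u - v)) = img k 0" if "i = Suc k" for k
    using u v that img_diff_eq[of "bd act K k u" k "bd act K k v"]
    by (auto simp: cyc_def pair.bd_diff bd_tchains)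
  then show ?thesis
    using u v by (auto simp: cyc_def tchains_diff)
qed

lemma img_in_cycles: "z \<in> tchains i \<Longrightarrow> img i z \<in> cycles F N i \<longleftrightarrow> z \<in> cyc i"
  by (auto simp: cycles_def carrier_tensor cyc_def tensor_ops res_map_img)

end

lemma annihilated_simps:
  "carrier (annihilated M y) = {t \<in> carrier M. y \<odot>\<^bsub>M\<^esub> t = \<zero>\<^bsub>M\<^esub>}"
  "\<zero>\<^bsub>annihilated M y\<^esub> = \<zero>\<^bsub>M\<^esub>"
  "x \<oplus>\<^bsub>annihilated M y\<^esub> z = x \<oplus>\<^bsub>M\<^esub> z"
  "gpart (annihilated M y) g = gpart M g \<inter> {t \<in> carrier M. y \<odot>\<^bsub>M\<^esub> t = \<zero>\<^bsub>M\<^esub>}"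
  by (simp_all add: annihilated_def submod_def)

text \<open>The record-level definition of Tor for a complex whose differentials compose to zero as matrices.\<close>

locale presented_tor = presented_complex dg N E e \<rho> \<pi> F
  for dg :: "('v \<Rightarrow>\<^sub>0 nat) \<Rightarrow> 'g::ab_group_add"
    and N :: "(('v, 'k::comm_ring_1) mpoly, 'b, 'g) graded_module"
    and E :: "('w \<Rightarrow>\<^sub>0 nat) set" and e \<rho> \<pi>
    and F :: "(('v, 'k) mpoly, 'z, 'g) free_complex" +
  assumes mat_mat: "p < length (res_degs F i) \<Longrightarrow> q < length (res_degs F (Suc (Suc i))) \<Longrightarrow>
    (\<Sum>r<length (res_degs F (Suc i)). res_mat F i p r * res_mat F (Suc i) r q) = 0"
begin

lemma bd_bd: "bd act K i (bd act K (Suc i) z) = 0"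
proof
  fix p
  show "bd act K i (bd act K (Suc i) z) p = 0 p"
  proof (cases "p < length (res_degs F i)")
    case True
    have "bd act K i (bd act K (Suc i) z) p =
        (\<Sum>r<length (res_degs F (Suc i)). \<Sum>q<length (res_degs F (Suc (Suc i))).
          act (res_mat F i p r * res_mat F (Suc i) r q) (z q))"
      using True by (simp add: bd_def pair.act_sum pair.act_act)
    also have "\<dots> = (\<Sum>q<length (res_degs F (Suc (Suc i))).
          act (\<Sum>r<length (res_degs F (Suc i)). res_mat F i p r * res_mat F (Suc i) r q) (z q))"
      by (subst sum.swap) (simp add: pair.sum_act)
    also have "\<dots> = 0"
      using True by (intro sum.neutral) (simp add: mat_mat pair.zero_act)
    finally show ?thesis
      by simp
  qed (simp add: bd_def)
qed

abbreviation "cyc_module i \<equiv> submod (free_tensor (res_degs F i) N) (cycles F N i)"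
abbreviation "tor i \<equiv> quot (cyc_module i) (boundaries F N i)"
definition "cls i z = boundaries F N i +>\<^bsub>cyc_module i\<^esub> img i z"

lemma cyc_zero [simp]: "0 \<in> cyc i"
  by (auto simp: cyc_def)

lemma cyc_tchains: "z \<in> cyc i \<Longrightarrow> z \<in> tchains i"
  by (simp add: cyc_def)

lemma cyc_module_ops:
  "carrier (cyc_module i) = img i ` cyc i"
  "\<zero>\<^bsub>cyc_module i\<^esub> = img i 0"
  "u \<in> tchains i \<Longrightarrow> v \<in> tchains i \<Longrightarrow> img i u \<oplus>\<^bsub>cyc_module i\<^esub> img i v = img i (u + v)"
  "u \<in> tchains i \<Longrightarrow> r \<odot>\<^bsub>cyc_module i\<^esub> img i u = img i (\<lambda>p. act r (u p))"
  using tensor_ops by (simp_all add: submod_def cycles_img)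

lemma abelian_group_cyc_module: "abelian_group (cyc_module i)"
  by (rule abelian_group_image[of "cyc i" _ "img i"])
    (auto simp: cyc_module_ops cyc_tchains intro: cyc_diff)

lemma boundary_cyc: "w \<in> tchains (Suc i) \<Longrightarrow> bd act K i w \<in> cyc i"
  using bd_tchains bd_bd by (auto simp: cyc_def)

lemma abelian_subgroup_boundaries: "abelian_subgroup (boundaries F N i) (cyc_module i)"
proof (rule abelian_subgroupI3)
  interpret M: abelian_group "cyc_module i"
    by (rule abelian_group_cyc_module)
  show "additive_subgroup (boundaries F N i) (cyc_module i)"
  proof (rule additive_subgroup.intro, rule group.subgroupI[OF M.a_group])
    show "boundaries F N i \<subseteq> carrier (add_monoid (cyc_module i))"
      using boundary_cyc by (auto simp: boundaries_img cyc_module_ops)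
    show "boundaries F N i \<noteq> {}"
      using tchains_zero[of "Suc i"] unfolding boundaries_img by blast
    show "inv\<^bsub>add_monoid (cyc_module i)\<^esub> a \<in> boundaries F N i" if a: "a \<in> boundaries F N i" for a
    proof -
      obtain w where w: "w \<in> tchains (Suc i)" "a = img i (bd act K i w)"
        using a by (auto simp: boundaries_img)
      have w': "- w \<in> tchains (Suc i)"
        using tchains_diff[OF tchains_zero w(1)] by simp
      have "img i (bd act K i (- w)) \<oplus>\<^bsub>cyc_module i\<^esub> a = \<zero>\<^bsub>cyc_module i\<^esub>"
        unfolding w(2) cyc_module_ops(3)[OF bd_tchains[OF w'] bd_tchains[OF w(1)]]
        by (simp add: cyc_module_ops(2) pair.bd_minus)
      then have "\<ominus>\<^bsub>cyc_module i\<^esub> a = img i (bd act K i (- w))"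
        by (rule M.minus_equality) (use boundary_cyc w w' in \<open>auto simp: cyc_module_ops\<close>)
      then show ?thesis
        using w' unfolding a_inv_def boundaries_img by auto
    qed
    show "a \<otimes>\<^bsub>add_monoid (cyc_module i)\<^esub> b \<in> boundaries F N i"
      if a: "a \<in> boundaries F N i" and b: "b \<in> boundaries F N i" for a b
    proof -
      obtain u where u: "u \<in> tchains (Suc i)" "a = img i (bd act K i u)"
        using a by (auto simp: boundaries_img)
      obtain v where v: "v \<in> tchains (Suc i)" "b = img i (bd act K i v)"
        using b by (auto simp: boundaries_img)
      have "a \<oplus>\<^bsub>cyc_module i\<^esub> b = img i (bd act K i (u + v))"
        using u v by (simp add: cyc_module_ops bd_tchains pair.bd_add)
      then show ?thesis
        using tchains_add[OF u(1) v(1)] by (auto simp: boundaries_img)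
    qed
  qed
qed (rule abelian_group_cyc_module)

lemma cls_eq_iff:
  assumes "u \<in> cyc i" "v \<in> cyc i"
  shows "cls i u = cls i v \<longleftrightarrow> img i (u - v) \<in> boundaries F N i"
proof -
  interpret B: abelian_subgroup "boundaries F N i" "cyc_module i"
    by (rule abelian_subgroup_boundaries)
  have c: "img i u \<in> carrier (cyc_module i)" "img i v \<in> carrier (cyc_module i)"
    using assms by (auto simp: cyc_module_ops)
  have "cls i u = cls i v \<longleftrightarrow> img i u \<in> boundaries F N i +>\<^bsub>cyc_module i\<^esub> img i v"
    using B.a_repr_independence[OF _ c(2) B.a_subgroup] B.a_rcos_self[OF c(1)]
    unfolding cls_def by metis
  also have "\<dots> \<longleftrightarrow> img i (u - v) \<in> boundaries F N i"
  proof
    assume "img i u \<in> boundaries F N i +>\<^bsub>cyc_module i\<^esub> img i v"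
    then obtain w where w: "w \<in> tchains (Suc i)" "img i u = img i (bd act K i w) \<oplus>\<^bsub>cyc_module i\<^esub> img i v"
      by (auto simp: a_r_coset_def' boundaries_img)
    then have "img i u = img i (bd act K i w + v)"
      using cyc_tchains[OF assms(2)] by (simp add: cyc_module_ops bd_tchains)
    then have "img i (u - v) = img i (bd act K i w)"
      using img_diff_eq[of u i "bd act K i w + v"] img_diff_eq[of "u - v" i "bd act K i w"]
        assms w(1) by (simp add: cyc_tchains bd_tchains tchains_add tchains_diff algebra_simps)
    then show "img i (u - v) \<in> boundaries F N i"
      using w(1) by (auto simp: boundaries_img)
  next
    assume "img i (u - v) \<in> boundaries F N i"
    moreover have "img i u = img i (u - v) \<oplus>\<^bsub>cyc_module i\<^esub> img i v"
      using assms by (simp add: cyc_module_ops cyc_tchains tchains_diff)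
    ultimately show "img i u \<in> boundaries F N i +>\<^bsub>cyc_module i\<^esub> img i v"
      by (auto simp: a_r_coset_def')
  qed
  finally show ?thesis .
qed

lemma cls_zero: "cls i 0 = boundaries F N i"
proof -
  interpret B: abelian_subgroup "boundaries F N i" "cyc_module i"
    by (rule abelian_subgroup_boundaries)
  show ?thesis
    unfolding cls_def cyc_module_ops(2)[symmetric] by (rule B.a_coset_add_zero[OF B.a_subset])
qed

lemma act_cyc: "z \<in> cyc i \<Longrightarrow> (\<lambda>p. act r (z p)) \<in> cyc i"
proof -
  assume z: "z \<in> cyc i"
  have "img k (\<lambda>p. act r (bd act K k z p)) = img k 0" if "i = Suc k" for k
    using z that pi_act_zero bd_tchains[of z k]
    by (auto simp: img_eq_iff cyc_def tchains_def)
  then show ?thesis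
    using z act_tchains by (auto simp: cyc_def pair.bd_act)
qed

lemma tor_ops:
  "carrier (tor i) = cls i ` cyc i"
  "\<zero>\<^bsub>tor i\<^esub> = cls i 0"
  "u \<in> cyc i \<Longrightarrow> v \<in> cyc i \<Longrightarrow> cls i u \<oplus>\<^bsub>tor i\<^esub> cls i v = cls i (u + v)"
  "u \<in> cyc i \<Longrightarrow> r \<odot>\<^bsub>tor i\<^esub> cls i u = cls i (\<lambda>p. act r (u p))"
  "gpart (tor i) g = cls i ` (cyc i \<inter> gchains comps K i g)"
proof -
  interpret B: abelian_subgroup "boundaries F N i" "cyc_module i"
    by (rule abelian_subgroup_boundaries)
  show "carrier (tor i) = cls i ` cyc i"
    by (auto simp: quot_def cls_def A_RCOSETS_def' cyc_module_ops)
  show "\<zero>\<^bsub>tor i\<^esub> = cls i 0"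
    by (simp add: quot_def cls_zero)
  show "cls i u \<oplus>\<^bsub>tor i\<^esub> cls i v = cls i (u + v)" if "u \<in> cyc i" "v \<in> cyc i"
    using that B.a_rcos_sum[of "img i u" "img i v"]
    by (simp add: quot_def cls_def cyc_module_ops cyc_tchains)
  show "r \<odot>\<^bsub>tor i\<^esub> cls i u = cls i (\<lambda>p. act r (u p))" if u: "u \<in> cyc i"
  proof -
    have "boundaries F N i +>\<^bsub>cyc_module i\<^esub> (r \<odot>\<^bsub>cyc_module i\<^esub> x) = cls i (\<lambda>p. act r (u p))"
      if x: "x \<in> cls i u" for x
    proof -
      obtain w where w: "w \<in> tchains (Suc i)" "x = img i (bd act K i w) \<oplus>\<^bsub>cyc_module i\<^esub> img i u"
        using x by (auto simp: cls_def a_r_coset_def' boundaries_img)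
      define z where "z = bd act K i w + u"
      have z: "z \<in> cyc i"
        unfolding z_def by (rule add_closed[OF cyc_zero cyc_diff]) (auto intro: boundary_cyc w u)
      have "x = img i z"
        using w u by (simp add: z_def cyc_module_ops bd_tchains cyc_tchains)
      then have "boundaries F N i +>\<^bsub>cyc_module i\<^esub> (r \<odot>\<^bsub>cyc_module i\<^esub> x) = cls i (\<lambda>p. act r (z p))"
        using z by (simp add: cls_def cyc_module_ops cyc_tchains)
      moreover have "(\<lambda>p. act r (z p)) - (\<lambda>p. act r (u p)) = bd act K i (\<lambda>p. act r (w p))"
        by (auto simp: z_def pair.act_add pair.bd_act)
      then have "img i ((\<lambda>p. act r (z p)) - (\<lambda>p. act r (u p))) \<in> boundaries F N i"
        using act_tchains[OF w(1)] by (auto simp: boundaries_img)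
      ultimately show ?thesis
        using cls_eq_iff act_cyc z u by metis
    qed
    moreover have "img i u \<in> cls i u"
      unfolding cls_def using u by (intro B.a_rcos_self) (auto simp: cyc_module_ops)
    ultimately show ?thesis
      by (auto simp: quot_def)
  qed
  have "gpart (cyc_module i) g = img i ` (cyc i \<inter> gchains comps K i g)"
    using gchains_tchains[of _ i g] img_in_cycles[of _ i]
    by (auto simp: submod_def gpart_tensor cycles_img)
  then show "gpart (tor i) g = cls i ` (cyc i \<inter> gchains comps K i g)"
    by (auto simp: quot_def cls_def)
qed

text \<open>The link between the modules Tor and the chains of polynomials on which all arguments are carried
  out.\<close>

theorem tor_vanishes_iff: "gpart (tor i) g = {\<zero>\<^bsub>tor i\<^esub>} \<longleftrightarrow> homology_zero act comps kers K i g"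
proof -
  have cyc: "(\<forall>k. i = Suc k \<longrightarrow> bd act K k z \<in> gchains kers K k g) \<longleftrightarrow> z \<in> cyc i"
    if "z \<in> gchains comps K i g" for z
  proof (cases i)
    case 0
    then show ?thesis
      using gchains_tchains[OF that] by (simp add: cyc_def)
  next
    case (Suc k)
    then have "bd act K k z \<in> gchains comps K k g"
      using pair.bd_C[OF F] that by simp
    from img_kers[OF this] show ?thesis
      using gchains_tchains[OF that] by (simp add: cyc_def Suc)
  qed
  have "gpart (tor i) g = {\<zero>\<^bsub>tor i\<^esub>} \<longleftrightarrow> (\<forall>z\<in>cyc i \<inter> gchains comps K i g. cls i z = cls i 0)"
  proof -
    have "0 \<in> cyc i \<inter> gchains comps K i g"
      by (auto intro: gchains_zero)
    then show ?thesis
      unfolding tor_ops(2,5) by blast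
  qed
  also have "\<dots> \<longleftrightarrow> (\<forall>z\<in>cyc i \<inter> gchains comps K i g. img i z \<in> boundaries F N i)"
    using cls_eq_iff[of _ i 0] by simp
  also have "\<dots> \<longleftrightarrow> homology_zero act comps kers K i g"
    unfolding homology_zero_def using cyc boundary_homogeneous by blast
  finally show ?thesis .
qed

text \<open>Multiplication by \<open>r\<close> sends a class of degree \<open>g\<close> into a component that is zero.\<close>

lemma homology_zero_along_injective:
  assumes r: "r \<in> homog dg h"
    and inj: "\<And>t. t \<in> gpart (tor i) g \<Longrightarrow> r \<odot>\<^bsub>tor i\<^esub> t = \<zero>\<^bsub>tor i\<^esub> \<Longrightarrow> t = \<zero>\<^bsub>tor i\<^esub>"
    and van: "homology_zero act comps kers K i (h + g)"
  shows "homology_zero act comps kers K i g"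
proof -
  have "t = \<zero>\<^bsub>tor i\<^esub>" if t: "t \<in> gpart (tor i) g" for t
  proof -
    obtain z where z: "z \<in> cyc i" "z \<in> gchains comps K i g" "t = cls i z"
      using t unfolding tor_ops(5) by blast
    have "(\<lambda>p. act r (z p)) \<in> gchains comps K i (h + g)"
      using pair.act_gchains[OF r, of z K i "h + g"] z(2) by simp
    then have "r \<odot>\<^bsub>tor i\<^esub> t \<in> gpart (tor i) (h + g)"
      using z act_cyc unfolding z(3) tor_ops(4)[OF z(1)] tor_ops(5) by blast
    then have "r \<odot>\<^bsub>tor i\<^esub> t = \<zero>\<^bsub>tor i\<^esub>"
      using van tor_vanishes_iff by blast
    then show ?thesis
      by (rule inj[OF t])
  qed
  moreover have "\<zero>\<^bsub>tor i\<^esub> \<in> gpart (tor i) g"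
    unfolding tor_ops(2,5) by (intro imageI IntI cyc_zero gchains_zero) simp
  ultimately show ?thesis
    unfolding tor_vanishes_iff[symmetric] by blast
qed

text \<open>Needed to evaluate the finite sums in the carrier of a strand of this submodule.\<close>

lemma abelian_group_annihilated: "abelian_group (annihilated (tor i) r)"
proof (rule abelian_group_image[of "{z \<in> cyc i. cls i (\<lambda>p. act r (z p)) = cls i 0}" _ "cls i"])
  let ?T = "{z \<in> cyc i. cls i (\<lambda>p. act r (z p)) = cls i 0}"
  show "0 \<in> ?T"
    using cyc_zero[of i] by (simp add: pair.act_zero zero_fun_def)
  show "u - v \<in> ?T" if u: "u \<in> ?T" and v: "v \<in> ?T" for u v
  proof -
    have "cls i (\<lambda>p. act r (u p)) = cls i (\<lambda>p. act r (v p))"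
      using u v by simp
    then have "img i ((\<lambda>p. act r (u p)) - (\<lambda>p. act r (v p))) \<in> boundaries F N i"
      using cls_eq_iff act_cyc u v by blast
    moreover have "(\<lambda>p. act r (u p)) - (\<lambda>p. act r (v p)) = (\<lambda>p. act r ((u - v) p))"
      by (auto simp: pair.act_diff)
    moreover have c: "u - v \<in> cyc i"
      using u v cyc_diff by blast
    ultimately have "cls i (\<lambda>p. act r ((u - v) p)) = cls i 0"
      using cls_eq_iff[OF act_cyc[OF c] cyc_zero] by (metis diff_zero)
    with c show ?thesis
      by simp
  qed
  show "carrier (annihilated (tor i) r) = cls i ` ?T"
  proof -
    have "{t \<in> cls i ` cyc i. r \<odot>\<^bsub>tor i\<^esub> t = cls i 0} = cls i ` {z \<in> cyc i. r \<odot>\<^bsub>tor i\<^esub> cls i z = cls i 0}"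
      by blast
    also have "{z \<in> cyc i. r \<odot>\<^bsub>tor i\<^esub> cls i z = cls i 0} = ?T"
      by (rule Collect_cong) (metis tor_ops(4))
    finally show ?thesis
      unfolding annihilated_simps tor_ops(1,2) .
  qed
  show "\<zero>\<^bsub>annihilated (tor i) r\<^esub> = cls i 0"
    unfolding annihilated_simps by (rule tor_ops(2))
  show "cls i u \<oplus>\<^bsub>annihilated (tor i) r\<^esub> cls i v = cls i (u + v)" if "u \<in> ?T" "v \<in> ?T" for u v
    using that unfolding annihilated_simps by (intro tor_ops(3)) blast+
qed

end

section \<open>Resolutions of presented modules\<close>

text \<open>Applying the composite of the differentials to a unit vector gives the matrix identity, which then
  holds for arbitrary coefficients.\<close>

lemma (in resolves) mat_mat:
  assumes p: "p \<in> basis P i" and q: "q \<in> basis P (Suc (Suc i))"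
  shows "(\<Sum>r\<in>basis P (Suc i). bmat P i p r * bmat P (Suc i) r q) = 0"
proof -
  let ?u = "\<lambda>b. if b = q then 1 else 0"
  have "?u \<in> gchains H P (Suc (Suc i)) (bdeg P (Suc (Suc i)) q)"
    using q H_one by (auto simp: gchains_def)
  then have "bd (*) P i (bd (*) P (Suc i) ?u) p = 0"
    using bd_bd by simp
  moreover have "bd (*) P (Suc i) ?u r = bmat P (Suc i) r q" if "r \<in> basis P (Suc i)" for r
    using that q by (simp add: bd_def if_distrib[of "\<lambda>x. _ * x"] cong: if_cong)
  ultimately show ?thesis
    using p by (simp add: bd_def)
qed

lemma (in grading) poly_module_presented:
  "presented dg (poly_module dg :: (('v, 'k::comm_ring_1) mpoly, _, _) graded_module) UNIV dg (\<lambda>r. r) (\<lambda>x. x)"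
  by unfold_locales (auto simp: poly_module_def hcomp_def intro: homog_mult)

locale presented_poly = presented_complex dg "poly_module dg :: (('v, 'k::comm_ring_1) mpoly, ('v, 'k::comm_ring_1) mpoly, 'g) graded_module"
    UNIV dg "\<lambda>r. r" "\<lambda>x. x" F
  for dg :: "('v \<Rightarrow>\<^sub>0 nat) \<Rightarrow> 'g::ab_group_add" and F :: "(('v, 'k::comm_ring_1) mpoly, 'z, 'g) free_complex"
begin

lemma act_eq: "act = (*)"
  by (simp add: fun_eq_iff act_def)

lemma comps_eq: "comps = homog dg"
  by (auto simp: fun_eq_iff comps_def elems_def)

lemma kers_eq: "kers = (\<lambda>_. {0})"
  by (auto simp: fun_eq_iff kers_def comps_eq)

text \<open>For the polynomial ring itself the presentation is the identity, so that nothing is lost by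
  passing to the record.\<close>

lemma img_inject:
  assumes "u \<in> tchains i" "v \<in> tchains i"
  shows "img i u = img i v \<longleftrightarrow> u = v"
proof
  assume *: "img i u = img i v"
  show "u = v"
  proof
    fix p
    show "u p = v p"
      using * assms by (cases "p < length (res_degs F i)") (simp_all add: img_eq_iff tchains_def)
  qed
qed simp

lemma zero_chain: "z \<in> gchains (\<lambda>_. {0}) K i g \<longleftrightarrow> z = 0"
  by (auto simp: gchains_def fun_eq_iff)

lemma boundary_iff:
  assumes "z \<in> gchains (homog dg) K i g"
  shows "img i z \<in> boundaries F (poly_module dg) i \<longleftrightarrow> (\<exists>w\<in>gchains (homog dg) K (Suc i) g. z = bd (*) K i w)"
  using boundary_homogeneous[of z i g] assms by (simp add: comps_eq kers_eq act_eq zero_chain)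

end

context presented
begin

lemma aug_img:
  fixes F :: "(('v, 'k) mpoly, 'b, 'g) free_complex"
  assumes P: "presented_poly dg F" and v: "v \<in> presented_complex.tchains UNIV F 0"
    and c: "\<And>q. q < length (res_degs F 0) \<Longrightarrow> c q \<in> elems \<and> \<pi> (c q) = res_aug F q"
  shows "aug_map F N (presented_complex.img (\<lambda>x. x) F 0 v) = \<pi> (aug act c (complex_of F) v)"
proof -
  interpret P: presented_poly dg F by (rule P)
  have sm: "v q \<odot>\<^bsub>N\<^esub> res_aug F q = \<pi> (act (v q) (c q))" if "q < length (res_degs F 0)" for q
    using c[OF that] smult_N[of "c q" "v q"] by (simp add: elems_def act_def)
  have el: "act (v q) (c q) \<in> elems" if "q < length (res_degs F 0)" for q
    using c[OF that] elems_act by blast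
  have "aug_map F N (P.img 0 v) = (\<Oplus>\<^bsub>N\<^esub>q\<in>{..<length (res_degs F 0)}. \<pi> (act (v q) (c q)))"
    unfolding aug_map_def
    by (rule abelian_monoid.finsum_cong'[OF abelian_group.axioms(1)[OF abelian_group_N]])
      (use sm el in \<open>auto simp: P.img_def carrier_N elems_def\<close>)
  also have "\<dots> = \<pi> (\<Sum>q<length (res_degs F 0). act (v q) (c q))"
    by (rule finsum_pi) (use el in auto)
  finally show ?thesis
    by (simp add: aug_def)
qed

lemma hcomp_aug:
  fixes F :: "(('v, 'k) mpoly, 'b, 'g) free_complex"
  assumes P: "presented_poly dg F" and v: "v \<in> presented_complex.tchains UNIV F 0"
    and c: "\<And>q. q < length (res_degs F 0) \<Longrightarrow> c q \<in> comps (res_degs F 0 ! q)"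
  shows "aug act c (complex_of F) (presented_complex.part dg F 0 g v) = hcomp e g (aug act c (complex_of F) v)"
proof -
  interpret P: presented_poly dg F by (rule P)
  have "act (hcomp dg (g - res_degs F 0 ! q) (v q)) (c q) = hcomp e g (act (v q) (c q))"
    if "q < length (res_degs F 0)" for q
    by (rule hcomp_act_coefficient[OF c[OF that], symmetric])
  then show ?thesis
    by (simp add: aug_def hcomp_sum P.part_def cong: sum.cong_simp)
qed

lemma aug_elems:
  assumes "\<And>q. q < length (res_degs F 0) \<Longrightarrow> c q \<in> elems"
  shows "aug act c (complex_of F) v \<in> elems"
  using assms by (auto simp: aug_def intro!: elems_sum elems_act)

text \<open>Exactness of the ungraded maps restricts to each degree, since all maps preserve degrees.\<close>

theorem resolves_if_free_resolution:
  fixes F :: "(('v, 'k) mpoly, 'b, 'g) free_complex"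
  assumes res: "free_resolution dg N F"
  shows "\<exists>c. resolves (homog dg) (complex_of F) act comps kers c"
proof -
  interpret graded_ring "homog dg :: 'g \<Rightarrow> ('v, 'k) mpoly set"
    by (rule graded_ring_homog)
  interpret graded_pair "homog dg" act comps kers
    by (rule graded_pair)
  interpret C: graded_complex "homog dg" "complex_of F"
    by unfold_locales (use res in \<open>auto simp: free_resolution_def\<close>)
  have F: "graded_complex (homog dg) (complex_of F)"
    by unfold_locales
  interpret P0: presented dg "poly_module dg :: (('v, 'k) mpoly, _, _) graded_module" UNIV dg "\<lambda>r. r" "\<lambda>x. x"
    by (rule poly_module_presented)
  interpret P: presented_poly dg F
    by unfold_locales
  have P: "presented_poly dg F"
    by unfold_locales
  have "\<exists>x\<in>comps (res_degs F 0 ! q). \<pi> x = res_aug F q" if "q < length (res_degs F 0)" for q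
    using res that unfolding free_resolution_def gpart_N comps_def elems_def by (auto simp: image_iff) metis
  then obtain c where c: "\<And>q. q < length (res_degs F 0) \<Longrightarrow> c q \<in> comps (res_degs F 0 ! q) \<and> \<pi> (c q) = res_aug F q"
    by metis
  have aug_img: "aug_map F N (P.img 0 v) = \<pi> (aug act c P.K v)" if "v \<in> P.tchains 0" for v
    by (rule aug_img[OF P that]) (use c comps_elems in blast)
  have aug_el: "aug act c P.K v \<in> elems" for v
    by (rule aug_elems) (use c comps_elems in blast)
  have carrier0: "carrier (free_tensor (res_degs F 0) (poly_module dg)) = P.img 0 ` P.tchains 0"
    by (rule P.carrier_tensor)
  have cyc_bd: "cycles F (poly_module dg) (Suc i) = boundaries F (poly_module dg) (Suc i)" for i
    using res by (simp add: free_resolution_def)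
  have tch: "v \<in> gchains (homog dg) P.K i g \<Longrightarrow> v \<in> P.tchains i" for v i g
    using P.gchains_tchains[of v i g] by (simp add: P.comps_eq)
  have "resolves (homog dg) P.K act comps kers c"
  proof (unfold_locales, goal_cases)
    case (1 v i g)
    then have v: "v \<in> P.tchains (Suc (Suc i))"
      by (rule tch)
    then have "P.img (Suc i) (bd (*) P.K (Suc i) v) \<in> cycles F (poly_module dg) (Suc i)"
      unfolding cyc_bd P.boundaries_img P.act_eq by blast
    then have "bd (*) P.K (Suc i) v \<in> P.cyc (Suc i)"
      using P.img_in_cycles P.bd_tchains[OF v] by (simp add: P.act_eq)
    then have "P.img i (bd (*) P.K i (bd (*) P.K (Suc i) v)) = P.img i 0"
      by (simp add: P.cyc_def P.act_eq)
    then show ?case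
      using P.img_inject[of "bd (*) P.K i (bd (*) P.K (Suc i) v)" i 0]
        P.bd_tchains[OF P.bd_tchains[OF v]] by (simp add: P.act_eq)
  next
    case (2 v i g)
    then have "v \<in> P.cyc (Suc i)"
      using tch by (simp add: P.cyc_def P.act_eq)
    then have "P.img (Suc i) v \<in> boundaries F (poly_module dg) (Suc i)"
      using P.img_in_cycles[of v "Suc i"] tch[OF 2(1)] by (simp add: cyc_bd)
    then show ?case
      using P.boundary_iff[OF 2(1)] by blast
  next
    case (3 p)
    then show ?case
      using c by simp
  next
    case (4 x g)
    have "\<pi> x \<in> carrier N"
      using 4 by (auto simp: carrier_N comps_def elems_def)
    then have "\<pi> x \<in> aug_map F N ` P.img 0 ` P.tchains 0"
      using res unfolding free_resolution_def carrier0 by blast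
    then obtain v where v: "v \<in> P.tchains 0" "\<pi> x = \<pi> (aug act c P.K v)"
      using aug_img by auto
    have x: "x \<in> elems"
      using 4 comps_elems by blast
    have "\<pi> (x - aug act c P.K v) = \<pi> 0"
      using v(2) pi_eq_iff[OF x aug_el] by blast
    then have "hcomp e g (x - aug act c P.K v) \<in> kers g"
      using ker_homog elems_diff[OF x aug_el, of v] hcomp_comps by (auto simp: kers_def elems_def)
    moreover have "hcomp e g (x - aug act c P.K v) = x - aug act c P.K (P.part 0 g v)"
      using hcomp_aug[OF P v(1)] c hcomp_comps_eq[OF 4] by (simp add: hcomp_diff)
    ultimately show ?case
      using P.part_gchains[OF v(1)] by (auto simp: P.comps_eq)
  next
    case (5 v g)
    have v: "v \<in> P.tchains 0"
      using 5 by (rule tch)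
    have "aug act c P.K v = hcomp e g (aug act c P.K v)"
      using hcomp_aug[OF P v, of c g] c P.part_id[of v 0 g] 5 by (simp add: P.comps_eq)
    then have "aug act c P.K v \<in> comps g"
      using hcomp_comps[OF aug_el] by metis
    then have "aug act c P.K v \<in> kers g \<longleftrightarrow> aug_map F N (P.img 0 v) = \<zero>\<^bsub>N\<^esub>"
      by (simp add: kers_def aug_img[OF v] zero_N)
    also have "\<dots> \<longleftrightarrow> P.img 0 v \<in> boundaries F (poly_module dg) 0"
      using res v unfolding free_resolution_def carrier0 by blast
    finally show ?case
      using P.boundary_iff[OF 5] by simp
  qed
  then show ?thesis
    by blast
qed

text \<open>Conversely a chain is the sum of its finitely many homogeneous parts, and exactness in each degree
  is summed up.\<close>

theorem free_resolution_if_resolves: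
  fixes D A c
  defines "F \<equiv> \<lparr> res_degs = D, res_mat = A, res_aug = \<lambda>q. \<pi> (c q) \<rparr>"
  assumes R: "resolves (homog dg) (list_complex D A) act comps kers c"
  shows "free_resolution dg N F"
proof -
  have F_sel [simp]: "res_degs F = D" "res_mat F = A" "res_aug F = (\<lambda>q. \<pi> (c q))"
    by (simp_all add: F_def)
  interpret R: resolves "homog dg" "complex_of F" act comps kers c
    using R by simp
  interpret P0: presented dg "poly_module dg :: (('v, 'k) mpoly, _, _) graded_module" UNIV dg "\<lambda>r. r" "\<lambda>x. x"
    by (rule poly_module_presented)
  interpret P: presented_poly dg F
    by unfold_locales
  have P: "presented_poly dg F"
    by unfold_locales
  interpret RP: graded_pair "homog dg" "(*)" "homog dg" "\<lambda>_. {0} :: ('v, 'k) mpoly set"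
    by (rule R.ring_pair)
  have c: "c q \<in> comps (D 0 ! q)" if "q < length (D 0)" for q
    using R.gens[of q] that by simp
  have aug_img: "aug_map F N (P.img 0 v) = \<pi> (aug act c P.K v)" if "v \<in> P.tchains 0" for v
    by (rule aug_img[OF P that]) (use c comps_elems in auto)
  have aug_el: "aug act c P.K v \<in> elems" for v
    by (rule aug_elems) (use c comps_elems in auto)
  have carrier0: "carrier (free_tensor (D i) (poly_module dg)) = P.img i ` P.tchains i" for i
    using P.carrier_tensor by simp
  have tch: "v \<in> gchains (homog dg) P.K i g \<Longrightarrow> v \<in> P.tchains i" for v i g
    using P.gchains_tchains[of v i g] by (simp add: P.comps_eq)
  have part: "P.part i g v \<in> gchains (homog dg) P.K i g" if "v \<in> P.tchains i" for v i g
    using P.part_gchains[OF that] by (simp add: P.comps_eq)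
  have bd_sum: "bd (*) P.K i (sum f G) = (\<Sum>g\<in>G. bd (*) P.K i (f g))" for i G and f :: "'g \<Rightarrow> nat \<Rightarrow> ('v, 'k) mpoly"
    by (induction G rule: infinite_finite_induct) (simp_all only: sum.infinite sum.empty sum.insert RP.bd_0 RP.bd_add not_False_eq_True)
  have tch_sum: "sum f G \<in> P.tchains i" if "\<And>g. g \<in> G \<Longrightarrow> f g \<in> P.tchains i" for i G and f :: "'g \<Rightarrow> _"
    by (rule sum_closed) (use that P.tchains_diff in auto)
  have aug_sum: "aug act c P.K (sum f G) = (\<Sum>g\<in>G. aug act c P.K (f g))" for G and f :: "'g \<Rightarrow> nat \<Rightarrow> ('v, 'k) mpoly"
    unfolding aug_def sum_apply_fun R.sum_act by (rule sum.swap)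
  have kerT: "sum f G \<in> {x \<in> elems. \<pi> x = \<pi> 0}" if "\<And>g. g \<in> G \<Longrightarrow> f g \<in> kers g" for G f
  proof (rule sum_closed)
    show "x - y \<in> {x \<in> elems. \<pi> x = \<pi> 0}" if "x \<in> {x \<in> elems. \<pi> x = \<pi> 0}" "y \<in> {x \<in> elems. \<pi> x = \<pi> 0}" for x y
      using that pi_eq_iff[of x y] elems_diff by auto
  qed (use that comps_elems in \<open>auto simp: kers_def\<close>)
  have surj: "\<exists>v\<in>P.tchains 0. \<pi> x = \<pi> (aug act c P.K v)" if x: "x \<in> elems" for x
  proof -
    have "\<forall>g. \<exists>v\<in>gchains (homog dg) P.K 0 g. hcomp e g x - aug act c P.K v \<in> kers g"
      using R.aug_surj hcomp_comps[OF x] by simp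
    then obtain v where v: "\<And>g. v g \<in> gchains (homog dg) P.K 0 g" "\<And>g. hcomp e g x - aug act c P.K (v g) \<in> kers g"
      by metis
    have "x - aug act c P.K (\<Sum>g\<in>e ` keys x. v g) = (\<Sum>g\<in>e ` keys x. hcomp e g x - aug act c P.K (v g))"
      by (subst (1) sum_hcomp[of x e]) (simp only: aug_sum sum_subtractf)
    also have "\<dots> \<in> {x \<in> elems. \<pi> x = \<pi> 0}"
      by (rule kerT) (rule v)
    finally have "\<pi> x = \<pi> (aug act c P.K (\<Sum>g\<in>e ` keys x. v g))"
      using pi_eq_iff[OF x aug_el] by blast
    moreover have "(\<Sum>g\<in>e ` keys x. v g) \<in> P.tchains 0"
      by (rule tch_sum) (rule tch, rule v)
    ultimately show ?thesis
      by blast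
  qed
  have kernel: "\<pi> (aug act c P.K v) = \<pi> 0 \<longleftrightarrow> (\<exists>w\<in>P.tchains 1. v = bd (*) P.K 0 w)" if v: "v \<in> P.tchains 0" for v
  proof
    assume ker: "\<pi> (aug act c P.K v) = \<pi> 0"
    obtain G where G: "v = (\<Sum>g\<in>G. P.part 0 g v)"
      by (rule P.sum_parts[OF v]) blast
    have "aug act c P.K (P.part 0 g v) \<in> kers g" for g
      using hcomp_aug[OF P v, of c g] c hcomp_comps[OF aug_el] ker_homog[of "aug act c P.K v" g] aug_el[of v] ker
      by (simp add: kers_def elems_def)
    then have "\<forall>g. \<exists>w\<in>gchains (homog dg) P.K 1 g. P.part 0 g v = bd (*) P.K 0 w"
      using R.aug_ker part[OF v] by blast
    then obtain w where w: "\<And>g. w g \<in> gchains (homog dg) P.K 1 g" "\<And>g. P.part 0 g v = bd (*) P.K 0 (w g)"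
      by metis
    have "v = bd (*) P.K 0 (\<Sum>g\<in>G. w g)"
      by (subst G) (simp only: w(2) bd_sum)
    then show "\<exists>w\<in>P.tchains 1. v = bd (*) P.K 0 w"
      using tch_sum tch w(1) by blast
  next
    assume "\<exists>w\<in>P.tchains 1. v = bd (*) P.K 0 w"
    then obtain w where w: "w \<in> P.tchains 1" "v = bd (*) P.K 0 w"
      by blast
    obtain G where G: "w = (\<Sum>g\<in>G. P.part 1 g w)"
      by (rule P.sum_parts[OF w(1)]) blast
    have "aug act c P.K (bd (*) P.K 0 (P.part 1 g w)) \<in> kers g" for g
      using R.aug_ker[of "bd (*) P.K 0 (P.part 1 g w)" g] RP.bd_C[OF P.F, of "P.part 1 g w" 0 g] part[OF w(1), of g]
      by auto
    moreover have "aug act c P.K v = (\<Sum>g\<in>G. aug act c P.K (bd (*) P.K 0 (P.part 1 g w)))"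
      unfolding w(2) by (subst G) (simp only: bd_sum aug_sum)
    ultimately show "\<pi> (aug act c P.K v) = \<pi> 0"
      using kerT by auto
  qed
  have exact: "bd (*) P.K i v = 0 \<longleftrightarrow> (\<exists>w\<in>P.tchains (Suc (Suc i)). v = bd (*) P.K (Suc i) w)"
    if v: "v \<in> P.tchains (Suc i)" for v i
  proof
    assume z: "bd (*) P.K i v = 0"
    obtain G where G: "v = (\<Sum>g\<in>G. P.part (Suc i) g v)"
      by (rule P.sum_parts[OF v]) blast
    have "bd (*) P.K i (P.part (Suc i) g v) = 0" for g
      using P.bd_part[OF v, of g] z by (simp add: P.act_eq)
    then have "\<forall>g. \<exists>w\<in>gchains (homog dg) P.K (Suc (Suc i)) g. P.part (Suc i) g v = bd (*) P.K (Suc i) w"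
      using R.exact part[OF v] by blast
    then obtain w where w: "\<And>g. w g \<in> gchains (homog dg) P.K (Suc (Suc i)) g"
      "\<And>g. P.part (Suc i) g v = bd (*) P.K (Suc i) (w g)"
      by metis
    have "v = bd (*) P.K (Suc i) (\<Sum>g\<in>G. w g)"
      by (subst G) (simp only: w(2) bd_sum)
    then show "\<exists>w\<in>P.tchains (Suc (Suc i)). v = bd (*) P.K (Suc i) w"
      using tch_sum tch w(1) by blast
  next
    assume "\<exists>w\<in>P.tchains (Suc (Suc i)). v = bd (*) P.K (Suc i) w"
    then obtain w where w: "w \<in> P.tchains (Suc (Suc i))" "v = bd (*) P.K (Suc i) w"
      by blast
    obtain G where G: "w = (\<Sum>g\<in>G. P.part (Suc (Suc i)) g w)"
      by (rule P.sum_parts[OF w(1)]) blast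
    have "bd (*) P.K i v = (\<Sum>g\<in>G. bd (*) P.K i (bd (*) P.K (Suc i) (P.part (Suc (Suc i)) g w)))"
      unfolding w(2) by (subst G) (simp only: bd_sum)
    also have "\<dots> = 0"
      by (rule sum.neutral) (use R.bd_bd part[OF w(1)] in blast)
    finally show "bd (*) P.K i v = 0" .
  qed
  show ?thesis
    unfolding free_resolution_def
  proof (intro conjI allI impI)
    fix i p q
    assume "p < length (res_degs F i)" "q < length (res_degs F (Suc i))"
    then show "res_mat F i p q \<in> homog dg (res_degs F (Suc i) ! q - res_degs F i ! p)"
      using R.mat_homog[of p i q] by simp
  next
    fix q assume "q < length (res_degs F 0)"
    then show "res_aug F q \<in> gpart N (res_degs F 0 ! q)"
      using c by (auto simp: gpart_N comps_def elems_def)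
  next
    have "aug_map F N ` P.img 0 ` P.tchains 0 = (\<lambda>v. \<pi> (aug act c P.K v)) ` P.tchains 0"
      using aug_img by (auto simp: image_image)
    also have "\<dots> = \<pi> ` elems"
      using aug_el surj by (auto simp: image_iff)
    finally show "aug_map F N ` carrier (free_tensor (res_degs F 0) (poly_module dg)) = carrier N"
      using carrier0[of 0] by (simp add: carrier_N elems_def)
  next
    have "aug_map F N (P.img 0 v) = \<zero>\<^bsub>N\<^esub> \<longleftrightarrow> \<pi> (aug act c P.K v) = \<pi> 0"
      if "v \<in> P.tchains 0" for v
      using aug_img[OF that] by (simp add: zero_N)
    then have "{z \<in> P.img 0 ` P.tchains 0. aug_map F N z = \<zero>\<^bsub>N\<^esub>} =
        P.img 0 ` {v \<in> P.tchains 0. \<pi> (aug act c P.K v) = \<pi> 0}"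
      by blast
    also have "{v \<in> P.tchains 0. \<pi> (aug act c P.K v) = \<pi> 0} = bd (*) P.K 0 ` P.tchains 1"
      using kernel P.bd_tchains[of _ 0] unfolding P.act_eq One_nat_def by blast
    finally show "{z \<in> carrier (free_tensor (res_degs F 0) (poly_module dg)). aug_map F N z = \<zero>\<^bsub>N\<^esub>} =
        boundaries F (poly_module dg) 0"
      using carrier0[of 0] P.boundaries_img[of 0] by (simp add: P.act_eq)
  next
    fix i
    have "P.cyc (Suc i) = {v \<in> P.tchains (Suc i). bd (*) P.K i v = 0}"
      using P.img_inject[of "bd (*) P.K i _" i 0] P.bd_tchains[of _ i]
      by (auto simp: P.cyc_def P.act_eq)
    also have "\<dots> = bd (*) P.K (Suc i) ` P.tchains (Suc (Suc i))"
      using exact P.bd_tchains[of _ "Suc i"] unfolding P.act_eq by blast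
    finally show "cycles F (poly_module dg) (Suc i) = boundaries F (poly_module dg) (Suc i)"
      unfolding P.cycles_img P.boundaries_img P.act_eq by simp
  qed
qed

end

section \<open>Substitution homomorphisms\<close>

definition mono_value :: "('v \<Rightarrow> 'b::comm_semiring_1) \<Rightarrow> ('v \<Rightarrow>\<^sub>0 nat) \<Rightarrow> 'b"
  where "mono_value s m = (\<Prod>v\<in>keys m. s v ^ lookup m v)"

lemma mono_value_superset:
  "finite A \<Longrightarrow> keys m \<subseteq> A \<Longrightarrow> mono_value s m = (\<Prod>v\<in>A. s v ^ lookup m v)"
  unfolding mono_value_def by (rule prod.mono_neutral_left) (auto simp: in_keys_iff)

lemma mono_value_add: "mono_value s (m + m') = mono_value s m * mono_value s m'"
proof -
  have "keys (m + m') \<subseteq> keys m \<union> keys m'"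
    by (rule Poly_Mapping.keys_add)
  then show ?thesis
    by (simp add: mono_value_superset[of "keys m \<union> keys m'"] lookup_add power_add prod.distrib)
qed

lemma mono_value_0 [simp]: "mono_value s 0 = 1"
  by (simp add: mono_value_def)

lemma mono_value_expo: "mono_value s (expo v) = s v"
  by (simp add: mono_value_def expo_def)

locale substitution =
  fixes c :: "'k::comm_ring_1 \<Rightarrow> 'b::comm_ring_1" and s :: "'v \<Rightarrow> 'b"
  assumes c_0: "c 0 = 0" and c_1: "c 1 = 1" and c_add: "c (a + b) = c a + c b" and c_mult: "c (a * b) = c a * c b"
begin

abbreviation "sub \<equiv> substitute c s"

lemma sub_superset:
  "finite A \<Longrightarrow> keys h \<subseteq> A \<Longrightarrow> sub h = (\<Sum>m\<in>A. c (lookup h m) * mono_value s m)"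
  unfolding substitute_def mono_value_def
  by (rule sum.mono_neutral_left) (auto simp: in_keys_iff c_0)

lemma sub_add: "sub (f + g) = sub f + sub g"
proof -
  have "keys (f + g) \<subseteq> keys f \<union> keys g"
    by (rule Poly_Mapping.keys_add)
  then show ?thesis
    by (simp add: sub_superset[of "keys f \<union> keys g"] lookup_add c_add distrib_right sum.distrib)
qed

lemma sub_0 [simp]: "sub 0 = 0"
  by (simp add: substitute_def)

lemma sub_single: "sub (Poly_Mapping.single m a) = c a * mono_value s m"
  by (simp add: sub_superset[of "{m}"])

lemma sub_sum: "sub (sum f A) = (\<Sum>a\<in>A. sub (f a))"
  by (induction A rule: infinite_finite_induct) (auto simp: sub_add)

lemma sub_uminus: "sub (- f) = - sub f"
  using sub_add[of f "- f"] by (simp add: eq_neg_iff_add_eq_0 add.commute)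

lemma sub_diff: "sub (f - g) = sub f - sub g"
  using sub_add[of f "- g"] by (simp add: sub_uminus)

lemma sub_mult: "sub (f * g) = sub f * sub g"
proof -
  have "sub (f * g) = sub ((\<Sum>m\<in>keys f. Poly_Mapping.single m (lookup f m)) *
      (\<Sum>m\<in>keys g. Poly_Mapping.single m (lookup g m)))"
    by (simp flip: poly_mapping_monomials)
  also have "\<dots> = (\<Sum>m\<in>keys f. \<Sum>m'\<in>keys g. sub (Poly_Mapping.single m (lookup f m)) * sub (Poly_Mapping.single m' (lookup g m')))"
    by (simp add: sum_product sub_sum mult_single sub_single mono_value_add c_mult algebra_simps)
  also have "\<dots> = sub (\<Sum>m\<in>keys f. Poly_Mapping.single m (lookup f m)) * sub (\<Sum>m\<in>keys g. Poly_Mapping.single m (lookup g m))"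
    by (simp add: sum_product sub_sum)
  finally show ?thesis
    by (simp flip: poly_mapping_monomials)
qed

lemma sub_1 [simp]: "sub 1 = 1"
  using sub_single[of 0 1] by (simp add: c_1)

lemma sub_Var [simp]: "sub (Var v) = s v"
  by (simp add: Var_expo sub_single c_1 mono_value_expo)

lemma sub_Const [simp]: "sub (Const a) = c a"
  by (simp add: Const_def sub_single)

lemma sub_power: "sub (f ^ n) = sub f ^ n"
  by (induction n) (auto simp: sub_mult)

end

lemma Const_hom:
  "Const 0 = (0 :: ('v, 'k::comm_ring_1) mpoly)" "Const 1 = (1 :: ('v, 'k) mpoly)"
  "Const (a + b) = (Const a + Const b :: ('v, 'k) mpoly)" "Const (a * b) = (Const a * Const b :: ('v, 'k) mpoly)"
  by (simp_all add: Const_def single_add mult_single)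

lemma substitution_Const: "substitution Const"
  by unfold_locales (simp_all add: Const_hom)

section \<open>The gradings of the two polynomial rings\<close>

abbreviation xdeg :: "('n::finite + 'm::finite \<Rightarrow>\<^sub>0 nat) \<Rightarrow> int" where "xdeg m \<equiv> fst (bideg m)"
abbreviation ydeg :: "('n::finite + 'm::finite \<Rightarrow>\<^sub>0 nat) \<Rightarrow> int" where "ydeg m \<equiv> snd (bideg m)"

lemma tdeg_grading: "grading tdeg"
  by unfold_locales (auto simp: tdeg_def lookup_add sum.distrib)

lemma bideg_grading: "grading bideg"
  by unfold_locales (auto simp: bideg_def lookup_add sum.distrib zero_prod_def)

lemma tdeg_expo: "tdeg (expo i) = 1"
  by (simp add: tdeg_def lookup_expo)

lemma bideg_expo: "bideg (expo (Inl i)) = (1, 0)" "bideg (expo (Inr j)) = (0, 1)"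
  by (simp_all add: bideg_def lookup_expo)

lemma bideg_nonneg: "0 \<le> xdeg m" "0 \<le> ydeg m"
  by (simp_all add: bideg_def sum_nonneg)

definition lift_expo :: "('n \<Rightarrow>\<^sub>0 nat) \<Rightarrow> 'n + 'm \<Rightarrow>\<^sub>0 nat"
  where "lift_expo m = (\<Sum>i\<in>keys m. Poly_Mapping.single (Inl i) (lookup m i))"

lemma lookup_lift_expo: "lookup (lift_expo m) v = (case v of Inl i \<Rightarrow> lookup m i | Inr j \<Rightarrow> 0)"
proof (cases v)
  case (Inl i)
  have "lookup (lift_expo m) v = (\<Sum>k\<in>keys m. if k = i then lookup m k else 0)"
    unfolding lift_expo_def lookup_sum by (rule sum.cong) (auto simp: lookup_single when_def Inl)
  also have "\<dots> = lookup m i"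
    by (auto simp: in_keys_iff)
  finally show ?thesis
    by (simp add: Inl)
next
  case (Inr j)
  then show ?thesis
    by (auto simp: lift_expo_def lookup_sum lookup_single when_def)
qed

lemma bideg_lift_expo: "bideg (lift_expo m :: 'n::finite + 'm::finite \<Rightarrow>\<^sub>0 nat) = (tdeg m, 0)"
  by (simp add: bideg_def tdeg_def lookup_lift_expo)

interpretation embed: substitution Const "\<lambda>i. Var (Inl i) :: ('n + 'm, 'k::comm_ring_1) mpoly"
  by (rule substitution_Const)

lemma single_power: "Poly_Mapping.single m (1 :: 'k::comm_ring_1) ^ n = Poly_Mapping.single (\<Sum>i<n. m) 1"
  for m :: "'v \<Rightarrow>\<^sub>0 nat"
  by (induction n) (simp_all add: mult_single add.commute)

lemma single_prod:
  "(\<Prod>i\<in>A. Poly_Mapping.single (f i) (1 :: 'k::comm_ring_1)) = Poly_Mapping.single (\<Sum>i\<in>A. f i) 1"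
  for f :: "'i \<Rightarrow> 'v \<Rightarrow>\<^sub>0 nat"
  by (induction A rule: infinite_finite_induct) (simp_all add: mult_single)

lemma mono_value_Var: "mono_value (\<lambda>i. Var (h i)) m =
    (Poly_Mapping.single (\<Sum>i\<in>keys m. Poly_Mapping.single (h i) (lookup m i)) 1 :: ('v, 'k::comm_ring_1) mpoly)"
proof -
  have "(\<Sum>i<n. expo v) = Poly_Mapping.single v n" for v :: 'v and n
    by (rule poly_mapping_eqI) (simp add: lookup_sum lookup_expo lookup_single when_def)
  then show ?thesis
    unfolding mono_value_def Var_expo single_power single_prod by simp
qed

lemma embed_x_single: "embed_x (Poly_Mapping.single m a) = Poly_Mapping.single (lift_expo m) a"
  unfolding embed_x_def embed.sub_single mono_value_Var by (simp add: Const_def mult_single lift_expo_def)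

lemma embed_x_keys:
  fixes m :: "'n + 'm \<Rightarrow>\<^sub>0 nat" and r :: "('n, 'k::comm_ring_1) mpoly"
  assumes m: "m \<in> keys (embed_x r)"
  shows "\<exists>m'\<in>keys r. m = lift_expo m'"
proof -
  have "(embed_x r :: ('n + 'm, 'k) mpoly) = (\<Sum>m\<in>keys r. Poly_Mapping.single (lift_expo m) (lookup r m))"
    by (subst poly_mapping_monomials[of r]) (simp add: embed_x_def embed.sub_sum embed_x_single[unfolded embed_x_def])
  then have "(\<Sum>m'\<in>keys r. lookup (Poly_Mapping.single (lift_expo m') (lookup r m')) m) \<noteq> 0"
    using m by (simp add: in_keys_iff lookup_sum)
  then show ?thesis
    by (metis (mono_tags, lifting) lookup_single_not_eq sum.neutral)
qed

section \<open>Presentations of the modules involved\<close>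

text \<open>The constant coefficient is the presentation; it is multiplicative because a sum of exponents is
  zero only if both are.\<close>

lemma (in grading) residue_presented:
  "presented dg (residue_module :: (('v, 'k::comm_ring_1) mpoly, 'k, 'g) graded_module) UNIV dg (\<lambda>r. r) (\<lambda>h. lookup h 0)"
proof -
  have mult0: "lookup (r * h) 0 = lookup r 0 * lookup h 0" for r h :: "('v, 'k) mpoly"
  proof -
    have zero: "(\<exists>t. m + t = 0) \<longleftrightarrow> m = 0" for m :: "'v \<Rightarrow>\<^sub>0 nat"
    proof
      assume "\<exists>t. m + t = 0"
      then obtain t where "m + t = 0" by blast
      then have "lookup m v + lookup t v = 0" for v
        by (metis lookup_add lookup_zero)
      then show "m = 0"
        by (intro poly_mapping_eqI) simp
    qed auto
    have "r * h = (\<Sum>m\<in>keys r. Poly_Mapping.single m (lookup r m) * h)"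
      by (subst (1) poly_mapping_monomials[of r]) (rule sum_distrib_right)
    then have "lookup (r * h) 0 = (\<Sum>m\<in>keys r. if m = 0 then lookup r 0 * lookup h 0 else 0)"
      by (auto simp: lookup_sum lookup_monomial_mult zero eq_commute[of 0] intro!: sum.cong)
    then show ?thesis
      by (simp add: in_keys_iff)
  qed
  show ?thesis
  proof (unfold_locales, goal_cases)
    case (6)
    have "c \<in> range (\<lambda>h :: ('v, 'k) mpoly. lookup h 0)" for c :: 'k
      by (rule image_eqI[of _ _ "Const c"]) (auto simp: Const_def)
    then show ?case
      by (auto simp: residue_module_def)
  next
    case (7 g)
    show ?case
    proof (cases "g = 0")
      case True
      have "c \<in> (\<lambda>h :: ('v, 'k) mpoly. lookup h 0) ` homog dg 0" for c :: 'k
        by (rule image_eqI[of _ _ "Const c"]) (auto simp: Const_def homog_def dg_zero)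
      then show ?thesis
        using True by (auto simp: residue_module_def)
    next
      case False
      have "lookup h 0 = 0" if "h \<in> homog dg g" for h :: "('v, 'k) mpoly"
        using that False dg_zero by (auto simp: homog_def in_keys_iff)
      moreover have "0 \<in> (\<lambda>h :: ('v, 'k) mpoly. lookup h 0) ` homog dg g"
        by (rule image_eqI[of _ _ 0]) auto
      ultimately show ?thesis
        using False by (auto simp: residue_module_def)
    qed
  qed (auto simp: residue_module_def lookup_add mult0 hcomp_def lookup_restr intro: homog_mult)
qed

text \<open>Homogeneity is expressed by closure under homogeneous components, for this is what makes the kernel
  of the presentation of the quotient homogeneous.\<close>

locale homogeneous_ideal = grading dg for dg :: "('v \<Rightarrow>\<^sub>0 nat) \<Rightarrow> 'g::ab_group_add" +
  fixes J :: "('v, 'k::comm_ring_1) mpoly set"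
  assumes J_zero: "0 \<in> J" and J_diff: "f \<in> J \<Longrightarrow> h \<in> J \<Longrightarrow> f - h \<in> J"
    and J_mult: "h \<in> J \<Longrightarrow> r * h \<in> J" and J_homog: "h \<in> J \<Longrightarrow> hcomp dg g h \<in> J"
begin

definition "coset x = J +>\<^bsub>(poly_module dg :: (('v, 'k) mpoly, _, 'g) graded_module)\<^esub> x"

lemma coset_eq: "coset x = (\<lambda>h. h + x) ` J"
  by (auto simp: coset_def a_r_coset_def' poly_module_def)

lemma J_add: "f \<in> J \<Longrightarrow> h \<in> J \<Longrightarrow> f + h \<in> J"
  by (rule add_closed[OF J_zero J_diff])

lemma coset_eq_iff: "coset x = coset y \<longleftrightarrow> x - y \<in> J"
proof
  assume "coset x = coset y"
  then have "x \<in> coset y"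
    using J_zero by (force simp: coset_eq)
  then show "x - y \<in> J"
    by (auto simp: coset_eq)
next
  assume xy: "x - y \<in> J"
  show "coset x = coset y"
  proof
    show "coset x \<subseteq> coset y"
    proof
      fix z assume "z \<in> coset x"
      then obtain h where "h \<in> J" "z = h + x" by (auto simp: coset_eq)
      then show "z \<in> coset y"
        unfolding coset_eq using J_add[OF _ xy] by (intro image_eqI[of _ _ "h + (x - y)"]) auto
    qed
    show "coset y \<subseteq> coset x"
    proof
      fix z assume "z \<in> coset y"
      then obtain h where "h \<in> J" "z = h + y" by (auto simp: coset_eq)
      then show "z \<in> coset x"
        unfolding coset_eq using J_diff[OF _ xy] by (intro image_eqI[of _ _ "h - (x - y)"]) auto
    qed
  qed
qed

lemma coset_zero_iff: "coset x = coset 0 \<longleftrightarrow> x \<in> J"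
  by (simp add: coset_eq_iff)

theorem quot_presented:
  "presented dg (quot (poly_module dg :: (('v, 'k) mpoly, _, 'g) graded_module) J) UNIV dg (\<lambda>r. r) coset"
proof (unfold_locales, goal_cases)
  case (6)
  show ?case
    by (auto simp: quot_def A_RCOSETS_def' coset_def poly_module_def)
next
  case (7 g)
  show ?case
    by (auto simp: quot_def coset_def poly_module_def)
next
  case (8 x y)
  have "coset x <+>\<^bsub>poly_module dg\<^esub> coset y = {a + b | a b. a \<in> coset x \<and> b \<in> coset y}"
    by (auto simp: set_add_def' poly_module_def)
  also have "\<dots> = coset (x + y)"
  proof (intro equalityI subsetI)
    fix z assume "z \<in> {a + b | a b. a \<in> coset x \<and> b \<in> coset y}"
    then obtain h h' where "h \<in> J" "h' \<in> J" "z = (h + x) + (h' + y)"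
      by (auto simp: coset_eq)
    then show "z \<in> coset (x + y)"
      unfolding coset_eq by (intro image_eqI[of _ _ "h + h'"] J_add) auto
  next
    fix z assume "z \<in> coset (x + y)"
    then obtain h where h: "h \<in> J" "z = (h + x) + (0 + y)"
      by (auto simp: coset_eq)
    then show "z \<in> {a + b | a b. a \<in> coset x \<and> b \<in> coset y}"
      using J_zero unfolding coset_eq by blast
  qed
  finally show ?case
    by (simp add: quot_def)
next
  case 9
  show ?case
    by (auto simp: quot_def coset_eq)
next
  case (10 x r)
  have "coset (r * x') = coset (r * x)" if "x' \<in> coset x" for x'
  proof -
    from that obtain h where "h \<in> J" "x' = h + x"
      by (auto simp: coset_eq)
    then show ?thesis
      using J_mult by (simp add: coset_eq_iff algebra_simps)
  qed
  moreover have "x \<in> coset x"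
    unfolding coset_eq using J_zero by (intro image_eqI[of _ _ 0]) auto
  ultimately have "(\<Union>x'\<in>coset x. coset (r * x')) = coset (r * x)"
    by (intro UN_constant_eq) blast+
  moreover have "r \<odot>\<^bsub>quot (poly_module dg) J\<^esub> coset x = (\<Union>x'\<in>coset x. coset (r * x'))"
    by (simp add: quot_def coset_def poly_module_def)
  ultimately show ?case
    by simp
next
  case (11 x g)
  then show ?case
    using J_homog by (simp add: coset_zero_iff)
qed (auto intro: homog_mult)

end

section \<open>Strands of a bigraded algebra and powers of an ideal\<close>

lemma embed_x_hom:
  "embed_x (r - s) = (embed_x r - embed_x s :: ('n + 'm, 'k::comm_ring_1) mpoly)"
  "embed_x (r * s) = (embed_x r * embed_x s :: ('n + 'm, 'k) mpoly)"
  "embed_x 1 = (1 :: ('n + 'm, 'k) mpoly)"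
  by (simp_all add: embed_x_def embed.sub_diff embed.sub_mult)

lemma bideg_add: "bideg (m + m') = bideg m + bideg m'"
  by (rule grading.dg_add[OF bideg_grading])

lemma embed_x_mult_keys:
  fixes x :: "('n::finite + 'm::finite, 'k::comm_ring_1) mpoly"
  assumes "m \<in> keys (embed_x r * x)"
  shows "\<exists>a\<in>keys r. \<exists>b\<in>keys x. xdeg m = tdeg a + xdeg b \<and> ydeg m = ydeg b"
proof -
  obtain a b where ab: "a \<in> keys (embed_x r :: ('n + 'm, 'k) mpoly)" "b \<in> keys x" "m = a + b"
    using keys_mult_subset[OF assms] by blast
  then obtain a' where "a' \<in> keys r" "a = lift_expo a'"
    using embed_x_keys[OF ab(1)] by blast
  with ab show ?thesis
    by (auto simp: bideg_add bideg_lift_expo)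
qed

lemma hcomp_eq: "(\<And>m. m \<in> keys x \<Longrightarrow> e m = g \<longleftrightarrow> e' m = g') \<Longrightarrow> hcomp e g x = hcomp e' g' x"
  by (rule poly_mapping_eqI) (auto simp: hcomp_def lookup_restr in_keys_iff)

text \<open>The elements of a strand are finite sums of homogeneous cosets, that is, cosets of polynomials all
  of whose monomials have y-degree \<open>b\<close>.\<close>

theorem strand_presented:
  fixes J :: "('n::finite + 'm::finite, 'k::field) mpoly set"
  assumes J: "homogeneous_ideal bideg J"
  shows "presented tdeg (shift s (strand (bigraded_algebra J) b)) {m. ydeg m = b} (\<lambda>m. xdeg m - s) embed_x
    (homogeneous_ideal.coset bideg J)"
proof -
  interpret J: homogeneous_ideal bideg J by (rule J)
  interpret R: presented bideg "bigraded_algebra J" UNIV bideg "\<lambda>r. r" J.coset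
    unfolding bigraded_algebra_def by (rule J.quot_presented)
  interpret tdeg: grading "tdeg :: ('n \<Rightarrow>\<^sub>0 nat) \<Rightarrow> int" by (rule tdeg_grading)
  let ?N = "shift s (strand (bigraded_algebra J) b)"
  let ?E = "{m :: 'n + 'm \<Rightarrow>\<^sub>0 nat. ydeg m = b}"
  have el: "x \<in> R.elems" for x
    by (simp add: R.elems_def)
  have carrier: "carrier ?N = J.coset ` {x. keys x \<subseteq> ?E}"
  proof
    show "carrier ?N \<subseteq> J.coset ` {x. keys x \<subseteq> ?E}"
    proof
      fix u assume "u \<in> carrier ?N"
      then obtain t A where t: "u = finsum (bigraded_algebra J) t A" "finite A" "\<forall>a\<in>A. t a \<in> gpart (bigraded_algebra J) (a, b)"
        by (auto simp: shift_def strand_def)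
      then have "\<forall>a\<in>A. \<exists>x\<in>homog bideg (a, b). t a = J.coset x"
        by (auto simp: R.gpart_N)
      then obtain x where x: "\<forall>a\<in>A. x a \<in> homog bideg (a, b) \<and> t a = J.coset (x a)"
        by metis
      have "u = finsum (bigraded_algebra J) (\<lambda>a. J.coset (x a)) A"
        unfolding t(1)
        by (rule abelian_monoid.finsum_cong'[OF abelian_group.axioms(1)[OF R.abelian_group_N]])
          (use x in \<open>auto simp: R.carrier_N\<close>)
      also have "\<dots> = J.coset (\<Sum>a\<in>A. x a)"
        by (rule R.finsum_pi) (use t(2) el in auto)
      finally have "u = J.coset (\<Sum>a\<in>A. x a)" .
      moreover have "(\<Sum>a\<in>A. x a) \<in> {x. keys x \<subseteq> ?E}"
      proof (rule sum_closed)
        show "x - y \<in> {x. keys x \<subseteq> ?E}" if "x \<in> {x. keys x \<subseteq> ?E}" "y \<in> {x. keys x \<subseteq> ?E}"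
          for x y :: "('n + 'm, 'k) mpoly"
          using that Poly_Mapping.keys_diff[of x y] by blast
      qed (use x in \<open>auto simp: homog_def\<close>)
      ultimately show "u \<in> J.coset ` {x. keys x \<subseteq> ?E}"
        by blast
    qed
    show "J.coset ` {x. keys x \<subseteq> ?E} \<subseteq> carrier ?N"
    proof clarify
      fix x :: "('n + 'm, 'k) mpoly" assume x: "keys x \<subseteq> ?E"
      define A where "A = xdeg ` keys x"
      have "x = (\<Sum>a\<in>A. hcomp bideg (a, b) x)"
      proof (rule poly_mapping_eqI)
        fix m
        have "(\<Sum>a\<in>A. lookup (hcomp bideg (a, b) x) m) = (\<Sum>a\<in>A. if a = xdeg m then lookup x m else 0)"
          by (rule sum.cong) (use x in \<open>auto simp: hcomp_def lookup_restr in_keys_iff prod_eq_iff\<close>)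
        also have "\<dots> = lookup x m"
          by (auto simp: A_def in_keys_iff)
        finally show "lookup x m = lookup (\<Sum>a\<in>A. hcomp bideg (a, b) x) m"
          by (simp add: lookup_sum)
      qed
      then have "J.coset x = finsum (bigraded_algebra J) (\<lambda>a. J.coset (hcomp bideg (a, b) x)) A"
        by (subst R.finsum_pi) (use el in \<open>auto simp: A_def\<close>)
      moreover have "\<forall>a\<in>A. J.coset (hcomp bideg (a, b) x) \<in> gpart (bigraded_algebra J) (a, b)"
        by (auto simp: R.gpart_N)
      moreover have "finite A"
        by (simp add: A_def)
      ultimately show "J.coset x \<in> carrier ?N"
        unfolding shift_def strand_def by auto
    qed
  qed
  show ?thesis
  proof (unfold_locales, goal_cases)
    case (4 x r)
    then show ?case
      by (fastforce dest: embed_x_mult_keys)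
  next
    case (5 r h x g)
    then show ?case
      by (fastforce simp: homog_def dest: embed_x_mult_keys)
  next
    case 6
    show ?case
      by (rule carrier)
  next
    case (7 g)
    have "{x. keys x \<subseteq> ?E \<and> x \<in> homog (\<lambda>m. xdeg m - s) g} = (homog bideg (s + g, b) :: ('n + 'm, 'k) mpoly set)"
      by (auto simp: homog_def prod_eq_iff)
    then show ?case
      by (simp add: shift_def strand_def R.gpart_N)
  next
    case (8 x y)
    then show ?case
      by (simp add: shift_def strand_def R.add_N)
  next
    case 9
    show ?case
      by (simp add: shift_def strand_def R.zero_N)
  next
    case (10 x r)
    then show ?case
      by (simp add: shift_def strand_def R.smult_N)
  next
    case (11 x g)
    have "hcomp (\<lambda>m. xdeg m - s) g x = hcomp bideg (s + g, b) x"
      by (rule hcomp_eq) (use 11 in \<open>auto simp: prod_eq_iff\<close>)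
    then show ?case
      using 11 J.J_homog by (simp add: J.coset_zero_iff)
  qed (auto simp: embed_x_hom)
qed

text \<open>The substitution \<open>y\<^sub>j \<mapsto> f\<^sub>j\<close>: the Rees homomorphism with the auxiliary variable set to 1.\<close>

definition ev :: "('m \<Rightarrow> ('n, 'k::comm_ring_1) mpoly) \<Rightarrow> ('n + 'm, 'k) mpoly \<Rightarrow> ('n, 'k) mpoly"
  where "ev f = substitute Const (case_sum Var f)"

interpretation ev: substitution Const "case_sum Var f :: 'n + 'm \<Rightarrow> ('n, 'k::comm_ring_1) mpoly"
  rewrites "substitute Const (case_sum Var f) = ev f" for f
  by (rule substitution_Const) (simp add: ev_def)

lemma ev_single:
  fixes f :: "'m::finite \<Rightarrow> ('n::finite, 'k::comm_ring_1) mpoly"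
  shows "ev f (Poly_Mapping.single m a) =
    Const a * ((\<Prod>i\<in>UNIV. Var i ^ lookup m (Inl i)) * (\<Prod>j\<in>UNIV. f j ^ lookup m (Inr j)))"
proof -
  have "mono_value (case_sum Var f) m = (\<Prod>v\<in>UNIV <+> UNIV. case_sum Var f v ^ lookup m v)"
    by (rule mono_value_superset) auto
  also have "\<dots> = (\<Prod>i\<in>UNIV. Var i ^ lookup m (Inl i)) * (\<Prod>j\<in>UNIV. f j ^ lookup m (Inr j))"
    by (subst prod.Plus) auto
  finally show ?thesis
    unfolding ev.sub_single by simp
qed

lemma ev_embed_x: "ev f (embed_x p) = p"
  for f :: "'m::finite \<Rightarrow> ('n::finite, 'k::comm_ring_1) mpoly"
proof -
  have "ev f (embed_x (Poly_Mapping.single m a)) = Poly_Mapping.single m a" for m a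
  proof -
    have "(\<Prod>i\<in>UNIV. Var i ^ lookup m i) = (mono_value Var m :: ('n, 'k) mpoly)"
      by (rule mono_value_superset[symmetric]) auto
    also have "\<dots> = Poly_Mapping.single m 1"
      by (simp add: mono_value_Var flip: poly_mapping_monomials)
    finally show ?thesis
      by (simp add: embed_x_single ev_single lookup_lift_expo) (simp add: Const_def mult_single)
  qed
  then have "ev f (embed_x (\<Sum>m\<in>keys p. Poly_Mapping.single m (lookup p m))) =
      (\<Sum>m\<in>keys p. Poly_Mapping.single m (lookup p m))"
    by (simp add: embed_x_def embed.sub_sum ev.sub_sum)
  then show ?thesis
    by (simp flip: poly_mapping_monomials)
qed

lemma (in grading) homog_one: "(1 :: ('v, 'k::comm_ring_1) mpoly) \<in> homog dg 0"
  by (simp add: homog_def dg_zero)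

lemma homog_power: "f \<in> homog tdeg g \<Longrightarrow> f ^ n \<in> homog tdeg (int n * g)"
  for f :: "('n::finite, 'k::comm_ring_1) mpoly"
proof (induction n)
  case 0
  show ?case
    using grading.homog_one[OF tdeg_grading] by simp
next
  case (Suc n)
  then have "f * f ^ n \<in> homog tdeg (g + int n * g)"
    by (intro grading.homog_mult[OF tdeg_grading])
  then show ?case
    by (simp add: algebra_simps)
qed

lemma homog_prod:
  "finite A \<Longrightarrow> (\<And>i. i \<in> A \<Longrightarrow> f i \<in> homog tdeg (g i)) \<Longrightarrow> prod f A \<in> homog tdeg (sum g A)"
  for f :: "'i \<Rightarrow> ('n::finite, 'k::comm_ring_1) mpoly"
  by (induction A rule: finite_induct)
     (auto intro: grading.homog_mult[OF tdeg_grading] grading.homog_one[OF tdeg_grading])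

lemma hcomp_single: "hcomp e g (Poly_Mapping.single m a) = (if e m = g then Poly_Mapping.single m a else 0)"
  by (rule poly_mapping_eqI) (auto simp: hcomp_def lookup_restr lookup_single when_def)

lemma hcomp_other: "x \<in> homog e h \<Longrightarrow> h \<noteq> g \<Longrightarrow> hcomp e g x = 0"
  unfolding hcomp_def by (rule restr_none) (auto simp: homog_def)

context
  fixes f :: "'m::finite \<Rightarrow> ('n::finite, 'k::field) mpoly" and d :: nat
  assumes f_homog: "\<And>j. f j \<in> homog tdeg (int d)"
begin

lemma ev_single_homog: "ev f (Poly_Mapping.single m a) \<in> homog tdeg (xdeg m + ydeg m * int d)"
proof -
  have V: "(Var i :: ('n, 'k) mpoly) \<in> homog tdeg 1" for i :: 'n
    using grading.Var_homog[OF tdeg_grading, of i] by (simp add: tdeg_expo)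
  have "(Const a :: ('n, 'k) mpoly) \<in> homog tdeg 0"
    using tdeg_grading by (auto simp: Const_def homog_def grading_def)
  moreover have "(\<Prod>i\<in>UNIV. Var i ^ lookup m (Inl i) :: ('n, 'k) mpoly) \<in> homog tdeg (\<Sum>i\<in>UNIV. int (lookup m (Inl i)) * 1)"
    by (rule homog_prod) (simp, rule homog_power[OF V])
  moreover have "(\<Prod>j\<in>UNIV. f j ^ lookup m (Inr j)) \<in> homog tdeg (\<Sum>j\<in>UNIV. int (lookup m (Inr j)) * int d)"
    by (rule homog_prod) (auto intro!: homog_power f_homog)
  ultimately have "ev f (Poly_Mapping.single m a) \<in> homog tdeg
      (0 + ((\<Sum>i\<in>UNIV. int (lookup m (Inl i)) * 1) + (\<Sum>j\<in>UNIV. int (lookup m (Inr j)) * int d)))"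
    unfolding ev_single by (intro grading.homog_mult[OF tdeg_grading])
  then show ?thesis
    by (simp add: bideg_def sum_distrib_right)
qed

text \<open>With \<open>y\<^sub>j\<close> given the weight \<open>d\<close>, the substitution preserves degrees.\<close>

lemma hcomp_ev: "hcomp tdeg g (ev f x) = ev f (hcomp (\<lambda>m. xdeg m + ydeg m * int d) g x)"
proof -
  let ?w = "\<lambda>m. xdeg m + ydeg m * int d"
  have "hcomp tdeg g (ev f (Poly_Mapping.single m a)) = ev f (hcomp ?w g (Poly_Mapping.single m a))" for m a
    using ev_single_homog[of m a] by (auto simp: hcomp_single hcomp_id hcomp_other)
  moreover have "hcomp tdeg g (sum F A) = (\<Sum>a\<in>A. hcomp tdeg g (F a))" for F :: "('n + 'm \<Rightarrow>\<^sub>0 nat) \<Rightarrow> ('n, 'k) mpoly" and A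
    by (simp add: hcomp_def restr_sum)
  moreover have "hcomp ?w g (sum F A) = (\<Sum>a\<in>A. hcomp ?w g (F a))" for F :: "('n + 'm \<Rightarrow>\<^sub>0 nat) \<Rightarrow> ('n + 'm, 'k) mpoly" and A
    by (simp add: hcomp_def restr_sum)
  ultimately have "hcomp tdeg g (ev f (\<Sum>m\<in>keys x. Poly_Mapping.single m (lookup x m))) =
      ev f (hcomp ?w g (\<Sum>m\<in>keys x. Poly_Mapping.single m (lookup x m)))"
    by (simp add: ev.sub_sum)
  then show ?thesis
    by (simp flip: poly_mapping_monomials)
qed

end

definition ystrand :: "nat \<Rightarrow> ('n::finite + 'm::finite, 'k::zero) mpoly set"
  where "ystrand j = {x. keys x \<subseteq> {m. ydeg m = int j}}"

lemma ystrand_diff: "x \<in> ystrand j \<Longrightarrow> y \<in> ystrand j \<Longrightarrow> x - y \<in> ystrand j"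
  for x :: "('n::finite + 'm::finite, 'k::ab_group_add) mpoly"
  using Poly_Mapping.keys_diff[of x y] by (auto simp: ystrand_def)

lemma ystrand_zero [simp]: "0 \<in> ystrand j"
  by (simp add: ystrand_def)

lemma ystrand_mult: "x \<in> ystrand i \<Longrightarrow> y \<in> ystrand j \<Longrightarrow> x * y \<in> ystrand (i + j)"
  for x :: "('n::finite + 'm::finite, 'k::comm_ring_1) mpoly"
  using keys_mult_subset[of _ x y] by (fastforce simp: ystrand_def bideg_add)

lemma embed_x_ystrand: "embed_x r \<in> ystrand 0"
  by (auto simp: ystrand_def bideg_lift_expo dest!: embed_x_keys)

lemma ydeg_split:
  assumes "ydeg m = int (Suc j)"
  obtains k m' where "m = m' + expo (Inr k)" "ydeg m' = int j"
proof -
  have "\<exists>k. lookup m (Inr k) \<noteq> 0"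
  proof (rule ccontr)
    assume "\<not> (\<exists>k. lookup m (Inr k) \<noteq> 0)"
    then show False
      using assms by (simp add: bideg_def)
  qed
  then obtain k where k: "lookup m (Inr k) \<noteq> 0" by blast
  define m' where "m' = m - expo (Inr k)"
  have m: "m = m' + expo (Inr k)"
    using exponent_split[OF k] by (simp add: m'_def add.commute)
  moreover have "ydeg m' = int j"
    using assms arg_cong[OF m, of ydeg] by (simp add: bideg_add bideg_expo)
  ultimately show ?thesis
    by (rule that)
qed

context
  fixes f :: "'m::finite \<Rightarrow> ('n::finite, 'k::field) mpoly"
begin

lemma ev_ystrand_ideal: "ideal (ev f ` ystrand j) ring_of_type_algebra"
proof (rule idealI)
  show "ring (ring_of_type_algebra :: ('n, 'k) mpoly ring)"
    by (rule ring_from_type_algebra)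
  then interpret ring "ring_of_type_algebra :: ('n, 'k) mpoly ring" .
  show "subgroup (ev f ` ystrand j) (add_monoid ring_of_type_algebra)"
  proof (rule group.subgroupI[OF a_group])
    show "ev f ` ystrand j \<subseteq> carrier (add_monoid ring_of_type_algebra)"
      by (simp add: ring_of_type_algebra_def)
    show "ev f ` ystrand j \<noteq> {}"
      using ystrand_zero by blast
    show "inv\<^bsub>add_monoid ring_of_type_algebra\<^esub> a \<in> ev f ` ystrand j" if a: "a \<in> ev f ` ystrand j" for a
    proof -
      obtain x where x: "x \<in> ystrand j" "a = ev f x"
        using a by blast
      have "\<ominus>\<^bsub>ring_of_type_algebra\<^esub> a = - a"
        by (rule minus_equality) (simp_all add: ring_of_type_algebra_def)
      also have "\<dots> = ev f (0 - x)"
        by (simp add: x ev.sub_uminus)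
      finally show ?thesis
        using ystrand_diff[OF ystrand_zero x(1)] unfolding a_inv_def by blast
    qed
    show "a \<otimes>\<^bsub>add_monoid ring_of_type_algebra\<^esub> b \<in> ev f ` ystrand j"
      if "a \<in> ev f ` ystrand j" "b \<in> ev f ` ystrand j" for a b
    proof -
      from that obtain x y where xy: "x \<in> ystrand j" "a = ev f x" "y \<in> ystrand j" "b = ev f y"
        by blast
      have "x + y \<in> ystrand j"
        by (rule add_closed) (use xy in \<open>auto intro: ystrand_diff\<close>)
      then show ?thesis
        by (auto simp: ring_of_type_algebra_def xy ev.sub_add[symmetric])
    qed
  qed
  have mult: "r * a \<in> ev f ` ystrand j" if a: "a \<in> ev f ` ystrand j" for r a
  proof -
    obtain x where x: "x \<in> ystrand j" "a = ev f x"
      using a by blast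
    have "r * a = ev f (embed_x r * x)"
      by (simp add: x ev.sub_mult ev_embed_x)
    moreover have "embed_x r * x \<in> ystrand j"
      using ystrand_mult[OF embed_x_ystrand x(1)] by simp
    ultimately show ?thesis
      by blast
  qed
  show "x \<otimes>\<^bsub>ring_of_type_algebra\<^esub> a \<in> ev f ` ystrand j"
    if "a \<in> ev f ` ystrand j" "x \<in> carrier ring_of_type_algebra" for a x
    using mult[OF that(1), of x] by (simp add: ring_of_type_algebra_def)
  show "a \<otimes>\<^bsub>ring_of_type_algebra\<^esub> x \<in> ev f ` ystrand j"
    if "a \<in> ev f ` ystrand j" "x \<in> carrier ring_of_type_algebra" for a x
    using mult[OF that(1), of x] by (simp add: ring_of_type_algebra_def mult.commute)
qed

text \<open>An induction principle for images of strands: a monomial of positive y-degree has a factor \<open>y\<^sub>k\<close>.\<close>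

lemma ev_ystrand_Suc_in:
  assumes x: "x \<in> ystrand (Suc j)"
    and A: "\<And>y k. y \<in> ystrand j \<Longrightarrow> ev f y * f k \<in> A"
    and zero: "0 \<in> A" and add: "\<And>p q. p \<in> A \<Longrightarrow> q \<in> A \<Longrightarrow> p + q \<in> A"
  shows "ev f x \<in> A"
proof -
  have "ev f (Poly_Mapping.single m a) \<in> A" if deg: "ydeg m = int (Suc j)" for m a
  proof -
    obtain k m' where m: "m = m' + expo (Inr k)" "ydeg m' = int j"
      by (rule ydeg_split[OF deg])
    have "Poly_Mapping.single m a = Poly_Mapping.single m' a * Var (Inr k)"
      by (simp add: m(1) Var_expo mult_single)
    then have "ev f (Poly_Mapping.single m a) = ev f (Poly_Mapping.single m' a) * f k"
      by (simp add: ev.sub_mult)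
    moreover have "Poly_Mapping.single m' a \<in> ystrand j"
      using m(2) by (auto simp: ystrand_def)
    ultimately show ?thesis
      using A by simp
  qed
  then have monomials: "\<forall>m\<in>keys x. ev f (Poly_Mapping.single m (lookup x m)) \<in> A"
    using x by (auto simp: ystrand_def)
  have "(\<forall>m\<in>B. F m \<in> A) \<Longrightarrow> sum F B \<in> A" for B and F :: "_ \<Rightarrow> ('n, 'k) mpoly"
    by (induction B rule: infinite_finite_induct) (auto intro: zero add)
  from this[OF monomials] show ?thesis
    unfolding ev.sub_sum[symmetric] poly_mapping_monomials[symmetric] .
qed

lemma gen_ideal_eq: "gen_ideal f = ev f ` ystrand 1"
proof -
  interpret ring "ring_of_type_algebra :: ('n, 'k) mpoly ring"
    by (rule ring_from_type_algebra)
  have car: "carrier (ring_of_type_algebra :: ('n, 'k) mpoly ring) = UNIV"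
    by (simp add: ring_of_type_algebra_def)
  have "Var (Inr k) \<in> ystrand 1" for k :: 'm
    by (auto simp: ystrand_def Var_expo bideg_expo)
  then have "range f \<subseteq> ev f ` ystrand 1"
    by (auto intro!: image_eqI[of _ "ev f" "Var (Inr _)"])
  then have 1: "gen_ideal f \<subseteq> ev f ` ystrand 1"
    unfolding gen_ideal_def by (rule genideal_minimal[OF ev_ystrand_ideal])
  interpret I: ideal "gen_ideal f" "ring_of_type_algebra :: ('n, 'k) mpoly ring"
    unfolding gen_ideal_def by (rule genideal_ideal) (simp add: car)
  have fI: "f k \<in> gen_ideal f" for k
    using genideal_self[of "range f"] by (auto simp: gen_ideal_def car)
  have "ev f x \<in> gen_ideal f" if "x \<in> ystrand 1" for x
  proof (rule ev_ystrand_Suc_in[of x 0])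
    show "x \<in> ystrand (Suc 0)" using that by simp
    show "ev f y * f k \<in> gen_ideal f" for y k
      using I.I_l_closed[OF fI[of k], of "ev f y"] by (simp add: ring_of_type_algebra_def)
    show "0 \<in> gen_ideal f"
      using I.zero_closed by (simp add: ring_of_type_algebra_def)
    show "p + q \<in> gen_ideal f" if "p \<in> gen_ideal f" "q \<in> gen_ideal f" for p q
      using I.a_closed[OF that] by (simp add: ring_of_type_algebra_def)
  qed
  with 1 show ?thesis
    by blast
qed

text \<open>By induction on \<open>j\<close>: a form of degree \<open>j + 1\<close> in the y-variables is a sum of products of forms of
  degree \<open>j\<close> with a variable.\<close>

lemma gen_ideal_power: "gen_ideal f [^]\<^bsub>ideals_set ring_of_type_algebra\<^esub> j = ev f ` ystrand j"
proof (induction j)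
  case 0
  have "ev f ` ystrand 0 = UNIV"
    using ev_embed_x[of f] embed_x_ystrand by (metis (no_types, opaque_lifting) UNIV_eq_I image_eqI)
  then show ?case
    by (simp add: nat_pow_def ideals_set_def ring_of_type_algebra_def)
next
  case (Suc j)
  let ?R = "ring_of_type_algebra :: ('n, 'k) mpoly ring"
  have "gen_ideal f [^]\<^bsub>ideals_set ?R\<^esub> (Suc j) = ideal_prod ?R (ev f ` ystrand j) (ev f ` ystrand 1)"
    using Suc gen_ideal_eq by (simp add: nat_pow_def ideals_set_def)
  also have "\<dots> = ev f ` ystrand (Suc j)"
  proof
    show "ideal_prod ?R (ev f ` ystrand j) (ev f ` ystrand 1) \<subseteq> ev f ` ystrand (Suc j)"
    proof
      fix p assume "p \<in> ideal_prod ?R (ev f ` ystrand j) (ev f ` ystrand 1)"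
      then show "p \<in> ev f ` ystrand (Suc j)"
      proof (induction rule: ideal_prod.induct)
        case (prod a b)
        then obtain x y where xy: "x \<in> ystrand j" "a = ev f x" "y \<in> ystrand 1" "b = ev f y"
          by blast
        then show ?case
          using ystrand_mult[OF xy(1,3)] by (auto simp: ring_of_type_algebra_def ev.sub_mult[symmetric])
      next
        case (sum p q)
        then obtain x y where xy: "x \<in> ystrand (Suc j)" "p = ev f x" "y \<in> ystrand (Suc j)" "q = ev f y"
          by blast
        have "x + y \<in> ystrand (Suc j)"
          by (rule add_closed) (use xy in \<open>auto intro: ystrand_diff\<close>)
        then show ?case
          by (auto simp: xy ring_of_type_algebra_def ev.sub_add[symmetric])
      qed
    qed
    show "ev f ` ystrand (Suc j) \<subseteq> ideal_prod ?R (ev f ` ystrand j) (ev f ` ystrand 1)"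
    proof clarify
      fix x :: "('n + 'm, 'k) mpoly" assume x: "x \<in> ystrand (Suc j)"
      have V: "Var (Inr k) \<in> ystrand 1" for k :: 'm
        by (auto simp: ystrand_def Var_expo bideg_expo)
      have prod: "ev f y * ev f z \<in> ideal_prod ?R (ev f ` ystrand j) (ev f ` ystrand 1)"
        if "y \<in> ystrand j" "z \<in> ystrand 1" for y z
        using ideal_prod.prod[of "ev f y" "ev f ` ystrand j" "ev f z" "ev f ` ystrand 1" ?R] that
        by (auto simp: ring_of_type_algebra_def)
      show "ev f x \<in> ideal_prod ?R (ev f ` ystrand j) (ev f ` ystrand 1)"
      proof (rule ev_ystrand_Suc_in[OF x])
        show "ev f y * f k \<in> ideal_prod ?R (ev f ` ystrand j) (ev f ` ystrand 1)" if "y \<in> ystrand j" for y k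
          using prod[OF that V[of k]] by simp
        show "0 \<in> ideal_prod ?R (ev f ` ystrand j) (ev f ` ystrand 1)"
          using prod[of 0 0] by simp
        show "p + q \<in> ideal_prod ?R (ev f ` ystrand j) (ev f ` ystrand 1)"
          if "p \<in> ideal_prod ?R (ev f ` ystrand j) (ev f ` ystrand 1)"
            "q \<in> ideal_prod ?R (ev f ` ystrand j) (ev f ` ystrand 1)" for p q
          using ideal_prod.sum[OF that] by (simp add: ring_of_type_algebra_def)
      qed
    qed
  qed
  finally show ?case .
qed

text \<open>This is the isomorphism of \<open>I\<^sup>j\<close> with the twisted strand of the Rees algebra: both are the strand of
  the polynomial ring modulo the elements with value zero.\<close>

theorem ideal_power_presented:
  assumes f_homog: "\<And>j. f j \<in> homog tdeg (int d)"
  shows "presented tdeg (ideal_power (gen_ideal f) j) {m. ydeg m = int j} (\<lambda>m. xdeg m - (- int (j * d))) embed_x (ev f)"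
proof -
  interpret tdeg: grading "tdeg :: ('n \<Rightarrow>\<^sub>0 nat) \<Rightarrow> int" by (rule tdeg_grading)
  let ?N = "ideal_power (gen_ideal f) j"
  let ?w = "\<lambda>m. xdeg m + ydeg m * int d"
  have w: "hcomp (\<lambda>m. xdeg m - (- int (j * d))) g x = hcomp ?w g x" if "x \<in> ystrand j" for x :: "('n + 'm, 'k) mpoly" and g
    by (rule hcomp_eq) (use that in \<open>auto simp: ystrand_def\<close>)
  have hc: "hcomp tdeg g (ev f x) = ev f (hcomp (\<lambda>m. xdeg m - (- int (j * d))) g x)" if "x \<in> ystrand j" for x g
    using hcomp_ev[OF f_homog, where g = g and x = x] w[OF that] by simp
  have ops: "carrier ?N = ev f ` ystrand j" "x \<oplus>\<^bsub>?N\<^esub> y = x + y" "\<zero>\<^bsub>?N\<^esub> = 0" "r \<odot>\<^bsub>?N\<^esub> x = r * x"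
    "gpart ?N g = homog tdeg g \<inter> ev f ` ystrand j" for x y r g
    by (simp_all add: ideal_power_def submod_def gen_ideal_power poly_module_def)
  have ys: "keys x \<subseteq> {m. ydeg m = int j} \<longleftrightarrow> x \<in> ystrand j" for x :: "('n + 'm, 'k) mpoly"
    by (simp add: ystrand_def)
  show ?thesis
  proof (unfold_locales, unfold ys, goal_cases)
    case (4 x r)
    then show ?case
      using ystrand_mult[OF embed_x_ystrand, of x j] by simp
  next
    case (5 r h x g)
    then show ?case
      by (fastforce simp: homog_def dest: embed_x_mult_keys)
  next
    case (6)
    then show ?case
      by (simp add: ops)
  next
    case (7 g)
    have "ev f x \<in> ev f ` {x. x \<in> ystrand j \<and> x \<in> homog (\<lambda>m. xdeg m - (- int (j * d))) g}"
      if x: "x \<in> ystrand j" "ev f x \<in> homog tdeg g" for x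
    proof (rule image_eqI)
      show "ev f x = ev f (hcomp (\<lambda>m. xdeg m - (- int (j * d))) g x)"
        using hc[OF x(1), of g] hcomp_id[OF x(2)] by simp
    qed (use x(1) in \<open>auto simp: ystrand_def hcomp_def keys_restr homog_def\<close>)
    moreover have "ev f x \<in> homog tdeg g" if "x \<in> ystrand j" "x \<in> homog (\<lambda>m. xdeg m - (- int (j * d))) g" for x
      using hc[OF that(1), of g] hcomp_id[OF that(2)] hcomp_homog by metis
    ultimately show ?case
      unfolding ops by blast
  next
    case (8 x y)
    then show ?case
      by (simp add: ops ev.sub_add)
  next
    case 9
    then show ?case
      by (simp add: ops)
  next
    case (10 x r)
    then show ?case
      by (simp add: ops ev.sub_mult ev_embed_x)
  next
    case (11 x g)
    then show ?case
      using hc[OF 11(1), of g] by (simp add: hcomp_def)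
  qed (auto simp: embed_x_hom)
qed

end

section \<open>Tor as Koszul homology\<close>

text \<open>Finitely many homogeneous elements generate \<open>C/Z\<close>, in the form that the construction of a resolution
  takes as input.\<close>

definition finitely_generated_pair ::
    "(('v \<Rightarrow>\<^sub>0 nat) \<Rightarrow> 'g::ab_group_add) \<Rightarrow> (('v, 'k::comm_ring_1) mpoly \<Rightarrow> 'c \<Rightarrow> 'c::ab_group_add)
      \<Rightarrow> ('g \<Rightarrow> 'c set) \<Rightarrow> ('g \<Rightarrow> 'c set) \<Rightarrow> bool"
  where "finitely_generated_pair dg act C Z \<longleftrightarrow> (\<exists>ds c. (\<forall>p<length ds. c p \<in> C (ds ! p)) \<and>
    (\<forall>g. \<forall>x\<in>C g. \<exists>v\<in>vec dg ds g. x - (\<Sum>p<length ds. act (v p) (c p)) \<in> Z g))"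

lemma presented_explicit:
  fixes N :: "(('v, 'k::comm_ring_1) mpoly, 'b, 'g::ab_group_add) graded_module"
    and \<pi> :: "('w, 'k) mpoly \<Rightarrow> 'b"
  assumes "presented dg N E e \<rho> \<pi>"
  shows "presented.act \<rho> = (\<lambda>r x. \<rho> r * x)"
    and "presented.comps E e = (\<lambda>g. {x :: ('w, 'k) mpoly. keys x \<subseteq> E \<and> x \<in> homog e g})"
    and "presented.kers E e \<pi> = (\<lambda>g. {x. keys x \<subseteq> E \<and> x \<in> homog e g \<and> \<pi> x = \<pi> 0})"
proof -
  interpret presented dg N E e \<rho> \<pi> by fact
  show "act = (\<lambda>r x. \<rho> r * x)" "comps = (\<lambda>g. {x. keys x \<subseteq> E \<and> x \<in> homog e g})"
    "kers = (\<lambda>g. {x. keys x \<subseteq> E \<and> x \<in> homog e g \<and> \<pi> x = \<pi> 0})"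
    by (auto simp: fun_eq_iff act_def comps_def kers_def elems_def)
qed

text \<open>The Hilbert choice in the definition of Tor selects a resolution because one exists.\<close>

lemma chosen_resolution:
  fixes dg :: "('v::finite \<Rightarrow>\<^sub>0 nat) \<Rightarrow> 'g::ab_group_add"
    and N :: "(('v, 'k::field) mpoly, 'b, 'g) graded_module"
    and M :: "(('v, 'k) mpoly, 'd, 'g) graded_module"
  assumes N: "presented dg N E e \<rho> \<pi>"
    and fg: "finitely_generated_pair dg (presented.act \<rho>) (presented.comps E e) (presented.kers E e \<pi>)"
  obtains F :: "(('v, 'k) mpoly, 'b, 'g) free_complex" and c
  where "\<And>i. Tor dg N M i = quot (submod (free_tensor (res_degs F i) M) (cycles F M i)) (boundaries F M i)"
    and "resolves (homog dg) (complex_of F) (presented.act \<rho>) (presented.comps E e) (presented.kers E e \<pi>) c"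
proof -
  interpret N: presented dg N E e \<rho> \<pi> by (rule N)
  have dg: "grading dg"
    by unfold_locales
  obtain ds c where gens: "\<forall>p<length ds. c p \<in> N.comps (ds ! p)"
    "\<forall>g. \<forall>x\<in>N.comps g. \<exists>v\<in>vec dg ds g. x - (\<Sum>p<length ds. N.act (v p) (c p)) \<in> N.kers g"
    using fg unfolding finitely_generated_pair_def by blast
  obtain D A where "resolves (homog dg) (list_complex D A) N.act N.comps N.kers c"
    using free_resolution_exists[OF dg N.graded_pair, of ds c] gens by blast
  then have ex: "free_resolution dg N \<lparr> res_degs = D, res_mat = A, res_aug = \<lambda>q. \<pi> (c q) \<rparr>"
    by (rule N.free_resolution_if_resolves)
  define F where "F = (SOME F. free_resolution dg N F)"
  have F: "free_resolution dg N F"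
    unfolding F_def by (rule someI) (rule ex)
  obtain c' where "resolves (homog dg) (complex_of F) N.act N.comps N.kers c'"
    using N.resolves_if_free_resolution[OF F] by blast
  moreover have "Tor dg N M i = quot (submod (free_tensor (res_degs F i) M) (cycles F M i)) (boundaries F M i)" for i
    by (simp add: Tor_def F_def Let_def)
  ultimately show ?thesis
    using that by blast
qed

lemma presented_tor_of_resolves:
  assumes M: "presented dg M E e \<rho> \<pi>" and F: "resolves (homog dg) (complex_of F) a C Z c"
  shows "presented_tor dg M E e \<rho> \<pi> F"
proof -
  interpret M: presented dg M E e \<rho> \<pi> by (rule M)
  interpret F: resolves "homog dg" "complex_of F" a C Z c by (rule F)
  show ?thesis
  proof unfold_locales
    show "(\<Sum>r<length (res_degs F (Suc i)). res_mat F i p r * res_mat F (Suc i) r q) = 0"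
      if "p < length (res_degs F i)" "q < length (res_degs F (Suc (Suc i)))" for p i q
      using F.mat_mat[of p i q] that by simp
  qed
qed

lemma exponent_nonzero: "m \<noteq> 0 \<longleftrightarrow> (\<exists>v. lookup m v \<noteq> 0)"
  by (metis lookup_zero poly_mapping_eqI)

text \<open>Balancing the chosen resolution of \<open>N\<close> against the Koszul resolution of the residue field.\<close>

theorem tor_residue_koszul:
  fixes dg :: "('v::finite \<Rightarrow>\<^sub>0 nat) \<Rightarrow> 'g::ab_group_add"
    and N :: "(('v, 'k::field) mpoly, 'b, 'g) graded_module"
  assumes N: "presented dg N E e \<rho> \<pi>"
    and fg: "finitely_generated_pair dg (presented.act \<rho>) (presented.comps E e) (presented.kers E e \<pi>)"
    and vs: "distinct vs" "set vs = UNIV"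
  shows "gpart (Tor dg N residue_module i) g = {\<zero>\<^bsub>Tor dg N residue_module i\<^esub>} \<longleftrightarrow>
    homology_zero (presented.act \<rho>) (presented.comps E e) (presented.kers E e \<pi>) (koszul (var_seq dg vs)) i g"
proof -
  interpret N: presented dg N E e \<rho> \<pi> by (rule N)
  let ?M = "residue_module :: (('v, 'k) mpoly, 'k, 'g) graded_module"
  obtain F :: "(('v, 'k) mpoly, 'b, 'g) free_complex" and c
    where Tor: "\<And>i. Tor dg N ?M i = quot (submod (free_tensor (res_degs F i) ?M) (cycles F ?M i)) (boundaries F ?M i)"
    and F: "resolves (homog dg) (complex_of F) N.act N.comps N.kers c"
    by (rule chosen_resolution[OF N fg, where M = ?M]) blast
  interpret R: presented_tor dg ?M UNIV dg "\<lambda>r. r" "\<lambda>h. lookup h 0" F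
    by (rule presented_tor_of_resolves[OF N.residue_presented F])
  have act: "R.act = (*)"
    by (simp add: fun_eq_iff R.act_def)
  have comps: "R.comps = homog dg"
    by (auto simp: fun_eq_iff R.comps_def R.elems_def)
  have kers: "R.kers = var_ideal dg (set vs)"
  proof -
    have "lookup h 0 = 0 \<longleftrightarrow> var_divisible UNIV h" for h :: "('v, 'k) mpoly"
      unfolding var_divisible_def by (metis UNIV_I exponent_nonzero in_keys_iff)
    then show ?thesis
      by (auto simp: fun_eq_iff R.kers_def comps var_ideal_def vs)
  qed
  have "gpart (Tor dg N ?M i) g = {\<zero>\<^bsub>Tor dg N ?M i\<^esub>} \<longleftrightarrow>
      homology_zero (*) (homog dg) (var_ideal dg (set vs)) (complex_of F) i g"
    unfolding Tor using R.tor_vanishes_iff[of i g] by (simp only: act comps kers)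
  also have "\<dots> \<longleftrightarrow> homology_zero N.act N.comps N.kers (koszul (var_seq dg vs)) i g"
    by (rule homology_zero_balanced[OF F N.koszul_resolves[OF vs(1)]])
  finally show ?thesis .
qed

section \<open>Finite generation\<close>

lemma (in homogeneous_ideal) quot_generated:
  "finitely_generated_pair dg (presented.act (\<lambda>r :: ('v, 'k) mpoly. r)) (presented.comps UNIV dg) (presented.kers UNIV dg coset)"
proof -
  interpret Q: presented dg "quot (poly_module dg :: (('v, 'k) mpoly, _, 'g) graded_module) J" UNIV dg "\<lambda>r. r" coset
    by (rule quot_presented)
  have "\<exists>v\<in>vec dg [0] g. x - (\<Sum>p<length [0]. Q.act (v p) 1) \<in> Q.kers g" if "x \<in> Q.comps g" for g x
    using that by (intro bexI[of _ "\<lambda>p. if p = 0 then x else 0"])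
      (auto simp: Q.act_def Q.kers_def Q.comps_def Q.elems_def vec_def)
  moreover have "1 \<in> Q.comps 0"
    by (simp add: Q.comps_def Q.elems_def homog_one)
  ultimately show ?thesis
    unfolding finitely_generated_pair_def
    by (intro exI[of _ "[0]"] exI[of _ "\<lambda>_. 1"]) simp
qed

lemma finite_ymonomials:
  "finite {m :: 'n::finite + 'm::finite \<Rightarrow>\<^sub>0 nat. ydeg m = b \<and> xdeg m = 0}"
proof -
  let ?S = "{m :: 'n + 'm \<Rightarrow>\<^sub>0 nat. ydeg m = b \<and> xdeg m = 0}"
  have "lookup m v \<le> nat b" if m: "m \<in> ?S" for m v
  proof (cases v)
    case (Inl i)
    have "lookup m (Inl i) \<le> (\<Sum>i\<in>UNIV. lookup m (Inl i))"
      by (rule member_le_sum) auto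
    then show ?thesis
      using m Inl by (simp add: bideg_def del: of_nat_sum)
  next
    case (Inr j)
    have "lookup m (Inr j) \<le> (\<Sum>j\<in>UNIV. lookup m (Inr j))"
      by (rule member_le_sum) auto
    then show ?thesis
      using m Inr by (auto simp: bideg_def simp del: of_nat_sum)
  qed
  then have "lookup ` ?S \<subseteq> (UNIV \<rightarrow>\<^sub>E {..nat b})"
    by auto
  then have "finite (lookup ` ?S)"
    by (rule finite_subset) (simp add: finite_PiE)
  then show ?thesis
    by (rule finite_imageD) (simp add: inj_on_def lookup_inject)
qed

lemma embed_x_0: "embed_x 0 = 0"
  by (simp add: embed_x_def)

text \<open>Over \<open>S_x\<close> a strand is generated by the monomials of the given degree in the y-variables.\<close>

lemma strand_generated:
  fixes N :: "(('n::finite, 'k::field) mpoly, 'b, int) graded_module"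
    and \<pi> :: "('n + 'm::finite, 'k) mpoly \<Rightarrow> 'b"
  assumes N: "presented tdeg N {m. ydeg m = b} (\<lambda>m. xdeg m - s) embed_x \<pi>"
  shows "finitely_generated_pair tdeg (presented.act embed_x)
    (presented.comps {m. ydeg m = b} (\<lambda>m. xdeg m - s) :: int \<Rightarrow> ('n + 'm, 'k) mpoly set)
    (presented.kers {m. ydeg m = b} (\<lambda>m. xdeg m - s) \<pi>)"
proof -
  interpret N: presented tdeg N "{m. ydeg m = b}" "\<lambda>m. xdeg m - s" embed_x \<pi> by (rule N)
  obtain bs where bs: "set bs = {m :: 'n + 'm \<Rightarrow>\<^sub>0 nat. ydeg m = b \<and> xdeg m = 0}"
    using finite_list[OF finite_ymonomials] by blast
  define ds where "ds = map (\<lambda>_. - s) bs"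
  define c where "c = (\<lambda>p. Poly_Mapping.single (bs ! p) (1 :: 'k))"
  have "c p \<in> N.comps (ds ! p)" if "p < length ds" for p
    using that bs nth_mem[of p bs] by (auto simp: ds_def c_def N.comps_def N.elems_def homog_def)
  moreover have "\<exists>v\<in>vec tdeg ds g. x - (\<Sum>p<length ds. N.act (v p) (c p)) \<in> N.kers g" if x: "x \<in> N.comps g" for g x
  proof -
    define S where "S = {x. \<exists>v\<in>vec tdeg ds g. x = (\<Sum>p<length ds. N.act (v p) (c p))}"
    have "Poly_Mapping.single m a \<in> S" if m: "ydeg m = b" "xdeg m - s = g" for m and a :: 'k
    proof -
      define \<alpha> where "\<alpha> = (\<Sum>i\<in>UNIV. Poly_Mapping.single i (lookup m (Inl i)))"
      have \<alpha>: "lookup \<alpha> i = lookup m (Inl i)" for i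
      proof -
        have "lookup \<alpha> i = (\<Sum>k\<in>UNIV. if k = i then lookup m (Inl k) else 0)"
          unfolding \<alpha>_def lookup_sum by (rule sum.cong) (auto simp: lookup_single when_def)
        then show ?thesis
          by simp
      qed
      define \<beta> where "\<beta> = m - lift_expo \<alpha>"
      have m_eq: "m = lift_expo \<alpha> + \<beta>"
        by (rule poly_mapping_eqI) (auto simp: \<beta>_def lookup_add lookup_minus lookup_lift_expo \<alpha> split: sum.split)
      have "xdeg \<beta> = 0"
        by (simp add: bideg_def \<beta>_def lookup_minus lookup_lift_expo \<alpha>)
      moreover have "bideg m = (tdeg \<alpha>, 0) + bideg \<beta>"
        by (subst m_eq) (simp add: bideg_add bideg_lift_expo)
      ultimately have deg: "ydeg \<beta> = b" "xdeg \<beta> = 0" "tdeg \<alpha> = g + s"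
        using m by auto
      then have "\<beta> \<in> set bs"
        by (simp add: bs)
      then obtain q where q: "q < length bs" "bs ! q = \<beta>"
        by (auto simp: in_set_conv_nth)
      define v where "v = (\<lambda>p. if p = q then Poly_Mapping.single \<alpha> a else 0)"
      have "v \<in> vec tdeg ds g"
        using q(1) deg by (auto simp: v_def vec_def ds_def homog_def)
      moreover have "(\<Sum>p<length ds. N.act (v p) (c p)) = (\<Sum>p<length ds. if p = q then Poly_Mapping.single m a else 0)"
        by (rule sum.cong)
           (auto simp: v_def N.act_def embed_x_single c_def q mult_single m_eq[symmetric] embed_x_0)
      then have "Poly_Mapping.single m a = (\<Sum>p<length ds. N.act (v p) (c p))"
        using q(1) by (simp add: ds_def)
      ultimately show ?thesis
        unfolding S_def by blast
    qed
    moreover have "keys x \<subseteq> {m. ydeg m = b}" "x \<in> homog (\<lambda>m. xdeg m - s) g"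
      using x by (auto simp: N.comps_def N.elems_def)
    ultimately have "(\<Sum>m\<in>keys x. Poly_Mapping.single m (lookup x m)) \<in> S"
    proof (intro sum_closed)
      show "0 \<in> S"
        unfolding S_def by (intro CollectI bexI[of _ 0]) (auto simp: N.act_def embed_x_0 vec_def)
      show "x - y \<in> S" if xy: "x \<in> S" "y \<in> S" for x y
      proof -
        obtain u v where "u \<in> vec tdeg ds g" "v \<in> vec tdeg ds g" "x = (\<Sum>p<length ds. N.act (u p) (c p))"
          "y = (\<Sum>p<length ds. N.act (v p) (c p))"
          using xy unfolding S_def by blast
        then show ?thesis
          unfolding S_def
          by (intro CollectI bexI[of _ "u - v"])
            (auto simp: vec_def N.act_def embed_x_hom algebra_simps sum_subtractf intro: homog_diff)
      qed
    qed (auto simp: homog_def)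
    then have "x \<in> S"
      by (simp flip: poly_mapping_monomials)
    then obtain v where "v \<in> vec tdeg ds g" "x = (\<Sum>p<length ds. N.act (v p) (c p))"
      unfolding S_def by blast
    then show ?thesis
      by (intro bexI[of _ v]) (auto simp: N.kers_def N.comps_def)
  qed
  ultimately show ?thesis
    unfolding finitely_generated_pair_def by blast
qed

section \<open>The modules Tor with the quotient by the x-variables\<close>

lemma var_divisible_eq_Idl:
  "Idl\<^bsub>ring_of_type_algebra\<^esub> (Var ` V) = {h :: ('v, 'k::comm_ring_1) mpoly. var_divisible V h}"
proof
  interpret ring "ring_of_type_algebra :: ('v, 'k) mpoly ring"
    by (rule ring_from_type_algebra)
  have car: "carrier (ring_of_type_algebra :: ('v, 'k) mpoly ring) = UNIV"
    by (simp add: ring_of_type_algebra_def)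
  show "Idl\<^bsub>ring_of_type_algebra\<^esub> (Var ` V) \<subseteq> {h :: ('v, 'k) mpoly. var_divisible V h}"
  proof (rule genideal_minimal)
    show "Var ` V \<subseteq> {h :: ('v, 'k) mpoly. var_divisible V h}"
      using var_divisible_Var_mult[of _ V 1] by auto
    show "ideal {h :: ('v, 'k) mpoly. var_divisible V h} ring_of_type_algebra"
    proof (rule idealI[OF ring_axioms])
      show "subgroup {h :: ('v, 'k) mpoly. var_divisible V h} (add_monoid ring_of_type_algebra)"
      proof (rule group.subgroupI[OF a_group])
        have "(0 :: ('v, 'k) mpoly) \<in> {h. var_divisible V h}"
          by (simp add: var_divisible_def)
        then show "{h :: ('v, 'k) mpoly. var_divisible V h} \<noteq> {}"
          by blast
        show "inv\<^bsub>add_monoid ring_of_type_algebra\<^esub> a \<in> {h. var_divisible V h}"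
          if a: "a \<in> {h. var_divisible V h}" for a :: "('v, 'k) mpoly"
        proof -
          have "\<ominus>\<^bsub>ring_of_type_algebra\<^esub> a = - a"
            by (rule minus_equality) (simp_all add: ring_of_type_algebra_def)
          then show ?thesis
            using a unfolding a_inv_def by (simp add: var_divisible_def Poly_Mapping.keys_minus)
        qed
      qed (auto simp: ring_of_type_algebra_def intro: var_divisible_add)
    qed (auto simp: ring_of_type_algebra_def intro: var_divisible_mult,
        subst mult.commute, rule var_divisible_mult)
  qed
  interpret I: ideal "Idl\<^bsub>ring_of_type_algebra\<^esub> (Var ` V)" "ring_of_type_algebra :: ('v, 'k) mpoly ring"
    by (rule genideal_ideal) (simp add: car)
  show "{h :: ('v, 'k) mpoly. var_divisible V h} \<subseteq> Idl\<^bsub>ring_of_type_algebra\<^esub> (Var ` V)"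
  proof
    fix h :: "('v, 'k) mpoly" assume h: "h \<in> {h. var_divisible V h}"
    have mono: "\<forall>m\<in>keys h. Poly_Mapping.single m (lookup h m) \<in> Idl\<^bsub>ring_of_type_algebra\<^esub> (Var ` V)"
    proof
      fix m assume m: "m \<in> keys h"
      obtain v where v: "v \<in> V" "lookup m v \<noteq> 0"
        using h m by (auto simp: var_divisible_def)
      have "Poly_Mapping.single m (lookup h m) = Poly_Mapping.single (m - expo v) (lookup h m) * Var v"
        using exponent_split[OF v(2)] by (simp add: Var_expo mult_single add.commute)
      moreover have "(Var v :: ('v, 'k) mpoly) \<in> Idl\<^bsub>ring_of_type_algebra\<^esub> (Var ` V)"
        using genideal_self[of "Var ` V"] v(1) by (auto simp: car)
      ultimately show "Poly_Mapping.single m (lookup h m) \<in> Idl\<^bsub>ring_of_type_algebra\<^esub> (Var ` V)"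
        using I.I_l_closed[of "Var v"] by (simp add: ring_of_type_algebra_def)
    qed
    have zero: "0 \<in> Idl\<^bsub>ring_of_type_algebra\<^esub> (Var ` V :: ('v, 'k) mpoly set)"
      using I.zero_closed by (simp add: ring_of_type_algebra_def)
    have add: "p + q \<in> Idl\<^bsub>ring_of_type_algebra\<^esub> (Var ` V)"
      if "p \<in> Idl\<^bsub>ring_of_type_algebra\<^esub> (Var ` V)" "q \<in> Idl\<^bsub>ring_of_type_algebra\<^esub> (Var ` V)" for p q :: "('v, 'k) mpoly"
      using I.a_closed[OF that] by (simp add: ring_of_type_algebra_def)
    have "(\<forall>m\<in>B. F m \<in> Idl\<^bsub>ring_of_type_algebra\<^esub> (Var ` V)) \<Longrightarrow> sum F B \<in> Idl\<^bsub>ring_of_type_algebra\<^esub> (Var ` V)"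
      for B and F :: "_ \<Rightarrow> ('v, 'k) mpoly"
      by (induction B rule: infinite_finite_induct) (auto intro: zero add)
    from this[OF mono] show "h \<in> Idl\<^bsub>ring_of_type_algebra\<^esub> (Var ` V)"
      by (simp flip: poly_mapping_monomials)
  qed
qed

lemma (in grading) var_divisible_ideal:
  "homogeneous_ideal dg {h :: ('v, 'k::comm_ring_1) mpoly. var_divisible V h}"
  by unfold_locales (auto intro: var_divisible_diff var_divisible_mult, auto simp: var_divisible_def hcomp_def keys_restr)

text \<open>The Koszul homology of \<open>S/J\<close> with respect to the variables \<open>vs\<close>.\<close>

definition koszul_vanishes ::
    "('n::finite + 'm::finite, 'k::field) mpoly set \<Rightarrow> ('n + 'm) list \<Rightarrow> nat \<Rightarrow> int \<times> int \<Rightarrow> bool"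
  where "koszul_vanishes J vs i g \<longleftrightarrow>
    homology_zero (*) (homog bideg) (\<lambda>g. homog bideg g \<inter> J) (koszul (var_seq bideg vs)) i g"

context
  fixes J :: "('n::finite + 'm::finite, 'k::field) mpoly set"
  assumes J: "homogeneous_ideal bideg J"
begin

lemma algebra_presented:
  "presented bideg (bigraded_algebra J) UNIV bideg (\<lambda>r. r) (homogeneous_ideal.coset bideg J)"
  unfolding bigraded_algebra_def by (rule homogeneous_ideal.quot_presented[OF J])

lemma algebra_pair:
  "presented.act (\<lambda>r. r :: ('n + 'm, 'k) mpoly) = (*)"
  "presented.comps UNIV bideg = (homog bideg :: _ \<Rightarrow> ('n + 'm, 'k) mpoly set)"
  "presented.kers UNIV bideg (homogeneous_ideal.coset bideg J) = (\<lambda>g. homog bideg g \<inter> J)"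
  using presented_explicit[OF algebra_presented] homogeneous_ideal.coset_zero_iff[OF J]
  by (auto simp: fun_eq_iff)

theorem tor_algebra_residue:
  assumes "distinct vs" "set vs = UNIV"
  shows "gpart (Tor bideg (bigraded_algebra J) residue_module i) g = {\<zero>\<^bsub>Tor bideg (bigraded_algebra J) residue_module i\<^esub>}
    \<longleftrightarrow> koszul_vanishes J vs i g"
  using tor_residue_koszul[OF algebra_presented homogeneous_ideal.quot_generated[OF J] assms]
  unfolding algebra_pair koszul_vanishes_def .

text \<open>Here the Koszul complex resolves the first argument, like the chosen resolution.  Both are compared
  with a resolution of \<open>S/J\<close>, so that balancing is used twice.  The second part reads injectivity of
  \<open>y\<close> off the strand of the submodule annihilated by it.\<close>

theorem tor_x_koszul:
  fixes xs :: "'n list"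
  assumes xs: "distinct xs" "set xs = UNIV"
  shows "gpart (Tor_x (bigraded_algebra J) i) g = {\<zero>\<^bsub>Tor_x (bigraded_algebra J) i\<^esub>}
      \<longleftrightarrow> koszul_vanishes J (map Inl xs) i g" (is ?vanishes)
    and "y \<in> homog bideg (0, 1) \<Longrightarrow>
      carrier (strand (annihilated (Tor_x (bigraded_algebra J) i) y) b) = {\<zero>\<^bsub>Tor_x (bigraded_algebra J) i\<^esub>} \<Longrightarrow>
      koszul_vanishes J (map Inl xs) i (a, b + 1) \<Longrightarrow> koszul_vanishes J (map Inl xs) i (a, b)"
proof -
  interpret bideg: grading "bideg :: ('n + 'm \<Rightarrow>\<^sub>0 nat) \<Rightarrow> int \<times> int"
    by (rule bideg_grading)
  let ?R = "bigraded_algebra J"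
  define XX :: "('n + 'm, 'k) mpoly set" where "XX = {h. var_divisible (range Inl) h}"
  have XX: "homogeneous_ideal bideg XX"
    unfolding XX_def by (rule bideg.var_divisible_ideal)
  have X_Idl: "Idl\<^bsub>ring_of_type_algebra\<^esub> (range (\<lambda>i. Var (Inl i))) = XX"
    using var_divisible_eq_Idl[of "range Inl"] by (simp add: XX_def image_image)
  have PX: "presented bideg (bigraded_algebra XX) UNIV bideg (\<lambda>r. r) (homogeneous_ideal.coset bideg XX)"
    unfolding bigraded_algebra_def by (rule homogeneous_ideal.quot_presented[OF XX])
  have pairX: "presented.kers UNIV bideg (homogeneous_ideal.coset bideg XX) = (var_ideal bideg (range Inl) :: _ \<Rightarrow> ('n + 'm, 'k) mpoly set)"
    using presented_explicit(3)[OF PX] homogeneous_ideal.coset_zero_iff[OF XX]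
    by (auto simp: fun_eq_iff var_ideal_def XX_def)
  obtain F :: "(('n + 'm, 'k) mpoly, ('n + 'm, 'k) mpoly set, int \<times> int) free_complex" and c
    where Tor: "\<And>i. Tor bideg (bigraded_algebra XX) ?R i = quot (submod (free_tensor (res_degs F i) ?R) (cycles F ?R i)) (boundaries F ?R i)"
    and F: "resolves (homog bideg) (complex_of F) (*) (homog bideg) (var_ideal bideg (range Inl)) c"
    by (rule chosen_resolution[OF PX homogeneous_ideal.quot_generated[OF XX], where M = ?R])
      (unfold algebra_pair pairX, blast)
  interpret R: presented_tor bideg ?R UNIV bideg "\<lambda>r. r" "homogeneous_ideal.coset bideg J" F
    by (rule presented_tor_of_resolves[OF algebra_presented F])
  obtain G :: "(('n + 'm, 'k) mpoly, ('n + 'm, 'k) mpoly set, int \<times> int) free_complex" and c'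
    where G: "resolves (homog bideg) (complex_of G) (*) (homog bideg) (\<lambda>g. homog bideg g \<inter> J) c'"
    by (rule chosen_resolution[OF algebra_presented homogeneous_ideal.quot_generated[OF J], where M = ?R])
      (unfold algebra_pair, blast)
  have K: "resolves (homog bideg) (koszul (var_seq bideg (map Inl xs))) (*) (homog bideg)
      (var_ideal bideg (range Inl) :: _ \<Rightarrow> ('n + 'm, 'k) mpoly set) (\<lambda>_. 1)"
    using bideg.koszul_resolves[of "map Inl xs"] xs by (simp add: distinct_map)
  have iff: "homology_zero R.act R.comps R.kers (complex_of F) i g \<longleftrightarrow> koszul_vanishes J (map Inl xs) i g" for g
    unfolding algebra_pair koszul_vanishes_def
    using homology_zero_balanced[OF F G, of i g] homology_zero_balanced[OF K G, of i g] by simp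
  have tor: "Tor_x ?R i = R.tor i"
    unfolding Tor_x_def X_Idl by (rule Tor)
  show ?vanishes
    unfolding tor R.tor_vanishes_iff by (rule iff)
  assume y: "y \<in> homog bideg (0, 1)"
    and ann: "carrier (strand (annihilated (Tor_x ?R i) y) b) = {\<zero>\<^bsub>Tor_x ?R i\<^esub>}"
    and van: "koszul_vanishes J (map Inl xs) i (a, b + 1)"
  have "homology_zero R.act R.comps R.kers (complex_of F) i (a, b)"
  proof (rule R.homology_zero_along_injective[OF y])
    show "homology_zero R.act R.comps R.kers R.K i ((0, 1) + (a, b))"
      using van by (simp add: iff add.commute)
    fix t assume t: "t \<in> gpart (R.tor i) (a, b)" and yt: "y \<odot>\<^bsub>R.tor i\<^esub> t = \<zero>\<^bsub>R.tor i\<^esub>"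
    let ?A = "annihilated (R.tor i) y"
    interpret A: abelian_group ?A
      by (rule R.abelian_group_annihilated)
    have "t \<in> carrier (R.tor i)"
      using t unfolding R.tor_ops(1,5) by blast
    then have tA: "t \<in> carrier ?A" and tg: "t \<in> gpart ?A (a, b)"
      using t yt by (simp_all add: annihilated_simps)
    have "finsum ?A (\<lambda>_. t) {a} = t"
      using A.finsum_insert[of "{}" a "\<lambda>_. t"] tA by simp
    then have "t \<in> carrier (strand ?A b)"
      unfolding strand_def using tg by (auto intro!: exI[of _ "\<lambda>_. t"] exI[of _ "{a}"])
    then show "t = \<zero>\<^bsub>R.tor i\<^esub>"
      using ann unfolding tor by blast
  qed
  then show "koszul_vanishes J (map Inl xs) i (a, b)"
    unfolding iff .
qed

end

section \<open>The ideal of the Rees algebra\<close>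

definition rees_ideal :: "('m::finite \<Rightarrow> ('n::finite, 'k::field) mpoly) \<Rightarrow> ('n + 'm, 'k) mpoly set"
  where "rees_ideal f = a_kernel ring_of_type_algebra ring_of_type_algebra (rees_map f)"

interpretation rees: substitution "\<lambda>c. [:Const c:]"
    "case_sum (\<lambda>i. [:Var i:]) (\<lambda>j. Polynomial.monom (f j) 1) :: 'n + 'm \<Rightarrow> ('n, 'k::field) mpoly poly"
  rewrites "substitute (\<lambda>c. [:Const c:]) (case_sum (\<lambda>i. [:Var i:]) (\<lambda>j. Polynomial.monom (f j) 1)) = rees_map f"
  for f
  by unfold_locales (simp_all add: Const_hom rees_map_def one_pCons)

lemma monom_power: "Polynomial.monom p k ^ n = Polynomial.monom (p ^ n) (k * n)"
  for p :: "'a::comm_ring_1"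
  by (induction n) (simp_all add: mult_monom)

lemma prod_monom: "finite A \<Longrightarrow> (\<Prod>i\<in>A. Polynomial.monom (p i) (n i)) = Polynomial.monom (\<Prod>i\<in>A. p i) (\<Sum>i\<in>A. n i)"
  for p :: "'i \<Rightarrow> 'a::comm_ring_1"
  by (induction A rule: finite_induct) (simp_all add: mult_monom)

lemma rees_map_single:
  fixes f :: "'m::finite \<Rightarrow> ('n::finite, 'k::field) mpoly"
  shows "rees_map f (Poly_Mapping.single m a) = Polynomial.monom (ev f (Poly_Mapping.single m a)) (nat (ydeg m))"
proof -
  let ?s = "case_sum (\<lambda>i. [:Var i:]) (\<lambda>j. Polynomial.monom (f j) 1) :: 'n + 'm \<Rightarrow> ('n, 'k) mpoly poly"
  have mv: "mono_value ?s m = Polynomial.monom (\<Prod>i\<in>UNIV. (Var i :: ('n, 'k) mpoly) ^ lookup m (Inl i)) 0 *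
      Polynomial.monom (\<Prod>j\<in>UNIV. f j ^ lookup m (Inr j)) (nat (ydeg m))"
  proof -
    have "mono_value ?s m = (\<Prod>v\<in>UNIV <+> UNIV. ?s v ^ lookup m v)"
      by (rule mono_value_superset) auto
    also have "\<dots> = (\<Prod>i\<in>UNIV. [:Var i:] ^ lookup m (Inl i)) * (\<Prod>j\<in>UNIV. Polynomial.monom (f j) 1 ^ lookup m (Inr j))"
    by (subst prod.Plus) auto
  also have "(\<Prod>i\<in>UNIV. [:Var i:] ^ lookup m (Inl i)) = Polynomial.monom (\<Prod>i\<in>UNIV. (Var i :: ('n, 'k) mpoly) ^ lookup m (Inl i)) 0"
    unfolding monom_0[symmetric] monom_power by (subst prod_monom) simp_all
  also have "(\<Prod>j\<in>UNIV. Polynomial.monom (f j) 1 ^ lookup m (Inr j)) =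
      Polynomial.monom (\<Prod>j\<in>UNIV. f j ^ lookup m (Inr j)) (nat (ydeg m))"
    unfolding monom_power by (subst prod_monom) (simp_all add: bideg_def del: of_nat_sum)
  finally show ?thesis .
  qed
  show ?thesis
    unfolding rees.sub_single ev_single mv unfolding monom_0[symmetric] mult_monom by simp
qed

lemma poly_mapping_sum_induct:
  fixes h :: "'m \<Rightarrow>\<^sub>0 'k::comm_monoid_add"
  assumes "\<And>m. m \<in> keys h \<Longrightarrow> Q (Poly_Mapping.single m (lookup h m))" and "Q 0"
    and "\<And>p q. Q p \<Longrightarrow> Q q \<Longrightarrow> Q (p + q)"
  shows "Q h"
proof -
  have "finite B \<Longrightarrow> (\<forall>m\<in>B. Q (F m)) \<Longrightarrow> Q (sum F B)" for B and F :: "'m \<Rightarrow> 'm \<Rightarrow>\<^sub>0 'k"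
    by (induction B rule: finite_induct) (auto intro: assms)
  from this[of "keys h" "\<lambda>m. Poly_Mapping.single m (lookup h m)"] show ?thesis
    using assms(1) by (simp flip: poly_mapping_monomials)
qed

text \<open>The part of degree \<open>b\<close> in the y-variables; its value is the coefficient of \<open>t\<^sup>b\<close> in the image under
  the Rees homomorphism.\<close>

definition ypart :: "nat \<Rightarrow> ('n::finite + 'm::finite, 'k::zero) mpoly \<Rightarrow> ('n + 'm, 'k) mpoly"
  where "ypart b h = restr {m. ydeg m = int b} h"

lemma ypart_add: "ypart b (p + q) = ypart b p + ypart b q"
  for p :: "('n::finite + 'm::finite, 'k::ab_group_add) mpoly"
  by (simp add: ypart_def restr_add)

lemma ypart_id: "h \<in> ystrand b \<Longrightarrow> ypart b h = h"
  unfolding ypart_def ystrand_def by (rule restr_all) auto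

lemma ypart_other: "h \<in> ystrand c \<Longrightarrow> c \<noteq> b \<Longrightarrow> ypart b h = 0"
  unfolding ypart_def ystrand_def by (rule restr_none) auto

lemma single_ystrand: "Poly_Mapping.single m a \<in> ystrand (nat (ydeg m))"
  using bideg_nonneg(2)[of m] by (auto simp: ystrand_def)

lemma hcomp_ystrand: "x \<in> ystrand b \<Longrightarrow> hcomp e g x \<in> ystrand b"
  by (auto simp: ystrand_def hcomp_def keys_restr)

lemma hcomp_ypart: "hcomp bideg (a, int b) h = hcomp (\<lambda>m. xdeg m + ydeg m * t) (a + int b * t) (ypart b h)"
  by (rule poly_mapping_eqI) (auto simp: hcomp_def ypart_def lookup_restr prod_eq_iff)

lemma hcomp_negative: "b < 0 \<Longrightarrow> hcomp bideg (a, b) h = 0"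
  unfolding hcomp_def by (rule restr_none) (metis (mono_tags, lifting) bideg_nonneg(2) disjoint_iff mem_Collect_eq not_le snd_conv)

lemma coeff_rees_map:
  fixes f :: "'m::finite \<Rightarrow> ('n::finite, 'k::field) mpoly"
  shows "coeff (rees_map f h) b = ev f (ypart b h)"
proof (rule poly_mapping_sum_induct[where h = h and Q = "\<lambda>h. coeff (rees_map f h) b = ev f (ypart b h)"])
  fix m
  let ?x = "Poly_Mapping.single m (lookup h m)"
  show "coeff (rees_map f ?x) b = ev f (ypart b ?x)"
  proof (cases "nat (ydeg m) = b")
    case True
    then have "?x \<in> ystrand b"
      using single_ystrand by metis
    then show ?thesis
      using True by (simp add: rees_map_single ypart_id)
  next
    case False
    then have "ypart b ?x = 0"
      by (rule ypart_other[OF single_ystrand])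
    then show ?thesis
      using False by (simp add: rees_map_single)
  qed
qed (simp_all add: ypart_add ev.sub_add rees.sub_add, simp add: ypart_def)

lemma rees_ideal_iff: "h \<in> rees_ideal f \<longleftrightarrow> (\<forall>b. ev f (ypart b h) = 0)"
proof -
  have "h \<in> rees_ideal f \<longleftrightarrow> rees_map f h = 0"
    by (simp add: rees_ideal_def a_kernel_def' ring_of_type_algebra_def)
  then show ?thesis
    by (simp add: poly_eq_iff coeff_rees_map)
qed

lemma rees_ideal_iff_zero: "h \<in> rees_ideal f \<longleftrightarrow> rees_map f h = 0"
  by (simp add: rees_ideal_def a_kernel_def' ring_of_type_algebra_def)

lemma rees_ideal_ystrand: "h \<in> ystrand b \<Longrightarrow> h \<in> rees_ideal f \<longleftrightarrow> ev f h = 0"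
  unfolding rees_ideal_iff by (metis ypart_id ypart_other ev.sub_0)

lemma bihomogeneous_if_strands:
  fixes f :: "'m::finite \<Rightarrow> ('n::finite, 'k::field) mpoly"
  assumes f: "\<And>j. f j \<in> homog tdeg (int d)" and "ev f (ypart b h) = 0"
  shows "ev f (hcomp bideg (a, int b) h) = 0"
  unfolding hcomp_ypart[of a b h "int d"] hcomp_ev[of f d, OF f, symmetric] assms(2) by (simp add: hcomp_def)

theorem rees_homogeneous_ideal:
  fixes f :: "'m::finite \<Rightarrow> ('n::finite, 'k::field) mpoly"
  assumes f: "\<And>j. f j \<in> homog tdeg (int d)"
  shows "homogeneous_ideal bideg (rees_ideal f)"
proof -
  interpret grading "bideg :: ('n + 'm \<Rightarrow>\<^sub>0 nat) \<Rightarrow> int \<times> int" by (rule bideg_grading)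
  show ?thesis
  proof unfold_locales
    fix h :: "('n + 'm, 'k) mpoly" and g :: "int \<times> int" assume h: "h \<in> rees_ideal f"
    obtain a b where g: "g = (a, b)" by (cases g)
    show "hcomp bideg g h \<in> rees_ideal f"
    proof (cases "b < 0")
      case True
      then show ?thesis
        by (simp add: g hcomp_negative rees_ideal_iff_zero)
    next
      case False
      then obtain n where n: "b = int n"
        by (metis nonneg_int_cases not_le)
      have "ev f (hcomp bideg (a, int n) h) = 0"
        using bihomogeneous_if_strands[of f d n h a, OF f] h by (simp add: rees_ideal_iff)
      moreover have "hcomp bideg (a, int n) h \<in> ystrand n"
        by (auto simp: ystrand_def hcomp_def keys_restr)
      ultimately show ?thesis
        by (simp add: g n rees_ideal_ystrand)
    qed
  qed (auto simp: rees_ideal_iff_zero rees.sub_diff rees.sub_mult)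
qed

section \<open>The ideal of the symmetric algebra\<close>

text \<open>These generate the ideal of the symmetric algebra.\<close>

definition linear_relations :: "('m::finite \<Rightarrow> ('n::finite, 'k::field) mpoly) \<Rightarrow> ('n + 'm, 'k) mpoly set"
  where "linear_relations f = {x \<in> ystrand 1. ev f x = 0}"

definition sym_kernel :: "('m::finite \<Rightarrow> ('n::finite, 'k::field) mpoly) \<Rightarrow> ('n + 'm, 'k) mpoly set"
  where "sym_kernel f = a_kernel ring_of_type_algebra (free_algebra (gen_ideal f) Quot sym_ideal (gen_ideal f)) (sym_map f)"

text \<open>The representative in the free algebra on \<open>I\<close> of the image of a polynomial in the symmetric
  algebra.\<close>

definition tsub :: "('m \<Rightarrow> ('n, 'k::field) mpoly) \<Rightarrow> ('n + 'm, 'k) mpoly \<Rightarrow> (('n, 'k) mpoly, ('n, 'k) mpoly) mpoly"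
  where "tsub f = substitute (\<lambda>c. Const (Const c)) (case_sum (\<lambda>i. Const (Var i)) (\<lambda>j. Var (f j)))"

interpretation tsub: substitution "\<lambda>c. Const (Const c)"
    "case_sum (\<lambda>i. Const (Var i)) (\<lambda>j. Var (f j)) :: 'n + 'm \<Rightarrow> (('n, 'k::field) mpoly, ('n, 'k) mpoly) mpoly"
  rewrites "substitute (\<lambda>c. Const (Const c)) (case_sum (\<lambda>i. Const (Var i)) (\<lambda>j. Var (f j))) = tsub f"
  for f
  by unfold_locales (simp_all add: Const_hom tsub_def)

lemma mpoly_induct [case_names Const Var add mult]:
  fixes h :: "('v, 'k::comm_ring_1) mpoly"
  assumes C: "\<And>c. Q (Const c)" and V: "\<And>v. Q (Var v)"
    and add: "\<And>p q. Q p \<Longrightarrow> Q q \<Longrightarrow> Q (p + q)" and mult: "\<And>p q. Q p \<Longrightarrow> Q q \<Longrightarrow> Q (p * q)"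
  shows "Q h"
proof (rule poly_mapping_sum_induct)
  have one: "Q 1"
    using C[of 1] by (simp add: Const_hom)
  show "Q 0"
    using C[of 0] by (simp add: Const_hom)
  fix m
  have pow: "Q (p ^ n)" if "Q p" for p :: "('v, 'k) mpoly" and n
    using that by (induction n) (auto intro: one mult)
  have "finite A \<Longrightarrow> Q (\<Prod>v\<in>A. Var v ^ lookup m v)" for A
    by (induction A rule: finite_induct) (auto intro: one mult pow V)
  then have "Q (mono_value Var m)"
    by (simp add: mono_value_def)
  moreover have "mono_value Var m = (Poly_Mapping.single m 1 :: ('v, 'k) mpoly)"
    by (simp add: mono_value_Var flip: poly_mapping_monomials)
  ultimately have "Q (Const (lookup h m) * Poly_Mapping.single m 1)"
    using C mult by simp
  then show "Q (Poly_Mapping.single m (lookup h m))"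
    by (simp add: Const_def mult_single)
qed (rule add)

context
  fixes f :: "'m::finite \<Rightarrow> ('n::finite, 'k::field) mpoly"
begin

abbreviation (input) "Ig \<equiv> gen_ideal f"
abbreviation (input) "FA \<equiv> free_algebra Ig"
abbreviation (input) "SI \<equiv> sym_ideal Ig"

lemma FA_ops: "x \<oplus>\<^bsub>FA\<^esub> y = x + y" "x \<otimes>\<^bsub>FA\<^esub> y = x * y" "\<zero>\<^bsub>FA\<^esub> = 0" "\<one>\<^bsub>FA\<^esub> = 1"
  "carrier FA = {p. \<forall>m\<in>keys p. keys m \<subseteq> Ig}"
  by (simp_all add: free_algebra_def ring_of_type_algebra_def)

lemma FA_closed:
  "0 \<in> carrier FA" "1 \<in> carrier FA" "p \<in> carrier FA \<Longrightarrow> q \<in> carrier FA \<Longrightarrow> p + q \<in> carrier FA"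
  "p \<in> carrier FA \<Longrightarrow> q \<in> carrier FA \<Longrightarrow> p * q \<in> carrier FA" "p \<in> carrier FA \<Longrightarrow> - p \<in> carrier FA"
  "Const c \<in> carrier FA" "g \<in> Ig \<Longrightarrow> Var g \<in> carrier FA"
proof -
  show "p + q \<in> carrier FA" if "p \<in> carrier FA" "q \<in> carrier FA"
    using that Poly_Mapping.keys_add[of p q] unfolding FA_ops by blast
  show "p * q \<in> carrier FA" if p: "p \<in> carrier FA" and q: "q \<in> carrier FA"
    unfolding FA_ops
  proof (intro CollectI ballI)
    fix m assume "m \<in> keys (p * q)"
    then obtain a b where ab: "a \<in> keys p" "b \<in> keys q" "m = a + b"
      using keys_mult_subset by blast
    have "keys (a + b) \<subseteq> keys a \<union> keys b"
      by (rule Poly_Mapping.keys_add)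
    then show "keys m \<subseteq> Ig"
      using ab p q unfolding FA_ops by blast
  qed
qed (auto simp: FA_ops Poly_Mapping.keys_minus Const_def Var_def)

lemma FA_ring: "ring FA"
proof (rule ringI)
  show "abelian_group FA"
  proof (rule abelian_groupI)
    show "\<exists>y\<in>carrier FA. y \<oplus>\<^bsub>FA\<^esub> x = \<zero>\<^bsub>FA\<^esub>" if "x \<in> carrier FA" for x
      by (rule bexI[of _ "- x"]) (use that FA_closed(5) in \<open>simp_all add: FA_ops(1,3)\<close>)
  qed (use FA_closed(1,3) in \<open>simp_all add: FA_ops(1,3) algebra_simps\<close>)
  show "Group.monoid FA"
    by (rule monoidI) (use FA_closed(2,4) in \<open>simp_all add: FA_ops(2,4) algebra_simps\<close>)
qed (simp_all add: FA_ops(1,2) algebra_simps)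

lemma gen_ideal_closed: "0 \<in> Ig" "g \<in> Ig \<Longrightarrow> h \<in> Ig \<Longrightarrow> g + h \<in> Ig" "g \<in> Ig \<Longrightarrow> a * g \<in> Ig" "f j \<in> Ig"
proof -
  interpret ring "ring_of_type_algebra :: ('n, 'k) mpoly ring"
    by (rule ring_from_type_algebra)
  interpret I: ideal Ig "ring_of_type_algebra :: ('n, 'k) mpoly ring"
    using ev_ystrand_ideal[of f 1] by (simp add: gen_ideal_eq)
  have "\<zero>\<^bsub>ring_of_type_algebra\<^esub> = (0 :: ('n, 'k) mpoly)" by (simp add: ring_of_type_algebra_def)
  then show "0 \<in> Ig" using additive_subgroup.zero_closed[OF ideal.axioms(1)[OF I.ideal_axioms]] by metis
  show "g + h \<in> Ig" if "g \<in> Ig" "h \<in> Ig" using I.a_closed[OF that] by (simp add: ring_of_type_algebra_def)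
  show "a * g \<in> Ig" if "g \<in> Ig" using I.I_l_closed[OF that, of a] by (simp add: ring_of_type_algebra_def)
  show "f j \<in> Ig"
    unfolding gen_ideal_eq by (rule image_eqI[of _ _ "Var (Inr j)"]) (simp, simp add: ystrand_def Var_expo bideg_expo)
qed

lemma relations_carrier: "sym_relations Ig \<subseteq> carrier FA"
proof -
  have minus: "p - q \<in> carrier FA" if "p \<in> carrier FA" "q \<in> carrier FA" for p q
    using FA_closed(3)[OF that(1) FA_closed(5)[OF that(2)]] by simp
  show ?thesis
    unfolding sym_relations_def
    by (auto intro!: minus FA_closed(3,4,6,7) gen_ideal_closed(2,3))
qed

lemma SI_ideal: "ideal SI FA"
  unfolding sym_ideal_def by (rule ring.genideal_ideal[OF FA_ring relations_carrier])

lemma SI_closed: "0 \<in> SI" "p \<in> SI \<Longrightarrow> q \<in> SI \<Longrightarrow> p + q \<in> SI" "p \<in> SI \<Longrightarrow> r \<in> carrier FA \<Longrightarrow> r * p \<in> SI"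
  "p \<in> SI \<Longrightarrow> - p \<in> SI" "p \<in> SI \<Longrightarrow> q \<in> SI \<Longrightarrow> p - q \<in> SI" "SI \<subseteq> carrier FA"
proof -
  interpret ring FA by (rule FA_ring)
  interpret S: ideal SI FA by (rule SI_ideal)
  show "0 \<in> SI" using additive_subgroup.zero_closed[OF ideal.axioms(1)[OF SI_ideal]] unfolding FA_ops(3) .
  show add: "p + q \<in> SI" if "p \<in> SI" "q \<in> SI" for p q using S.a_closed[OF that] by (simp add: FA_ops)
  show mult: "r * p \<in> SI" if "p \<in> SI" "r \<in> carrier FA" for p r using S.I_l_closed[OF that] by (simp add: FA_ops)
  show neg: "- p \<in> SI" if "p \<in> SI" for p
    using mult[OF that FA_closed(5)[OF FA_closed(2)]] by simp
  show "p - q \<in> SI" if "p \<in> SI" "q \<in> SI"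
    using add[OF that(1) neg[OF that(2)]] by simp
  show "SI \<subseteq> carrier FA" by (rule S.a_subset)
qed

lemma SI_relations:
  "g \<in> Ig \<Longrightarrow> h \<in> Ig \<Longrightarrow> Var (g + h) - (Var g + Var h) \<in> SI" "g \<in> Ig \<Longrightarrow> Var (a * g) - Const a * Var g \<in> SI"
  using ring.genideal_self[OF FA_ring relations_carrier] unfolding sym_ideal_def sym_relations_def by blast+

lemma tsub_carrier: "tsub f h \<in> carrier FA"
proof (induction h rule: mpoly_induct)
  case (Var v)
  then show ?case
    using FA_closed(6,7) gen_ideal_closed(4) by (cases v) auto
qed (use FA_closed in \<open>auto simp: tsub.sub_add tsub.sub_mult\<close>)

lemma sym_kernel_iff: "h \<in> sym_kernel f \<longleftrightarrow> tsub f h \<in> SI"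
proof -
  interpret S: ideal SI FA by (rule SI_ideal)
  have "h \<in> sym_kernel f \<longleftrightarrow> SI +>\<^bsub>FA\<^esub> tsub f h = SI"
    by (simp add: sym_kernel_def a_kernel_def' FactRing_def sym_map_def tsub_def ring_of_type_algebra_def)
  also have "\<dots> \<longleftrightarrow> tsub f h \<in> SI"
    using S.a_rcos_self[OF tsub_carrier] S.a_coset_join2[OF tsub_carrier S.a_subgroup] by metis
  finally show ?thesis .
qed

text \<open>A monomial of y-degree 1 is a monomial in the x-variables times some \<open>y\<^sub>k\<close>, and the relations
  \<open>T\<^sub>a\<^sub>g = a T\<^sub>g\<close> of the symmetric algebra absorb the coefficient; sums are handled by
  \<open>T\<^sub>g\<^sub>+\<^sub>h = T\<^sub>g + T\<^sub>h\<close>.\<close>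

lemma tsub_linear: "x \<in> ystrand 1 \<Longrightarrow> tsub f x - Var (ev f x) \<in> SI \<and> ev f x \<in> Ig"
proof -
  assume x: "x \<in> ystrand 1"
  have zero: "Var 0 \<in> SI"
    using SI_relations(2)[OF gen_ideal_closed(1), of 0] by (simp add: Const_hom)
  show ?thesis
  proof (rule poly_mapping_sum_induct[where h = x and Q = "\<lambda>x. tsub f x - Var (ev f x) \<in> SI \<and> ev f x \<in> Ig"])
    fix m assume "m \<in> keys x"
    then have "ydeg m = int (Suc 0)"
      using x by (auto simp: ystrand_def)
    then obtain k m' where m: "m = m' + expo (Inr k)" "ydeg m' = int 0"
      by (rule ydeg_split)
    define p where "p = Poly_Mapping.single m' (lookup x m)"
    have sp: "Poly_Mapping.single m (lookup x m) = p * Var (Inr k)"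
      by (simp add: p_def m(1) Var_expo mult_single)
    have p: "tsub f p = Const (ev f p)"
    proof -
      have y0: "lookup m' (Inr j) = 0" for j
        using m(2) by (simp add: bideg_def del: of_nat_sum)
      define \<alpha> where "\<alpha> = (\<Sum>i\<in>UNIV. Poly_Mapping.single i (lookup m' (Inl i)))"
      have "lookup \<alpha> i = lookup m' (Inl i)" for i
      proof -
        have "lookup \<alpha> i = (\<Sum>k\<in>UNIV. if k = i then lookup m' (Inl k) else 0)"
          unfolding \<alpha>_def lookup_sum by (rule sum.cong) (auto simp: lookup_single when_def)
        then show ?thesis
          by simp
      qed
      then have "m' = lift_expo \<alpha>"
        by (intro poly_mapping_eqI) (auto simp: lookup_lift_expo y0 split: sum.split)
      then have p_eq: "p = embed_x (Poly_Mapping.single \<alpha> (lookup x m))"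
        by (simp add: p_def embed_x_single)
      have "tsub f (embed_x h) = Const h" for h
        by (induction h rule: mpoly_induct)
          (simp_all add: embed_x_def tsub.sub_add tsub.sub_mult embed.sub_add embed.sub_mult Const_hom)
      then show ?thesis
        by (simp add: p_eq ev_embed_x)
    qed
    show "tsub f (Poly_Mapping.single m (lookup x m)) - Var (ev f (Poly_Mapping.single m (lookup x m))) \<in> SI \<and>
        ev f (Poly_Mapping.single m (lookup x m)) \<in> Ig"
      unfolding sp using SI_closed(4)[OF SI_relations(2)[OF gen_ideal_closed(4), of "ev f p" k]]
      by (simp add: tsub.sub_mult ev.sub_mult p gen_ideal_closed(3,4))
  next
    show "tsub f 0 - Var (ev f 0) \<in> SI \<and> ev f 0 \<in> Ig"
      using SI_closed(4)[OF zero] by (simp add: gen_ideal_closed(1))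
  next
    fix p q
    assume p: "tsub f p - Var (ev f p) \<in> SI \<and> ev f p \<in> Ig" and q: "tsub f q - Var (ev f q) \<in> SI \<and> ev f q \<in> Ig"
    have "tsub f p - Var (ev f p) + (tsub f q - Var (ev f q)) - (Var (ev f p + ev f q) - (Var (ev f p) + Var (ev f q))) \<in> SI"
      by (rule SI_closed(5)[OF SI_closed(2)[OF conjunct1[OF p] conjunct1[OF q]]
          SI_relations(1)[OF conjunct2[OF p] conjunct2[OF q]]])
    then show "tsub f (p + q) - Var (ev f (p + q)) \<in> SI \<and> ev f (p + q) \<in> Ig"
      using p q by (simp add: tsub.sub_add ev.sub_add gen_ideal_closed(2) algebra_simps)
  qed
qed

lemma sym_kernel_ideal: "0 \<in> sym_kernel f" "p \<in> sym_kernel f \<Longrightarrow> q \<in> sym_kernel f \<Longrightarrow> p - q \<in> sym_kernel f"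
  "p \<in> sym_kernel f \<Longrightarrow> r * p \<in> sym_kernel f"
  using SI_closed(1,3,5) tsub_carrier by (auto simp: sym_kernel_iff tsub.sub_diff tsub.sub_mult)

lemma linear_relations_sym_kernel: "linear_relations f \<subseteq> sym_kernel f"
proof
  fix x assume x: "x \<in> linear_relations f"
  have "Var 0 \<in> SI"
    using SI_relations(2)[OF gen_ideal_closed(1), of 0] by (simp add: Const_hom)
  moreover have "tsub f x - Var 0 \<in> SI"
    using tsub_linear[of x] x by (auto simp: linear_relations_def)
  ultimately have "tsub f x - Var 0 + Var 0 \<in> SI"
    by (rule SI_closed(2)[rotated])
  then show "x \<in> sym_kernel f"
    by (simp add: sym_kernel_iff)
qed

text \<open>Choosing preimages of the elements of the ideal defines a homomorphism from the free algebra
  back to the polynomial ring that is inverse to the presentation modulo the linear relations.\<close>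

theorem sym_kernel_generated:
  assumes L: "0 \<in> L" "\<And>p q. p \<in> L \<Longrightarrow> q \<in> L \<Longrightarrow> p - q \<in> L" "\<And>p r. p \<in> L \<Longrightarrow> r * p \<in> L"
    and gen: "linear_relations f \<subseteq> L"
  shows "sym_kernel f \<subseteq> L"
proof -
  \<comment> \<open>Chosen preimages under the evaluation of linear forms.\<close>
  define pre where "pre = (\<lambda>g. if g \<in> Ig then SOME x. x \<in> ystrand 1 \<and> ev f x = g else 0 :: ('n + 'm, 'k) mpoly)"
  have pre: "pre g \<in> ystrand 1 \<and> ev f (pre g) = g" if "g \<in> Ig" for g
  proof -
    have "\<exists>x. x \<in> ystrand 1 \<and> ev f x = g"
      using that unfolding gen_ideal_eq by blast
    then show ?thesis
      using someI_ex[of "\<lambda>x. x \<in> ystrand 1 \<and> ev f x = g"] that by (simp add: pre_def)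
  qed
  interpret psi: substitution "embed_x :: ('n, 'k) mpoly \<Rightarrow> ('n + 'm, 'k) mpoly" pre
    by unfold_locales (simp_all add: embed_x_def embed.sub_add embed.sub_mult)
  have Ladd: "p + q \<in> L" if "p \<in> L" "q \<in> L" for p q
    by (rule add_closed[OF L(1,2) that])
  have lin: "x \<in> L" if "x \<in> ystrand 1" "ev f x = 0" for x
    using that gen by (auto simp: linear_relations_def)
  have yadd: "x + y \<in> ystrand 1" if "x \<in> ystrand 1" "y \<in> ystrand 1" for x y :: "('n + 'm, 'k) mpoly"
    by (rule add_closed[OF ystrand_zero ystrand_diff that])
  \<comment> \<open>The preimage of \<open>L\<close> is an ideal that contains the defining relations of the symmetric algebra.\<close>
  define A where "A = {p \<in> carrier FA. psi.sub p \<in> L}"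
  have "ideal A FA"
  proof (rule idealI[OF FA_ring])
    interpret FA: ring FA by (rule FA_ring)
    show "subgroup A (add_monoid FA)"
    proof (rule group.subgroupI[OF FA.a_group])
      show "A \<noteq> {}"
        using FA_closed(1) L(1) by (auto simp: A_def intro!: exI[of _ 0])
      show "inv\<^bsub>add_monoid FA\<^esub> a \<in> A" if a: "a \<in> A" for a
      proof -
        have "\<ominus>\<^bsub>FA\<^esub> a = - a"
          by (rule FA.minus_equality) (use a FA_closed(5) in \<open>simp_all add: A_def FA_ops(1,3)\<close>)
        moreover have "- a \<in> A"
          using a FA_closed(5) L(2)[OF L(1), of "psi.sub a"] by (simp add: A_def psi.sub_uminus)
        ultimately show ?thesis
          unfolding a_inv_def by simp
      qed
      show "a \<otimes>\<^bsub>add_monoid FA\<^esub> b \<in> A" if "a \<in> A" "b \<in> A" for a b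
        using that FA_closed(3) Ladd by (simp add: A_def FA_ops(1) psi.sub_add)
    qed (auto simp: A_def)
    show "x \<otimes>\<^bsub>FA\<^esub> a \<in> A" if "a \<in> A" "x \<in> carrier FA" for a x
      using that FA_closed(4) L(3) by (simp add: A_def FA_ops(2) psi.sub_mult)
    show "a \<otimes>\<^bsub>FA\<^esub> x \<in> A" if "a \<in> A" "x \<in> carrier FA" for a x
      using that FA_closed(4) L(3) by (simp add: A_def FA_ops(2) psi.sub_mult mult.commute)
  qed
  moreover have "sym_relations Ig \<subseteq> A"
  proof
    fix r assume r: "r \<in> sym_relations Ig"
    then consider g h where "g \<in> Ig" "h \<in> Ig" "r = Var (g + h) - (Var g + Var h)"
      | a g where "g \<in> Ig" "r = Var (a * g) - Const a * Var g"
      by (auto simp: sym_relations_def)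
    then have "psi.sub r \<in> L"
    proof cases
      case 1
      have "pre (g + h) - (pre g + pre h) \<in> ystrand 1"
        using 1 pre gen_ideal_closed(2) by (intro ystrand_diff yadd) auto
      moreover have "ev f (pre (g + h) - (pre g + pre h)) = 0"
        using 1 pre gen_ideal_closed(2) by (simp add: ev.sub_diff ev.sub_add)
      ultimately show ?thesis
        using lin by (simp add: 1 psi.sub_diff psi.sub_add)
    next
      case 2
      have "embed_x a * pre g \<in> ystrand 1"
        using ystrand_mult[OF embed_x_ystrand[of a], of "pre g" 1] pre 2 by simp
      then have "pre (a * g) - embed_x a * pre g \<in> ystrand 1"
        using 2 pre gen_ideal_closed(3) by (intro ystrand_diff) auto
      moreover have "ev f (pre (a * g) - embed_x a * pre g) = 0"
        using 2 pre gen_ideal_closed(3) by (simp add: ev.sub_diff ev.sub_mult ev_embed_x)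
      ultimately show ?thesis
        using lin by (simp add: 2 psi.sub_diff psi.sub_mult)
    qed
    then show "r \<in> A"
      using r relations_carrier by (auto simp: A_def)
  qed
  ultimately have SI_A: "SI \<subseteq> A"
    unfolding sym_ideal_def by (rule ring.genideal_minimal[OF FA_ring])
  have embed_C: "embed_x (Const c) = Const c" and embed_V: "embed_x (Var i) = Var (Inl i)" for c i
    by (simp_all add: embed_x_def)
  \<comment> \<open>Both sides agree on constants and x-variables, and differ on \<open>y\<^sub>j\<close> by a linear relation.\<close>
  have inv: "psi.sub (tsub f h) - h \<in> L" for h
  proof (induction h rule: mpoly_induct)
    case (Const c)
    then show ?case
      using L(1) by (simp add: psi.sub_Const embed_C)
  next
    case (Var v)
    show ?case
    proof (cases v)
      case (Inl i)
      then show ?thesis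
        using L(1) by (simp add: psi.sub_Const embed_V)
    next
      case (Inr j)
      have "pre (f j) - Var (Inr j) \<in> ystrand 1"
        using pre[OF gen_ideal_closed(4)[of j]] by (intro ystrand_diff) (auto simp: ystrand_def Var_expo bideg_expo)
      moreover have "ev f (pre (f j) - Var (Inr j)) = 0"
        using pre[OF gen_ideal_closed(4)[of j]] by (simp add: ev.sub_diff)
      ultimately show ?thesis
        using lin by (simp add: Inr)
    qed
  next
    case (add p q)
    then show ?case
      using Ladd[OF add] by (simp add: tsub.sub_add psi.sub_add algebra_simps)
  next
    case (mult p q)
    have "psi.sub (tsub f p) * (psi.sub (tsub f q) - q) + q * (psi.sub (tsub f p) - p) \<in> L"
      using mult L(3) by (intro Ladd) auto
    then show ?case
      by (simp add: tsub.sub_mult psi.sub_mult algebra_simps)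
  qed
  show ?thesis
  proof
    fix h assume "h \<in> sym_kernel f"
    then have "psi.sub (tsub f h) \<in> L"
      using SI_A by (auto simp: sym_kernel_iff A_def)
    then show "h \<in> L"
      using L(2)[OF _ inv[of h]] by fastforce
  qed
qed

text \<open>The canonical surjection from the symmetric algebra to the Rees algebra.\<close>

lemma sym_kernel_rees: "(\<And>j. f j \<in> homog tdeg (int d)) \<Longrightarrow> sym_kernel f \<subseteq> rees_ideal f"
  by (rule sym_kernel_generated)
     (auto simp: rees_ideal_iff_zero rees.sub_diff rees.sub_mult linear_relations_def rees_ideal_ystrand[of _ 1, symmetric])

text \<open>The polynomials all of whose homogeneous components lie in the kernel form an ideal, and it contains
  the linear relations because the \<open>f\<^sub>j\<close> have equal degree.\<close>

theorem sym_homogeneous_ideal: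
  assumes f: "\<And>j. f j \<in> homog tdeg (int d)"
  shows "homogeneous_ideal bideg (sym_kernel f)"
proof -
  interpret grading "bideg :: ('n + 'm \<Rightarrow>\<^sub>0 nat) \<Rightarrow> int \<times> int" by (rule bideg_grading)
  interpret P: presented bideg "poly_module bideg :: (('n + 'm, 'k) mpoly, _, _) graded_module" UNIV bideg "\<lambda>r. r" "\<lambda>x. x"
    by (rule poly_module_presented)
  note K = sym_kernel_ideal
  have Kadd: "p + q \<in> sym_kernel f" if "p \<in> sym_kernel f" "q \<in> sym_kernel f" for p q
    by (rule add_closed[OF K(1,2) that])
  have "sym_kernel f \<subseteq> {h. \<forall>g. hcomp bideg g h \<in> sym_kernel f}"
  proof (rule sym_kernel_generated)
    show "0 \<in> {h. \<forall>g. hcomp bideg g h \<in> sym_kernel f}"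
      using K(1) by (simp add: hcomp_def)
    show "p - q \<in> {h. \<forall>g. hcomp bideg g h \<in> sym_kernel f}"
      if "p \<in> {h. \<forall>g. hcomp bideg g h \<in> sym_kernel f}" "q \<in> {h. \<forall>g. hcomp bideg g h \<in> sym_kernel f}" for p q
      using that K(2) by (simp add: hcomp_def restr_diff)
    show "r * p \<in> {h. \<forall>g. hcomp bideg g h \<in> sym_kernel f}"
      if p: "p \<in> {h. \<forall>g. hcomp bideg g h \<in> sym_kernel f}" for p r
    proof (intro CollectI allI)
      fix g :: "int \<times> int"
      have "hcomp bideg g (hcomp bideg a r * p) \<in> sym_kernel f" for a
        using P.hcomp_act[of "hcomp bideg a r" a p g] p K(3)[of "hcomp bideg (g - a) p" "hcomp bideg a r"] by (simp add: P.act_def P.elems_def del: split_paired_All)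
      then have "(\<Sum>a\<in>bideg ` keys r. hcomp bideg g (hcomp bideg a r * p)) \<in> sym_kernel f"
        by (intro sum_closed K(1,2)) auto
      also have "(\<Sum>a\<in>bideg ` keys r. hcomp bideg g (hcomp bideg a r * p)) = hcomp bideg g ((\<Sum>a\<in>bideg ` keys r. hcomp bideg a r) * p)"
        by (simp add: hcomp_def restr_sum sum_distrib_right)
      also have "(\<Sum>a\<in>bideg ` keys r. hcomp bideg a r) = r"
        by (rule sum_hcomp[symmetric])
      finally show "hcomp bideg g (r * p) \<in> sym_kernel f" .
    qed
    show "linear_relations f \<subseteq> {h. \<forall>g. hcomp bideg g h \<in> sym_kernel f}"
    proof (intro subsetI CollectI allI)
      fix x :: "('n + 'm, 'k) mpoly" and g :: "int \<times> int" assume x: "x \<in> linear_relations f"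
      obtain a b where g: "g = (a, b)" by (cases g)
      have x1: "x \<in> ystrand 1" "ev f x = 0"
        using x by (auto simp: linear_relations_def)
      show "hcomp bideg g x \<in> sym_kernel f"
      proof (cases "b = 1")
        case True
        have "ev f (hcomp bideg (a, int 1) x) = 0"
          by (rule bihomogeneous_if_strands[of f d, OF f]) (unfold ypart_id[OF x1(1)], rule x1(2))
        then have "hcomp bideg g x \<in> linear_relations f"
          using True hcomp_ystrand[OF x1(1), of bideg g] by (simp add: g linear_relations_def)
        then show ?thesis
          using linear_relations_sym_kernel by blast
      next
        case False
        then have "hcomp bideg g x = 0"
          using x1(1) unfolding g hcomp_def by (intro restr_none) (auto simp: ystrand_def)
        then show ?thesis
          using K(1) by simp
      qed
    qed
  qed
  then show ?thesis
    by unfold_locales (use K in auto)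
qed

end

section \<open>Koszul homology of a quotient algebra\<close>

lemma (in homogeneous_ideal) ideal_pair:
  "graded_pair (homog dg) (*) (homog dg) (\<lambda>g. homog dg g \<inter> J)"
proof -
  interpret graded_ring "homog dg :: 'g \<Rightarrow> ('v, 'k) mpoly set"
    by (rule graded_ring_homog)
  show ?thesis
    by unfold_locales (auto simp: algebra_simps J_zero intro: homog_mult homog_diff J_mult J_diff)
qed

lemma (in graded_pair) homology_zero_if_no_chains:
  assumes "gchains C P i g \<subseteq> {0}"
  shows "homology_zero act C Z P i g"
proof -
  have "0 - bd act P i 0 \<in> gchains Z P i g"
    by (simp add: gchains_zero)
  moreover have "0 \<in> gchains C P (Suc i) g"
    by (rule gchains_zero) simp
  ultimately show ?thesis
    using assms unfolding homology_zero_def by blast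
qed

lemma homog_bideg_negative: "a < 0 \<Longrightarrow> h \<in> homog bideg (a, b) \<Longrightarrow> h = 0"
proof (rule poly_mapping_eqI)
  fix m assume "a < 0" "h \<in> homog bideg (a, b)"
  then have "m \<notin> keys h"
    using bideg_nonneg(1)[of m] by (auto simp: homog_def)
  then show "lookup h m = lookup 0 m"
    by (simp add: in_keys_iff)
qed

lemma bideg_expo_nonneg: "0 \<le> fst (bideg (expo v))"
  by (rule bideg_nonneg)

lemma koszul_deg_nonneg: "0 \<le> fst (koszul_deg (var_seq bideg vs) bs)"
proof (induction vs arbitrary: bs)
  case (Cons v vs)
  show ?case
    using Cons[of "tl bs"] bideg_expo_nonneg[of v] by (cases bs) (auto simp: var_seq_Cons)
qed (simp add: var_seq_def)

lemma koszul_deg_x: "length bs = length xs \<Longrightarrow>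
    koszul_deg (var_seq bideg (map Inl xs)) bs = (int (count_list bs True), 0)"
proof (induction xs arbitrary: bs)
  case (Cons x xs)
  then show ?case
    by (cases bs) (auto simp: var_seq_Cons bideg_expo)
qed (simp add: var_seq_def zero_prod_def)

lemma koszul_deg_y: "length bs = length ys \<Longrightarrow>
    koszul_deg (var_seq bideg (map Inr ys)) bs = (0, int (count_list bs True))"
proof (induction ys arbitrary: bs)
  case (Cons x xs)
  then show ?case
    by (cases bs) (auto simp: var_seq_Cons bideg_expo)
qed (simp add: var_seq_def zero_prod_def)

text \<open>The regularity over \<open>S_x\<close> of the strand of \<open>S/J\<close> in y-degree \<open>b\<close>.\<close>

definition strand_regularity :: "('n::finite + 'm::finite, 'k::field) mpoly set \<Rightarrow> 'n list \<Rightarrow> int \<Rightarrow> ereal"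
  where "strand_regularity J xs b =
    (SUP r\<in>{r::int. \<exists>i. \<not> koszul_vanishes J (map Inl xs) i (int i + r, b)}. ereal (real_of_int r))"

context
  fixes J :: "('n::finite + 'm::finite, 'k::field) mpoly set"
  assumes J: "homogeneous_ideal bideg J"
begin

interpretation J: homogeneous_ideal bideg J
  by (rule J)

interpretation pair: graded_pair "homog bideg" "(*)" "homog bideg" "\<lambda>g. homog bideg g \<inter> J"
  by (rule J.ideal_pair)

text \<open>Nakayama's lemma for a variable of positive x-degree: the long exact sequence makes multiplication
  by it surjective on Koszul homology, which is zero in negative x-degrees.  The induction is on the
  x-degree.\<close>

lemma koszul_vanishes_drop_variable:
  assumes "\<And>a. koszul_vanishes J (v # vs) i (a, b)" and v: "bideg (expo v) = (1, 0)"
  shows "koszul_vanishes J vs i (a, b)"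
proof -
  have "koszul_vanishes J vs i (a, b)" if "a < int n" for a n
    using that
  proof (induction n arbitrary: a)
    case 0
    have "gchains (homog bideg :: _ \<Rightarrow> ('n + 'm, 'k) mpoly set) (koszul (var_seq bideg vs :: (('n + 'm, 'k) mpoly \<times> int \<times> int) list)) i (a, b) \<subseteq> {0}"
    proof
      let ?K = "koszul (var_seq bideg vs :: (('n + 'm, 'k) mpoly \<times> int \<times> int) list)"
      fix z :: "bool list \<Rightarrow> ('n + 'm, 'k) mpoly" assume z: "z \<in> gchains (homog bideg) ?K i (a, b)"
      have "z p = 0" for p
      proof (cases "p \<in> basis ?K i")
        case True
        obtain a' b' where d: "koszul_deg (var_seq bideg vs :: (('n + 'm, 'k) mpoly \<times> int \<times> int) list) p = (a', b')"
          by (metis surj_pair)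
        have "z p \<in> homog bideg ((a, b) - bdeg ?K i p)"
          using z True by (simp add: gchains_def)
        then have "z p \<in> homog bideg (a - a', b - b')"
          by (simp add: koszul_def d)
        moreover have "0 \<le> a'"
        proof -
          have "0 \<le> fst (koszul_deg (var_seq bideg vs :: (('n + 'm, 'k) mpoly \<times> int \<times> int) list) p)"
            by (rule koszul_deg_nonneg)
          then show ?thesis
            by (simp add: d)
        qed
        ultimately show ?thesis
          using 0 homog_bideg_negative[of "a - a'" "z p" "b - b'"] by simp
      next
        case False
        then show ?thesis
          using z by (simp add: gchains_def)
      qed
      then show "z \<in> {0}"
        by (simp add: fun_eq_iff)
    qed
    then have "homology_zero (*) (homog bideg) (\<lambda>g. homog bideg g \<inter> J) (koszul (var_seq bideg vs)) i (a, b)"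
      by (rule pair.homology_zero_if_no_chains)
    then show ?case
      by (simp add: koszul_vanishes_def)
  next
    case (Suc n)
    have "homology_zero (*) (homog bideg) (\<lambda>g. homog bideg g \<inter> J) (koszul (var_seq bideg vs)) i
        ((a, b) - snd (Var v :: ('n + 'm, 'k) mpoly, bideg (expo v)))"
      using Suc.IH[of "a - 1"] Suc.prems v by (simp add: koszul_vanishes_def)
    moreover have "homology_zero (*) (homog bideg) (\<lambda>g. homog bideg g \<inter> J)
        (koszul ((Var v, bideg (expo v)) # var_seq bideg vs)) i (a, b)"
      using assms(1)[of a] by (simp add: koszul_vanishes_def var_seq_Cons)
    moreover have "r \<in> homog bideg d"
      if "(r, d) \<in> set ((Var v :: ('n + 'm, 'k) mpoly, bideg (expo v)) # var_seq bideg vs)" for r d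
      using that by (auto simp: var_seq_def J.Var_homog)
    ultimately show ?case
      unfolding koszul_vanishes_def by (blast intro: pair.koszul_homology_zero_tail)
  qed
  from this[of a "nat (a + 1)"] show ?thesis
    by simp
qed

lemma koszul_vanishes_drop_x:
  "(\<And>a. koszul_vanishes J (map Inl xs @ vs) i (a, b)) \<Longrightarrow> koszul_vanishes J vs i (a, b)"
proof (induction xs arbitrary: a)
  case (Cons x xs)
  have "koszul_vanishes J (map Inl xs @ vs) i (a, b)" for a
    by (rule koszul_vanishes_drop_variable[of "Inl x"]) (use Cons.prems in \<open>simp_all add: bideg_expo\<close>)
  then show ?case
    by (rule Cons.IH)
qed simp

lemma koszul_vanishes_beyond: "length vs < i \<Longrightarrow> koszul_vanishes J vs i g"
  unfolding koszul_vanishes_def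
  by (rule pair.homology_zero_if_no_chains) (auto simp: gchains_def koszul_def koszul_basis_empty fun_eq_iff)

lemma koszul_vanishes_0_iff:
  "koszul_vanishes J vs 0 g \<longleftrightarrow> (\<forall>h\<in>homog bideg g. \<exists>q\<in>homog bideg g. var_divisible (set vs) q \<and> h - q \<in> J)"
proof -
  let ?K = "koszul (var_seq bideg vs :: (('n + 'm, 'k) mpoly \<times> int \<times> int) list)"
  let ?r = "replicate (length vs) False"
  define pt :: "('n + 'm, 'k) mpoly \<Rightarrow> bool list \<Rightarrow> ('n + 'm, 'k) mpoly"
    where "pt = (\<lambda>f bs. if bs = ?r then f else 0)"
  have pt: "pt h \<in> gchains (homog bideg) ?K 0 g" if "h \<in> homog bideg g" for h
    using that by (auto simp: gchains_koszul_level_0 pt_def)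
  have K: "graded_complex (homog bideg) ?K"
    by (rule pair.koszul_complex) (auto simp: var_seq_def J.Var_homog)
  show ?thesis
  proof (intro iffI ballI)
    fix h :: "('n + 'm, 'k) mpoly"
    assume van: "koszul_vanishes J vs 0 g" and h: "h \<in> homog bideg g"
    have "\<exists>w\<in>gchains (homog bideg) ?K (Suc 0) g. pt h - bd (*) ?K 0 w \<in> gchains (\<lambda>g. homog bideg g \<inter> J) ?K 0 g"
      by (rule van[unfolded koszul_vanishes_def homology_zero_def, rule_format, OF pt[OF h]]) simp
    then obtain w where w: "w \<in> gchains (homog bideg) ?K (Suc 0) g"
      "pt h - bd (*) ?K 0 w \<in> gchains (\<lambda>g. homog bideg g \<inter> J) ?K 0 g"
      by (rule bexE)
    have bw: "bd (*) ?K 0 w \<in> gchains (homog bideg) ?K 0 g"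
      by (rule pair.bd_C[OF K w(1)])
    let ?q = "bd (*) ?K 0 w ?r"
    have "?q \<in> homog bideg g"
      using bw by (simp add: gchains_koszul_level_0)
    moreover have "var_divisible (set vs) ?q"
      by (rule iffD1[OF J.koszul_image[OF bw]]) (rule bexI[OF refl w(1)])
    moreover have "h - ?q \<in> J"
      using w(2) by (simp add: gchains_koszul_level_0 pt_def)
    ultimately show "\<exists>q\<in>homog bideg g. var_divisible (set vs) q \<and> h - q \<in> J"
      by blast
  next
    assume *: "\<forall>h\<in>homog bideg g. \<exists>q\<in>homog bideg g. var_divisible (set vs) q \<and> h - q \<in> J"
    show "koszul_vanishes J vs 0 g"
      unfolding koszul_vanishes_def homology_zero_def
    proof (intro ballI impI)
      fix z :: "bool list \<Rightarrow> ('n + 'm, 'k) mpoly" assume z: "z \<in> gchains (homog bideg) ?K 0 g"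
      then have zr: "z ?r \<in> homog bideg g" and z0: "\<And>bs. bs \<noteq> ?r \<Longrightarrow> z bs = 0"
        by (simp_all add: gchains_koszul_level_0)
      obtain q where q: "q \<in> homog bideg g" "var_divisible (set vs) q" "z ?r - q \<in> J"
        using * zr by blast
      have "var_divisible (set vs) (pt q ?r)"
        using q(2) by (simp add: pt_def)
      then have "\<exists>w\<in>gchains (homog bideg) ?K (Suc 0) g. pt q = bd (*) ?K 0 w"
        by (rule iffD2[OF J.koszul_image[OF pt[OF q(1)]]])
      then obtain w where w: "w \<in> gchains (homog bideg) ?K (Suc 0) g" "pt q = bd (*) ?K 0 w"
        by (rule bexE)
      have "z - pt q \<in> gchains (\<lambda>g. homog bideg g \<inter> J) ?K 0 g"
        using zr z0 q by (auto simp: gchains_koszul_level_0 pt_def intro: homog_diff)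
      then show "\<exists>w\<in>gchains (homog bideg) ?K (Suc 0) g.
          z - bd (*) ?K 0 w \<in> gchains (\<lambda>g. homog bideg g \<inter> J) ?K 0 g"
        unfolding w(2) by (rule bexI[OF _ w(1)])
    qed
  qed
qed

text \<open>Exactness of the y-Koszul complex in y-degree \<open>b + 1\<close> puts \<open>H\<^sub>i(x)\<close> of that degree under the control
  of the terms at positions \<open>k + 1\<close>, where \<open>k\<close> is less than the number of y-variables; these are
  copies of \<open>H\<^sub>i\<^sub>-\<^sub>k(x)\<close> of y-degree \<open>b - k\<close>, since the basis elements there have y-degree \<open>k + 1\<close>.\<close>

lemma koszul_spectral:
  fixes xs :: "'n list" and ys :: "'m list"
  assumes columns: "\<And>i a. koszul_vanishes J (map Inr ys) i (a, b + 1)"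
    and non: "\<not> koszul_vanishes J (map Inl xs) i (a, b + 1)"
  obtains k where "k \<le> i" "k < length ys" "\<not> koszul_vanishes J (map Inl xs) (i - k) (a, b - int k)"
proof -
  let ?P = "koszul (var_seq bideg (map Inl xs) :: (('n + 'm, 'k) mpoly \<times> int \<times> int) list)"
  let ?Q = "koszul (var_seq bideg (map Inr ys) :: (('n + 'm, 'k) mpoly \<times> int \<times> int) list)"
  have P: "graded_complex (homog bideg) ?P" and Q: "graded_complex (homog bideg) ?Q"
    by (rule pair.koszul_complex, auto simp: var_seq_def J.Var_homog)+
  have degP: "bdeg ?P i p = (int i, 0)" if "p \<in> basis ?P i" for i p
    using that by (auto simp: koszul_def koszul_basis_def koszul_deg_x)
  have degQ: "bdeg ?Q i p = (0, int i)" if "p \<in> basis ?Q i" for i p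
    using that by (auto simp: koszul_def koszul_basis_def koszul_deg_y)
  let ?r = "replicate (length ys) False"
  have r: "?r \<in> basis ?Q 0"
    by (simp add: koszul_def koszul_basis_0)
  have "\<exists>k\<le>i. k < length ys \<and> \<not> koszul_vanishes J (map Inl xs) (i - k) (a, b - int k)"
  proof (rule ccontr)
    assume no: "\<not> ?thesis"
    have "homology_zero (*) (homog bideg) (\<lambda>g. homog bideg g \<inter> J) ?P i ((a, b + 1) - bdeg ?Q 0 ?r)"
    proof (rule pair.homology_zero_from_exact_columns[OF P Q pair.koszul_bd_bd pair.koszul_bd_bd _ _ r])
      fix p q c assume pq: "p + q = i" and c: "c \<in> basis ?Q (Suc q)"
      have "Suc q \<le> length ys"
        using c count_le_length[of c True] by (auto simp: koszul_def koszul_basis_def)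
      then have "koszul_vanishes J (map Inl xs) (i - q) (a, b - int q)"
        using no pq by auto
      then show "homology_zero (*) (homog bideg) (\<lambda>g. homog bideg g \<inter> J) ?P p ((a, b + 1) - bdeg ?Q (Suc q) c)"
        unfolding degQ[OF c] using pq by (auto simp: koszul_vanishes_def)
    next
      fix p q c assume pq: "p + q = i" and c: "c \<in> basis ?P p"
      show "homology_zero (*) (homog bideg) (\<lambda>g. homog bideg g \<inter> J) ?Q q ((a, b + 1) - bdeg ?P p c)"
        unfolding degP[OF c] using columns[of q "a - int p"] by (simp add: koszul_vanishes_def)
    qed
    then show False
      using non unfolding degQ[OF r] by (simp add: koszul_vanishes_def)
  qed
  then show ?thesis
    using that by blast
qed

section \<open>Stability of the regularity of strands\<close>

lemma homog_origin:
  assumes "q \<in> homog bideg (0, 0)" "var_divisible UNIV q"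
  shows "q = (0 :: ('n + 'm, 'k) mpoly)"
proof (rule poly_mapping_eqI)
  fix m
  have "m \<notin> keys q"
  proof
    assume m: "m \<in> keys q"
    then have "bideg m = (0, 0)"
      using assms(1) by (simp add: homog_def)
    then have "lookup m v = 0" for v
      by (cases v) (simp_all add: bideg_def del: of_nat_sum)
    then show False
      using assms(2) m by (auto simp: var_divisible_def)
  qed
  then show "lookup q m = lookup 0 m"
    by (simp add: in_keys_iff)
qed

text \<open>\<open>H\<^sub>0(x)\<close> is \<open>R\<close> modulo the x-variables, a quotient of the polynomial ring in the y-variables.\<close>

lemma koszul_vanishes_0_x:
  fixes xs :: "'n list"
  assumes xs: "set xs = UNIV"
  shows "koszul_vanishes J (map Inl xs) 0 (a, b) \<longleftrightarrow> a \<noteq> 0 \<or> homog bideg (0, b) \<subseteq> J"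
proof (cases "a = 0")
  case True
  have "q = 0" if q: "q \<in> homog bideg (0, b)" "var_divisible (range Inl) q" for q :: "('n + 'm, 'k) mpoly"
  proof (rule poly_mapping_eqI)
    fix m
    have "m \<notin> keys q"
    proof
      assume m: "m \<in> keys q"
      then have "xdeg m = 0"
        using q(1) by (simp add: homog_def)
      then have "lookup m (Inl i) = 0" for i
        by (simp add: bideg_def del: of_nat_sum)
      then show False
        using q(2) m by (auto simp: var_divisible_def)
    qed
    then show "lookup q m = lookup 0 m"
      by (simp add: in_keys_iff)
  qed
  moreover have "var_divisible (range Inl) (0 :: ('n + 'm, 'k) mpoly)"
    by (simp add: var_divisible_def)
  ultimately show ?thesis
    unfolding koszul_vanishes_0_iff using True xs by fastforce
next
  case False
  have "var_divisible (range Inl) h" if h: "h \<in> homog bideg (a, b)" for h :: "('n + 'm, 'k) mpoly"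
    unfolding var_divisible_def
  proof
    fix m assume "m \<in> keys h"
    then have m: "xdeg m \<noteq> 0"
      using h False by (simp add: homog_def)
    show "\<exists>v\<in>range Inl. lookup m v \<noteq> 0"
    proof (rule ccontr)
      assume "\<not> ?thesis"
      then have "xdeg m = 0"
        by (simp add: bideg_def)
      then show False
        using m by simp
    qed
  qed
  then show ?thesis
    unfolding koszul_vanishes_0_iff using False xs J.J_zero by fastforce
qed

text \<open>The bound on \<open>reg_y\<close> produces classes in earlier strands from classes in the strand of degree \<open>j + 1\<close>,
  and the bound on \<open>w\<close> moves classes to later strands; together they fix the supremum.\<close>

theorem strand_regularity_stable:
  fixes xs :: "'n list" and j :: nat
  assumes xs: "distinct xs" "set xs = UNIV"
    and one: "1 \<notin> J"
    and strands: "\<And>c. 1 \<le> c \<Longrightarrow> \<not> homog bideg (0, c) \<subseteq> J \<Longrightarrow> \<not> homog bideg (0, c + 1) \<subseteq> J"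
    and y: "y \<in> homog bideg (0, 1)"
    and reg: "reg_y (bigraded_algebra J) + ereal (real CARD('m)) \<le> ereal (real j)"
    and w: "w_inv y (bigraded_algebra J) + ereal (real CARD('m)) \<le> ereal (real j)"
  shows "strand_regularity J xs (int j + 1) = strand_regularity J xs (int j)"
proof -
  let ?R = "bigraded_algebra J" and ?m = "CARD('m)"
  obtain ys :: "'m list" where ys: "set ys = UNIV" "distinct ys"
    using finite_distinct_list[of "UNIV :: 'm set"] by auto
  have len: "length ys = ?m" "length xs = CARD('n)"
    using ys xs by (metis distinct_card)+
  let ?vs = "map Inl xs @ map Inr ys"
  have vs: "distinct ?vs" "set ?vs = UNIV"
    using xs ys by (auto simp: distinct_map UNIV_sum)
  have bound: "b + int ?m \<le> int j" if "\<not> koszul_vanishes J ?vs i (a, b + int i)" for i a b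
  proof -
    have "ereal (real_of_int b) \<le> reg_y ?R"
      unfolding reg_y_def
    proof (intro SUP_upper CollectI exI notI)
      assume "gpart (Tor bideg ?R residue_module i) (a, b + int i) = {\<zero>\<^bsub>Tor bideg ?R residue_module i\<^esub>}"
      then show False
        using that unfolding tor_algebra_residue[OF J vs] by contradiction
    qed
    then have "ereal (real_of_int b) + ereal (real ?m) \<le> ereal (real j)"
      using reg by (meson add_right_mono order_trans)
    then show ?thesis
      by simp
  qed
  \<comment> \<open>The class of 1 makes \<open>reg_y\<close> nonnegative, so that \<open>j\<close> is at least the number of y-variables and all
    degrees met below are positive.\<close>
  have "\<not> koszul_vanishes J ?vs 0 (0, 0)"
  proof
    assume "koszul_vanishes J ?vs 0 (0, 0)"
    moreover have "1 \<in> (homog bideg (0, 0) :: ('n + 'm, 'k) mpoly set)"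
      using J.homog_one by (simp add: zero_prod_def)
    ultimately obtain q where "q \<in> homog bideg (0, 0)" "var_divisible UNIV q" "1 - q \<in> J"
      unfolding koszul_vanishes_0_iff vs by blast
    then show False
      using homog_origin one by fastforce
  qed
  then have m_le: "?m \<le> j"
    using bound[of 0 0 0] by simp
  \<comment> \<open>For \<open>i \<le> m\<close> the number \<open>j + 1 - i\<close> exceeds \<open>reg_y\<close>.\<close>
  have columns: "koszul_vanishes J (map Inr ys) i (a, int j + 1)" for i a
  proof (cases "?m < i")
    case True
    then show ?thesis
      by (intro koszul_vanishes_beyond) (simp add: len)
  next
    case False
    have "koszul_vanishes J ?vs i (a, int j + 1)" for a
    proof (rule ccontr)
      assume "\<not> ?thesis"
      then show False
        using bound[of i a "int j + 1 - int i"] False by simp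
    qed
    then show ?thesis
      by (rule koszul_vanishes_drop_x)
  qed
  have step: "\<not> koszul_vanishes J (map Inl xs) i (a, c + 1)"
    if non: "\<not> koszul_vanishes J (map Inl xs) i (a, c)" and c: "int j + 1 - int ?m \<le> c" for i a c
  proof (cases "i = 0")
    case True
    then show ?thesis
      using non strands[of c] c m_le by (simp add: koszul_vanishes_0_x[OF xs(2)])
  next
    case False
    have i: "i \<in> {1..CARD('n)}"
      using non koszul_vanishes_beyond[of "map Inl xs" i] False by (auto simp: len not_less[symmetric])
    have "carrier (strand (annihilated (Tor_x ?R i) y) c) = {\<zero>\<^bsub>Tor_x ?R i\<^esub>}"
    proof (rule ccontr)
      assume "\<not> ?thesis"
      then have "ereal (real_of_int c) \<le> w_inv y ?R"
        unfolding w_inv_def by (intro SUP_upper CollectI bexI[OF _ i])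
      then have "ereal (real_of_int c) + ereal (real ?m) \<le> ereal (real j)"
        using w by (meson add_right_mono order_trans)
      then show False
        using c by simp
    qed
    from tor_x_koszul(2)[OF J xs y this, of a] show ?thesis
      using non by (rule contrapos_nn[rotated])
  qed
  have steps: "\<not> koszul_vanishes J (map Inl xs) i (a, c + int k)"
    if "\<not> koszul_vanishes J (map Inl xs) i (a, c)" "int j + 1 - int ?m \<le> c" for i a c k
    using that
  proof (induction k)
    case (Suc k)
    then show ?case
      using step[of i a "c + int k"] by (simp add: add.assoc add.commute[of 1])
  qed simp
  show ?thesis
  proof (rule antisym)
    show "strand_regularity J xs (int j + 1) \<le> strand_regularity J xs (int j)"
      unfolding strand_regularity_def[of J xs "int j + 1"]
    proof (rule SUP_least, clarify)
      fix r i assume "\<not> koszul_vanishes J (map Inl xs) i (int i + r, int j + 1)"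
      then obtain k where k: "k \<le> i" "k < ?m" "\<not> koszul_vanishes J (map Inl xs) (i - k) (int i + r, int j - int k)"
        by (rule koszul_spectral[OF columns]) (auto simp: len)
      have "int (i - k) + (r + int k) = int i + r" "int j - int k + int k = int j"
        using k(1) by simp_all
      moreover have "\<not> koszul_vanishes J (map Inl xs) (i - k) (int i + r, int j - int k + int k)"
        by (rule steps[OF k(3)]) (use k(2) in simp)
      ultimately have "\<not> koszul_vanishes J (map Inl xs) (i - k) (int (i - k) + (r + int k), int j)"
        by (simp only:) simp
      then have "ereal (real_of_int (r + int k)) \<le> strand_regularity J xs (int j)"
        unfolding strand_regularity_def by (intro SUP_upper CollectI exI)
      then show "ereal (real_of_int r) \<le> strand_regularity J xs (int j)"
        by (rule order_trans[rotated]) simp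
    qed
    have "\<exists>i. \<not> koszul_vanishes J (map Inl xs) i (int i + r, int j + 1)"
      if "\<exists>i. \<not> koszul_vanishes J (map Inl xs) i (int i + r, int j)" for r
    proof -
      from that obtain i where "\<not> koszul_vanishes J (map Inl xs) i (int i + r, int j)"
        by blast
      then have "\<not> koszul_vanishes J (map Inl xs) i (int i + r, int j + 1)"
        by (rule step) simp
      then show ?thesis
        by blast
    qed
    then show "strand_regularity J xs (int j) \<le> strand_regularity J xs (int j + 1)"
      unfolding strand_regularity_def by (intro SUP_subset_mono Collect_mono impI order_refl)
  qed
qed

end

section \<open>The regularity of powers and symmetric powers\<close>

lemma koszul_deg_embed:
  "koszul_deg (var_seq bideg (map Inl xs) :: (('n::finite + 'm::finite, 'k::comm_ring_1) mpoly \<times> int \<times> int) list) bs =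
    (koszul_deg (var_seq tdeg xs :: (('n, 'k) mpoly \<times> int) list) bs, 0)"
proof (induction xs arbitrary: bs)
  case (Cons x xs)
  then show ?case
    by (cases bs) (auto simp: var_seq_Cons bideg_expo tdeg_expo zero_prod_def)
qed (simp add: var_seq_def zero_prod_def)

lemma embed_x_Var: "embed_x (Var i) = Var (Inl i)"
  by (simp add: embed_x_def)

lemma embed_x_uminus: "embed_x (- p) = - embed_x p"
  by (simp add: embed_x_def embed.sub_uminus)

lemma koszul_mat_embed:
  "koszul_mat (var_seq bideg (map Inl xs)) as bs = embed_x (koszul_mat (var_seq tdeg xs) as bs)"
proof (induction xs arbitrary: as bs)
  case (Cons x xs)
  then show ?case
    by (cases as; cases bs) (auto simp: var_seq_Cons embed_x_Var embed_x_uminus embed_x_0)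
qed (simp add: var_seq_def embed_x_0)

text \<open>The Koszul complex over \<open>S_x\<close> of a strand is, degree by degree, the x-part of the Koszul complex over
  \<open>S\<close>: chains and differentials agree literally after embedding the coefficients.\<close>

lemma koszul_strand:
  fixes J :: "('n::finite + 'm::finite, 'k::field) mpoly set" and \<pi> :: "('n + 'm, 'k) mpoly \<Rightarrow> 'b"
  assumes \<pi>: "\<And>x. x \<in> ystrand b \<Longrightarrow> \<pi> x = \<pi> 0 \<longleftrightarrow> x \<in> J"
  shows "homology_zero (\<lambda>r x. embed_x r * x)
      (\<lambda>g. {x. keys x \<subseteq> {m. ydeg m = int b} \<and> x \<in> homog (\<lambda>m. xdeg m - s) g})
      (\<lambda>g. {x. keys x \<subseteq> {m. ydeg m = int b} \<and> x \<in> homog (\<lambda>m. xdeg m - s) g \<and> \<pi> x = \<pi> 0})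
      (koszul (var_seq tdeg xs)) i a \<longleftrightarrow>
    koszul_vanishes J (map Inl xs) i (s + a, int b)"
proof -
  let ?P = "koszul (var_seq tdeg xs :: (('n, 'k) mpoly \<times> int) list)"
  let ?Q = "koszul (var_seq bideg (map Inl xs) :: (('n + 'm, 'k) mpoly \<times> int \<times> int) list)"
  have comps: "{x. keys x \<subseteq> {m. ydeg m = int b} \<and> x \<in> homog (\<lambda>m. xdeg m - s) g} =
      (homog bideg (s + g, int b) :: ('n + 'm, 'k) mpoly set)" for g
    by (auto simp: homog_def prod_eq_iff)
  have kers: "{x. keys x \<subseteq> {m. ydeg m = int b} \<and> x \<in> homog (\<lambda>m. xdeg m - s) g \<and> \<pi> x = \<pi> 0} =
      homog bideg (s + g, int b) \<inter> J" for g
    using \<pi> unfolding comps[symmetric] by (auto simp: ystrand_def)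
  have basis: "basis ?Q = basis ?P"
    by (simp add: koszul_def)
  have chains: "gchains (\<lambda>g. D (s + g, int b)) ?P i a = gchains D ?Q i (s + a, int b)"
    for D :: "int \<times> int \<Rightarrow> ('n + 'm, 'k) mpoly set" and i
    by (simp add: gchains_def koszul_def koszul_deg_embed add_diff_eq)
  have bd: "bd (\<lambda>r x. embed_x r * x) ?P i = bd (*) ?Q i" for i
    by (simp add: bd_def koszul_def koszul_mat_embed fun_eq_iff)
  show ?thesis
    unfolding koszul_vanishes_def homology_zero_def comps kers bd
      chains[of "homog bideg"] chains[of "\<lambda>g. homog bideg g \<inter> J"] ..
qed

lemma SUP_ereal_shift: "(SUP r\<in>A. ereal (real_of_int r + c)) = ereal c + (SUP r\<in>A. ereal (real_of_int r))"
proof (cases "A = {}")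
  case False
  have "(SUP r\<in>A. ereal c + ereal (real_of_int r)) = ereal c + (SUP r\<in>A. ereal (real_of_int r))"
    using False by (intro SUP_ereal_add_right) auto
  then show ?thesis
    by (simp add: add.commute)
qed (simp add: bot_ereal_def)

theorem reg_x_strand:
  fixes N :: "(('n::finite, 'k::field) mpoly, 'b, int) graded_module"
    and \<pi> :: "('n + 'm::finite, 'k) mpoly \<Rightarrow> 'b"
  assumes N: "presented tdeg N {m. ydeg m = int b} (\<lambda>m. xdeg m - (- int s)) embed_x \<pi>"
    and \<pi>: "\<And>x. x \<in> ystrand b \<Longrightarrow> \<pi> x = \<pi> 0 \<longleftrightarrow> x \<in> J"
    and xs: "distinct xs" "set xs = UNIV"
  shows "reg_x N = ereal (real s) + strand_regularity J xs (int b)"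
proof -
  have tor: "gpart (Tor tdeg N residue_module i) a = {\<zero>\<^bsub>Tor tdeg N residue_module i\<^esub>} \<longleftrightarrow>
      koszul_vanishes J (map Inl xs) i (- int s + a, int b)" for i a
    using tor_residue_koszul[OF N strand_generated[OF N] xs] koszul_strand[of b \<pi> J "- int s" xs i a] \<pi>
    unfolding presented_explicit[OF N] by blast
  have "{r. \<exists>i. \<not> koszul_vanishes J (map Inl xs) i (- int s + (int i + r), int b)} =
      (\<lambda>r. r + int s) ` {r. \<exists>i. \<not> koszul_vanishes J (map Inl xs) i (int i + r, int b)}" (is "?A = ?f ` ?B")
  proof (intro equalityI subsetI)
    fix r assume "r \<in> ?A"
    then have "r - int s \<in> ?B"
      by (auto simp: algebra_simps)
    then show "r \<in> ?f ` ?B"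
      by (rule rev_image_eqI) simp
  qed (auto simp: algebra_simps)
  then have "reg_x N = (SUP r\<in>?B. ereal (real_of_int r + real s))"
    unfolding reg_x_def tor by (simp add: image_image)
  then show ?thesis
    unfolding strand_regularity_def by (simp add: SUP_ereal_shift)
qed

text \<open>The product of the leading terms is the coefficient at the sum of the leading exponents.  The
  index type of the variables carries no order, hence the explicit monomial order.\<close>

lemma mpoly_mult_nonzero:
  fixes p q :: "('v::finite, 'k::field) mpoly"
  assumes "p \<noteq> 0" "q \<noteq> 0"
  shows "p * q \<noteq> 0"
proof -
  have lead: "\<exists>m\<in>keys h. \<forall>m'\<in>keys h. mono_key 0 m' \<le> mono_key 0 m" if "h \<noteq> 0" for h :: "('v, 'k) mpoly"
  proof -
    have "keys h \<noteq> {}"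
      using that by simp
    then have "Max (mono_key 0 ` keys h) \<in> mono_key 0 ` keys h"
      by (intro Max_in) auto
    then obtain m where m: "m \<in> keys h" "Max (mono_key 0 ` keys h) = mono_key 0 m"
      by blast
    have "mono_key 0 m' \<le> mono_key 0 m" if "m' \<in> keys h" for m'
      unfolding m(2)[symmetric] using that by (intro Max_ge) auto
    then show ?thesis
      using m(1) by blast
  qed
  obtain a where a: "a \<in> keys p" "\<And>m. m \<in> keys p \<Longrightarrow> mono_key 0 m \<le> mono_key 0 a"
    using lead[OF assms(1)] by blast
  obtain b where b: "b \<in> keys q" "\<And>m. m \<in> keys q \<Longrightarrow> mono_key 0 m \<le> mono_key 0 b"
    using lead[OF assms(2)] by blast
  have other: "lookup (Poly_Mapping.single m (lookup p m) * q) (a + b) = 0" if m: "m \<in> keys p" "m \<noteq> a" for m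
  proof (rule ccontr)
    assume "\<not> ?thesis"
    then obtain t where t: "a + b = m + t" "t \<in> keys q"
      by (auto simp: lookup_monomial_mult in_keys_iff split: if_splits)
    have "mono_key 0 (m + t) \<le> mono_key 0 (m + b)"
      using mono_key_translate[OF b(2)[OF t(2)]] .
    moreover have "mono_key 0 (b + m) \<le> mono_key 0 (b + a)"
      using mono_key_translate[OF a(2)[OF m(1)]] .
    ultimately have "mono_key 0 (b + m) = mono_key 0 (b + a)"
      by (simp add: t(1)[symmetric] add.commute)
    then show False
      using m(2) by (simp add: mono_key_inject)
  qed
  have "p * q = (\<Sum>m\<in>keys p. Poly_Mapping.single m (lookup p m) * q)"
    by (subst (1) poly_mapping_monomials[of p]) (rule sum_distrib_right)
  then have "lookup (p * q) (a + b) = (\<Sum>m\<in>keys p. lookup (Poly_Mapping.single m (lookup p m) * q) (a + b))"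
    by (simp add: lookup_sum)
  also have "\<dots> = (\<Sum>m\<in>{a}. lookup (Poly_Mapping.single m (lookup p m) * q) (a + b))"
    by (rule sum.mono_neutral_right) (use a(1) other in auto)
  also have "\<dots> = lookup p a * lookup q b"
    by (auto simp: lookup_monomial_mult)
  also have "\<dots> \<noteq> 0"
    using a(1) b(1) by (simp add: in_keys_iff)
  finally show ?thesis
    by (metis lookup_zero)
qed

lemma power_nonzero: "p \<noteq> 0 \<Longrightarrow> p ^ n \<noteq> 0" for p :: "('v::finite, 'k::field) mpoly"
  by (induction n) (simp_all add: mpoly_mult_nonzero)

text \<open>Either all \<open>f\<^sub>j\<close> are zero, and then \<open>J\<close> contains every form of positive degree in the y-variables, or
  a power of some \<open>y\<^sub>j\<close> with \<open>f\<^sub>j \<noteq> 0\<close> lies outside \<open>J\<close>.\<close>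

lemma top_strands:
  fixes f :: "'m::finite \<Rightarrow> ('n::finite, 'k::field) mpoly"
  assumes J: "\<And>r p. p \<in> J \<Longrightarrow> r * p \<in> J" "0 \<in> J" "\<And>p q. p \<in> J \<Longrightarrow> q \<in> J \<Longrightarrow> p - q \<in> J"
    and lin: "linear_relations f \<subseteq> J" and rees: "J \<subseteq> rees_ideal f"
    and c: "1 \<le> c" and non: "\<not> homog bideg (0, c) \<subseteq> J"
  shows "\<not> homog bideg (0, c + 1) \<subseteq> J"
proof -
  have "\<exists>j. f j \<noteq> 0"
  proof (rule ccontr)
    assume zero: "\<not> ?thesis"
    have V: "Var (Inr j) \<in> J" for j
    proof -
      have "Var (Inr j) \<in> ystrand 1"
        by (simp add: ystrand_def Var_expo bideg_expo)
      moreover have "ev f (Var (Inr j)) = 0"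
        using zero by simp
      ultimately show ?thesis
        using lin unfolding linear_relations_def by blast
    qed
    have "h \<in> J" if h: "h \<in> homog bideg (0, c)" for h
    proof (rule poly_mapping_sum_induct[where Q = "\<lambda>h. h \<in> J"])
      fix m assume "m \<in> keys h"
      then have "ydeg m = int (Suc (nat (c - 1)))"
        using h c by (simp add: homog_def)
      then obtain k m' where m: "m = m' + expo (Inr k)"
        by (rule ydeg_split)
      have "Poly_Mapping.single m (lookup h m) = Poly_Mapping.single m' (lookup h m) * Var (Inr k)"
        by (simp add: m Var_expo mult_single)
      then show "Poly_Mapping.single m (lookup h m) \<in> J"
        using J(1)[OF V[of k]] by simp
    next
      show "p + q \<in> J" if "p \<in> J" "q \<in> J" for p q
        by (rule add_closed[OF J(2,3) that])
    qed (rule J(2))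
    then show False
      using non by blast
  qed
  then obtain j where j: "f j \<noteq> 0"
    by blast
  define n where "n = nat (c + 1)"
  have n: "c + 1 = int n"
    using c by (simp add: n_def)
  define h :: "('n + 'm, 'k) mpoly" where "h = Var (Inr j) ^ n"
  have "h \<in> homog bideg (0, int n)"
    unfolding h_def
  proof (induction n)
    case 0
    then show ?case
      using grading.homog_one[OF bideg_grading] by (simp add: zero_prod_def)
  next
    case (Suc n)
    have "(Var (Inr j) :: ('n + 'm, 'k) mpoly) * Var (Inr j) ^ n \<in> homog bideg (bideg (expo (Inr j) :: 'n + 'm \<Rightarrow>\<^sub>0 nat) + (0, int n))"
      by (rule grading.homog_mult[OF bideg_grading grading.Var_homog[OF bideg_grading] Suc])
    then show ?case
      by (simp add: bideg_expo)
  qed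
  moreover have "h \<notin> J"
  proof
    assume "h \<in> J"
    then have "h \<in> rees_ideal f"
      using rees by blast
    moreover have "h \<in> ystrand n"
      using \<open>h \<in> homog bideg (0, int n)\<close> by (auto simp: ystrand_def homog_def)
    ultimately have "ev f h = 0"
      by (simp add: rees_ideal_ystrand)
    then show False
      using power_nonzero[OF j, of n] by (simp add: h_def ev.sub_power)
  qed
  ultimately show ?thesis
    unfolding n by blast
qed

lemma linear_relations_rees: "linear_relations f \<subseteq> rees_ideal f"
  by (auto simp: linear_relations_def rees_ideal_ystrand)

lemma one_notin_rees: "1 \<notin> rees_ideal f"
  by (simp add: rees_ideal_iff_zero)

theorem corollary5p9:
  fixes f :: "'m::finite \<Rightarrow> ('n::finite, 'k::field) mpoly" and d :: nat
  assumes "infinite (UNIV :: 'k set)"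
    and "\<And>j. f j \<in> homog tdeg (int d)"
  shows "(\<forall>y j. almost_regular y (rees_algebra f) \<longrightarrow>
            ereal (real j) \<ge> max (reg_y (rees_algebra f) + ereal (real CARD('m)))
                                (w_inv y (rees_algebra f) + ereal (real CARD('m))) \<longrightarrow>
            reg_x (ideal_power (gen_ideal f) (j + 1)) =
              ereal (real d) + reg_x (ideal_power (gen_ideal f) j)) \<and>
         (\<forall>y j. almost_regular y (sym_algebra f) \<longrightarrow>
            ereal (real j) \<ge> max (reg_y (sym_algebra f) + ereal (real CARD('m)))
                                (w_inv y (sym_algebra f) + ereal (real CARD('m))) \<longrightarrow>
            reg_x (sym_power f d (j + 1)) = ereal (real d) + reg_x (sym_power f d j))"
proof -
  note f = assms(2)
  obtain xs :: "'n list" where xs: "set xs = UNIV" "distinct xs"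
    using finite_distinct_list[of "UNIV :: 'n set"] by auto
  have stable: "ereal (real ((j + 1) * d)) + strand_regularity J xs (int (j + 1)) =
      ereal (real d) + (ereal (real (j * d)) + strand_regularity J xs (int j))"
    if J: "homogeneous_ideal bideg J" and lin: "linear_relations f \<subseteq> J" and rees: "J \<subseteq> rees_ideal f"
      and y: "almost_regular y (bigraded_algebra J)"
      and j: "ereal (real j) \<ge> max (reg_y (bigraded_algebra J) + ereal (real CARD('m)))
                              (w_inv y (bigraded_algebra J) + ereal (real CARD('m)))" for J y j
  proof -
    interpret J: homogeneous_ideal bideg J by (rule J)
    have "strand_regularity J xs (int j + 1) = strand_regularity J xs (int j)"
    proof (rule strand_regularity_stable[OF J xs(2,1)])
      show "1 \<notin> J"
        using rees one_notin_rees by blast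
      show "\<not> homog bideg (0, c + 1) \<subseteq> J" if "1 \<le> c" "\<not> homog bideg (0, c) \<subseteq> J" for c
        by (rule top_strands[OF J.J_mult J.J_zero J.J_diff lin rees that])
      show "y \<in> homog bideg (0, 1)"
        using y by (simp add: almost_regular_def)
    qed (use j in simp_all)
    then show ?thesis
      by (simp add: add.assoc[symmetric] algebra_simps)
  qed
  have rees: "homogeneous_ideal bideg (rees_ideal f)"
    by (rule rees_homogeneous_ideal[OF f])
  have sym: "homogeneous_ideal bideg (sym_kernel f)"
    by (rule sym_homogeneous_ideal[OF f])
  have power: "reg_x (ideal_power (gen_ideal f) j) = ereal (real (j * d)) + strand_regularity (rees_ideal f) xs (int j)" for j
    by (rule reg_x_strand[OF ideal_power_presented[OF f] _ xs(2,1)]) (simp add: rees_ideal_ystrand)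
  have sympower: "reg_x (sym_power f d j) = ereal (real (j * d)) + strand_regularity (sym_kernel f) xs (int j)" for j
    unfolding sym_power_def sym_algebra_def sym_kernel_def[symmetric]
    by (rule reg_x_strand[OF strand_presented[OF sym] _ xs(2,1)])
      (simp add: homogeneous_ideal.coset_zero_iff[OF sym])
  show ?thesis
    unfolding power sympower rees_algebra_def sym_algebra_def rees_ideal_def[symmetric] sym_kernel_def[symmetric]
    using stable[OF rees linear_relations_rees order_refl]
      stable[OF sym linear_relations_sym_kernel sym_kernel_rees[OF f]] by blast
qed

end
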